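(* Let $\kappa\in\mathbb{N}$. For every $0<\delta<\infty$ the quantities $\widetilde E^\delta_0(v)$, $\widetilde E^\delta_{\kappa-\frac12}(v)$ and $\widetilde E^\delta_\kappa(v)$ are conserved under the flow of the scaled ILW equation $$\partial_tv-\widetilde{\mathcal{G}}_\delta\partial_x^2v=\partial_x(v^2)\quad\text{on }\mathbb{R}\times\mathbb{T}.$$ Similarly, $\widetilde E^{\rm KdV}_0(v)$ and $\widetilde E^{\rm KdV}_\kappa(v)$ are conserved under the flow of the KdV equation $$\partial_tv+\tfrac13\partial_x^3v=\partial_x(v^2)\quad\text{on }\mathbb{R}\times\mathbb{T}.$$ Moreover, for every (real-valued, mean-zero) $v\in H^\kappa(\mathbb{T})$, $$\lim_{\delta\to0}\widetilde E^\delta_{\kappa-\frac12}(v)=\lim_{\delta\to0}\widetilde E^\delta_\kappa(v)=\widetilde E^{\rm KdV}_\kappa(v).$$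
   Context: $\mathbb{T}=\mathbb{R}/(2\pi\mathbb{Z})$; all functions $v$ are real-valued with mean zero. Conservation means conservation along sufficiently smooth solutions. For $0<\delta<\infty$, $\mathcal{G}_\delta$ is the Fourier multiplier operator with multiplier $-i\big(\coth(\delta n)-\frac{1}{\delta n}\big)$ for $n\ne0$ and $0$ for $n=0$, and $\widetilde{\mathcal{G}}_\delta=\delta^{-1}\mathcal{G}_\delta$. Put $\widetilde{\mathcal{L}}_0=(1+i\delta\widetilde{\mathcal{G}}_\delta)\partial_x$ and define recursively $h_0=-v$, $h_1=-i\delta h_0^2+\widetilde{\mathcal{L}}_0h_0$, and for $n\ge2$ $$h_n=-\frac1{2\delta^2}\sum_{j=2}^n\frac{(2i\delta)^j}{j!}\sum_{\substack{n_1,\dots,n_j\in\mathbb{Z}_{\ge0}\\ n_1+\cdots+n_j=n-j}}h_{n_1}\cdots h_{n_j}+\frac{i}{2\delta}\sum_{j=2}^{n+1}\frac{(2i\delta)^j}{j!}\sum_{\substack{n_1,\dots,n_j\in\mathbb{Z}_{\ge0}\\ n_1+\cdots+n_j=n+1-j}}h_{n_1}\cdots h_{n_j}+\widetilde{\mathcal{L}}_0h_{n-1}.$$ With $\mathfrak{p}(n)=0$ for $n$ even and $1$ for $n$ odd, set $\widetilde h_n=\frac{(-i\delta)^{\mathfrak{p}(n)}}{\delta^2}\sum_{j=1}^n\frac{1}{(i\delta)^{n-j}}h_j$ for $n\in\mathbb{N}$, and $$\widetilde E^\delta_0(v)=-\tfrac12\int_{\mathbb{T}}\widetilde h_1dx,\quad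 \widetilde E^\delta_{\kappa-\frac12}(v)=(-1)^{\kappa+1}\tfrac{3}{4\kappa}\mathrm{Re}\int_{\mathbb{T}}\widetilde h_{2\kappa}dx,\quad \widetilde E^\delta_{\kappa}(v)=(-1)^{\kappa+1}\tfrac12\mathrm{Re}\int_{\mathbb{T}}\widetilde h_{2\kappa+1}dx\quad(\kappa\in\mathbb{N}).$$ For KdV: $h^{\rm KdV}_0=-v$, $h^{\rm KdV}_1=-\partial_xv$, $h_n^{\rm KdV}=\sum_{n_1,n_2\ge0,\,n_1+n_2=n-2}h^{\rm KdV}_{n_1}h^{\rm KdV}_{n_2}+\partial_xh^{\rm KdV}_{n-1}$ for $n\ge2$, and $\widetilde E^{\rm KdV}_\kappa(v)=(-1)^\kappa\frac12\int_{\mathbb{T}}h^{\rm KdV}_{2\kappa+2}dx$ for $\kappa\in\mathbb{Z}_{\ge0}$. These quantities are of the form: $\widetilde E^\delta_0=\widetilde E_0^{\rm KdV}=\frac12\|v\|_{L^2}^2$; $\widetilde E^\delta_{\kappa-\frac12}$, $\widetilde E^\delta_\kappa$, $\widetilde E_\kappa^{\rm KdV}$ have quadratic parts $\frac12\sum_{\ell\text{ odd},\,1\le \ell\le 2\kappa-1}\frac{3}{2\kappa}\binom{2\kappa}{\ell}\delta^{\ell-1}\sum_{n\ne0}|n|^{2\kappa-1}|\widehat{\widetilde{\mathcal{G}}_\delta}(n)|^{\ell}|\hat v(n)|^2$, $\frac12\sum_{\ell\text{ even},\,0\le\ell\le2\kappa}\binom{2\kappa+1}{\ell}\delta^{\ell}\sum_{n\ne0}|n|^{2\kappa}|\widehat{\widetilde{\mathcal{G}}_\delta}(n)|^{\ell}|\hat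 v(n)|^2$ and $\frac12\|v\|_{\dot H^\kappa}^2$, respectively, plus terms at least cubic in $v$. For mean-zero $v\in H^\kappa(\mathbb{T})$, the quantities are understood as continuous extensions from mean-zero $C^\infty(\mathbb{T})$ functions. *)

theory Defs
  imports "HOL-Analysis.Analysis"
begin

text \<open>
  Functions on the torus are \<open>2 * pi\<close>-periodic functions on the real line, and the integral over
  the torus is the (unnormalised) Lebesgue integral over \<open>{0..2 * pi}\<close>.
\<close>

definition torus_integral :: "(real \<Rightarrow> 'a::{banach, second_countable_topology}) \<Rightarrow> 'a" where
  "torus_integral f = (LINT x:{0..2 * pi}|lebesgue. f x)"

definition periodic_mean_zero :: "(real \<Rightarrow> real) \<Rightarrow> bool" where
  "periodic_mean_zero v \<longleftrightarrow> (\<forall>x. v (x + 2 * pi) = v x) \<and> torus_integral v = 0"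

definition smooth_mean_zero :: "(real \<Rightarrow> real) \<Rightarrow> bool" where
  "smooth_mean_zero v \<longleftrightarrow>
     periodic_mean_zero v \<and> (\<forall>k x. (deriv ^^ k) v differentiable (at x))"

definition fourier_coeff :: "(real \<Rightarrow> complex) \<Rightarrow> int \<Rightarrow> complex" where
  "fourier_coeff f n = torus_integral (\<lambda>x. f x * cis (- (of_int n * x))) / (2 * of_real pi)"

definition fourier_multiplier :: "(int \<Rightarrow> complex) \<Rightarrow> (real \<Rightarrow> complex) \<Rightarrow> real \<Rightarrow> complex" where
  "fourier_multiplier m f = (\<lambda>x. \<Sum>\<^sub>\<infinity>n. m n * fourier_coeff f n * cis (of_int n * x))"


subsection \<open>The scaled intermediate long wave operators and densities\<close>

definition coth :: "real \<Rightarrow> real" where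
  "coth y = cosh y / sinh y"

definition G_symbol :: "real \<Rightarrow> int \<Rightarrow> complex" where
  "G_symbol \<delta> n =
     (if n = 0 then 0 else - \<i> * of_real (coth (\<delta> * of_int n) - 1 / (\<delta> * of_int n)))"

definition G_op :: "real \<Rightarrow> (real \<Rightarrow> complex) \<Rightarrow> real \<Rightarrow> complex" where
  "G_op \<delta> = fourier_multiplier (G_symbol \<delta>)"

definition Gt_op :: "real \<Rightarrow> (real \<Rightarrow> complex) \<Rightarrow> real \<Rightarrow> complex" where
  "Gt_op \<delta> f = (\<lambda>x. G_op \<delta> f x / of_real \<delta>)"

definition L0_op :: "real \<Rightarrow> (real \<Rightarrow> complex) \<Rightarrow> real \<Rightarrow> complex" where
  "L0_op \<delta> f =
     (let f' = (\<lambda>x. vector_derivative f (at x))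
      in (\<lambda>x. f' x + \<i> * of_real \<delta> * Gt_op \<delta> f' x))"

text \<open>A tuple \<open>(n\<^sub>1, \<dots>, n\<^sub>j)\<close> is a list of length \<open>j\<close>.\<close>

definition compositions :: "nat \<Rightarrow> nat \<Rightarrow> nat list set" where
  "compositions j s = {ns. length ns = j \<and> sum_list ns = s}"

function h_ILW :: "real \<Rightarrow> (real \<Rightarrow> real) \<Rightarrow> nat \<Rightarrow> real \<Rightarrow> complex" where
  "h_ILW \<delta> v 0 = (\<lambda>x. - of_real (v x))"
| "h_ILW \<delta> v (Suc 0) = (\<lambda>x. - \<i> * of_real \<delta> * (h_ILW \<delta> v 0 x)\<^sup>2 + L0_op \<delta> (h_ILW \<delta> v 0) x)"
| "n \<ge> 2 \<Longrightarrow> h_ILW \<delta> v n = (\<lambda>x.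
     - (1 / (2 * (of_real \<delta>)\<^sup>2)) *
         (\<Sum>j=2..n. (2 * \<i> * of_real \<delta>) ^ j / fact j *
            (\<Sum>ns\<in>compositions j (n - j). prod_list (map (\<lambda>m. h_ILW \<delta> v m x) ns)))
     + \<i> / (2 * of_real \<delta>) *
         (\<Sum>j=2..n+1. (2 * \<i> * of_real \<delta>) ^ j / fact j *
            (\<Sum>ns\<in>compositions j (n + 1 - j). prod_list (map (\<lambda>m. h_ILW \<delta> v m x) ns)))
     + L0_op \<delta> (h_ILW \<delta> v (n - 1)) x)"
proof goal_cases
  case (1 P x)
  obtain \<delta> v n where x: "x = (\<delta>, v, n)"
    by (metis prod.exhaust)
  consider "n = 0" | "n = Suc 0" | "n \<ge> 2"
    by linarith
  then show ?case
    using 1 x by cases blast+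
qed auto
termination
proof (relation "Wellfounded.measure (\<lambda>(\<delta>, v, n). n)", goal_cases)
  case (4 n \<delta> v x j ns m)
  then have "m \<le> n - j" using member_le_sum_list[of m ns] by (auto simp: compositions_def)
  with 4 show ?case by auto
next
  case (5 n \<delta> v x j ns m)
  then have "m \<le> n + 1 - j" using member_le_sum_list[of m ns] by (auto simp: compositions_def)
  with 5 show ?case by auto
qed auto

definition ht_ILW :: "real \<Rightarrow> (real \<Rightarrow> real) \<Rightarrow> nat \<Rightarrow> real \<Rightarrow> complex" where
  "ht_ILW \<delta> v n = (\<lambda>x. (- \<i> * of_real \<delta>) ^ (if even n then 0 else 1) / (of_real \<delta>)\<^sup>2 *
     (\<Sum>j=1..n. 1 / (\<i> * of_real \<delta>) ^ (n - j) * h_ILW \<delta> v j x))"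

definition E_ILW_zero :: "real \<Rightarrow> (real \<Rightarrow> real) \<Rightarrow> complex" where
  "E_ILW_zero \<delta> v = - (1 / 2) * torus_integral (ht_ILW \<delta> v 1)"

text \<open>The functionals of index \<open>\<kappa> - 1/2\<close> and \<open>\<kappa>\<close>, for \<open>\<kappa> \<ge> 1\<close>.\<close>

definition E_ILW_half :: "nat \<Rightarrow> real \<Rightarrow> (real \<Rightarrow> real) \<Rightarrow> real" where
  "E_ILW_half \<kappa> \<delta> v =
     (- 1) ^ (\<kappa> + 1) * (3 / (4 * real \<kappa>)) * Re (torus_integral (ht_ILW \<delta> v (2 * \<kappa>)))"

definition E_ILW :: "nat \<Rightarrow> real \<Rightarrow> (real \<Rightarrow> real) \<Rightarrow> real" where
  "E_ILW \<kappa> \<delta> v =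
     (- 1) ^ (\<kappa> + 1) * (1 / 2) * Re (torus_integral (ht_ILW \<delta> v (2 * \<kappa> + 1)))"


subsection \<open>The KdV densities\<close>

function h_KdV :: "(real \<Rightarrow> real) \<Rightarrow> nat \<Rightarrow> real \<Rightarrow> real" where
  "h_KdV v 0 = (\<lambda>x. - v x)"
| "h_KdV v (Suc 0) = (\<lambda>x. - deriv v x)"
| "n \<ge> 2 \<Longrightarrow> h_KdV v n = (\<lambda>x.
     (\<Sum>ns\<in>compositions 2 (n - 2). prod_list (map (\<lambda>m. h_KdV v m x) ns))
     + deriv (h_KdV v (n - 1)) x)"
proof goal_cases
  case (1 P x)
  obtain v n where x: "x = (v, n)"
    by (metis prod.exhaust)
  consider "n = 0" | "n = Suc 0" | "n \<ge> 2"
    by linarith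
  then show ?case
    using 1 x by cases blast+
qed auto
termination
proof (relation "Wellfounded.measure (\<lambda>(v, n). n)", goal_cases)
  case (2 n v x ns m)
  then have "m \<le> n - 2" using member_le_sum_list[of m ns] by (auto simp: compositions_def)
  with 2 show ?case by auto
qed auto

definition E_KdV :: "nat \<Rightarrow> (real \<Rightarrow> real) \<Rightarrow> real" where
  "E_KdV \<kappa> v = (- 1) ^ \<kappa> * (1 / 2) * torus_integral (h_KdV v (2 * \<kappa> + 2))"


subsection \<open>Conservation along sufficiently smooth solutions\<close>

text \<open>
  A time-dependent function \<open>v t x\<close>, with \<open>v\<close> in \<open>C(\<real>; C\<^sup>N)\<close> with respect to the space variable.
\<close>

definition spacetime_class :: "nat \<Rightarrow> (real \<Rightarrow> real \<Rightarrow> real) \<Rightarrow> bool" where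
  "spacetime_class N v \<longleftrightarrow>
     (\<forall>t. periodic_mean_zero (v t)) \<and>
     (\<forall>k<N. \<forall>t x. (deriv ^^ k) (v t) differentiable (at x)) \<and>
     (\<forall>k\<le>N. continuous_on UNIV (\<lambda>(t, x). (deriv ^^ k) (v t) x))"

definition ILW_solution :: "nat \<Rightarrow> real \<Rightarrow> (real \<Rightarrow> real \<Rightarrow> real) \<Rightarrow> bool" where
  "ILW_solution N \<delta> v \<longleftrightarrow> spacetime_class N v \<and>
     (\<forall>t x. (\<lambda>s. v s x) differentiable (at t) \<and>
        of_real (deriv (\<lambda>s. v s x) t) - Gt_op \<delta> (\<lambda>y. of_real ((deriv ^^ 2) (v t) y)) x
          = complex_of_real (deriv (\<lambda>y. (v t y)\<^sup>2) x))"

definition KdV_solution :: "nat \<Rightarrow> (real \<Rightarrow> real \<Rightarrow> real) \<Rightarrow> bool" where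
  "KdV_solution N v \<longleftrightarrow> spacetime_class N v \<and>
     (\<forall>t x. (\<lambda>s. v s x) differentiable (at t) \<and>
        deriv (\<lambda>s. v s x) t + (1 / 3) * (deriv ^^ 3) (v t) x = deriv (\<lambda>y. (v t y)\<^sup>2) x)"

definition conserved :: "((real \<Rightarrow> real) \<Rightarrow> 'a) \<Rightarrow> (real \<Rightarrow> real \<Rightarrow> real) \<Rightarrow> bool" where
  "conserved E v \<longleftrightarrow> (\<forall>s t. E (v s) = E (v t))"


subsection \<open>Sobolev spaces and continuous extension from smooth functions\<close>

definition sobolev_mean_zero :: "nat \<Rightarrow> (real \<Rightarrow> real) \<Rightarrow> bool" where
  "sobolev_mean_zero \<kappa> v \<longleftrightarrow>
     periodic_mean_zero v \<and>
     v \<in> borel_measurable lebesgue \<and>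
     set_integrable lebesgue {0..2 * pi} (\<lambda>x. (v x)\<^sup>2) \<and>
     (\<lambda>n::int. (1 + (of_int n)\<^sup>2) ^ \<kappa> * (cmod (fourier_coeff (\<lambda>x. of_real (v x)) n))\<^sup>2)
       summable_on UNIV"

definition sobolev_norm :: "nat \<Rightarrow> (real \<Rightarrow> real) \<Rightarrow> real" where
  "sobolev_norm \<kappa> v =
     sqrt (\<Sum>\<^sub>\<infinity>n::int. (1 + (of_int n)\<^sup>2) ^ \<kappa> * (cmod (fourier_coeff (\<lambda>x. of_real (v x)) n))\<^sup>2)"

text \<open>
  The filter of smooth mean-zero functions tending to \<open>v\<close> in \<open>H\<^sup>\<kappa>\<close>. If \<open>v\<close> is itself smooth, then
  \<open>v\<close> lies in every set of the filter, so that a limit of \<open>E\<close> along it can only be \<open>E v\<close>.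
\<close>

definition smooth_approx :: "nat \<Rightarrow> (real \<Rightarrow> real) \<Rightarrow> (real \<Rightarrow> real) filter" where
  "smooth_approx \<kappa> v =
     inf (filtercomap (\<lambda>u. sobolev_norm \<kappa> (\<lambda>x. u x - v x)) (nhds 0))
         (principal {u. smooth_mean_zero u})"

definition extendable :: "nat \<Rightarrow> ((real \<Rightarrow> real) \<Rightarrow> real) \<Rightarrow> bool" where
  "extendable \<kappa> E \<longleftrightarrow> (\<forall>v. sobolev_mean_zero \<kappa> v \<longrightarrow> (\<exists>l. (E \<longlongrightarrow> l) (smooth_approx \<kappa> v)))"

definition extension :: "nat \<Rightarrow> ((real \<Rightarrow> real) \<Rightarrow> real) \<Rightarrow> (real \<Rightarrow> real) \<Rightarrow> real" where
  "extension \<kappa> E v = Lim (smooth_approx \<kappa> v) E"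

end

theory Submission
  imports Defs "HOL-Library.Poly_Mapping" "HOL-Computational_Algebra.Formal_Power_Series" "HOL-Real_Asymp.Real_Asymp"
begin

text \<open>
  On the Fourier side the densities are polynomials in the coefficients of \<open>v\<close> that make sense for
  any even dispersion symbol \<open>A\<close> and any complex \<open>\<theta>\<close>; ILW is the case \<open>\<theta> = \<i> \<delta>\<close> and KdV is \<open>\<theta> = 0\<close>,
  \<open>A = - \<partial>\<^sup>2 / 3\<close>. The product \<open>H\<^sup>s \<times> H\<^sup>r \<rightarrow> H\<^sup>s\<^sup>+\<^sup>r\<^sup>-\<^sup>\<kappa>\<^sup>-\<^sup>1\<close> (for \<open>s, r \<le> \<kappa>\<close> and \<open>s + r \<ge> 0\<close>) shows that
  \<open>h\<^sub>n\<close> depends continuously on \<open>v \<in> H\<^sup>\<kappa>\<close>, as an element of \<open>H\<^sup>\<kappa>\<^sup>-\<^sup>n\<close>, for \<open>n \<le> 2 \<kappa> + 1\<close>. Hence the functionals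
  extend, converge as \<open>\<delta> \<rightarrow> 0\<close>, and may be differentiated in time and in \<open>\<theta>\<close>, and identities between
  them need only be checked for trigonometric polynomials, where they are identities of formal power
  series. Conservation holds because the variation of the generating function of the densities along
  the flow has a closed form with vanishing mean. By conjugation symmetry the functional of index
  \<open>\<kappa> - 1/2\<close> is a difference quotient in \<open>\<theta>\<close> between \<open>\<i> \<delta>\<close> and \<open>- \<i> \<delta>\<close>, so that its limit is a
  \<open>\<theta>\<close>-derivative at \<open>0\<close>, which an Euler-type identity reduces to the KdV functional.
\<close>

subsection \<open>Weighted sequence spaces and convolution\<close>

text \<open>For rough v the top density, of index 2 \<kappa> + 1, is a distribution of order
  -\<kappa> - 1, so products involving negative regularity need a meaning. The target index s + r -
  \<kappa> - 1 is not optimal, but it makes the bookkeeping additive: if density i has order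
  \<kappa> - i, a product of j + 1 densities of total index s has order \<kappa> - s - j, exactly
  what the recursion assigns to that term. The condition s + r \<ge> 0 at each multiplication then
  becomes an index of at most 2 \<kappa> + 1.

  In closed form \<Psi>(H) = (exp(2 \<theta> H) - 1 - 2 \<theta> H) / (2 \<theta>^2). The algebra
  rests on its equation \<Psi>' = 2 \<theta> \<Psi> + 2 H, which survives at \<theta> = 0, where
  \<Psi> = H^2; hence one computation serves both flows.

  The functional of index \<kappa> is the mean of a coefficient of \<Psi>(H); that of index \<kappa>
  - 1/2 is such a mean divided by \<theta>, hence singular at first sight. One \<theta>-derivative
  costs one order, so at index 2 \<kappa> it has the order of density 2 \<kappa> + 1, and H^\<kappa>
  still suffices.\<close>

definition weight :: "int \<Rightarrow> real" where
  "weight n = 1 + (of_int n)\<^sup>2"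

text \<open>\<open>weight\<close> is the squared Japanese bracket, so this is H^s on the Fourier
  side. The index is an integer that is often negative, hence \<open>powi\<close>.\<close>

definition sob :: "int \<Rightarrow> (int \<Rightarrow> complex) \<Rightarrow> bool" where
  "sob s F \<longleftrightarrow> (\<lambda>n. weight n powi s * (cmod (F n))\<^sup>2) summable_on UNIV"

definition sobsq :: "int \<Rightarrow> (int \<Rightarrow> complex) \<Rightarrow> real" where
  "sobsq s F = (\<Sum>\<^sub>\<infinity>n. weight n powi s * (cmod (F n))\<^sup>2)"

definition conv :: "(int \<Rightarrow> complex) \<Rightarrow> (int \<Rightarrow> complex) \<Rightarrow> int \<Rightarrow> complex" where
  "conv F G n = (\<Sum>\<^sub>\<infinity>m. F m * G (n - m))"

lemma weight_ge_1: "1 \<le> weight n"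
  by (simp add: weight_def)

lemma weight_pos: "0 < weight n"
  using weight_ge_1[of n] by linarith

lemma weight_minus [simp]: "weight (- n) = weight n"
  by (simp add: weight_def)

lemma weight_add_le: "weight (m + k) \<le> 2 * (weight m + weight k)"
proof -
  have "0 \<le> (real_of_int m - real_of_int k)\<^sup>2" by simp
  then show ?thesis by (simp add: weight_def power2_eq_square algebra_simps)
qed

lemma weight_add_le_mult: "weight (m + k) \<le> 2 * weight m * weight k"
proof -
  have "0 \<le> (real_of_int m - real_of_int k)\<^sup>2 + 2 * (real_of_int m * real_of_int k)\<^sup>2" by simp
  then show ?thesis by (simp add: weight_def power2_eq_square algebra_simps)
qed

lemma summable_on_inverse_weight: "(\<lambda>n. 1 / weight n) summable_on UNIV"
proof -
  have s: "summable (\<lambda>n. 1 / weight (int n))"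
  proof (rule summable_comparison_test')
    show "summable (\<lambda>n. 1 / (real n)\<^sup>2)"
      using inverse_power_summable[of 2, where ?'a = real] by (simp add: inverse_eq_divide)
    show "norm (1 / weight (int n)) \<le> 1 / (real n)\<^sup>2" if "n \<ge> 1" for n
      using that by (auto simp: weight_def intro!: divide_left_mono mult_pos_pos add_pos_nonneg)
  qed
  have "(\<lambda>n. 1 / weight (int n)) summable_on UNIV"
    using s by (subst summable_on_UNIV_nonneg_real_iff) (auto intro: less_imp_le weight_pos)
  then have 1: "(\<lambda>n. 1 / weight n) summable_on range int"
    by (subst summable_on_reindex) (auto simp: o_def inj_on_def)
  have "(\<lambda>n. 1 / weight (- int n)) summable_on UNIV"
    using s by (subst summable_on_UNIV_nonneg_real_iff) (auto intro: less_imp_le weight_pos)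
  then have 2: "(\<lambda>n. 1 / weight n) summable_on range (\<lambda>n. - int n)"
    by (subst summable_on_reindex) (auto simp: o_def inj_on_def)
  have "range int \<union> range (\<lambda>n. - int n) = UNIV"
    by (auto intro: int_cases2)
  then show ?thesis
    using summable_on_union[OF 1 2] by simp
qed

lemma Cauchy_Schwarz_infsum:
  fixes f g :: "'a \<Rightarrow> real"
  assumes "\<And>x. 0 \<le> f x" "\<And>x. 0 \<le> g x"
    and "(\<lambda>x. (f x)\<^sup>2) summable_on UNIV" "(\<lambda>x. (g x)\<^sup>2) summable_on UNIV"
  shows "(\<lambda>x. f x * g x) summable_on UNIV"
    and "(\<Sum>\<^sub>\<infinity>x. f x * g x)\<^sup>2 \<le> (\<Sum>\<^sub>\<infinity>x. (f x)\<^sup>2) * (\<Sum>\<^sub>\<infinity>x. (g x)\<^sup>2)"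
proof -
  let ?B = "sqrt ((\<Sum>\<^sub>\<infinity>x. (f x)\<^sup>2) * (\<Sum>\<^sub>\<infinity>x. (g x)\<^sup>2))"
  have nn: "0 \<le> (\<Sum>\<^sub>\<infinity>x. (f x)\<^sup>2)" "0 \<le> (\<Sum>\<^sub>\<infinity>x. (g x)\<^sup>2)"
    by (auto intro: infsum_nonneg)
  have bd: "sum (\<lambda>x. f x * g x) X \<le> ?B" if "finite X" for X
  proof -
    have "(sum (\<lambda>x. f x * g x) X)\<^sup>2 \<le> (\<Sum>x\<in>X. (f x)\<^sup>2) * (\<Sum>x\<in>X. (g x)\<^sup>2)"
      by (rule Cauchy_Schwarz_ineq_sum)
    also have "\<dots> \<le> (\<Sum>\<^sub>\<infinity>x. (f x)\<^sup>2) * (\<Sum>\<^sub>\<infinity>x. (g x)\<^sup>2)"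
      using that assms nn by (intro mult_mono finite_sum_le_infsum sum_nonneg) auto
    finally show ?thesis by (rule real_le_rsqrt)
  qed
  show s: "(\<lambda>x. f x * g x) summable_on UNIV"
    using bd assms by (intro nonneg_bdd_above_summable_on) (auto intro!: bdd_aboveI2)
  have "(\<Sum>\<^sub>\<infinity>x. f x * g x) \<le> ?B"
    using bd s by (intro infsum_le_finite_sums) auto
  then have "(\<Sum>\<^sub>\<infinity>x. f x * g x)\<^sup>2 \<le> ?B\<^sup>2"
    using assms by (intro power_mono infsum_nonneg) auto
  then show "(\<Sum>\<^sub>\<infinity>x. f x * g x)\<^sup>2 \<le> (\<Sum>\<^sub>\<infinity>x. (f x)\<^sup>2) * (\<Sum>\<^sub>\<infinity>x. (g x)\<^sup>2)"
    using nn by simp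
qed

text \<open>The shear (n, m) to (m, n - m) turns the double sum into a sum of products; the rest is
  Fubini for absolutely summable families.\<close>

lemma has_sum_convolution:
  fixes u v :: "int \<Rightarrow> 'a::{real_normed_field, banach}"
  assumes "(\<lambda>n. norm (u n)) summable_on UNIV" "(\<lambda>n. norm (v n)) summable_on UNIV"
  shows "(\<lambda>(n, m). norm (u m * v (n - m))) summable_on UNIV \<times> UNIV"
    and "(\<lambda>m. norm (u m * v (n - m))) summable_on UNIV"
    and "(\<lambda>n. norm (\<Sum>\<^sub>\<infinity>m. u m * v (n - m))) summable_on UNIV"
    and "(\<Sum>\<^sub>\<infinity>n. \<Sum>\<^sub>\<infinity>m. u m * v (n - m)) = (\<Sum>\<^sub>\<infinity>n. u n) * (\<Sum>\<^sub>\<infinity>n. v n)"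
proof -
  have bij: "bij_betw (\<lambda>(n, m). (m, n - m)) (UNIV \<times> UNIV) (UNIV \<times> (UNIV :: int set))"
    by (rule bij_betwI[where g = "\<lambda>(m, k). (m + k, m)"]) auto
  have "(\<lambda>(m, k). norm (u m * v k)) summable_on UNIV \<times> UNIV"
  proof (rule summable_on_SigmaI[where g = "\<lambda>m. norm (u m) * (\<Sum>\<^sub>\<infinity>k. norm (v k))"], goal_cases)
    case (1 m)
    show ?case
      using has_sum_cmult_right[OF has_sum_infsum[OF assms(2)], of "norm (u m)"]
      by (simp add: norm_mult)
  next
    case 2
    show ?case by (intro summable_on_cmult_left assms)
  qed auto
  then show 1: "(\<lambda>(n, m). norm (u m * v (n - m))) summable_on UNIV \<times> UNIV"
    by (subst (asm) summable_on_reindex_bij_betw[OF bij, symmetric]) (simp add: case_prod_unfold)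
  have a: "(\<lambda>z. norm (case z of (n, m) \<Rightarrow> u m * v (n - m))) summable_on (SIGMA n:UNIV. UNIV)"
    using 1 by (simp add: case_prod_unfold)
  show 2: "(\<lambda>m. norm (u m * v (n - m))) summable_on UNIV" for n
    using Infinite_Sum.abs_summable_on_Sigma_iff[THEN iffD1, OF a] by simp
  have 3: "(\<lambda>n. \<Sum>\<^sub>\<infinity>m. norm (u m * v (n - m))) summable_on UNIV"
    using Infinite_Sum.abs_summable_on_Sigma_iff[THEN iffD1, OF a, THEN conjunct2]
    by (simp add: infsum_nonneg)
  show "(\<lambda>n. norm (\<Sum>\<^sub>\<infinity>m. u m * v (n - m))) summable_on UNIV"
    by (rule summable_on_comparison_test[OF 3]) (auto intro: norm_infsum_bound 2)
  have "(\<Sum>\<^sub>\<infinity>n. \<Sum>\<^sub>\<infinity>m. u m * v (n - m)) = (\<Sum>\<^sub>\<infinity>(n, m)\<in>UNIV \<times> UNIV. u m * v (n - m))"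
    using abs_summable_summable[OF a] by (intro infsum_Sigma'_banach) simp
  also have "\<dots> = (\<Sum>\<^sub>\<infinity>(m, k)\<in>UNIV \<times> UNIV. u m * v k)"
    by (subst infsum_reindex_bij_betw[OF bij, symmetric]) (simp add: case_prod_unfold)
  also have "\<dots> = (\<Sum>\<^sub>\<infinity>m. \<Sum>\<^sub>\<infinity>k. u m * v k)"
  proof (rule infsum_Sigma'_banach[symmetric])
    show "(\<lambda>(m, k). u m * v k) summable_on UNIV \<times> UNIV"
      using abs_summable_summable[OF a]
      by (subst summable_on_reindex_bij_betw[OF bij, symmetric]) (simp add: case_prod_unfold)
  qed
  also have "\<dots> = (\<Sum>\<^sub>\<infinity>n. u n) * (\<Sum>\<^sub>\<infinity>n. v n)"
    by (simp add: infsum_cmult_right' infsum_cmult_left')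
  finally show "(\<Sum>\<^sub>\<infinity>n. \<Sum>\<^sub>\<infinity>m. u m * v (n - m)) = (\<Sum>\<^sub>\<infinity>n. u n) * (\<Sum>\<^sub>\<infinity>n. v n)" .
qed

text \<open>Here a, b, c are the weights at n, m, n - m. The negative power of b is traded for
  powers of a and c through b \<le> 2ac; since -s \<le> r, the power of c so created is absorbed by
  c^r, and r \<le> \<kappa> makes the remaining power of a at most 1.\<close>

lemma kernel_bound_neg:
  fixes a b c :: real and s r \<kappa> :: int
  assumes "1 \<le> a" "1 \<le> b" "1 \<le> c" "b \<le> 2 * a * c" "r \<le> \<kappa>" "0 \<le> s + r" "s < 0"
  shows "a powi (s + r - \<kappa> - 1) \<le> 4 powi \<kappa> * (b powi s * c powi r) * (1 / a)"
proof -
  have pos: "a > 0" "b > 0" "c > 0" using assms by auto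
  have "b powi (- s) \<le> (2 * a * c) powi (- s)"
    using assms pos by (intro power_int_mono) auto
  also have "\<dots> = 2 powi (- s) * (a powi (- s) * c powi (- s))"
    by (simp add: power_int_mult_distrib)
  also have "\<dots> \<le> 4 powi \<kappa> * (a powi (- s) * c powi r)"
  proof (intro mult_mono)
    have "(2::real) powi (- s) \<le> 2 powi \<kappa>"
      using assms by (intro power_int_increasing) auto
    also have "\<dots> \<le> 4 powi \<kappa>"
      using assms by (intro power_int_mono) auto
    finally show "(2::real) powi (- s) \<le> 4 powi \<kappa>" .
    show "c powi (- s) \<le> c powi r"
      using assms by (intro power_int_increasing) auto
  qed (use pos in auto)
  finally have "b powi (- s) \<le> 4 powi \<kappa> * (a powi (- s) * c powi r)" .
  then have "a powi (s + r - \<kappa>) * b powi (- s) \<le> a powi (s + r - \<kappa>) * (4 powi \<kappa> * (a powi (- s) * c powi r))"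
    using pos by (intro mult_left_mono) auto
  also have "\<dots> = 4 powi \<kappa> * c powi r * a powi (r - \<kappa>)"
    using pos by (simp add: power_int_add[symmetric] mult.assoc mult.left_commute)
  also have "\<dots> \<le> 4 powi \<kappa> * c powi r * 1"
  proof (intro mult_left_mono)
    have "a powi (r - \<kappa>) \<le> a powi 0" using assms by (intro power_int_increasing) auto
    then show "a powi (r - \<kappa>) \<le> 1" by simp
  qed (use pos in auto)
  finally show ?thesis
    using pos by (simp add: power_int_diff power_int_minus power_int_add field_simps)
qed

text \<open>In the application b is the weight of the larger of the two frequencies, whence a \<le>
  4b. As r \<le> \<kappa>, at most s - 1 powers of b are used, which leaves one factor 1/b to
  spare.\<close>

lemma kernel_bound_nonneg:
  fixes a b c :: real and s r \<kappa> :: int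
  assumes "1 \<le> a" "1 \<le> b" "1 \<le> c" "a \<le> 4 * b" "s \<le> \<kappa>" "r \<le> \<kappa>" "0 \<le> s" "0 \<le> r"
    and "0 \<le> s + r - \<kappa> - 1"
  shows "a powi (s + r - \<kappa> - 1) \<le> 4 powi \<kappa> * (b powi s * c powi r) * (1 / b)"
proof -
  have pos: "a > 0" "b > 0" "c > 0" using assms by auto
  have "a powi (s + r - \<kappa> - 1) \<le> (4 * b) powi (s + r - \<kappa> - 1)"
    using assms by (intro power_int_mono) auto
  also have "\<dots> = 4 powi (s + r - \<kappa> - 1) * b powi (s + r - \<kappa> - 1)"
    by (simp add: power_int_mult_distrib)
  also have "\<dots> \<le> 4 powi \<kappa> * b powi (s - 1)"
    using assms by (intro mult_mono power_int_increasing) auto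
  also have "\<dots> = 4 powi \<kappa> * (b powi s * 1) * (1 / b)"
    using pos by (simp add: power_int_diff)
  also have "\<dots> \<le> 4 powi \<kappa> * (b powi s * c powi r) * (1 / b)"
  proof (intro mult_mono)
    have "c powi 0 \<le> c powi r" using assms by (intro power_int_increasing) auto
    then show "1 \<le> c powi r" by simp
  qed (use pos in auto)
  finally show ?thesis .
qed

text \<open>Every case leaves one spare inverse weight, at n, m or n - m, and inverse weights are
  summable over the integers; this is what the extra -1 in the target index buys. At most one index
  can be negative; if none is, the sign of the target exponent and then the larger frequency
  decide.\<close>

lemma kernel_bound:
  fixes s r \<kappa> :: int
  assumes "s \<le> \<kappa>" "r \<le> \<kappa>" "0 \<le> s + r"
  shows "weight n powi (s + r - \<kappa> - 1) \<le> 4 powi \<kappa> * (weight m powi s * weight (n - m) powi r) *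
           (1 / weight n + 1 / weight m + 1 / weight (n - m))"
proof -
  define a b c where "a = weight n" and "b = weight m" and "c = weight (n - m)"
  have ge: "1 \<le> a" "1 \<le> b" "1 \<le> c"
    by (simp_all add: a_def b_def c_def weight_ge_1)
  have b: "b \<le> 2 * a * c" and c: "c \<le> 2 * a * b" and a: "a \<le> 2 * (b + c)"
    using weight_add_le_mult[of n "m - n"] weight_add_le_mult[of n "- m"] weight_add_le[of m "n - m"]
      weight_minus[of "n - m"]
    by (simp_all add: a_def b_def c_def)
  have le: "a powi (s + r - \<kappa> - 1) \<le> 4 powi \<kappa> * (b powi s * c powi r) * (1 / a + 1 / b + 1 / c)"
    if "a powi (s + r - \<kappa> - 1) \<le> 4 powi \<kappa> * (b powi s * c powi r) * x" "x \<in> {1 / a, 1 / b, 1 / c}"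
    for x
  proof -
    have "x \<le> 1 / a + 1 / b + 1 / c" using that(2) ge by auto
    then have "4 powi \<kappa> * (b powi s * c powi r) * x \<le> 4 powi \<kappa> * (b powi s * c powi r) * (1 / a + 1 / b + 1 / c)"
      using ge by (intro mult_left_mono) auto
    then show ?thesis using that(1) by linarith
  qed
  consider "s < 0" | "r < 0" | "0 \<le> s" "0 \<le> r" "s + r - \<kappa> - 1 < 0"
    | "0 \<le> s" "0 \<le> r" "0 \<le> s + r - \<kappa> - 1" "c \<le> b" | "0 \<le> s" "0 \<le> r" "0 \<le> s + r - \<kappa> - 1" "b \<le> c"
    by linarith
  then have "a powi (s + r - \<kappa> - 1) \<le> 4 powi \<kappa> * (b powi s * c powi r) * (1 / a + 1 / b + 1 / c)"
  proof cases
    case 1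
    show ?thesis by (rule le[OF kernel_bound_neg]) (use 1 ge b assms in auto)
  next
    case 2
    have "a powi (r + s - \<kappa> - 1) \<le> 4 powi \<kappa> * (c powi r * b powi s) * (1 / a)"
      by (rule kernel_bound_neg) (use 2 ge c assms in auto)
    then show ?thesis by (intro le[of "1 / a"]) (auto simp: ac_simps)
  next
    case 3
    have "a powi (s + r - \<kappa> - 1) \<le> a powi (- 1)"
      using ge 3 by (intro power_int_increasing) auto
    also have "\<dots> = 1 * (1 * 1) * (1 / a)" by (simp add: power_int_minus inverse_eq_divide)
    also have "\<dots> \<le> 4 powi \<kappa> * (b powi s * c powi r) * (1 / a)"
    proof (intro mult_right_mono mult_mono)
      have "(4::real) powi 0 \<le> 4 powi \<kappa>" using 3 assms by (intro power_int_increasing) auto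
      then show "(1::real) \<le> 4 powi \<kappa>" by simp
      have "b powi 0 \<le> b powi s" using ge 3 by (intro power_int_increasing) auto
      then show "1 \<le> b powi s" by simp
      have "c powi 0 \<le> c powi r" using ge 3 by (intro power_int_increasing) auto
      then show "1 \<le> c powi r" by simp
    qed (use ge in auto)
    finally show ?thesis by (intro le[of "1 / a"]) auto
  next
    case 4
    show ?thesis by (rule le[OF kernel_bound_nonneg]) (use 4 ge a assms in auto)
  next
    case 5
    have "a powi (r + s - \<kappa> - 1) \<le> 4 powi \<kappa> * (c powi r * b powi s) * (1 / c)"
      by (rule kernel_bound_nonneg) (use 5 ge a assms in auto)
    then show ?thesis by (intro le[of "1 / c"]) (auto simp: ac_simps)
  qed
  then show ?thesis by (simp add: a_def b_def c_def)
qed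


lemma summable_on_sum3:
  fixes f g h :: "'a \<Rightarrow> real"
  assumes "f summable_on A" "g summable_on A" "h summable_on A"
  shows "(\<lambda>x. f x + g x + h x) summable_on A"
    and "infsum (\<lambda>x. f x + g x + h x) A = infsum f A + infsum g A + infsum h A"
  using assms by (simp_all add: summable_on_add infsum_add)

lemma square_sum3_le: "(x + y + z)\<^sup>2 \<le> 3 * (x\<^sup>2 + y\<^sup>2 + (z::real)\<^sup>2)"
proof -
  have "0 \<le> (x - y)\<^sup>2 + (y - z)\<^sup>2 + (z - x)\<^sup>2" by simp
  then show ?thesis by (simp add: power2_eq_square algebra_simps)
qed

lemma sqrt_sum3_le:
  assumes "0 \<le> x" "0 \<le> y" "0 \<le> z"
  shows "sqrt (x + y + z) \<le> sqrt x + sqrt y + sqrt z"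
  using sqrt_add_le_add_sqrt[of "x + y" z] sqrt_add_le_add_sqrt[of x y] assms by simp

text \<open>The square-summable factor \<alpha> may sit on the output or on either input. On the
  output, Cauchy-Schwarz bounds the convolution uniformly; on an input, it leaves \<open>W\<close>,
  the convolution of the squares, whose sum is the product of the squared norms. The 9 is 3 for the
  square of a sum of three terms, times three terms.\<close>

lemma conv_l2_weighted:
  fixes f g \<alpha> :: "int \<Rightarrow> real"
  assumes nn: "\<And>n. 0 \<le> f n" "\<And>n. 0 \<le> g n" "\<And>n. 0 \<le> \<alpha> n"
    and sf: "(\<lambda>n. (f n)\<^sup>2) summable_on UNIV" and sg: "(\<lambda>n. (g n)\<^sup>2) summable_on UNIV"
    and sa: "(\<lambda>n. (\<alpha> n)\<^sup>2) summable_on UNIV" and le1: "\<And>n. \<alpha> n \<le> 1"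
  defines "B \<equiv> (\<Sum>\<^sub>\<infinity>n. (\<alpha> n)\<^sup>2) * ((\<Sum>\<^sub>\<infinity>n. (f n)\<^sup>2) * (\<Sum>\<^sub>\<infinity>n. (g n)\<^sup>2))"
    and "T \<equiv> \<lambda>n. \<Sum>\<^sub>\<infinity>m. (\<alpha> n + \<alpha> m + \<alpha> (n - m)) * (f m * g (n - m))"
  shows "(\<lambda>m. f m * g (n - m)) summable_on UNIV"
    and "(\<lambda>m. (\<alpha> n + \<alpha> m + \<alpha> (n - m)) * (f m * g (n - m))) summable_on UNIV"
    and "(\<lambda>n. (T n)\<^sup>2) summable_on UNIV" and "(\<Sum>\<^sub>\<infinity>n. (T n)\<^sup>2) \<le> 9 * B"
proof -
  have bij: "bij_betw (\<lambda>m. n - m) UNIV (UNIV :: int set)" for n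
    by (rule bij_betwI[where g = "\<lambda>m. n - m"]) auto
  have sh: "(\<lambda>m. (h (n - m))\<^sup>2) summable_on UNIV" "(\<Sum>\<^sub>\<infinity>m. (h (n - m))\<^sup>2) = (\<Sum>\<^sub>\<infinity>m. (h m)\<^sup>2)"
    if "(\<lambda>n. (h n)\<^sup>2) summable_on UNIV" for h :: "int \<Rightarrow> real" and n
    using that summable_on_reindex_bij_betw[OF bij, of "\<lambda>m. (h m)\<^sup>2" n]
      infsum_reindex_bij_betw[OF bij, of "\<lambda>m. (h m)\<^sup>2" n] by auto
  note C1 = Cauchy_Schwarz_infsum[of f "\<lambda>m. g (n - m)" for n, OF nn(1) nn(2) sf sh(1)[OF sg], unfolded sh(2)[OF sg]]
  show 1: "(\<lambda>m. f m * g (n - m)) summable_on UNIV" for n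
    by (rule C1(1))
  have u: "(\<lambda>n. norm ((f n)\<^sup>2)) summable_on UNIV" "(\<lambda>n. norm ((g n)\<^sup>2)) summable_on UNIV"
    using sf sg by auto
  define W where "W n = (\<Sum>\<^sub>\<infinity>m. (f m)\<^sup>2 * (g (n - m))\<^sup>2)" for n
  note hc = has_sum_convolution[OF u]
  have W: "W summable_on UNIV" "(\<Sum>\<^sub>\<infinity>n. W n) = (\<Sum>\<^sub>\<infinity>n. (f n)\<^sup>2) * (\<Sum>\<^sub>\<infinity>n. (g n)\<^sup>2)"
    using hc(3)[THEN abs_summable_summable] hc(4) by (simp_all add: W_def[abs_def])
  have fg: "(\<lambda>m. (f m * g (n - m))\<^sup>2) summable_on UNIV" for n
    using hc(2)[of n] by (simp add: power_mult_distrib)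
  have fgW: "(\<Sum>\<^sub>\<infinity>m. (f m * g (n - m))\<^sup>2) = W n" for n
    by (simp add: W_def power_mult_distrib)
  have nfg: "0 \<le> f m * g (n - m)" for n m using nn by simp
  note C2 = Cauchy_Schwarz_infsum[of \<alpha> "\<lambda>m. f m * g (n - m)" for n, OF nn(3) nfg sa fg, unfolded fgW]
  note C3 = Cauchy_Schwarz_infsum[of "\<lambda>m. \<alpha> (n - m)" "\<lambda>m. f m * g (n - m)" for n, OF nn(3) nfg sh(1)[OF sa] fg, unfolded fgW sh(2)[OF sa]]
  have s1: "(\<lambda>m. \<alpha> n * (f m * g (n - m))) summable_on UNIV" for n
    using 1 by (rule summable_on_cmult_right)
  note s123 = summable_on_sum3[OF s1 C2(1) C3(1)]
  show "(\<lambda>m. (\<alpha> n + \<alpha> m + \<alpha> (n - m)) * (f m * g (n - m))) summable_on UNIV"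
    using s123(1)[of n] by (simp add: algebra_simps)
  have Tn: "T n = (\<Sum>\<^sub>\<infinity>m. \<alpha> n * (f m * g (n - m))) + (\<Sum>\<^sub>\<infinity>m. \<alpha> m * (f m * g (n - m)))
      + (\<Sum>\<^sub>\<infinity>m. \<alpha> (n - m) * (f m * g (n - m)))" for n
    unfolding T_def s123(2)[symmetric] by (simp add: algebra_simps)
  define A where "A = (\<Sum>\<^sub>\<infinity>n. (\<alpha> n)\<^sup>2)"
  define P where "P = (\<Sum>\<^sub>\<infinity>n. (f n)\<^sup>2) * (\<Sum>\<^sub>\<infinity>n. (g n)\<^sup>2)"
  have T2: "(T n)\<^sup>2 \<le> 3 * ((\<alpha> n)\<^sup>2 * P + A * W n + A * W n)" for n
  proof -
    have "(\<Sum>\<^sub>\<infinity>m. \<alpha> n * (f m * g (n - m)))\<^sup>2 \<le> (\<alpha> n)\<^sup>2 * P"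
      using C1(2)[of n] by (simp add: infsum_cmult_right' power_mult_distrib P_def mult_left_mono)
    moreover have "(T n)\<^sup>2 \<le> 3 * ((\<Sum>\<^sub>\<infinity>m. \<alpha> n * (f m * g (n - m)))\<^sup>2 + (\<Sum>\<^sub>\<infinity>m. \<alpha> m * (f m * g (n - m)))\<^sup>2
        + (\<Sum>\<^sub>\<infinity>m. \<alpha> (n - m) * (f m * g (n - m)))\<^sup>2)"
      unfolding Tn by (rule square_sum3_le)
    moreover note C2(2)[of n] C3(2)[of n]
    ultimately show ?thesis
      unfolding A_def by (smt (verit))
  qed
  have sa': "(\<lambda>n. (\<alpha> n)\<^sup>2 * P) summable_on UNIV" and sW: "(\<lambda>n. A * W n) summable_on UNIV"
    using sa W(1) by (auto intro: summable_on_cmult_left summable_on_cmult_right)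
  note s3 = summable_on_sum3[OF sa' sW sW]
  have dom: "(\<lambda>n. 3 * ((\<alpha> n)\<^sup>2 * P + A * W n + A * W n)) summable_on UNIV"
    using s3(1) by (rule summable_on_cmult_right)
  show sT: "(\<lambda>n. (T n)\<^sup>2) summable_on UNIV"
    by (rule summable_on_comparison_test[OF dom T2]) auto
  have "(\<Sum>\<^sub>\<infinity>n. (T n)\<^sup>2) \<le> (\<Sum>\<^sub>\<infinity>n. 3 * ((\<alpha> n)\<^sup>2 * P + A * W n + A * W n))"
    by (rule infsum_mono[OF sT dom T2])
  also have "\<dots> = 9 * B"
    unfolding infsum_cmult_right' s3(2)
    by (simp add: infsum_cmult_right' infsum_cmult_left' W(2) A_def P_def B_def)
  finally show "(\<Sum>\<^sub>\<infinity>n. (T n)\<^sup>2) \<le> 9 * B" .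
qed

lemma sqrt_powi_square: "0 < x \<Longrightarrow> (sqrt (x powi s) * y)\<^sup>2 = x powi s * y\<^sup>2"
  by (simp add: power_mult_distrib)

text \<open>The square root of the kernel bound reduces the estimate to square-summable sequences
  with \<alpha> = weight^(-1/2). The first conclusion, absolute convergence at each frequency, is
  what later permits linear algebra with convolutions.\<close>

lemma sob_conv:
  fixes s r \<kappa> :: int
  assumes "s \<le> \<kappa>" "r \<le> \<kappa>" "0 \<le> s + r" and F: "sob s F" and G: "sob r G"
  shows "(\<lambda>m. norm (F m * G (n - m))) summable_on UNIV"
    and "sob (s + r - \<kappa> - 1) (conv F G)"
    and "sobsq (s + r - \<kappa> - 1) (conv F G)
           \<le> 9 * 4 powi \<kappa> * (\<Sum>\<^sub>\<infinity>n. 1 / weight n) * (sobsq s F * sobsq r G)"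
proof -
  define f where "f m = sqrt (weight m powi s) * cmod (F m)" for m
  define g where "g m = sqrt (weight m powi r) * cmod (G m)" for m
  define \<alpha> where "\<alpha> m = sqrt (1 / weight m)" for m
  define T where "T n = (\<Sum>\<^sub>\<infinity>m. (\<alpha> n + \<alpha> m + \<alpha> (n - m)) * (f m * g (n - m)))" for n
  have f2: "(f m)\<^sup>2 = weight m powi s * (cmod (F m))\<^sup>2"
    and g2: "(g m)\<^sup>2 = weight m powi r * (cmod (G m))\<^sup>2" for m
    by (simp_all add: f_def g_def sqrt_powi_square weight_pos)
  have a2: "(\<alpha> m)\<^sup>2 = 1 / weight m" for m
    using weight_pos[of m] by (simp add: \<alpha>_def)
  have le1: "\<alpha> m \<le> 1" for m
    using weight_ge_1[of m] by (simp add: \<alpha>_def)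
  have nn: "0 \<le> f n" "0 \<le> g n" "0 \<le> \<alpha> n" for n
    using weight_pos[of n] by (simp_all add: f_def g_def \<alpha>_def)
  have sf: "(\<lambda>n. (f n)\<^sup>2) summable_on UNIV" and sg: "(\<lambda>n. (g n)\<^sup>2) summable_on UNIV"
    and sa: "(\<lambda>n. (\<alpha> n)\<^sup>2) summable_on UNIV"
    using F G summable_on_inverse_weight by (simp_all add: f2 g2 a2 sob_def)
  note L = conv_l2_weighted[OF nn sf sg sa le1]
  define C where "C = sqrt (4 powi \<kappa>)"
  have ker: "sqrt (weight n powi (s + r - \<kappa> - 1)) * cmod (F m * G (n - m)) \<le>
      C * ((\<alpha> n + \<alpha> m + \<alpha> (n - m)) * (f m * g (n - m)))" for n m
  proof -
    have "sqrt (weight n powi (s + r - \<kappa> - 1)) \<le> sqrt (4 powi \<kappa> * (weight m powi s * weight (n - m) powi r) *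
           (1 / weight n + 1 / weight m + 1 / weight (n - m)))"
      using kernel_bound[OF assms(1-3)] by simp
    also have "\<dots> = C * (sqrt (weight m powi s) * sqrt (weight (n - m) powi r)) *
        sqrt (1 / weight n + 1 / weight m + 1 / weight (n - m))"
      by (simp add: real_sqrt_mult C_def)
    also have "\<dots> \<le> C * (sqrt (weight m powi s) * sqrt (weight (n - m) powi r)) * (\<alpha> n + \<alpha> m + \<alpha> (n - m))"
      unfolding \<alpha>_def using weight_pos[THEN less_imp_le]
      by (intro mult_left_mono sqrt_sum3_le) (auto simp: C_def)
    finally have "sqrt (weight n powi (s + r - \<kappa> - 1)) * cmod (F m * G (n - m)) \<le>
      C * (sqrt (weight m powi s) * sqrt (weight (n - m) powi r)) * (\<alpha> n + \<alpha> m + \<alpha> (n - m)) * cmod (F m * G (n - m))"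
      by (intro mult_right_mono) auto
    then show ?thesis by (simp add: f_def g_def norm_mult mult_ac)
  qed
  have pw: "0 < sqrt (weight n powi j)" for n j using weight_pos[of n] by simp
  show 1: "(\<lambda>m. norm (F m * G (n - m))) summable_on UNIV" for n
  proof (rule summable_on_comparison_test)
    show "(\<lambda>m. C / sqrt (weight n powi (s + r - \<kappa> - 1)) * ((\<alpha> n + \<alpha> m + \<alpha> (n - m)) * (f m * g (n - m)))) summable_on UNIV"
      by (rule summable_on_cmult_right[OF L(2)])
    show "norm (F m * G (n - m)) \<le> C / sqrt (weight n powi (s + r - \<kappa> - 1)) * ((\<alpha> n + \<alpha> m + \<alpha> (n - m)) * (f m * g (n - m)))" for m
      using ker[of n m] pw[of n "s + r - \<kappa> - 1"] by (simp add: field_simps)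
  qed auto
  have le: "weight n powi (s + r - \<kappa> - 1) * (cmod (conv F G n))\<^sup>2 \<le> 4 powi \<kappa> * (T n)\<^sup>2" for n
  proof -
    have "sqrt (weight n powi (s + r - \<kappa> - 1)) * cmod (conv F G n)
        \<le> sqrt (weight n powi (s + r - \<kappa> - 1)) * (\<Sum>\<^sub>\<infinity>m. norm (F m * G (n - m)))"
      unfolding conv_def using pw[THEN less_imp_le] by (intro mult_left_mono norm_infsum_bound 1) auto
    also have "\<dots> = (\<Sum>\<^sub>\<infinity>m. sqrt (weight n powi (s + r - \<kappa> - 1)) * norm (F m * G (n - m)))"
      by (simp add: infsum_cmult_right')
    also have "\<dots> \<le> (\<Sum>\<^sub>\<infinity>m. C * ((\<alpha> n + \<alpha> m + \<alpha> (n - m)) * (f m * g (n - m))))"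
      by (intro infsum_mono summable_on_cmult_right 1 L(2) ker)
    also have "\<dots> = C * T n" by (simp add: infsum_cmult_right' T_def)
    finally have "(sqrt (weight n powi (s + r - \<kappa> - 1)) * cmod (conv F G n))\<^sup>2 \<le> (C * T n)\<^sup>2"
      using pw[of n, THEN less_imp_le] by (intro power_mono) auto
    then show ?thesis by (simp add: power_mult_distrib weight_pos less_imp_le C_def)
  qed
  have dom: "(\<lambda>n. 4 powi \<kappa> * (T n)\<^sup>2) summable_on UNIV"
    unfolding T_def by (rule summable_on_cmult_right[OF L(3)])
  show s: "sob (s + r - \<kappa> - 1) (conv F G)"
    unfolding sob_def
    by (rule summable_on_comparison_test[OF dom le]) (auto simp: weight_pos less_imp_le)
  have "sobsq (s + r - \<kappa> - 1) (conv F G) \<le> (\<Sum>\<^sub>\<infinity>n. 4 powi \<kappa> * (T n)\<^sup>2)"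
    unfolding sobsq_def by (rule infsum_mono[OF _ dom le]) (use s in \<open>simp add: sob_def\<close>)
  also have "\<dots> = 4 powi \<kappa> * (\<Sum>\<^sub>\<infinity>n. (T n)\<^sup>2)" by (simp add: infsum_cmult_right')
  also have "\<dots> \<le> 4 powi \<kappa> * (9 * ((\<Sum>\<^sub>\<infinity>n. (\<alpha> n)\<^sup>2) * ((\<Sum>\<^sub>\<infinity>n. (f n)\<^sup>2) * (\<Sum>\<^sub>\<infinity>n. (g n)\<^sup>2))))"
    unfolding T_def by (intro mult_left_mono L(4)) auto
  finally show "sobsq (s + r - \<kappa> - 1) (conv F G)
           \<le> 9 * 4 powi \<kappa> * (\<Sum>\<^sub>\<infinity>n. 1 / weight n) * (sobsq s F * sobsq r G)"
    by (simp add: f2 g2 a2 sobsq_def mult_ac)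
qed

subsection \<open>Convergence in the Sobolev scale\<close>

text \<open>Dominated convergence for unordered sums along an arbitrary filter: the majorant makes
  the finite partial sums converge uniformly in the parameter, so the two limits may be
  exchanged.\<close>

lemma infsum_dominated_tendsto:
  fixes f :: "'p \<Rightarrow> 'a \<Rightarrow> 'b::banach"
  assumes B: "B summable_on UNIV" and le: "\<forall>\<^sub>F p in \<F>. \<forall>x. norm (f p x) \<le> B x"
    and lim: "\<And>x. ((\<lambda>p. f p x) \<longlongrightarrow> g x) \<F>" and leg: "\<And>x. norm (g x) \<le> B x"
  shows "((\<lambda>p. \<Sum>\<^sub>\<infinity>x. f p x) \<longlongrightarrow> (\<Sum>\<^sub>\<infinity>x. g x)) \<F>"
proof (rule swap_uniform_limit'[where F = "finite_subsets_at_top UNIV" and S = "{p. \<forall>x. norm (f p x) \<le> B x}"])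
  show "\<forall>\<^sub>F X in finite_subsets_at_top UNIV. ((\<lambda>p. \<Sum>x\<in>X. f p x) \<longlongrightarrow> (\<Sum>x\<in>X. g x)) \<F>"
    by (intro always_eventually allI tendsto_sum lim)
  have "(\<lambda>x. norm (g x)) summable_on UNIV"
    by (rule summable_on_comparison_test[OF B leg]) auto
  then show "((\<lambda>X. \<Sum>x\<in>X. g x) \<longlongrightarrow> (\<Sum>\<^sub>\<infinity>x. g x)) (finite_subsets_at_top UNIV)"
    by (rule infsum_tendsto[OF abs_summable_summable])
  show "uniform_limit {p. \<forall>x. norm (f p x) \<le> B x} (\<lambda>X p. \<Sum>x\<in>X. f p x) (\<lambda>p. \<Sum>\<^sub>\<infinity>x. f p x)
      (finite_subsets_at_top UNIV)"
    by (rule Weierstrass_m_test_general[OF _ B]) auto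
  show "\<forall>\<^sub>F p in \<F>. p \<in> {p. \<forall>x. norm (f p x) \<le> B x}"
    using le by simp
qed simp

lemma weight_powi_pos: "0 < weight n powi s"
  using weight_pos[of n] by simp

lemma cmod_add_square_le: "(cmod (x + y))\<^sup>2 \<le> 2 * (cmod x)\<^sup>2 + 2 * (cmod y)\<^sup>2"
proof -
  have "(cmod (x + y))\<^sup>2 \<le> (cmod x + cmod y)\<^sup>2"
    by (intro power_mono norm_triangle_ineq) auto
  also have "\<dots> \<le> 2 * (cmod x)\<^sup>2 + 2 * (cmod y)\<^sup>2"
    using zero_le_power2[of "cmod x - cmod y"] by (simp add: power2_eq_square algebra_simps)
  finally show ?thesis .
qed

lemma sobsq_nonneg: "0 \<le> sobsq s F"
  unfolding sobsq_def by (intro infsum_nonneg mult_nonneg_nonneg) (auto simp: weight_powi_pos less_imp_le)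

lemma sob_comparison:
  assumes "\<And>n. weight n powi s * (cmod (F n))\<^sup>2 \<le> B n" "B summable_on UNIV"
  shows "sob s F" "sobsq s F \<le> infsum B UNIV"
proof -
  show "sob s F"
    unfolding sob_def
    by (rule summable_on_comparison_test[OF assms(2,1)])
       (simp add: weight_powi_pos less_imp_le)
  then show "sobsq s F \<le> infsum B UNIV"
    unfolding sob_def sobsq_def by (intro infsum_mono assms)
qed

lemma sob_add:
  assumes "sob s F" "sob s G"
  shows "sob s (\<lambda>n. F n + G n)" and "sobsq s (\<lambda>n. F n + G n) \<le> 2 * sobsq s F + 2 * sobsq s G"
proof -
  let ?B = "\<lambda>n. 2 * (weight n powi s * (cmod (F n))\<^sup>2) + 2 * (weight n powi s * (cmod (G n))\<^sup>2)"
  have le: "weight n powi s * (cmod (F n + G n))\<^sup>2 \<le> ?B n" for n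
    using mult_left_mono[OF cmod_add_square_le[of "F n" "G n"], of "weight n powi s"] weight_powi_pos[of n s]
    by (simp add: algebra_simps)
  have s: "(\<lambda>n. 2 * (weight n powi s * (cmod (F n))\<^sup>2)) summable_on UNIV"
    "(\<lambda>n. 2 * (weight n powi s * (cmod (G n))\<^sup>2)) summable_on UNIV"
    using assms by (auto simp: sob_def intro: summable_on_cmult_right)
  have eq: "infsum ?B UNIV = 2 * sobsq s F + 2 * sobsq s G"
    unfolding infsum_add[OF s] sobsq_def by (simp add: infsum_cmult_right')
  show "sob s (\<lambda>n. F n + G n)" "sobsq s (\<lambda>n. F n + G n) \<le> 2 * sobsq s F + 2 * sobsq s G"
    using sob_comparison[OF le summable_on_add[OF s]] unfolding eq by auto
qed

lemma sob_multiplier: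
  assumes le: "\<And>n. (cmod (m n))\<^sup>2 \<le> C * weight n powi d" and F: "sob s F"
  shows "sob (s - d) (\<lambda>n. m n * F n)" and "sobsq (s - d) (\<lambda>n. m n * F n) \<le> C * sobsq s F"
proof -
  let ?B = "\<lambda>n. C * (weight n powi s * (cmod (F n))\<^sup>2)"
  have le: "weight n powi (s - d) * (cmod (m n * F n))\<^sup>2 \<le> ?B n" for n
  proof -
    have "weight n powi (s - d) * (cmod (m n * F n))\<^sup>2 = (weight n powi (s - d) * (cmod (F n))\<^sup>2) * (cmod (m n))\<^sup>2"
      by (simp add: norm_mult power_mult_distrib)
    also have "\<dots> \<le> (weight n powi (s - d) * (cmod (F n))\<^sup>2) * (C * weight n powi d)"
      using weight_powi_pos[of n] by (intro mult_left_mono le) (auto simp: less_imp_le)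
    also have "\<dots> = ?B n"
      using weight_pos[of n] by (simp add: power_int_diff)
    finally show ?thesis .
  qed
  have s: "?B summable_on UNIV"
    using F by (auto simp: sob_def intro: summable_on_cmult_right)
  have eq: "infsum ?B UNIV = C * sobsq s F"
    by (simp add: infsum_cmult_right' sobsq_def)
  show "sob (s - d) (\<lambda>n. m n * F n)" "sobsq (s - d) (\<lambda>n. m n * F n) \<le> C * sobsq s F"
    using sob_comparison[OF le s] unfolding eq by auto
qed

lemma sob_scale:
  assumes "sob s F"
  shows "sob s (\<lambda>n. c * F n)" and "sobsq s (\<lambda>n. c * F n) = (cmod c)\<^sup>2 * sobsq s F"
proof -
  show "sob s (\<lambda>n. c * F n)"
    using sob_multiplier(1)[of "\<lambda>n. c" "(cmod c)\<^sup>2" 0, OF _ assms] by simp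
  have "sobsq s (\<lambda>n. c * F n) = (\<Sum>\<^sub>\<infinity>n. (cmod c)\<^sup>2 * (weight n powi s * (cmod (F n))\<^sup>2))"
    by (simp add: sobsq_def norm_mult power_mult_distrib mult_ac)
  also have "\<dots> = (cmod c)\<^sup>2 * sobsq s F"
    by (simp add: infsum_cmult_right' sobsq_def)
  finally show "sobsq s (\<lambda>n. c * F n) = (cmod c)\<^sup>2 * sobsq s F" .
qed

lemma sob_zero [simp]: "sob s (\<lambda>n. 0)" "sobsq s (\<lambda>n. 0) = 0"
  by (simp_all add: sob_def sobsq_def)

lemma sob_diff:
  assumes "sob s F" "sob s G"
  shows "sob s (\<lambda>n. F n - G n)" and "sobsq s (\<lambda>n. F n - G n) \<le> 2 * sobsq s F + 2 * sobsq s G"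
  using sob_add[OF assms(1) sob_scale(1)[OF assms(2), of "-1"]] sob_scale(2)[OF assms(2), of "-1"] by auto

lemma sob_mono:
  assumes "t \<le> s" "sob s F"
  shows "sob t F" and "sobsq t F \<le> sobsq s F"
proof -
  have "(cmod (1::complex))\<^sup>2 \<le> 1 * weight n powi (s - t)" for n
    using power_int_increasing[of 0 "s - t" "weight n"] assms(1) weight_ge_1[of n] by simp
  from sob_multiplier[OF this assms(2)] show "sob t F" "sobsq t F \<le> sobsq s F" by auto
qed

lemma sob_eval_le:
  assumes "sob s F"
  shows "weight n powi s * (cmod (F n))\<^sup>2 \<le> sobsq s F"
  using finite_sum_le_infsum[of "\<lambda>n. weight n powi s * (cmod (F n))\<^sup>2" UNIV "{n}"] assms weight_powi_pos
  by (auto simp: sob_def sobsq_def less_imp_le)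

lemma conv_diff:
  assumes "\<And>n. (\<lambda>m. norm (F m * G (n - m))) summable_on UNIV"
    and "\<And>n. (\<lambda>m. norm (F' m * G' (n - m))) summable_on UNIV"
    and "\<And>n. (\<lambda>m. norm (F m * G' (n - m))) summable_on UNIV"
  shows "conv F G n - conv F' G' n = conv F (\<lambda>n. G n - G' n) n + conv (\<lambda>n. F n - F' n) G' n"
proof -
  have s: "(\<lambda>m. F m * G (n - m)) summable_on UNIV" "(\<lambda>m. F' m * G' (n - m)) summable_on UNIV"
    "(\<lambda>m. F m * G' (n - m)) summable_on UNIV"
    using assms[of n] by (auto intro: abs_summable_summable)
  have sd: "(\<lambda>m. u m - v m) summable_on UNIV" "(\<Sum>\<^sub>\<infinity>m. u m - v m) = infsum u UNIV - infsum v UNIV"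
    if "u summable_on UNIV" "v summable_on UNIV" for u v :: "int \<Rightarrow> complex"
    using summable_on_add[OF that(1) summable_on_uminus[THEN iffD2, OF that(2)]]
      infsum_add[OF that(1) summable_on_uminus[THEN iffD2, OF that(2)]] by (auto simp: infsum_uminus)
  show ?thesis
    unfolding conv_def right_diff_distrib left_diff_distrib
    using s by (simp add: sd)
qed

lemma conv_commute: "conv F G n = conv G F n"
proof -
  have bij: "bij_betw (\<lambda>m. n - m) UNIV (UNIV :: int set)"
    by (rule bij_betwI[where g = "\<lambda>m. n - m"]) auto
  show ?thesis
    unfolding conv_def
    by (subst infsum_reindex_bij_betw[OF bij, symmetric]) (simp add: mult.commute)
qed

lemma conv_scale_left: "conv (\<lambda>n. c * F n) G n = c * conv F G n"
  by (simp add: conv_def infsum_cmult_right' mult.assoc)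

lemma conv_scale_right: "conv F (\<lambda>n. c * G n) n = c * conv F G n"
  by (simp add: conv_commute[of F] conv_scale_left)

text \<open>Convergence in H^s along a filter. An infinite sum that does not converge is 0 by
  convention, so a small \<open>sobsq\<close> alone says nothing and membership is demanded
  separately. It is demanded only eventually, since the families are controlled only for positive
  \<delta>, or for smooth functions.\<close>

definition slim :: "int \<Rightarrow> 'p filter \<Rightarrow> ('p \<Rightarrow> int \<Rightarrow> complex) \<Rightarrow> (int \<Rightarrow> complex) \<Rightarrow> bool" where
  "slim s \<F> F G \<longleftrightarrow> (\<forall>\<^sub>F p in \<F>. sob s (F p)) \<and> sob s G \<and>
     ((\<lambda>p. sobsq s (\<lambda>n. F p n - G n)) \<longlongrightarrow> 0) \<F>"

lemma slimI:
  assumes "\<forall>\<^sub>F p in \<F>. sob s (F p)" "sob s G"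
    and "\<forall>\<^sub>F p in \<F>. sobsq s (\<lambda>n. F p n - G n) \<le> b p" "(b \<longlongrightarrow> 0) \<F>"
  shows "slim s \<F> F G"
  unfolding slim_def
  using assms tendsto_sandwich[OF always_eventually assms(3) tendsto_const assms(4)] sobsq_nonneg by auto

lemma slim_const [intro]: "sob s G \<Longrightarrow> slim s \<F> (\<lambda>_. G) G"
  by (simp add: slim_def)

lemma slim_sob: "slim s \<F> F G \<Longrightarrow> sob s G"
  by (simp add: slim_def)

lemma slim_cong:
  assumes "\<forall>\<^sub>F p in \<F>. F p = F' p" "slim s \<F> F G"
  shows "slim s \<F> F' G"
proof -
  have "((\<lambda>p. sobsq s (\<lambda>n. F' p n - G n)) \<longlongrightarrow> 0) \<F>"
  proof (rule Lim_transform_eventually)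
    show "((\<lambda>p. sobsq s (\<lambda>n. F p n - G n)) \<longlongrightarrow> 0) \<F>" using assms(2) by (simp add: slim_def)
    show "\<forall>\<^sub>F p in \<F>. sobsq s (\<lambda>n. F p n - G n) = sobsq s (\<lambda>n. F' p n - G n)"
      using assms(1) by eventually_elim simp
  qed
  moreover have "\<forall>\<^sub>F p in \<F>. sob s (F' p)"
    using assms(1) assms(2)[unfolded slim_def, THEN conjunct1] by eventually_elim simp
  ultimately show ?thesis using assms by (simp add: slim_def)
qed

lemma slim_mono:
  assumes "t \<le> s" "slim s \<F> F G"
  shows "slim t \<F> F G"
proof (rule slimI)
  show "\<forall>\<^sub>F p in \<F>. sob t (F p)"
    using assms(2) by (auto simp: slim_def intro: sob_mono(1)[OF assms(1)] elim: eventually_mono)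
  show "sob t G" using assms by (auto simp: slim_def intro: sob_mono)
  have "\<forall>\<^sub>F p in \<F>. sob s (F p)" using assms by (simp add: slim_def)
  then show "\<forall>\<^sub>F p in \<F>. sobsq t (\<lambda>n. F p n - G n) \<le> sobsq s (\<lambda>n. F p n - G n)"
    by eventually_elim (use assms in \<open>auto simp: slim_def intro!: sob_mono sob_diff\<close>)
qed (use assms in \<open>simp add: slim_def\<close>)

lemma slim_add:
  assumes "slim s \<F> F G" "slim s \<F> F' G'"
  shows "slim s \<F> (\<lambda>p n. F p n + F' p n) (\<lambda>n. G n + G' n)"
proof (rule slimI)
  have ev: "\<forall>\<^sub>F p in \<F>. sob s (F p) \<and> sob s (F' p)" and G: "sob s G" "sob s G'"
    using assms by (auto simp: slim_def intro: eventually_conj)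
  show "\<forall>\<^sub>F p in \<F>. sob s (\<lambda>n. F p n + F' p n)"
    using ev by eventually_elim (auto intro: sob_add)
  show "sob s (\<lambda>n. G n + G' n)" using G by (rule sob_add)
  show "\<forall>\<^sub>F p in \<F>. sobsq s (\<lambda>n. F p n + F' p n - (G n + G' n))
      \<le> 2 * sobsq s (\<lambda>n. F p n - G n) + 2 * sobsq s (\<lambda>n. F' p n - G' n)"
    using ev
  proof eventually_elim
    case (elim p)
    show ?case
      using sob_add(2)[of s "\<lambda>n. F p n - G n" "\<lambda>n. F' p n - G' n"] elim G
      by (simp add: sob_diff algebra_simps)
  qed
  have "((\<lambda>p. 2 * sobsq s (\<lambda>n. F p n - G n) + 2 * sobsq s (\<lambda>n. F' p n - G' n)) \<longlongrightarrow> 2 * 0 + 2 * 0) \<F>"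
    using assms by (intro tendsto_intros) (auto simp: slim_def)
  then show "((\<lambda>p. 2 * sobsq s (\<lambda>n. F p n - G n) + 2 * sobsq s (\<lambda>n. F' p n - G' n)) \<longlongrightarrow> 0) \<F>"
    by simp
qed

text \<open>The symbols converge only pointwise, not in operator norm. In the splitting m F - m' G =
  m (F - G) + (m - m') G the uniform bound controls the first part, and dominated convergence for
  the fixed sequence G the second.\<close>

lemma slim_multiplier:
  assumes ev: "\<forall>\<^sub>F p in \<F>. \<forall>n. (cmod (m p n))\<^sup>2 \<le> C * weight n powi d"
    and m': "\<And>n. (cmod (m' n))\<^sup>2 \<le> C * weight n powi d"
    and lim: "\<And>n. ((\<lambda>p. m p n) \<longlongrightarrow> m' n) \<F>"
    and F: "slim s \<F> F G"
  shows "slim (s - d) \<F> (\<lambda>p n. m p n * F p n) (\<lambda>n. m' n * G n)"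
proof (rule slimI)
  have sG: "sob s G" and evF: "\<forall>\<^sub>F p in \<F>. sob s (F p)" using F by (simp_all add: slim_def)
  show "\<forall>\<^sub>F p in \<F>. sob (s - d) (\<lambda>n. m p n * F p n)"
    using ev evF by eventually_elim (auto intro: sob_multiplier)
  show "sob (s - d) (\<lambda>n. m' n * G n)" by (rule sob_multiplier(1)[OF m' sG])
  let ?r = "\<lambda>p. sobsq (s - d) (\<lambda>n. (m p n - m' n) * G n)"
  have C0: "0 \<le> C" using order_trans[OF zero_le_power2 m'[of 0]] by (simp add: weight_def)
  have le4: "(cmod (m p n - m' n))\<^sup>2 \<le> (4 * C) * weight n powi d"
    if "\<forall>n. (cmod (m p n))\<^sup>2 \<le> C * weight n powi d" for p n
    using cmod_add_square_le[of "m p n" "- m' n"] that[rule_format, of n] m'[of n] by simp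
  show "\<forall>\<^sub>F p in \<F>. sobsq (s - d) (\<lambda>n. m p n * F p n - m' n * G n)
      \<le> 2 * (C * sobsq s (\<lambda>n. F p n - G n)) + 2 * ?r p"
    using ev evF
  proof eventually_elim
    case (elim p)
    have sd: "sob s (\<lambda>n. F p n - G n)" using elim sG by (auto intro: sob_diff)
    note 1 = sob_multiplier[where m = "m p" and C = C and d = d, OF _ sd]
    have "sobsq (s - d) (\<lambda>n. m p n * F p n - m' n * G n)
        = sobsq (s - d) (\<lambda>n. m p n * (F p n - G n) + (m p n - m' n) * G n)"
      by (simp add: algebra_simps)
    also have "\<dots> \<le> 2 * sobsq (s - d) (\<lambda>n. m p n * (F p n - G n)) + 2 * ?r p"
      by (intro sob_add(2) 1 sob_multiplier(1)[OF le4] sG) (use elim in auto)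
    also have "\<dots> \<le> 2 * (C * sobsq s (\<lambda>n. F p n - G n)) + 2 * ?r p"
      using 1(2) elim by auto
    finally show ?case .
  qed
  have "(?r \<longlongrightarrow> (\<Sum>\<^sub>\<infinity>n::int. 0)) \<F>"
    unfolding sobsq_def
  proof (rule infsum_dominated_tendsto)
    show "(\<lambda>n. 4 * C * (weight n powi s * (cmod (G n))\<^sup>2)) summable_on UNIV"
      using sG by (auto simp: sob_def intro: summable_on_cmult_right)
    show "\<forall>\<^sub>F p in \<F>. \<forall>n. norm (weight n powi (s - d) * (cmod ((m p n - m' n) * G n))\<^sup>2)
        \<le> 4 * C * (weight n powi s * (cmod (G n))\<^sup>2)"
      using ev
    proof eventually_elim
      case (elim p)
      show ?case
      proof
        fix n
        have "norm (weight n powi (s - d) * (cmod ((m p n - m' n) * G n))\<^sup>2)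
          = weight n powi (s - d) * (cmod (G n))\<^sup>2 * (cmod (m p n - m' n))\<^sup>2"
          using weight_powi_pos[of n "s - d"] by (simp add: norm_mult power_mult_distrib)
        also have "\<dots> \<le> weight n powi (s - d) * (cmod (G n))\<^sup>2 * (4 * C * weight n powi d)"
          using weight_powi_pos[of n "s - d"] by (intro mult_left_mono le4 elim) auto
        also have "\<dots> = 4 * C * (weight n powi s * (cmod (G n))\<^sup>2)"
          using weight_pos[of n] by (simp add: power_int_diff)
        finally show "norm (weight n powi (s - d) * (cmod ((m p n - m' n) * G n))\<^sup>2)
          \<le> 4 * C * (weight n powi s * (cmod (G n))\<^sup>2)" .
      qed
    qed
    have "((\<lambda>p. weight n powi (s - d) * (cmod ((m p n - m' n) * G n))\<^sup>2) \<longlongrightarrow>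
        weight n powi (s - d) * (cmod ((m' n - m' n) * G n))\<^sup>2) \<F>" for n
      by (intro tendsto_intros lim)
    then show "((\<lambda>p. weight n powi (s - d) * (cmod ((m p n - m' n) * G n))\<^sup>2) \<longlongrightarrow> 0) \<F>" for n
      by simp
    show "norm (0::real) \<le> 4 * C * (weight n powi s * (cmod (G n))\<^sup>2)" for n
      using C0 weight_powi_pos[of n s] by simp
  qed
  then have "((\<lambda>p. 2 * (C * sobsq s (\<lambda>n. F p n - G n)) + 2 * ?r p) \<longlongrightarrow> 2 * (C * 0) + 2 * 0) \<F>"
    using F by (intro tendsto_intros) (auto simp: slim_def)
  then show "((\<lambda>p. 2 * (C * sobsq s (\<lambda>n. F p n - G n)) + 2 * ?r p) \<longlongrightarrow> 0) \<F>"
    by simp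
qed

lemma slim_scale:
  assumes c: "(c \<longlongrightarrow> c') \<F>" and F: "slim s \<F> F G"
  shows "slim s \<F> (\<lambda>p n. c p * F p n) (\<lambda>n. c' * G n)"
proof -
  have "\<forall>\<^sub>F p in \<F>. cmod (c p) < cmod c' + 1"
    using c by (intro order_tendstoD(2)[OF tendsto_norm]) auto
  then have "\<forall>\<^sub>F p in \<F>. \<forall>n. (cmod (c p))\<^sup>2 \<le> (cmod c' + 1)\<^sup>2 * weight n powi 0"
    by eventually_elim (auto intro!: power_mono)
  then have "slim (s - 0) \<F> (\<lambda>p n. c p * F p n) (\<lambda>n. c' * G n)"
    by (rule slim_multiplier[OF _ _ c F]) (simp add: power_mono)
  then show ?thesis by simp
qed

lemma slim_diff:
  assumes "slim s \<F> F G" "slim s \<F> F' G'"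
  shows "slim s \<F> (\<lambda>p n. F p n - F' p n) (\<lambda>n. G n - G' n)"
  using slim_add[OF assms(1) slim_scale[OF tendsto_const[of "-1"] assms(2)]] by simp

lemma slim_sum:
  assumes "\<And>i. i \<in> I \<Longrightarrow> slim s \<F> (F i) (G i)"
  shows "slim s \<F> (\<lambda>p n. \<Sum>i\<in>I. F i p n) (\<lambda>n. \<Sum>i\<in>I. G i n)"
  using assms by (induction I rule: infinite_finite_induct) (auto intro: slim_add)

lemma slim_eval:
  assumes "slim s \<F> F G"
  shows "((\<lambda>p. F p n) \<longlongrightarrow> G n) \<F>"
proof -
  have "((\<lambda>p. (cmod (F p n - G n))\<^sup>2) \<longlongrightarrow> 0) \<F>"
  proof (rule tendsto_sandwich[where f = "\<lambda>_. 0" and h = "\<lambda>p. sobsq s (\<lambda>n. F p n - G n) / weight n powi s"])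
    have "\<forall>\<^sub>F p in \<F>. sob s (F p)" using assms by (simp add: slim_def)
    then show "\<forall>\<^sub>F p in \<F>. (cmod (F p n - G n))\<^sup>2 \<le> sobsq s (\<lambda>n. F p n - G n) / weight n powi s"
    proof eventually_elim
      case (elim p)
      then have "sob s (\<lambda>n. F p n - G n)" using assms by (auto simp: slim_def intro: sob_diff)
      from sob_eval_le[OF this, of n] show ?case
        using weight_powi_pos[of n s] by (simp add: field_simps)
    qed
    have "((\<lambda>p. sobsq s (\<lambda>n. F p n - G n) / weight n powi s) \<longlongrightarrow> 0 / weight n powi s) \<F>"
      using assms weight_pos[of n] by (intro tendsto_intros) (auto simp: slim_def)
    then show "((\<lambda>p. sobsq s (\<lambda>n. F p n - G n) / weight n powi s) \<longlongrightarrow> 0) \<F>" by simp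
  qed auto
  then have "((\<lambda>p. sqrt ((cmod (F p n - G n))\<^sup>2)) \<longlongrightarrow> sqrt 0) \<F>" by (rule tendsto_real_sqrt)
  then show ?thesis by (simp add: tendsto_norm_zero_iff LIM_zero_iff)
qed

text \<open>By bilinearity the difference is F (G - G') + (F - F') G'. In the first part F still
  moves, so its norm is bounded through its distance to F'.\<close>

lemma slim_conv:
  fixes s r \<kappa> :: int
  assumes "s \<le> \<kappa>" "r \<le> \<kappa>" "0 \<le> s + r" and F: "slim s \<F> F F'" and G: "slim r \<F> G G'"
  shows "slim (s + r - \<kappa> - 1) \<F> (\<lambda>p. conv (F p) (G p)) (conv F' G')"
proof (rule slimI)
  define C where "C = 9 * 4 powi \<kappa> * (\<Sum>\<^sub>\<infinity>n. 1 / weight n)"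
  have C0: "0 \<le> C" unfolding C_def
    by (intro mult_nonneg_nonneg infsum_nonneg) (auto simp: weight_pos less_imp_le)
  note P = sob_conv[OF assms(1-3), folded C_def]
  have ev: "\<forall>\<^sub>F p in \<F>. sob s (F p) \<and> sob r (G p)" and F': "sob s F'" and G': "sob r G'"
    using F G by (auto simp: slim_def intro: eventually_conj)
  show "\<forall>\<^sub>F p in \<F>. sob (s + r - \<kappa> - 1) (conv (F p) (G p))"
    using ev by eventually_elim (auto intro: P)
  show "sob (s + r - \<kappa> - 1) (conv F' G')" by (rule P(2)[OF F' G'])
  let ?f = "\<lambda>p. sobsq s (\<lambda>n. F p n - F' n)" and ?g = "\<lambda>p. sobsq r (\<lambda>n. G p n - G' n)"
  let ?b = "\<lambda>p. 2 * (C * ((2 * ?f p + 2 * sobsq s F') * ?g p)) + 2 * (C * (?f p * sobsq r G'))"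
  show "\<forall>\<^sub>F p in \<F>. sobsq (s + r - \<kappa> - 1) (\<lambda>n. conv (F p) (G p) n - conv F' G' n) \<le> ?b p"
    using ev
  proof eventually_elim
    case (elim p)
    then have Fp: "sob s (F p)" and Gp: "sob r (G p)" by auto
    note d = sob_diff(1)[OF Fp F'] sob_diff(1)[OF Gp G']
    have "sobsq s (F p) \<le> 2 * ?f p + 2 * sobsq s F'"
      using sob_add(2)[OF d(1) F'] by simp
    then have 1: "sobsq (s + r - \<kappa> - 1) (conv (F p) (\<lambda>n. G p n - G' n)) \<le> C * ((2 * ?f p + 2 * sobsq s F') * ?g p)"
      by (intro order_trans[OF P(3)[OF Fp d(2)]] mult_left_mono mult_right_mono C0 sobsq_nonneg)
    have "sobsq (s + r - \<kappa> - 1) (\<lambda>n. conv (F p) (G p) n - conv F' G' n)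
      = sobsq (s + r - \<kappa> - 1) (\<lambda>n. conv (F p) (\<lambda>n. G p n - G' n) n + conv (\<lambda>n. F p n - F' n) G' n)"
      by (subst conv_diff) (auto intro: P(1) Fp Gp F' G' simp del: norm_mult)
    also have "\<dots> \<le> 2 * sobsq (s + r - \<kappa> - 1) (conv (F p) (\<lambda>n. G p n - G' n))
        + 2 * sobsq (s + r - \<kappa> - 1) (conv (\<lambda>n. F p n - F' n) G')"
      by (intro sob_add(2) P(2) Fp d G')
    also have "\<dots> \<le> ?b p"
      using 1 P(3)[OF d(1) G'] by auto
    finally show ?case .
  qed
  have "(?b \<longlongrightarrow> 2 * (C * ((2 * 0 + 2 * sobsq s F') * 0)) + 2 * (C * (0 * sobsq r G'))) \<F>"
    using F G by (intro tendsto_intros) (auto simp: slim_def)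
  then show "(?b \<longlongrightarrow> 0) \<F>" by simp
qed

subsection \<open>The recursion for the densities and its variations\<close>

text \<open>
  \<open>cpow h j s\<close> is the coefficient of \<open>\<epsilon> ^ s\<close> in the \<open>(j + 1)\<close>-st convolution power of
  \<open>\<Sum>i. h i \<epsilon> ^ i\<close>, and \<open>dcpow g k h j s\<close> is the corresponding coefficient of
  \<open>\<Sum>a+b=j. g ^ a k h ^ b\<close>, so that it is both the derivative of the power (for \<open>g = h\<close>) and its
  divided difference.
\<close>

primrec cpow :: "(nat \<Rightarrow> int \<Rightarrow> complex) \<Rightarrow> nat \<Rightarrow> nat \<Rightarrow> int \<Rightarrow> complex" where
  "cpow h 0 s = h s"
| "cpow h (Suc j) s = (\<lambda>n. \<Sum>i\<le>s. conv (h i) (cpow h j (s - i)) n)"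

primrec dcpow :: "(nat \<Rightarrow> int \<Rightarrow> complex) \<Rightarrow> (nat \<Rightarrow> int \<Rightarrow> complex) \<Rightarrow> (nat \<Rightarrow> int \<Rightarrow> complex) \<Rightarrow>
    nat \<Rightarrow> nat \<Rightarrow> int \<Rightarrow> complex" where
  "dcpow g k h 0 s = k s"
| "dcpow g k h (Suc j) s =
     (\<lambda>n. \<Sum>i\<le>s. conv (k i) (cpow h j (s - i)) n + conv (g i) (dcpow g k h j (s - i)) n)"

text \<open>If H is the series with coefficient \<open>h i\<close> at \<epsilon>^(i+1), then
  \<open>psum p h m\<close> is the coefficient of \<epsilon>^(m+1) in the sum over j \<ge> 1 of p_j
  H^(j+1); \<open>dpsum\<close> is its variation.\<close>

definition psum :: "(nat \<Rightarrow> complex) \<Rightarrow> (nat \<Rightarrow> int \<Rightarrow> complex) \<Rightarrow> nat \<Rightarrow> int \<Rightarrow> complex" where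
  "psum p h m = (\<lambda>n. \<Sum>j=1..m. p j * cpow h j (m - j) n)"

definition dpsum :: "(nat \<Rightarrow> complex) \<Rightarrow> (nat \<Rightarrow> int \<Rightarrow> complex) \<Rightarrow> (nat \<Rightarrow> int \<Rightarrow> complex) \<Rightarrow>
    (nat \<Rightarrow> int \<Rightarrow> complex) \<Rightarrow> nat \<Rightarrow> int \<Rightarrow> complex" where
  "dpsum p g k h m = (\<lambda>n. \<Sum>j=1..m. p j * dcpow g k h j (m - j) n)"

lemma cpow_cong:
  assumes "\<And>i. i \<le> s \<Longrightarrow> h i = h' i"
  shows "cpow h j s = cpow h' j s"
  using assms
proof (induction j arbitrary: s)
  case (Suc j)
  have "cpow h j (s - i) = cpow h' j (s - i)" if "i \<le> s" for i
    using Suc.prems by (intro Suc.IH) auto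
  then show ?case using Suc.prems by (auto intro!: sum.cong)
qed auto

lemma dcpow_cong:
  assumes "\<And>i. i \<le> s \<Longrightarrow> k i = k' i"
  shows "dcpow g k h j s = dcpow g k' h j s"
  using assms
proof (induction j arbitrary: s)
  case (Suc j)
  have "dcpow g k h j (s - i) = dcpow g k' h j (s - i)" if "i \<le> s" for i
    using Suc.prems by (intro Suc.IH) auto
  then show ?case using Suc.prems by (auto intro!: sum.cong)
qed auto

text \<open>The strict bound on i, due to j \<ge> 1, is what makes the recursion \<open>hs\<close>
  well-founded although \<open>psum q\<close> occurs there at the index \<open>Suc n\<close> being
  defined.\<close>

lemma psum_cong [fundef_cong]:
  assumes "p = p'" "m = m'" "\<And>i. i < m' \<Longrightarrow> h i = h' i"
  shows "psum p h m = psum p' h' m'"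
proof -
  have "cpow h j (m - j) = cpow h' j (m - j)" if "j \<in> {1..m}" for j
    using that assms by (intro cpow_cong) auto
  then show ?thesis using assms by (auto simp: psum_def intro!: sum.cong)
qed

lemma dpsum_cong [fundef_cong]:
  assumes "p = p'" "m = m'" "\<And>i. i < m' \<Longrightarrow> k i = k' i"
  shows "dpsum p g k h m = dpsum p' g k' h m'"
proof -
  have "dcpow g k h j (m - j) = dcpow g k' h j (m - j)" if "j \<in> {1..m}" for j
    using that assms by (intro dcpow_cong) auto
  then show ?thesis using assms by (auto simp: dpsum_def intro!: sum.cong)
qed

text \<open>One recursion for both hierarchies: \<open>p\<close> and \<open>q\<close> carry the
  coefficients of the first and second nonlinear sum, \<open>l\<close> is the symbol of the linear
  operator. The exceptional density of index 1 needs no clause of its own, because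
  \<open>psum p\<close> is empty at 0 and \<open>psum q\<close> at 1 is quadratic in density
  0.\<close>

fun hs :: "(nat \<Rightarrow> complex) \<Rightarrow> (nat \<Rightarrow> complex) \<Rightarrow> (int \<Rightarrow> complex) \<Rightarrow> (int \<Rightarrow> complex) \<Rightarrow>
    nat \<Rightarrow> int \<Rightarrow> complex" where
  "hs p q l V 0 = (\<lambda>m. - V m)"
| "hs p q l V (Suc n) =
     (\<lambda>m. psum p (hs p q l V) n m - psum q (hs p q l V) (Suc n) m + l m * hs p q l V n m)"

text \<open>
  \<open>ks\<close> is the variation of \<open>hs\<close> around \<open>h\<close> when \<open>p\<close>, \<open>q\<close>, \<open>l\<close>, \<open>V\<close> vary in the directions \<open>p'\<close>, \<open>q'\<close>, \<open>l'\<close>, \<open>W\<close>.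
\<close>

fun ks :: "(nat \<Rightarrow> complex) \<Rightarrow> (nat \<Rightarrow> complex) \<Rightarrow> (int \<Rightarrow> complex) \<Rightarrow>
    (nat \<Rightarrow> complex) \<Rightarrow> (nat \<Rightarrow> complex) \<Rightarrow> (int \<Rightarrow> complex) \<Rightarrow>
    (nat \<Rightarrow> int \<Rightarrow> complex) \<Rightarrow> (int \<Rightarrow> complex) \<Rightarrow> nat \<Rightarrow> int \<Rightarrow> complex" where
  "ks p q l p' q' l' h W 0 = (\<lambda>m. - W m)"
| "ks p q l p' q' l' h W (Suc n) = (\<lambda>m.
     (dpsum p h (ks p q l p' q' l' h W) h n m + psum p' h n m)
     - (dpsum q h (ks p q l p' q' l' h W) h (Suc n) m + psum q' h (Suc n) m)
     + (l m * ks p q l p' q' l' h W n m + l' m * h n m))"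

text \<open>Each convolution costs one order on top of those of its factors. The hypothesis s + j
  \<le> 2 \<kappa> + 1 says precisely that the orders of the two factors of the last convolution add
  up to a nonnegative number.\<close>

lemma cpow_slim:
  fixes \<kappa> :: int
  assumes "\<And>i. i \<le> s \<Longrightarrow> slim (\<kappa> - int i) \<F> (\<lambda>p. h p i) (h' i)" "int s + int j \<le> 2 * \<kappa> + 1"
  shows "slim (\<kappa> - int s - int j) \<F> (\<lambda>p. cpow (h p) j s) (cpow h' j s)"
  using assms
proof (induction j arbitrary: s)
  case (Suc j)
  have "slim (\<kappa> - int s - int (Suc j)) \<F> (\<lambda>p. conv (h p i) (cpow (h p) j (s - i))) (conv (h' i) (cpow h' j (s - i)))"
    if i: "i \<le> s" for i
  proof -
    have "slim (\<kappa> - int (s - i) - int j) \<F> (\<lambda>p. cpow (h p) j (s - i)) (cpow h' j (s - i))"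
      using Suc.prems by (intro Suc.IH) auto
    then have "slim ((\<kappa> - int i) + (\<kappa> - int (s - i) - int j) - \<kappa> - 1) \<F>
        (\<lambda>p. conv (h p i) (cpow (h p) j (s - i))) (conv (h' i) (cpow h' j (s - i)))"
      using Suc.prems i by (intro slim_conv) auto
    moreover have "(\<kappa> - int i) + (\<kappa> - int (s - i) - int j) - \<kappa> - 1 = \<kappa> - int s - int (Suc j)"
      using i by simp
    ultimately show ?thesis by metis
  qed
  then show ?case by (auto intro!: slim_sum)
qed simp

text \<open>\<open>b\<close> counts the orders lost by the variation \<open>k\<close>: 0 for the
  derivative in time, 1 for the derivative in \<theta>. It shrinks the admissible range of indices
  by the same amount.\<close>

lemma dcpow_slim:
  fixes \<kappa> :: int and b :: nat
  assumes "\<And>i. i \<le> s \<Longrightarrow> slim (\<kappa> - int i) \<F> (\<lambda>p. h p i) (h' i)"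
    and "\<And>i. i \<le> s \<Longrightarrow> slim (\<kappa> - int i) \<F> (\<lambda>p. g p i) (g' i)"
    and "\<And>i. i \<le> s \<Longrightarrow> slim (\<kappa> - int i - int b) \<F> (\<lambda>p. k p i) (k' i)"
    and "int s + int j + int b \<le> 2 * \<kappa> + 1"
  shows "slim (\<kappa> - int s - int j - int b) \<F> (\<lambda>p. dcpow (g p) (k p) (h p) j s) (dcpow g' k' h' j s)"
  using assms
proof (induction j arbitrary: s)
  case (Suc j)
  let ?t = "\<kappa> - int s - int (Suc j) - int b"
  have "slim ?t \<F> (\<lambda>p n. conv (k p i) (cpow (h p) j (s - i)) n + conv (g p i) (dcpow (g p) (k p) (h p) j (s - i)) n)
     (\<lambda>n. conv (k' i) (cpow h' j (s - i)) n + conv (g' i) (dcpow g' k' h' j (s - i)) n)"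
    if i: "i \<le> s" for i
  proof (rule slim_add)
    have "slim (\<kappa> - int (s - i) - int j - int b) \<F> (\<lambda>p. dcpow (g p) (k p) (h p) j (s - i)) (dcpow g' k' h' j (s - i))"
      using Suc.prems by (intro Suc.IH) auto
    then have "slim ((\<kappa> - int i) + (\<kappa> - int (s - i) - int j - int b) - \<kappa> - 1) \<F>
        (\<lambda>p. conv (g p i) (dcpow (g p) (k p) (h p) j (s - i))) (conv (g' i) (dcpow g' k' h' j (s - i)))"
      using Suc.prems i by (intro slim_conv) auto
    moreover have "(\<kappa> - int i) + (\<kappa> - int (s - i) - int j - int b) - \<kappa> - 1 = ?t"
      using i by simp
    ultimately show "slim ?t \<F> (\<lambda>p. conv (g p i) (dcpow (g p) (k p) (h p) j (s - i))) (conv (g' i) (dcpow g' k' h' j (s - i)))"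
      by metis
    have "slim (\<kappa> - int (s - i) - int j) \<F> (\<lambda>p. cpow (h p) j (s - i)) (cpow h' j (s - i))"
      using Suc.prems by (intro cpow_slim) auto
    then have "slim ((\<kappa> - int i - int b) + (\<kappa> - int (s - i) - int j) - \<kappa> - 1) \<F>
        (\<lambda>p. conv (k p i) (cpow (h p) j (s - i))) (conv (k' i) (cpow h' j (s - i)))"
      using Suc.prems i by (intro slim_conv) auto
    moreover have "(\<kappa> - int i - int b) + (\<kappa> - int (s - i) - int j) - \<kappa> - 1 = ?t"
      using i by simp
    ultimately show "slim ?t \<F> (\<lambda>p. conv (k p i) (cpow (h p) j (s - i))) (conv (k' i) (cpow h' j (s - i)))"
      by metis
  qed
  then show ?case by (auto intro!: slim_sum)
qed simp

lemma psum_slim: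
  fixes \<kappa> :: int
  assumes "\<And>i. i < m \<Longrightarrow> slim (\<kappa> - int i) \<F> (\<lambda>r. h r i) (h' i)" "int m \<le> 2 * \<kappa> + 1"
    and "\<And>j. ((\<lambda>r. p r j) \<longlongrightarrow> p' j) \<F>"
  shows "slim (\<kappa> - int m) \<F> (\<lambda>r. psum (p r) (h r) m) (psum p' h' m)"
  unfolding psum_def
proof (intro slim_sum slim_scale assms(3))
  fix j assume j: "j \<in> {1..m}"
  then have "slim (\<kappa> - int (m - j) - int j) \<F> (\<lambda>r. cpow (h r) j (m - j)) (cpow h' j (m - j))"
    using assms by (intro cpow_slim) auto
  then show "slim (\<kappa> - int m) \<F> (\<lambda>r. cpow (h r) j (m - j)) (cpow h' j (m - j))"
    using j by (simp add: of_nat_diff)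
qed

lemma dpsum_slim:
  fixes \<kappa> :: int and b :: nat
  assumes "\<And>i. i < m \<Longrightarrow> slim (\<kappa> - int i) \<F> (\<lambda>r. h r i) (h' i)"
    and "\<And>i. i < m \<Longrightarrow> slim (\<kappa> - int i) \<F> (\<lambda>r. g r i) (g' i)"
    and "\<And>i. i < m \<Longrightarrow> slim (\<kappa> - int i - int b) \<F> (\<lambda>r. k r i) (k' i)" "int m + int b \<le> 2 * \<kappa> + 1"
    and "\<And>j. ((\<lambda>r. p r j) \<longlongrightarrow> p' j) \<F>"
  shows "slim (\<kappa> - int m - int b) \<F> (\<lambda>r. dpsum (p r) (g r) (k r) (h r) m) (dpsum p' g' k' h' m)"
  unfolding dpsum_def
proof (intro slim_sum slim_scale assms(5))
  fix j assume j: "j \<in> {1..m}"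
  then have "slim (\<kappa> - int (m - j) - int j - int b) \<F> (\<lambda>r. dcpow (g r) (k r) (h r) j (m - j)) (dcpow g' k' h' j (m - j))"
    using assms by (intro dcpow_slim) auto
  then show "slim (\<kappa> - int m - int b) \<F> (\<lambda>r. dcpow (g r) (k r) (h r) j (m - j)) (dcpow g' k' h' j (m - j))"
    using j by (simp add: of_nat_diff)
qed

lemma hs_slim:
  fixes \<kappa> :: int
  assumes V: "slim \<kappa> \<F> V V'"
    and p: "\<And>j. ((\<lambda>r. p r j) \<longlongrightarrow> p' j) \<F>" and q: "\<And>j. ((\<lambda>r. q r j) \<longlongrightarrow> q' j) \<F>"
    and l: "\<forall>\<^sub>F r in \<F>. \<forall>n. (cmod (l r n))\<^sup>2 \<le> C * weight n powi 1"
      "\<And>n. (cmod (l' n))\<^sup>2 \<le> C * weight n powi 1" "\<And>n. ((\<lambda>r. l r n) \<longlongrightarrow> l' n) \<F>"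
    and "int n \<le> 2 * \<kappa> + 1"
  shows "slim (\<kappa> - int n) \<F> (\<lambda>r. hs (p r) (q r) (l r) (V r) n) (hs p' q' l' V' n)"
  using assms(7)
proof (induction n rule: less_induct)
  case (less n)
  show ?case
  proof (cases n)
    case 0
    then show ?thesis using slim_scale[OF tendsto_const[of "-1"] V] by simp
  next
    case (Suc m)
    have IH: "slim (\<kappa> - int i) \<F> (\<lambda>r. hs (p r) (q r) (l r) (V r) i) (hs p' q' l' V' i)" if "i \<le> m" for i
      using that less Suc by auto
    have "slim (\<kappa> - int m - 1) \<F> (\<lambda>r. psum (p r) (hs (p r) (q r) (l r) (V r)) m) (psum p' (hs p' q' l' V') m)"
      by (rule slim_mono[OF _ psum_slim[where \<kappa> = \<kappa>]]) (use IH p less.prems Suc in auto)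
    moreover have "slim (\<kappa> - int (Suc m)) \<F> (\<lambda>r. psum (q r) (hs (p r) (q r) (l r) (V r)) (Suc m))
        (psum q' (hs p' q' l' V') (Suc m))"
      by (rule psum_slim) (use IH q less.prems Suc in auto)
    moreover have "slim (\<kappa> - int m - 1) \<F> (\<lambda>r n. l r n * hs (p r) (q r) (l r) (V r) m n)
        (\<lambda>n. l' n * hs p' q' l' V' m n)"
      by (rule slim_multiplier[OF l IH]) auto
    ultimately show ?thesis
      unfolding Suc hs.simps by (intro slim_add slim_diff) (simp_all add: algebra_simps)
  qed
qed

lemma sob_hs:
  fixes \<kappa> :: int
  assumes "sob \<kappa> V" "\<And>n. (cmod (l n))\<^sup>2 \<le> C * weight n powi 1" "int n \<le> 2 * \<kappa> + 1"
  shows "sob (\<kappa> - int n) (hs p q l V n)"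
  \<comment> \<open>Convergence of a constant family contains membership of its limit, so no second
    induction is needed; any filter would do.\<close>
  using hs_slim[of \<kappa> "top :: unit filter" "\<lambda>_. V" V "\<lambda>_. p" p "\<lambda>_. q" q "\<lambda>_. l" C l n] assms
  by (auto simp: slim_const dest: slim_sob)

lemma sob_cpow:
  fixes \<kappa> :: int
  assumes "\<And>i. i \<le> s \<Longrightarrow> sob (\<kappa> - int i) (h i)" "int s + int j \<le> 2 * \<kappa> + 1"
  shows "sob (\<kappa> - int s - int j) (cpow h j s)"
  using cpow_slim[of s \<kappa> "top :: unit filter" "\<lambda>_. h" h j] assms by (auto simp: slim_const dest: slim_sob)

section \<open>Difference quotients of the densities\<close>

lemma conv_cong: "(\<And>m. F m = F' m) \<Longrightarrow> (\<And>m. G m = G' m) \<Longrightarrow> conv F G n = conv F' G' n"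
  by (simp add: conv_def)

text \<open>The factorisation of h^(j+1) - g^(j+1) as the sum of g^a (h - g) h^b. The Sobolev
  hypotheses supply the absolute convergence without which convolutions cannot be subtracted term by
  term.\<close>

lemma cpow_diff:
  fixes \<kappa> :: int
  assumes "\<And>i. i \<le> s \<Longrightarrow> sob (\<kappa> - int i) (h i)" "\<And>i. i \<le> s \<Longrightarrow> sob (\<kappa> - int i) (g i)"
    and "int s + int j \<le> 2 * \<kappa> + 1"
  shows "cpow h j s n - cpow g j s n = dcpow g (\<lambda>i n. h i n - g i n) h j s n"
  using assms
proof (induction j arbitrary: s n)
  case (Suc j)
  have "conv (h i) (cpow h j (s - i)) n - conv (g i) (cpow g j (s - i)) n =
      conv (\<lambda>n. h i n - g i n) (cpow h j (s - i)) n
      + conv (g i) (dcpow g (\<lambda>i n. h i n - g i n) h j (s - i)) n" if i: "i \<le> s" for i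
  proof -
    have c: "sob (\<kappa> - int (s - i) - int j) (cpow u j (s - i))" if "u = h \<or> u = g" for u
      using Suc.prems i that by (intro sob_cpow) auto
    have s: "(\<lambda>m. norm (u m * v (n - m))) summable_on UNIV"
      if "sob (\<kappa> - int i) u" "sob (\<kappa> - int (s - i) - int j) v" for u v n
      using that i Suc.prems by (intro sob_conv(1)[where \<kappa> = \<kappa>]) auto
    have "conv (g i) (cpow g j (s - i)) n - conv (h i) (cpow h j (s - i)) n
        = conv (g i) (\<lambda>n. cpow g j (s - i) n - cpow h j (s - i) n) n
          + conv (\<lambda>n. g i n - h i n) (cpow h j (s - i)) n"
      by (rule conv_diff) (intro s c Suc.prems i disjI1[OF refl] disjI2[OF refl])+
    also have "conv (g i) (\<lambda>n. cpow g j (s - i) n - cpow h j (s - i) n) n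
        = conv (g i) (\<lambda>n. (-1) * (cpow h j (s - i) n - cpow g j (s - i) n)) n"
      by (rule conv_cong) auto
    also have "\<dots> = (-1) * conv (g i) (\<lambda>n. cpow h j (s - i) n - cpow g j (s - i) n) n"
      by (rule conv_scale_right)
    also have "conv (g i) (\<lambda>n. cpow h j (s - i) n - cpow g j (s - i) n) n
        = conv (g i) (dcpow g (\<lambda>i n. h i n - g i n) h j (s - i)) n"
      using Suc.prems i by (intro conv_cong Suc.IH) auto
    also have "conv (\<lambda>n. g i n - h i n) (cpow h j (s - i)) n
        = conv (\<lambda>n. (-1) * (h i n - g i n)) (cpow h j (s - i)) n"
      by (rule conv_cong) auto
    also have "\<dots> = (-1) * conv (\<lambda>n. h i n - g i n) (cpow h j (s - i)) n"
      by (rule conv_scale_left)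
    finally show ?thesis by (simp add: algebra_simps)
  qed
  then show ?case by (simp add: sum_subtractf[symmetric])
qed simp

lemma dcpow_scale: "dcpow g (\<lambda>i n. c * k i n) h j s n = c * dcpow g k h j s n"
proof (induction j arbitrary: s n)
  case (Suc j)
  have "conv (g i) (dcpow g (\<lambda>i n. c * k i n) h j (s - i)) n = c * conv (g i) (dcpow g k h j (s - i)) n" for i
    by (subst conv_scale_right[symmetric], rule conv_cong) (simp_all add: Suc.IH)
  then show ?case by (simp add: conv_scale_left sum_distrib_left distrib_left)
qed simp

lemma psum_diff:
  fixes \<kappa> :: int
  assumes "\<And>i. i < m \<Longrightarrow> sob (\<kappa> - int i) (h i)" "\<And>i. i < m \<Longrightarrow> sob (\<kappa> - int i) (g i)"
    and "int m \<le> 2 * \<kappa> + 1"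
  shows "(psum p h m n - psum p' g m n) / \<tau> =
      dpsum p g (\<lambda>i n. (h i n - g i n) / \<tau>) h m n + psum (\<lambda>j. (p j - p' j) / \<tau>) g m n"
proof -
  have "(p j * cpow h j (m - j) n - p' j * cpow g j (m - j) n) / \<tau> =
      p j * dcpow g (\<lambda>i n. (h i n - g i n) / \<tau>) h j (m - j) n + (p j - p' j) / \<tau> * cpow g j (m - j) n"
    if "j \<in> {1..m}" for j
  proof -
    have "cpow h j (m - j) n - cpow g j (m - j) n = dcpow g (\<lambda>i n. h i n - g i n) h j (m - j) n"
      using that assms by (intro cpow_diff[where \<kappa> = \<kappa>]) auto
    then have h: "cpow h j (m - j) n = dcpow g (\<lambda>i n. h i n - g i n) h j (m - j) n + cpow g j (m - j) n"
      by (simp add: algebra_simps)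
    have d: "dcpow g (\<lambda>i n. (h i n - g i n) / \<tau>) h j (m - j) n
        = inverse \<tau> * dcpow g (\<lambda>i n. h i n - g i n) h j (m - j) n"
      by (subst dcpow_scale[symmetric]) (simp add: divide_inverse mult.commute)
    show ?thesis
      unfolding h d by (simp add: divide_inverse ring_distribs mult_ac)
  qed
  then show ?thesis
    unfolding psum_def dpsum_def sum_subtractf[symmetric] sum_divide_distrib sum.distrib[symmetric]
    by (rule sum.cong[OF refl])
qed

text \<open>By the factorisation of differences of powers, the quotient satisfies exactly, not
  merely to first order, a recursion like that of \<open>ks\<close>, with powers of
  \<open>h2\<close> and \<open>h1\<close> mixed in place of powers of \<open>h\<close>. Its
  coefficients converge, and so does the quotient, by induction. Letting both families move covers
  the forward quotient in time as well as the symmetric quotient in \<theta>.\<close>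

lemma quotient_slim:
  fixes \<kappa> :: int and b :: nat
  assumes h1_def: "h1 = (\<lambda>r. hs (p1 r) (q1 r) (l1 r) (V1 r))"
    and h2_def: "h2 = (\<lambda>r. hs (p2 r) (q2 r) (l2 r) (V2 r))" and h_def: "h = hs p q l V"
    and V: "slim \<kappa> \<F> V1 V" "slim \<kappa> \<F> V2 V"
    and p: "\<And>j. ((\<lambda>r. p1 r j) \<longlongrightarrow> p j) \<F>" "\<And>j. ((\<lambda>r. p2 r j) \<longlongrightarrow> p j) \<F>"
    and q: "\<And>j. ((\<lambda>r. q1 r j) \<longlongrightarrow> q j) \<F>" "\<And>j. ((\<lambda>r. q2 r j) \<longlongrightarrow> q j) \<F>"
    and l1: "\<forall>\<^sub>F r in \<F>. \<forall>n. (cmod (l1 r n))\<^sup>2 \<le> C * weight n powi 1" "\<And>n. ((\<lambda>r. l1 r n) \<longlongrightarrow> l n) \<F>"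
    and l2: "\<forall>\<^sub>F r in \<F>. \<forall>n. (cmod (l2 r n))\<^sup>2 \<le> C * weight n powi 1" "\<And>n. ((\<lambda>r. l2 r n) \<longlongrightarrow> l n) \<F>"
    and l: "\<And>n. (cmod (l n))\<^sup>2 \<le> C * weight n powi 1"
    and W: "slim (\<kappa> - int b) \<F> (\<lambda>r n. (V1 r n - V2 r n) / \<tau> r) W"
    and p': "\<And>j. ((\<lambda>r. (p1 r j - p2 r j) / \<tau> r) \<longlongrightarrow> p' j) \<F>"
    and q': "\<And>j. ((\<lambda>r. (q1 r j - q2 r j) / \<tau> r) \<longlongrightarrow> q' j) \<F>"
    and l': "\<forall>\<^sub>F r in \<F>. \<forall>n. (cmod ((l1 r n - l2 r n) / \<tau> r))\<^sup>2 \<le> D * weight n powi (1 + int b)"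
      "\<And>n. ((\<lambda>r. (l1 r n - l2 r n) / \<tau> r) \<longlongrightarrow> l' n) \<F>" "\<And>n. (cmod (l' n))\<^sup>2 \<le> D * weight n powi (1 + int b)"
    and nb: "int n + int b \<le> 2 * \<kappa> + 1"
  shows "slim (\<kappa> - int n - int b) \<F> (\<lambda>r m. (h1 r n m - h2 r n m) / \<tau> r) (ks p q l p' q' l' h W n)"
  using nb
proof (induction n rule: less_induct)
  case (less n)
  have s1: "slim (\<kappa> - int i) \<F> (\<lambda>r. h1 r i) (h i)" and s2: "slim (\<kappa> - int i) \<F> (\<lambda>r. h2 r i) (h i)"
    if "i \<le> n" for i
    unfolding h1_def h2_def h_def
    using that less.prems V p q l l1 l2 by (auto intro!: hs_slim[where C = C])
  let ?Q = "\<lambda>r i m. (h1 r i m - h2 r i m) / \<tau> r"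
  let ?k = "ks p q l p' q' l' h W"
  show ?case
  proof (cases n)
    case 0
    have "slim (\<kappa> - int b) \<F> (\<lambda>r m. (-1) * ((V1 r m - V2 r m) / \<tau> r)) (\<lambda>m. (-1) * W m)"
      by (intro slim_scale W tendsto_const)
    then show ?thesis using 0 by (simp add: h1_def h2_def h_def minus_divide_left algebra_simps)
  next
    case (Suc m)
    have IH: "slim (\<kappa> - int i - int b) \<F> (\<lambda>r. ?Q r i) (?k i)" if "i < n" for i
      using that less by auto
    let ?R = "\<lambda>r x. (dpsum (p1 r) (h2 r) (?Q r) (h1 r) m x + psum (\<lambda>j. (p1 r j - p2 r j) / \<tau> r) (h2 r) m x)
        - (dpsum (q1 r) (h2 r) (?Q r) (h1 r) (Suc m) x + psum (\<lambda>j. (q1 r j - q2 r j) / \<tau> r) (h2 r) (Suc m) x)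
        + (l1 r x * ?Q r m x + (l1 r x - l2 r x) / \<tau> r * h2 r m x)"
    have "\<forall>\<^sub>F r in \<F>. \<forall>i\<in>{..m}. sob (\<kappa> - int i) (h1 r i) \<and> sob (\<kappa> - int i) (h2 r i)"
      using s1 s2 Suc by (intro eventually_ball_finite) (auto simp: slim_def intro: eventually_conj)
    \<comment> \<open>The rewriting is legitimate only where the convolutions converge absolutely,
      that is, once both families have their Sobolev regularity.\<close>
    then have eq: "\<forall>\<^sub>F r in \<F>. ?R r = ?Q r n"
    proof eventually_elim
      case (elim r)
      show ?case
      proof
        fix x
        have P: "(psum (p1 r) (h1 r) m x - psum (p2 r) (h2 r) m x) / \<tau> r =
          dpsum (p1 r) (h2 r) (?Q r) (h1 r) m x + psum (\<lambda>j. (p1 r j - p2 r j) / \<tau> r) (h2 r) m x"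
          using elim less.prems Suc by (intro psum_diff[where \<kappa> = \<kappa>]) auto
        have Q: "(psum (q1 r) (h1 r) (Suc m) x - psum (q2 r) (h2 r) (Suc m) x) / \<tau> r =
          dpsum (q1 r) (h2 r) (?Q r) (h1 r) (Suc m) x + psum (\<lambda>j. (q1 r j - q2 r j) / \<tau> r) (h2 r) (Suc m) x"
          using elim less.prems Suc by (intro psum_diff[where \<kappa> = \<kappa>]) auto
        have "?Q r n x = (psum (p1 r) (h1 r) m x - psum (p2 r) (h2 r) m x) / \<tau> r
          - (psum (q1 r) (h1 r) (Suc m) x - psum (q2 r) (h2 r) (Suc m) x) / \<tau> r
          + (l1 r x * h1 r m x - l2 r x * h2 r m x) / \<tau> r"
          unfolding Suc h1_def h2_def hs.simps by (simp add: diff_divide_distrib add_divide_distrib)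
        also have "(l1 r x * h1 r m x - l2 r x * h2 r m x) / \<tau> r
            = l1 r x * ?Q r m x + (l1 r x - l2 r x) / \<tau> r * h2 r m x"
          by (simp add: divide_inverse algebra_simps)
        finally show "?R r x = ?Q r n x" unfolding P Q by simp
      qed
    qed
    have S: "slim (\<kappa> - int n - int b) \<F> ?R (ks p q l p' q' l' h W (Suc m))"
      unfolding ks.simps
    proof (intro slim_add slim_diff)
      have 1: "int m + int b \<le> 2 * \<kappa> + 1" "int (Suc m) + int b \<le> 2 * \<kappa> + 1"
        using less.prems Suc by auto
      show "slim (\<kappa> - int n - int b) \<F> (\<lambda>r. dpsum (p1 r) (h2 r) (?Q r) (h1 r) m) (dpsum p h ?k h m)"
        by (rule slim_mono[OF _ dpsum_slim[where \<kappa> = \<kappa> and b = b]]) (use s1 s2 IH 1 p Suc in auto)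
      show "slim (\<kappa> - int n - int b) \<F> (\<lambda>r. dpsum (q1 r) (h2 r) (?Q r) (h1 r) (Suc m)) (dpsum q h ?k h (Suc m))"
        by (rule slim_mono[OF _ dpsum_slim[where \<kappa> = \<kappa> and b = b]]) (use s1 s2 IH 1 q Suc in auto)
      show "slim (\<kappa> - int n - int b) \<F> (\<lambda>r. psum (\<lambda>j. (p1 r j - p2 r j) / \<tau> r) (h2 r) m) (psum p' h m)"
        by (rule slim_mono[OF _ psum_slim[where \<kappa> = \<kappa>]]) (use s1 s2 1 p' Suc in auto)
      show "slim (\<kappa> - int n - int b) \<F> (\<lambda>r. psum (\<lambda>j. (q1 r j - q2 r j) / \<tau> r) (h2 r) (Suc m)) (psum q' h (Suc m))"
        by (rule slim_mono[OF _ psum_slim[where \<kappa> = \<kappa>]]) (use s1 s2 1 q' Suc in auto)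
      have "slim (\<kappa> - int m - int b - 1) \<F> (\<lambda>r x. l1 r x * ?Q r m x) (\<lambda>x. l x * ?k m x)"
        using IH[of m] Suc by (intro slim_multiplier[OF l1(1) l l1(2)]) auto
      then show "slim (\<kappa> - int n - int b) \<F> (\<lambda>r x. l1 r x * ?Q r m x) (\<lambda>x. l x * ?k m x)"
        using Suc by (simp add: algebra_simps)
      have "slim (\<kappa> - int m - (1 + int b)) \<F> (\<lambda>r x. (l1 r x - l2 r x) / \<tau> r * h2 r m x) (\<lambda>x. l' x * h m x)"
        using s2[of m] Suc by (intro slim_multiplier[OF l'(1,3,2)]) auto
      then show "slim (\<kappa> - int n - int b) \<F> (\<lambda>r x. (l1 r x - l2 r x) / \<tau> r * h2 r m x) (\<lambda>x. l' x * h m x)"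
        using Suc by (simp add: algebra_simps)
    qed
    show ?thesis
      using slim_cong[OF eq S] Suc by simp
  qed
qed

subsection \<open>Generating functions over trigonometric polynomials\<close>

unbundle no vec_syntax and fps_syntax

text \<open>Finitely supported coefficient sequences with convolution as product, i.e. trigonometric
  polynomials. They form a commutative ring, so equations between generating functions become ring
  identities in the power series over it.\<close>

type_synonym trig = "int \<Rightarrow>\<^sub>0 complex"

abbreviation coef :: "trig \<Rightarrow> int \<Rightarrow> complex" where
  "coef \<equiv> Poly_Mapping.lookup"

definition cst :: "complex \<Rightarrow> trig" where
  "cst c = Poly_Mapping.single 0 c"

definition mlt :: "(int \<Rightarrow> complex) \<Rightarrow> trig \<Rightarrow> trig" where
  "mlt m F = Poly_Mapping.mapp (\<lambda>n c. m n * c) F"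

lemma coef_mlt [simp]: "coef (mlt m F) n = m n * coef F n"
  by (simp add: mlt_def lookup_mapp when_def in_keys_iff)

lemma coef_mult:
  assumes "finite S" "Poly_Mapping.keys F \<subseteq> S"
  shows "coef (F * G) n = (\<Sum>p\<in>S. coef F p * coef G (n - p))"
proof -
  have "Sum_any (\<lambda>q. coef G q when n = l + q) = coef G (n - l)" for l
  proof -
    have "(coef G q when n = l + q) = (coef G q when q = n - l)" for q
      by (auto simp: when_def)
    then show ?thesis by simp
  qed
  then have "coef (F * G) n = Sum_any (\<lambda>l. coef F l * coef G (n - l))"
    by (simp add: lookup_mult)
  also have "\<dots> = (\<Sum>p\<in>S. coef F p * coef G (n - p))"
    using assms by (intro Sum_any.expand_superset) (auto simp: in_keys_iff)
  finally show ?thesis .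
qed

lemma coef_cst_mult [simp]: "coef (cst c * F) n = c * coef F n"
  by (subst coef_mult[of "{0}"]) (auto simp: cst_def split: if_splits)

lemma trig_eqI: "(\<And>n. coef F n = coef G n) \<Longrightarrow> F = G"
  by (rule poly_mapping_eqI)

lemma cst_mult: "cst c * cst d = cst (c * d)"
  by (simp add: cst_def mult_single)

lemma cst_simps [simp]: "cst 0 = 0" "cst 1 = 1"
  by (simp_all add: cst_def)

lemma of_nat_cst: "of_nat k = cst (of_nat k)"
  by (simp add: cst_def)

lemma cst_numeral: "cst (numeral k) = numeral k"
  by (simp add: cst_def)

lemma coef_add [simp]: "coef (F + G) n = coef F n + coef G n"
  by (rule lookup_add)

lemma coef_diff [simp]: "coef (F - G) n = coef F n - coef G n"
  by (rule lookup_minus)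

lemma coef_sum [simp]: "coef (sum f S) n = (\<Sum>i\<in>S. coef (f i) n)"
  by (rule lookup_sum)

lemma mlt_simps [simp]:
  "mlt m (F + G) = mlt m F + mlt m G" "mlt m (F - G) = mlt m F - mlt m G" "mlt m 0 = 0"
  "mlt m (cst c * F) = cst c * mlt m F"
  by (rule trig_eqI; simp add: ring_distribs mult.left_commute)+

lemma mlt_sum: "mlt m (sum f S) = (\<Sum>i\<in>S. mlt m (f i))"
  by (rule trig_eqI) (simp add: sum_distrib_left)

lemma mlt_commute: "mlt m (mlt m' F) = mlt m' (mlt m F)"
  by (rule trig_eqI) simp

definition fmlt :: "(int \<Rightarrow> complex) \<Rightarrow> trig fps \<Rightarrow> trig fps" where
  "fmlt m H = Abs_fps (\<lambda>n. mlt m (H $ n))"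

lemma fmlt_nth [simp]: "fmlt m H $ n = mlt m (H $ n)"
  by (simp add: fmlt_def)

lemma fmlt_simps [simp]:
  "fmlt m (F + G) = fmlt m F + fmlt m G" "fmlt m (F - G) = fmlt m F - fmlt m G" "fmlt m 0 = 0"
  "fmlt m (fps_const (cst c) * F) = fps_const (cst c) * fmlt m F"
  "fmlt m (fps_X * F) = fps_X * fmlt m F"
  by (rule fps_ext; simp)+

lemma fmlt_numeral [simp]: "fmlt m (numeral k * F) = numeral k * fmlt m F"
  using fmlt_simps(4)[of m "numeral k" F] by (simp add: cst_numeral numeral_fps_const)

lemma fmlt_commute: "fmlt m (fmlt m' F) = fmlt m' (fmlt m F)"
  by (rule fps_ext) (simp add: mlt_commute)

abbreviation dd :: "int \<Rightarrow> complex" where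
  "dd \<equiv> \<lambda>n. \<i> * of_int n"

lemma mlt_dd_mult: "mlt dd (F * G) = mlt dd F * G + F * mlt dd G"
proof (rule trig_eqI)
  fix n
  let ?S = "Poly_Mapping.keys F \<union> Poly_Mapping.keys (mlt dd F)"
  show "coef (mlt dd (F * G)) n = coef (mlt dd F * G + F * mlt dd G) n"
    by (simp add: coef_mult[of ?S] sum_distrib_left sum.distrib[symmetric])
       (rule sum.cong, simp_all add: algebra_simps)
qed

lemma fmlt_dd_mult: "fmlt dd (F * G) = fmlt dd F * G + F * fmlt dd G"
  by (rule fps_ext) (simp add: fps_mult_nth mlt_sum mlt_dd_mult sum.distrib)

lemma fmlt_dd_1 [simp]: "fmlt dd 1 = 0"
  by (rule fps_ext, rule trig_eqI) (auto simp: fps_one_nth when_def lookup_one)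

lemma fmlt_dd_power: "fmlt dd (H ^ j) = of_nat j * H ^ (j - 1) * fmlt dd H"
proof (induction j)
  case (Suc j)
  then show ?case by (cases j) (auto simp: fmlt_dd_mult algebra_simps)
qed simp

lemma fps_compose_mult_nth:
  fixes A H K :: "'a::comm_ring_1 fps"
  assumes "H $ 0 = 0"
  shows "((A oo H) * K) $ n = (\<Sum>j\<le>n. A $ j * (H ^ j * K) $ n)"
proof -
  have "((A oo H) * K) $ n = (\<Sum>i\<le>n. (\<Sum>j\<le>n. A $ j * (H ^ j) $ i) * K $ (n - i))"
  proof -
    have "(A oo H) $ i = (\<Sum>j\<le>n. A $ j * (H ^ j) $ i)" if "i \<le> n" for i
      unfolding fps_compose_nth atLeast0AtMost
      using that by (intro sum.mono_neutral_left ballI) (auto simp: startsby_zero_power_prefix[OF assms, rule_format])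
    then show ?thesis by (simp add: fps_mult_nth atLeast0AtMost)
  qed
  also have "\<dots> = (\<Sum>j\<le>n. A $ j * (H ^ j * K) $ n)"
    by (simp add: fps_mult_nth atLeast0AtMost sum_distrib_left sum_distrib_right mult.assoc) (rule sum.swap)
  finally show ?thesis .
qed

lemma fps_of_nat_mult_nth: "(of_nat k * F) $ n = of_nat k * F $ n"
  by (subst fps_of_nat[symmetric]) simp

text \<open>Since H and K have no constant term, H^n K has no coefficient at n. The index shift
  caused by differentiation therefore costs nothing, and the sum can run over the same range as for
  the composition itself.\<close>

lemma fps_deriv_compose_mult_nth:
  fixes C H K :: "'a::comm_ring_1 fps"
  assumes H: "H $ 0 = 0" and K: "K $ 0 = 0"
  shows "((fps_deriv C oo H) * K) $ n = (\<Sum>j\<le>n. C $ j * (of_nat j * H ^ (j - 1) * K) $ n)"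
proof -
  have top: "(H ^ n * K) $ n = 0"
    unfolding fps_mult_nth
  proof (rule sum.neutral, rule ballI)
    fix i assume "i \<in> {0..n}"
    then show "(H ^ n) $ i * K $ (n - i) = 0"
      using startsby_zero_power_prefix[OF H, rule_format, of i n] K by (cases "i = n") auto
  qed
  have "((fps_deriv C oo H) * K) $ n = (\<Sum>j<Suc n. of_nat (Suc j) * C $ Suc j * (H ^ j * K) $ n)"
    by (simp add: fps_compose_mult_nth[OF H] lessThan_Suc_atMost)
  also have "\<dots> = (\<Sum>j<n. of_nat (Suc j) * C $ Suc j * (H ^ j * K) $ n)"
    using top by simp
  also have "\<dots> = (\<Sum>j<n. C $ Suc j * (of_nat (Suc j) * H ^ j * K) $ n)"
    by (rule sum.cong[OF refl], simp only: mult.assoc fps_of_nat_mult_nth, rule mult.left_commute)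
  also have "\<dots> = (\<Sum>j\<in>{1..n}. C $ j * (of_nat j * H ^ (j - 1) * K) $ n)"
    by (rule sum.reindex_bij_witness[of _ "\<lambda>j. j - 1" Suc]) auto
  also have "\<dots> = (\<Sum>j\<le>n. C $ j * (of_nat j * H ^ (j - 1) * K) $ n)"
    by (rule sum.mono_neutral_left) (auto simp: not_le Suc_le_eq)
  finally show ?thesis .
qed

text \<open>The chain rule in x. The coefficients of the outer series must be constants, or they
  would be differentiated as well.\<close>

lemma fmlt_dd_compose:
  assumes H: "H $ 0 = 0" and C: "\<And>j. \<exists>c. C $ j = cst c"
  shows "fmlt dd (C oo H) = (fps_deriv C oo H) * fmlt dd H"
proof (rule fps_ext)
  fix n
  have "mlt dd (C $ j * F) = C $ j * mlt dd F" for j F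
    using C[of j] by auto
  then have "fmlt dd (C oo H) $ n = (\<Sum>j\<le>n. C $ j * fmlt dd (H ^ j) $ n)"
    by (simp add: fps_compose_nth mlt_sum atLeast0AtMost)
  also have "\<dots> = ((fps_deriv C oo H) * fmlt dd H) $ n"
    using H by (subst fps_deriv_compose_mult_nth) (simp_all add: fmlt_dd_power)
  finally show "fmlt dd (C oo H) $ n = ((fps_deriv C oo H) * fmlt dd H) $ n" .
qed

lemma conv_coef: "conv (coef F) (coef G) n = coef (F * G) n"
proof -
  have "conv (coef F) (coef G) n = (\<Sum>\<^sub>\<infinity>m\<in>Poly_Mapping.keys F. coef F m * coef G (n - m))"
    unfolding conv_def by (rule infsum_cong_neutral) (auto simp: in_keys_iff)
  then show ?thesis by (simp add: coef_mult[OF finite_keys order_refl])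
qed

section \<open>The recursions as equations between power series\<close>

definition trig_of :: "(int \<Rightarrow> complex) \<Rightarrow> trig" where
  "trig_of F = Abs_poly_mapping F"

lemma coef_trig_of: "finite {n. F n \<noteq> 0} \<Longrightarrow> coef (trig_of F) = F"
  by (simp add: trig_of_def)

definition gen :: "(nat \<Rightarrow> int \<Rightarrow> complex) \<Rightarrow> trig fps" where
  "gen h = Abs_fps (\<lambda>i. trig_of (h i))"

lemma cpow_gen:
  assumes "\<And>i. i \<le> s \<Longrightarrow> finite {n. h i n \<noteq> 0}"
  shows "cpow h j s n = coef ((gen h ^ Suc j) $ s) n"
  using assms
proof (induction j arbitrary: s n)
  case 0
  then show ?case by (simp add: gen_def coef_trig_of)
next
  case (Suc j)
  have "conv (h i) (cpow h j (s - i)) n = coef (gen h $ i * (gen h ^ Suc j) $ (s - i)) n" if "i \<le> s" for i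
    unfolding conv_coef[symmetric]
    using Suc.prems that by (intro conv_cong) (auto simp: gen_def coef_trig_of Suc.IH simp del: power_Suc)
  then show ?case by (simp add: fps_mult_nth[of "gen h"] atLeast0AtMost del: power_Suc) (simp add: fps_mult_nth[of "gen h"] atLeast0AtMost)
qed

lemma dcpow_gen:
  assumes "\<And>i. i \<le> s \<Longrightarrow> finite {n. h i n \<noteq> 0}" "\<And>i. i \<le> s \<Longrightarrow> finite {n. k i n \<noteq> 0}"
  shows "dcpow h k h j s n = coef ((of_nat (Suc j) * gen h ^ j * gen k) $ s) n"
  using assms
proof (induction j arbitrary: s n)
  case 0
  then show ?case by (simp add: gen_def coef_trig_of)
next
  case (Suc j)
  have 1: "conv (k i) (cpow h j (s - i)) n = coef (gen k $ i * (gen h ^ Suc j) $ (s - i)) n" if "i \<le> s" for i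
    unfolding conv_coef[symmetric]
    using Suc.prems that by (intro conv_cong) (auto simp: gen_def[of k] coef_trig_of cpow_gen simp del: power_Suc)
  have 2: "conv (h i) (dcpow h k h j (s - i)) n = coef (gen h $ i * (of_nat (Suc j) * gen h ^ j * gen k) $ (s - i)) n"
    if "i \<le> s" for i
    unfolding conv_coef[symmetric]
    using Suc.prems that by (intro conv_cong) (auto simp: gen_def[of h] coef_trig_of Suc.IH simp del: of_nat_Suc)
  have "dcpow h k h (Suc j) s n = coef ((gen k * gen h ^ Suc j + gen h * (of_nat (Suc j) * gen h ^ j * gen k)) $ s) n"
    by (simp add: 1 2 sum.distrib fps_mult_nth[of "gen k"] fps_mult_nth[of "gen h"] atLeast0AtMost
        del: power_Suc of_nat_Suc)
  also have "gen k * gen h ^ Suc j + gen h * (of_nat (Suc j) * gen h ^ j * gen k) = of_nat (Suc (Suc j)) * gen h ^ Suc j * gen k"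
    by (simp add: algebra_simps)
  finally show ?case .
qed

text \<open>The exponent is shifted: \<open>p j\<close> belongs to the power j + 1. The series
  starts at the square because \<open>psum\<close> starts at j = 1.\<close>

definition pser :: "(nat \<Rightarrow> complex) \<Rightarrow> trig fps" where
  "pser p = Abs_fps (\<lambda>j. if j < 2 then 0 else cst (p (j - 1)))"

lemma psum_gen:
  assumes "\<And>i. i < m \<Longrightarrow> finite {n. h i n \<noteq> 0}"
  shows "psum p h m n = coef ((pser p oo (fps_X * gen h)) $ Suc m) n"
proof -
  have "(pser p oo (fps_X * gen h)) $ Suc m = (\<Sum>j\<in>{0..Suc m}. pser p $ j * ((fps_X * gen h) ^ j) $ Suc m)"
    by (rule fps_compose_nth)
  also have "\<dots> = (\<Sum>j\<in>{2..Suc m}. pser p $ j * ((fps_X * gen h) ^ j) $ Suc m)"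
    by (rule sum.mono_neutral_right) (auto simp: pser_def)
  also have "\<dots> = (\<Sum>j=1..m. cst (p j) * (gen h ^ Suc j) $ (m - j))"
    by (rule sum.reindex_bij_witness[of _ Suc "\<lambda>j. j - 1"])
       (auto simp: pser_def power_mult_distrib fps_X_power_mult_nth)
  finally show ?thesis
    using assms by (auto simp: psum_def cpow_gen simp del: power_Suc intro!: sum.cong)
qed

lemma dpsum_gen:
  assumes "\<And>i. i < m \<Longrightarrow> finite {n. h i n \<noteq> 0}" "\<And>i. i < m \<Longrightarrow> finite {n. k i n \<noteq> 0}"
  shows "dpsum p h k h m n = coef (((fps_deriv (pser p) oo (fps_X * gen h)) * (fps_X * gen k)) $ Suc m) n"
proof -
  have "((fps_deriv (pser p) oo (fps_X * gen h)) * (fps_X * gen k)) $ Suc m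
    = (\<Sum>j\<le>Suc m. pser p $ j * (of_nat j * (fps_X * gen h) ^ (j - 1) * (fps_X * gen k)) $ Suc m)"
    by (rule fps_deriv_compose_mult_nth) auto
  also have "\<dots> = (\<Sum>j\<in>{2..Suc m}. pser p $ j * (of_nat j * (fps_X * gen h) ^ (j - 1) * (fps_X * gen k)) $ Suc m)"
    by (rule sum.mono_neutral_right) (auto simp: pser_def)
  also have "\<dots> = (\<Sum>j=1..m. cst (p j) * (of_nat (Suc j) * gen h ^ j * gen k) $ (m - j))"
  proof (rule sum.reindex_bij_witness[of _ Suc "\<lambda>j. j - 1"])
    fix j assume "j \<in> {2..Suc m}"
    then obtain i where j: "j = Suc i" "1 \<le> i" "i \<le> m" by (cases j) auto
    let ?F = "of_nat (Suc i) * gen h ^ i * gen k"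
    have A: "of_nat j * (fps_X * gen h) ^ (j - 1) * (fps_X * gen k) = fps_X ^ Suc i * ?F"
      unfolding j diff_Suc_1 power_mult_distrib by (simp only: power_Suc mult_ac)
    have B: "(fps_X ^ Suc i * ?F) $ Suc m = ?F $ (m - i)"
      using j by (simp add: fps_X_power_mult_nth del: power_Suc of_nat_Suc)
    show "cst (p (j - 1)) * (of_nat (Suc (j - 1)) * gen h ^ (j - 1) * gen k) $ (m - (j - 1)) =
        pser p $ j * (of_nat j * (fps_X * gen h) ^ (j - 1) * (fps_X * gen k)) $ Suc m"
      unfolding A B using j by (simp add: pser_def del: of_nat_Suc)
  qed auto
  finally show ?thesis
    using assms by (auto simp: dpsum_def dcpow_gen simp del: power_Suc of_nat_Suc intro!: sum.cong)
qed

lemma finite_psum: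
  assumes "\<And>i. i < m \<Longrightarrow> finite {n. h i n \<noteq> 0}"
  shows "finite {n. psum p h m n \<noteq> 0}"
  using assms by (simp add: psum_gen)

lemma finite_dpsum:
  assumes "\<And>i. i < m \<Longrightarrow> finite {n. h i n \<noteq> 0}" "\<And>i. i < m \<Longrightarrow> finite {n. k i n \<noteq> 0}"
  shows "finite {n. dpsum p h k h m n \<noteq> 0}"
  using assms by (simp add: dpsum_gen)

lemma finite_hs:
  assumes "finite {n. V n \<noteq> 0}"
  shows "finite {n. hs p q l V i n \<noteq> 0}"
proof (induction i rule: less_induct)
  case (less i)
  show ?case
  proof (cases i)
    case (Suc m)
    have "finite ({n. psum p (hs p q l V) m n \<noteq> 0} \<union> {n. psum q (hs p q l V) (Suc m) n \<noteq> 0} \<union> {n. hs p q l V m n \<noteq> 0})"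
      using less Suc by (intro finite_UnI finite_psum) auto
    then show ?thesis by (rule rev_finite_subset) (auto simp: Suc)
  qed (use assms in simp)
qed

lemma finite_ks:
  assumes "finite {n. W n \<noteq> 0}" "\<And>i. finite {n. h i n \<noteq> 0}"
  shows "finite {n. ks p q l p' q' l' h W i n \<noteq> 0}"
proof (induction i rule: less_induct)
  case (less i)
  let ?k = "ks p q l p' q' l' h W"
  show ?case
  proof (cases i)
    case (Suc m)
    have "finite ({n. dpsum p h ?k h m n \<noteq> 0} \<union> {n. psum p' h m n \<noteq> 0} \<union> {n. dpsum q h ?k h (Suc m) n \<noteq> 0}
       \<union> {n. psum q' h (Suc m) n \<noteq> 0} \<union> {n. ?k m n \<noteq> 0} \<union> {n. h m n \<noteq> 0})"
      using less Suc assms by (intro finite_UnI finite_psum finite_dpsum) auto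
    then show ?thesis by (rule rev_finite_subset) (auto simp: Suc)
  qed (use assms in simp)
qed

text \<open>In the recursion the p-sum and the linear term lag one index behind the density while
  the q-sum does not; hence the factor \<open>fps_X\<close> on the former only.\<close>

lemma hs_gen:
  fixes V :: trig and p q :: "nat \<Rightarrow> complex" and l :: "int \<Rightarrow> complex"
  defines "H \<equiv> fps_X * gen (hs p q l (coef V))"
  shows "H = fps_X * (fps_const (- V) + (pser p oo H) + fmlt l H) - (pser q oo H)"
proof (rule fps_ext, rule trig_eqI)
  fix i n
  have fin: "finite {n. hs p q l (coef V) i n \<noteq> 0}" for i
    by (rule finite_hs) simp
  have q1: "(pser q oo H) $ Suc 0 = 0"
    by (rule trig_eqI) (use psum_gen[of 0 "hs p q l (coef V)" q] in \<open>simp add: H_def psum_def\<close>)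
  consider "i = 0" | "i = 1" | m where "i = Suc (Suc m)"
    by (metis One_nat_def not0_implies_Suc)
  then show "coef (H $ i) n = coef ((fps_X * (fps_const (- V) + (pser p oo H) + fmlt l H) - (pser q oo H)) $ i) n"
  proof cases
    case 1
    then show ?thesis by (simp add: H_def pser_def)
  next
    case 2
    then show ?thesis using q1 coef_trig_of[OF fin, of 0] by (simp add: H_def pser_def gen_def)
  next
    case 3
    have "psum p (hs p q l (coef V)) m n = coef ((pser p oo H) $ Suc m) n"
      and "psum q (hs p q l (coef V)) (Suc m) n = coef ((pser q oo H) $ Suc (Suc m)) n"
      unfolding H_def by (intro psum_gen fin)+
    then show ?thesis
      using coef_trig_of[OF fin, of "Suc m"] coef_trig_of[OF fin, of m]
      by (simp add: 3 H_def gen_def)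
  qed
qed

lemma ks_gen:
  fixes W :: trig and p q p' q' :: "nat \<Rightarrow> complex" and l l' :: "int \<Rightarrow> complex"
    and h :: "nat \<Rightarrow> int \<Rightarrow> complex"
  assumes fin: "\<And>i. finite {n. h i n \<noteq> 0}"
  defines "H \<equiv> fps_X * gen h" and "K \<equiv> fps_X * gen (ks p q l p' q' l' h (coef W))"
  shows "K = fps_X * (fps_const (- W) + (fps_deriv (pser p) oo H) * K + (pser p' oo H) + fmlt l K + fmlt l' H)
      - (fps_deriv (pser q) oo H) * K - (pser q' oo H)"
proof (rule fps_ext, rule trig_eqI)
  fix i n
  let ?k = "ks p q l p' q' l' h (coef W)"
  have fk: "finite {n. ?k i n \<noteq> 0}" for i
    by (rule finite_ks) (simp_all add: fin)
  have q1: "(pser r oo H) $ Suc 0 = 0" for r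
    by (rule trig_eqI) (use psum_gen[of 0 h r] in \<open>simp add: H_def psum_def\<close>)
  have q2: "((fps_deriv (pser r) oo H) * K) $ Suc 0 = 0" for r
    by (rule trig_eqI) (use dpsum_gen[of 0 h ?k r] in \<open>simp add: H_def K_def dpsum_def\<close>)
  consider "i = 0" | "i = 1" | m where "i = Suc (Suc m)"
    by (metis One_nat_def not0_implies_Suc)
  then show "coef (K $ i) n = coef ((fps_X * (fps_const (- W) + (fps_deriv (pser p) oo H) * K + (pser p' oo H)
      + fmlt l K + fmlt l' H) - (fps_deriv (pser q) oo H) * K - (pser q' oo H)) $ i) n"
  proof cases
    case 1
    then show ?thesis by (simp add: H_def K_def pser_def)
  next
    case 2
    then show ?thesis using q1[of q'] q2[of q] coef_trig_of[OF fk, of 0] by (simp add: H_def K_def pser_def gen_def[of ?k])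
  next
    case 3
    have "psum p' h m n = coef ((pser p' oo H) $ Suc m) n"
      and "psum q' h (Suc m) n = coef ((pser q' oo H) $ Suc (Suc m)) n"
      unfolding H_def by (intro psum_gen fin)+
    moreover have "dpsum p h ?k h m n = coef (((fps_deriv (pser p) oo H) * K) $ Suc m) n"
      and "dpsum q h ?k h (Suc m) n = coef (((fps_deriv (pser q) oo H) * K) $ Suc (Suc m)) n"
      unfolding H_def K_def by (intro dpsum_gen fin fk)+
    ultimately show ?thesis
      using coef_trig_of[OF fk, of "Suc m"] coef_trig_of[OF fk, of m] coef_trig_of[OF fin, of m]
      by (simp add: 3 H_def[symmetric] K_def[symmetric])
         (simp add: H_def K_def gen_def)
  qed
qed

text \<open>The factor \<open>fps_X\<close> makes coefficient n of the right-hand side depend on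
  lower coefficients only. This is uniqueness for the linearised recursion; it turns a guessed
  closed form of a variation into a proof by substitution.\<close>

lemma fps_linear_unique:
  fixes U Z :: "trig fps"
  assumes "U $ 0 = 1" "U * Z = fps_X * fmlt l Z"
  shows "Z = 0"
proof (rule fps_ext)
  fix n
  show "Z $ n = 0 $ n"
  proof (induction n rule: less_induct)
    case (less n)
    have "(U * Z) $ n = U $ 0 * Z $ n + (\<Sum>i\<in>{1..n}. U $ i * Z $ (n - i))"
      by (simp add: fps_mult_nth sum.atLeast_Suc_atMost)
    also have "(\<Sum>i\<in>{1..n}. U $ i * Z $ (n - i)) = 0"
      by (rule sum.neutral) (use less in auto)
    finally have "Z $ n = (fps_X * fmlt l Z) $ n"
      using assms by simp
    also have "\<dots> = 0" using less[of "n - 1"] by (cases n) auto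
    finally show ?case by simp
  qed
qed

subsection \<open>The algebraic identities\<close>

text \<open>
  Put \<open>L = \<partial> + \<theta> A\<close>, where \<open>\<theta> = \<i> \<delta>\<close> for ILW and \<open>\<theta> = 0\<close> for KdV. For the generating function
  \<open>H = \<Sum>n. h\<^sub>n \<epsilon> ^ (n + 1)\<close> the recursion reads \<open>H + (\<theta> - \<epsilon>) \<Psi>(H) = \<epsilon> (- v + L H)\<close> with
  \<open>\<Psi>(H) = \<Sum>j\<ge>2. 2 ^ (j - 1) \<theta> ^ (j - 2) / j! H ^ j\<close>. In \<open>pcoef\<close> the index is shifted:
  \<open>pcoef \<theta> j\<close> is the coefficient of \<open>H ^ (j + 1)\<close> in \<open>\<Psi>\<close>, and \<open>qcoef\<close> belongs to \<open>\<theta> \<Psi>\<close>.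
\<close>

definition pcoef :: "complex \<Rightarrow> nat \<Rightarrow> complex" where
  "pcoef \<theta> j = 2 ^ j * \<theta> ^ (j - 1) / fact (j + 1)"

definition qcoef :: "complex \<Rightarrow> nat \<Rightarrow> complex" where
  "qcoef \<theta> j = 2 ^ j * \<theta> ^ j / fact (j + 1)"

lemma qcoef_eq: "1 \<le> j \<Longrightarrow> qcoef \<theta> j = \<theta> * pcoef \<theta> j"
  by (cases j) (auto simp: qcoef_def pcoef_def)

lemma pser_qcoef: "pser (qcoef \<theta>) = fps_const (cst \<theta>) * pser (pcoef \<theta>)"
  by (rule fps_ext) (auto simp: pser_def qcoef_eq cst_mult)

lemma pser_zero: "pser (\<lambda>_. 0) = 0"
  by (rule fps_ext) (simp add: pser_def)

lemma pcoef_Suc: "1 \<le> j \<Longrightarrow> of_nat (j + 2) * pcoef \<theta> (Suc j) = 2 * \<theta> * pcoef \<theta> j"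
proof -
  assume "1 \<le> j"
  then obtain i where j: "j = Suc i" by (cases j) auto
  have "of_nat (Suc (Suc (Suc i))) * (2 ^ Suc (Suc i) * \<theta> ^ Suc i / fact (Suc (Suc (Suc i)))) =
      (2 ^ Suc (Suc i) * \<theta> ^ Suc i / (fact (Suc (Suc i)) :: complex))"
    unfolding fact_Suc[of "Suc (Suc i)"] using of_nat_neq_0[of "Suc (Suc i)"]
    by (simp add: divide_simps del: fact_Suc of_nat_Suc)
  then show ?thesis
    by (simp add: pcoef_def j del: fact_Suc of_nat_Suc)
qed

text \<open>The differential equation of (exp(2 \<theta> X) - 1 - 2 \<theta> X) / (2 \<theta>^2), in
  a form free of division by \<theta>, so that \<theta> = 0 is included.\<close>

lemma fps_deriv_pser: "fps_deriv (pser (pcoef \<theta>)) = 2 * fps_const (cst \<theta>) * pser (pcoef \<theta>) + 2 * fps_X"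
proof (rule fps_ext)
  fix n
  have num: "(2 * F) $ k = 2 * F $ k" for F :: "trig fps" and k
    by (simp add: numeral_fps_const)
  consider "n = 0" | "n = 1" | j where "n = Suc j" "1 \<le> j"
    by (metis One_nat_def not0_implies_Suc not_less_eq_eq le0)
  then show "fps_deriv (pser (pcoef \<theta>)) $ n = (2 * fps_const (cst \<theta>) * pser (pcoef \<theta>) + 2 * fps_X) $ n"
  proof cases
    case 1
    then show ?thesis by (simp add: pser_def mult.assoc num)
  next
    case 2
    then show ?thesis by (simp add: pser_def mult.assoc num pcoef_def)
  next
    case 3
    have "fps_deriv (pser (pcoef \<theta>)) $ n = of_nat (j + 2) * cst (pcoef \<theta> (Suc j))"
      using 3 by (simp add: pser_def algebra_simps)
    also have "\<dots> = 2 * (cst \<theta> * cst (pcoef \<theta> j))"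
      unfolding of_nat_cst cst_mult pcoef_Suc[OF 3(2)] by (simp add: cst_mult[symmetric] cst_numeral mult.assoc)
    finally show ?thesis using 3 by (simp add: pser_def mult.assoc num fps_numeral_nth)
  qed
qed

lemma mlt_add_symbol: "mlt (\<lambda>n. m n + c * m' n) F = mlt m F + cst c * mlt m' F"
  by (rule trig_eqI) (simp add: algebra_simps)

lemma fmlt_add_symbol: "fmlt (\<lambda>n. m n + c * m' n) F = fmlt m F + fps_const (cst c) * fmlt m' F"
  by (rule fps_ext) (simp add: mlt_add_symbol)

lemma fmlt_const [simp]: "fmlt m (fps_const F) = fps_const (mlt m F)"
  by (rule fps_ext) simp

lemma pser_single:
  assumes "1 \<le> k" "p k = c" "\<And>j. j \<noteq> k \<Longrightarrow> 1 \<le> j \<Longrightarrow> p j = 0"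
  shows "pser p = fps_const (cst c) * fps_X ^ Suc k"
proof (rule fps_ext)
  fix n
  show "pser p $ n = (fps_const (cst c) * fps_X ^ Suc k) $ n"
    using assms by (cases "n = Suc k") (auto simp: pser_def fps_X_power_nth simp del: power_Suc)
qed

lemma pser_pcoef_0: "pser (pcoef 0) = fps_X * fps_X"
  using pser_single[of 1 "pcoef 0" 1] by (simp add: pcoef_def)

lemma mlt_dd_cst: "mlt dd (cst c) = 0"
  by (rule trig_eqI) (simp add: cst_def lookup_single when_def)

lemma fmlt_dd_constants: "fmlt dd (fps_const (cst c)) = 0" "fmlt dd fps_X = 0" "fmlt dd (numeral k) = 0"
proof -
  show 1: "fmlt dd (fps_const (cst c)) = 0" for c
    by (simp add: mlt_dd_cst)
  show "fmlt dd fps_X = 0"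
    by (rule fps_ext) (use mlt_dd_cst[of 1] in \<open>simp add: fps_X_def\<close>)
  show "fmlt dd (numeral k) = 0"
    using 1[of "numeral k"] by (simp add: cst_numeral numeral_fps_const)
qed

lemma fmlt_zero_symbol [simp]: "fmlt (\<lambda>_. 0) F = 0"
  by (rule fps_ext, rule trig_eqI) simp

text \<open>
  Besides evenness of \<open>a\<close>, this is the polarised form of
  \<open>- \<theta>\<^sup>2 A (2 H\<^sub>x A H) + A (H\<^sup>2)\<^sub>x = - \<theta>\<^sup>2 ((A H)\<^sup>2)\<^sub>x + 2 H A H\<^sub>x - (H\<^sub>x\<^sup>2)\<^sub>x\<close>, the only property of the
  dispersion that conservation uses. For ILW it is the addition theorem of \<open>coth\<close>.
\<close>

definition ILW_symbol :: "complex \<Rightarrow> (int \<Rightarrow> complex) \<Rightarrow> bool" where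
  "ILW_symbol \<theta> a \<longleftrightarrow> (\<forall>n. a (- n) = a n) \<and>
     (\<forall>m n. - (\<theta>\<^sup>2 * a (m + n) * (dd m * a n + dd n * a m)) + a (m + n) * dd (m + n) =
       - (\<theta>\<^sup>2 * dd (m + n) * a m * a n) + dd n * a n + dd m * a m - dd (m + n) * dd m * dd n)"

text \<open>The symbol identity at the frequencies m and n - m, multiplied by the two coefficients
  and summed over m.\<close>

lemma ILW_symbol_bilinear:
  assumes "ILW_symbol \<theta> a"
  shows "mlt a (mlt dd (F * G)) - cst (\<theta>\<^sup>2) * mlt a (mlt dd F * mlt a G + mlt a F * mlt dd G) =
    F * mlt a (mlt dd G) + mlt a (mlt dd F) * G - cst (\<theta>\<^sup>2) * mlt dd (mlt a F * mlt a G)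
      - mlt dd (mlt dd F * mlt dd G)"
proof (rule trig_eqI)
  fix n
  \<comment> \<open>A single finite set containing the supports of all left factors, so that every
    product expands over the same index set.\<close>
  let ?S = "Poly_Mapping.keys F \<union> Poly_Mapping.keys (mlt dd F) \<union> Poly_Mapping.keys (mlt a F)
    \<union> Poly_Mapping.keys (mlt a (mlt dd F))"
  have "(a n * dd n - \<theta>\<^sup>2 * a n * (dd m * a (n - m) + a m * dd (n - m))) * (coef F m * coef G (n - m)) =
    (a (n - m) * dd (n - m) + a m * dd m - \<theta>\<^sup>2 * dd n * (a m * a (n - m)) - dd n * dd m * dd (n - m))
      * (coef F m * coef G (n - m))" for m
  proof -
    have "- (\<theta>\<^sup>2 * a (m + (n - m)) * (dd m * a (n - m) + dd (n - m) * a m)) + a (m + (n - m)) * dd (m + (n - m)) =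
       - (\<theta>\<^sup>2 * dd (m + (n - m)) * a m * a (n - m)) + dd (n - m) * a (n - m) + dd m * a m
       - dd (m + (n - m)) * dd m * dd (n - m)"
      using assms unfolding ILW_symbol_def by blast
    then have "a n * dd n - \<theta>\<^sup>2 * a n * (dd m * a (n - m) + a m * dd (n - m)) =
      a (n - m) * dd (n - m) + a m * dd m - \<theta>\<^sup>2 * dd n * (a m * a (n - m)) - dd n * dd m * dd (n - m)"
      by (simp only: add_diff_cancel_left' diff_add_cancel add.commute[of m] mult_ac) (simp add: algebra_simps)
    then show ?thesis by simp
  qed
  then show "coef (mlt a (mlt dd (F * G)) - cst (\<theta>\<^sup>2) * mlt a (mlt dd F * mlt a G + mlt a F * mlt dd G)) n =
    coef (F * mlt a (mlt dd G) + mlt a (mlt dd F) * G - cst (\<theta>\<^sup>2) * mlt dd (mlt a F * mlt a G)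
      - mlt dd (mlt dd F * mlt dd G)) n"
    by (simp only: coef_diff coef_add coef_mlt coef_cst_mult)
       (simp only: coef_mult[of ?S] finite_Un finite_keys sum_distrib_left sum.distrib[symmetric]
          sum_subtractf[symmetric] coef_mlt Un_upper1 Un_upper2 simp_thms le_supI1 le_supI2 order_refl Un_assoc,
        rule sum.cong, simp_all only: ring_distribs mult_ac)
qed

lemma ILW_symbol_square:
  assumes "ILW_symbol \<theta> a"
  shows "fmlt a (fmlt dd (H * H)) - fps_const (cst (\<theta>\<^sup>2)) * (2 * fmlt a (fmlt dd H * fmlt a H)) =
    2 * H * fmlt a (fmlt dd H) - fps_const (cst (\<theta>\<^sup>2)) * fmlt dd (fmlt a H * fmlt a H)
      - fmlt dd (fmlt dd H * fmlt dd H)"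
proof -
  have "fmlt a (fmlt dd (H * H)) - fps_const (cst (\<theta>\<^sup>2)) * fmlt a (fmlt dd H * fmlt a H + fmlt a H * fmlt dd H) =
    H * fmlt a (fmlt dd H) + fmlt a (fmlt dd H) * H - fps_const (cst (\<theta>\<^sup>2)) * fmlt dd (fmlt a H * fmlt a H)
      - fmlt dd (fmlt dd H * fmlt dd H)"
  (is "?L = ?R")
  proof (rule fps_ext)
    fix n
    have "?L $ n = (\<Sum>i=0..n. mlt a (mlt dd (H $ i * H $ (n - i)))
        - cst (\<theta>\<^sup>2) * mlt a (mlt dd (H $ i) * mlt a (H $ (n - i)) + mlt a (H $ i) * mlt dd (H $ (n - i))))"
      unfolding fps_sub_nth fps_add_nth fmlt_nth fps_mult_left_const_nth
      unfolding fps_add_nth fps_mult_nth fmlt_nth mlt_sum mlt_simps sum_subtractf sum.distrib sum_distrib_left distrib_left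
      by simp
    also have "\<dots> = ?R $ n"
      unfolding ILW_symbol_bilinear[OF assms]
      unfolding fps_sub_nth fps_add_nth fmlt_nth fps_mult_left_const_nth
      unfolding fps_mult_nth fmlt_nth mlt_sum sum_subtractf sum.distrib sum_distrib_left
      by simp
    finally show "?L $ n = ?R $ n" .
  qed
  moreover have "fmlt a (fmlt dd H * fmlt a H + fmlt a H * fmlt dd H) = 2 * fmlt a (fmlt dd H * fmlt a H)"
    unfolding mult.commute[of "fmlt a H" "fmlt dd H"] fmlt_simps(1) by (rule mult_2[symmetric])
  moreover have "H * fmlt a (fmlt dd H) + fmlt a (fmlt dd H) * H = 2 * H * fmlt a (fmlt dd H)"
    by (simp add: algebra_simps)
  ultimately show ?thesis by simp
qed

text \<open>The computation behind the closed form of the flow, with e, t for \<epsilon>, \<theta>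
  and the letters x and A for \<partial> and the dispersion. The recursion identifies
  \<open>G\<close> with \<epsilon> v, so \<open>e * AG + 2 * G * Gx\<close> is \<epsilon>^2 times
  the velocity of v, and the factor on the left is the one of the linearised recursion.
  \<open>tAX\<close> is \<theta> A X after the dispersive identity has eliminated every A applied to
  a product.\<close>

lemma conservation_identity:
  fixes t e H Hx Hxx AH AHx AHxx AAHx P AP Px :: "'a::comm_ring_1"
  assumes "Px = 2 * (t * P + H) * Hx"
  defines "G \<equiv> e * (P + Hx + t * AH) - t * P - H"
    and "Gx \<equiv> e * (Px + Hxx + t * AHx) - t * Px - Hx"
    and "AG \<equiv> e * (AP + AHxx + t * AAHx) - t * AP - AHx"
    and "X \<equiv> e * (AHx + 2 * P * Hx + 2 * t * Hx * AH) - Px"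
    and "Xx \<equiv> e * (AHxx + 2 * (Px * Hx + P * Hxx) + 2 * t * (Hxx * AH + Hx * AHx))
      - (2 * (t * Px + Hx) * Hx + 2 * (t * P + H) * Hxx)"
    and "tAX \<equiv> e * (t * AAHx + AP + 2 * t\<^sup>2 * AH * AHx - 2 * H * AHx + 2 * Hx * Hxx) - t * AP"
  shows "(1 + 2 * (t - e) * (t * P + H)) * X = e * (Xx + tAX) - (e * AG + 2 * G * Gx)"
  unfolding G_def Gx_def AG_def X_def Xx_def tAX_def assms(1)
  by (simp add: algebra_simps power2_eq_square)

text \<open>For the pairing given by the mean of a product, A is symmetric and commutes with the
  antisymmetric \<partial>, so the two terms cancel.\<close>

lemma coef_dd_skew:
  assumes "\<And>n. a (- n) = a n"
  shows "coef (mlt dd F * mlt a G + mlt dd G * mlt a F) 0 = 0"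
proof -
  let ?S = "(Poly_Mapping.keys F \<union> uminus ` Poly_Mapping.keys G) \<union> (uminus ` Poly_Mapping.keys F \<union> Poly_Mapping.keys G)"
  have k: "Poly_Mapping.keys (mlt dd E) \<subseteq> Poly_Mapping.keys E" for E
    by (auto simp: in_keys_iff)
  have S: "finite ?S" "Poly_Mapping.keys (mlt dd F) \<subseteq> ?S" "Poly_Mapping.keys (mlt dd G) \<subseteq> ?S"
    using k[of F] k[of G] by auto
  have "coef (mlt dd G * mlt a F) 0 = (\<Sum>m\<in>?S. dd m * coef G m * (a (- m) * coef F (- m)))"
    using coef_mult[OF S(1,3), of "mlt a F" 0] by simp
  also have "\<dots> = (\<Sum>m\<in>?S. dd (- m) * coef G (- m) * (a m * coef F m))"
    by (rule sum.reindex_bij_witness[of _ uminus uminus]) auto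
  finally show ?thesis
    using coef_mult[OF S(1,2), of "mlt a G" 0] assms
    by (simp add: sum.distrib[symmetric] sum_negf[symmetric] algebra_simps)
qed

lemma coef_dd_skew_fps:
  assumes "\<And>n. a (- n) = a n"
  shows "coef ((fmlt dd H * fmlt a H) $ n) 0 = 0"
proof -
  define S where "S = (\<Sum>i\<le>n. mlt dd (H $ i) * mlt a (H $ (n - i)))"
  define S' where "S' = (\<Sum>i\<le>n. mlt dd (H $ (n - i)) * mlt a (H $ i))"
  have "(fmlt dd H * fmlt a H) $ n = S"
    by (simp add: S_def fps_mult_nth atLeast0AtMost)
  moreover have "S = S'"
    unfolding S_def S'_def by (rule sum.reindex_bij_witness[of _ "\<lambda>i. n - i" "\<lambda>i. n - i"]) auto
  ultimately have "2 * coef ((fmlt dd H * fmlt a H) $ n) 0 = coef (S + S') 0"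
    by (metis coef_add mult_2)
  also have "\<dots> = (\<Sum>i\<le>n. coef (mlt dd (H $ i) * mlt a (H $ (n - i)) + mlt dd (H $ (n - i)) * mlt a (H $ i)) 0)"
    unfolding S_def S'_def sum.distrib[symmetric] coef_sum ..
  also have "\<dots> = 0"
    by (intro sum.neutral ballI coef_dd_skew assms)
  finally show ?thesis by simp
qed

lemma const_square: "fps_const (cst (\<theta>\<^sup>2)) = (fps_const (cst \<theta>))\<^sup>2"
  by (simp add: power2_eq_square cst_mult)

lemma fps_cst_mult_nth: "coef ((fps_const (cst c) * F) $ n) m = c * coef (F $ n) m"
  by simp

lemma coef_num_mult_nth: "coef ((numeral k * F) $ n) m = numeral k * coef (F $ n) m"
  using fps_cst_mult_nth[of "numeral k" F n m] by (simp add: cst_numeral numeral_fps_const)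

lemma coef_num_mult: "coef (numeral k * F) m = numeral k * coef F m"
  using coef_cst_mult[of "numeral k" F m] by (simp only: cst_numeral)

text \<open>
  The variation of \<open>H\<close> along the flow is \<open>X = A H\<^sub>x + 2 \<Psi> H\<^sub>x + 2 \<theta> H\<^sub>x A H - \<Psi>\<^sub>x / \<epsilon>\<close>, since both sides
  solve the linearised recursion; the mean of \<open>X\<close> vanishes.
\<close>

lemma conservation_trig:
  fixes V :: trig
  assumes a: "ILW_symbol \<theta> a" and l: "\<And>n. l n = dd n + \<theta> * a n"
  defines "h \<equiv> hs (pcoef \<theta>) (qcoef \<theta>) l (coef V)"
    and "W \<equiv> mlt a (mlt dd V) + mlt dd (V * V)"
  shows "ks (pcoef \<theta>) (qcoef \<theta>) l (\<lambda>_. 0) (\<lambda>_. 0) (\<lambda>_. 0) h (coef W) n 0 = 0"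
proof -
  define e :: "trig fps" where "e = fps_X"
  define t where "t = fps_const (cst \<theta>)"
  let ?k = "ks (pcoef \<theta>) (qcoef \<theta>) l (\<lambda>_. 0) (\<lambda>_. 0) (\<lambda>_. 0) h (coef W)"
  have fh: "finite {n. h i n \<noteq> 0}" for i
    unfolding h_def by (rule finite_hs) simp
  have fk: "finite {n. ?k i n \<noteq> 0}" for i
    by (rule finite_ks[OF _ fh]) simp
  have l': "l = (\<lambda>n. dd n + \<theta> * a n)" using l by auto
  define H where "H = fps_X * gen h"
  define K where "K = fps_X * gen ?k"
  define P where "P = pser (pcoef \<theta>) oo H"
  define Hx where "Hx = fmlt dd H"
  define AH where "AH = fmlt a H"
  define Px where "Px = 2 * (t * P + H) * Hx"
  have H0: "H $ 0 = 0" and P0: "P $ 0 = 0"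
    by (simp_all add: H_def P_def pser_def)
  have qP: "pser (qcoef \<theta>) oo H = t * P"
    by (simp add: pser_qcoef t_def P_def fps_const_mult_apply_left)
  have two: "(2 * F oo H) = 2 * (F oo H)" for F :: "trig fps"
    using fps_const_mult_apply_left[of 2 F H] by (simp add: numeral_fps_const)
  have dP: "fps_deriv (pser (pcoef \<theta>)) oo H = 2 * (t * P + H)"
    unfolding fps_deriv_pser fps_compose_add_distrib mult.assoc two
    using H0 by (simp add: t_def P_def fps_const_mult_apply_left distrib_left)
  have dqP: "fps_deriv (pser (qcoef \<theta>)) oo H = t * (2 * (t * P + H))"
    by (simp add: pser_qcoef dP fps_const_mult_apply_left[symmetric] t_def)
  have dP': "fmlt dd P = Px"
  proof -
    have "\<exists>c. pser p $ j = cst c" for p j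
      by (cases "j < 2") (auto simp: pser_def intro: exI[of _ 0])
    then have "fmlt dd P = (fps_deriv (pser (pcoef \<theta>)) oo H) * fmlt dd H"
      unfolding P_def by (rule fmlt_dd_compose[OF H0])
    then show ?thesis by (simp only: dP Px_def Hx_def)
  qed
  have t_mult: "fmlt m (t * F) = t * fmlt m F" for m F
    by (simp add: t_def)
  have e_mult: "fmlt m (e * F) = e * fmlt m F" for m F
    by (simp add: e_def)
  have L: "fmlt l F = fmlt dd F + t * fmlt a F" for F
    unfolding l' fmlt_add_symbol t_def ..
  have eqH: "H = e * (fps_const (- V) + P + (Hx + t * AH)) - t * P"
    using hs_gen[of "pcoef \<theta>" "qcoef \<theta>" l V, folded h_def, folded H_def]
    unfolding qP L P_def[symmetric] Hx_def[symmetric] AH_def[symmetric] e_def .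
  define G where "G = e * fps_const V"
  have negV: "e * fps_const (- V) = - G"
    by (simp add: G_def fps_const_neg[symmetric] del: fps_const_neg)
  have G: "G = e * (P + Hx + t * AH) - t * P - H"
    using eqH unfolding add.assoc distrib_left negV by (simp add: algebra_simps)
  have "K = e * (fps_const (- W) + 2 * (t * P + H) * K + (fmlt dd K + t * fmlt a K))
      - t * (2 * (t * P + H)) * K"
    using ks_gen[of h "pcoef \<theta>" "qcoef \<theta>" l "\<lambda>_. 0" "\<lambda>_. 0" "\<lambda>_. 0" W, OF fh, folded H_def, folded K_def]
    unfolding dP dqP L pser_zero e_def by simp
  moreover have "e * fps_const (- W) = - (e * fps_const W)"
    by (simp add: fps_const_neg[symmetric] del: fps_const_neg)
  ultimately have eqK: "(1 + 2 * (t - e) * (t * P + H)) * K = e * (fmlt dd K + t * fmlt a K) - e * fps_const W"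
    by (simp add: algebra_simps)
  \<comment> \<open>The closed form multiplied by \<open>e\<close>, which clears its division by
    \<epsilon>; accordingly it is compared with \<open>e * K\<close> instead of
    \<open>K\<close>.\<close>
  define X where "X = e * (fmlt a Hx + 2 * P * Hx + 2 * t * Hx * AH) - Px"
  have AHx: "fmlt dd AH = fmlt a Hx"
    by (simp add: AH_def Hx_def fmlt_commute)
  have Xx: "fmlt dd X = e * (fmlt a (fmlt dd Hx) + 2 * (Px * Hx + P * fmlt dd Hx) + 2 * t * (fmlt dd Hx * AH + Hx * fmlt a Hx))
      - (2 * (t * Px + Hx) * Hx + 2 * (t * P + H) * fmlt dd Hx)"
    unfolding X_def Px_def mult.assoc
    by (simp add: fmlt_dd_constants[folded e_def t_def] fmlt_dd_constants(1)[of \<theta>, folded t_def]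
        fmlt_dd_mult dP' AHx Hx_def[symmetric] fmlt_commute[of dd a])
       (simp add: Px_def algebra_simps)
  \<comment> \<open>The place where the dispersive identity enters. A obeys no product rule, so
    A(H_x A H) and A(\<Psi> H_x) can be removed only in the combination that occurs in \<theta> A
    X.\<close>
  have sq: "fmlt a (fmlt dd (H * H)) - t\<^sup>2 * (2 * fmlt a (Hx * AH)) =
      2 * H * fmlt a Hx - t\<^sup>2 * (2 * AH * fmlt a Hx) - 2 * Hx * fmlt dd Hx"
    using ILW_symbol_square[OF a, of H]
    by (simp add: const_square t_def[symmetric] Hx_def[symmetric] AH_def[symmetric] AHx fmlt_dd_mult algebra_simps)
  have "Px = t * (2 * (P * Hx)) + fmlt dd (H * H)"
    by (simp add: Px_def fmlt_dd_mult Hx_def algebra_simps)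
  then have APx: "fmlt a Px = t * (2 * fmlt a (P * Hx)) + fmlt a (fmlt dd (H * H))"
    by (simp add: t_mult)
  have "t * fmlt a X = e * (t * fmlt a (fmlt a Hx) + t * (2 * fmlt a (P * Hx)) + t\<^sup>2 * (2 * fmlt a (Hx * AH))) - t * fmlt a Px"
    unfolding X_def mult.assoc
    by (simp add: e_mult t_mult) (simp add: algebra_simps power2_eq_square)
  also have "\<dots> = e * (t * fmlt a (fmlt a Hx) + fmlt a Px + 2 * t\<^sup>2 * AH * fmlt a Hx
      - 2 * H * fmlt a Hx + 2 * Hx * fmlt dd Hx) - t * fmlt a Px"
  proof -
    have "t * (2 * fmlt a (P * Hx)) + t\<^sup>2 * (2 * fmlt a (Hx * AH)) = fmlt a Px + 2 * t\<^sup>2 * AH * fmlt a Hx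
      - 2 * H * fmlt a Hx + 2 * Hx * fmlt dd Hx"
      using APx sq by (simp add: algebra_simps)
    then show ?thesis by (simp only: add.assoc diff_conv_add_uminus)
  qed
  finally have tAX: "t * fmlt a X = e * (t * fmlt a (fmlt a Hx) + fmlt a Px + 2 * t\<^sup>2 * AH * fmlt a Hx
      - 2 * H * fmlt a Hx + 2 * Hx * fmlt dd Hx) - t * fmlt a Px" .
  have Gx: "fmlt dd G = e * (Px + fmlt dd Hx + t * fmlt a Hx) - t * Px - Hx"
    unfolding G by (simp add: e_mult t_mult dP' AHx Hx_def)
  have AG: "fmlt a (fmlt dd G) = e * (fmlt a Px + fmlt a (fmlt dd Hx) + t * fmlt a (fmlt a Hx)) - t * fmlt a Px - fmlt a Hx"
    unfolding Gx by (simp add: e_mult t_mult)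
  have eW: "e * (e * fps_const W) = e * fmlt a (fmlt dd G) + 2 * G * fmlt dd G"
  proof -
    define v where "v = fps_const V"
    have W': "fps_const W = fmlt a (fmlt dd v) + fmlt dd (v * v)"
      by (simp add: W_def v_def)
    have Gv: "G = e * v" by (simp add: G_def v_def)
    show ?thesis
      unfolding W' Gv by (simp add: e_mult[of _ v] e_mult[of a] fmlt_dd_mult fmlt_dd_constants(2)[folded e_def]) (simp add: algebra_simps)
  qed
  have X: "(1 + 2 * (t - e) * (t * P + H)) * X = e * (fmlt dd X + t * fmlt a X) - e * (e * fps_const W)"
    unfolding eW AG unfolding Gx Xx tAX unfolding X_def unfolding G
    by (rule conservation_identity[OF Px_def])
  have "(1 + 2 * (t - e) * (t * P + H)) * (e * K) = e * ((1 + 2 * (t - e) * (t * P + H)) * K)"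
    by (simp only: mult_ac)
  also have "\<dots> = e * (e * (fmlt dd K + t * fmlt a K)) - e * (e * fps_const W)"
    unfolding eqK by (simp add: algebra_simps)
  also have "e * (fmlt dd K + t * fmlt a K) = fmlt dd (e * K) + t * fmlt a (e * K)"
    unfolding e_mult by (simp add: algebra_simps)
  finally have EK: "(1 + 2 * (t - e) * (t * P + H)) * (e * K)
      = e * (fmlt dd (e * K) + t * fmlt a (e * K)) - e * (e * fps_const W)" .
  have "(1 + 2 * (t - e) * (t * P + H)) * (e * K - X) = fps_X * fmlt l (e * K - X)"
    unfolding right_diff_distrib[of _ "e * K" X] EK X L fmlt_simps(2) e_def[symmetric]
    by (simp add: algebra_simps)
  then have "e * K - X = 0"
    by (rule fps_linear_unique[rotated]) (simp add: H0 P0 e_def)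
  then have XK: "X = e * K" by simp
  have "?k n 0 = coef (X $ Suc (Suc n)) 0"
    by (simp add: XK e_def K_def gen_def coef_trig_of[OF fk])
  also have "\<dots> = 2 * coef ((P * Hx) $ Suc n) 0"
  proof -
    have "coef (fmlt a Hx $ Suc n) 0 = 0" "coef (Px $ Suc (Suc n)) 0 = 0"
      unfolding AHx[symmetric] dP'[symmetric] by simp_all
    moreover have "coef ((2 * (t * (Hx * AH))) $ Suc n) 0 = 0"
      using coef_dd_skew_fps[of a H "Suc n"] a unfolding coef_num_mult_nth t_def fps_cst_mult_nth
      by (simp add: Hx_def AH_def ILW_symbol_def)
    ultimately show ?thesis
      unfolding X_def e_def mult.assoc fps_sub_nth fps_X_mult_nth fps_add_nth coef_add coef_diff
      by (simp del: fmlt_nth add: coef_num_mult)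
  qed
  also have "\<dots> = 0"
  \<comment> \<open>What remains is the mean of \<Psi> H_x. The equation for \<Psi>_x gives 2
    \<theta> \<Psi> H_x = (\<Psi> - H^2)_x, which is conclusive unless \<theta> = 0; in that case
    \<Psi> = H^2 and 3 \<Psi> H_x = (H^3)_x.\<close>
  proof (cases "\<theta> = 0")
    case False
    have "t * (2 * (P * Hx)) = fmlt dd (P - H * H)"
      using dP' by (simp add: Px_def fmlt_dd_mult Hx_def algebra_simps)
    then have "coef ((t * (2 * (P * Hx))) $ Suc n) 0 = coef (fmlt dd (P - H * H) $ Suc n) 0"
      by simp
    then have "\<theta> * (2 * coef ((P * Hx) $ Suc n) 0) = 0"
      unfolding t_def fps_cst_mult_nth coef_num_mult_nth by simp
    then show ?thesis using False by simp
  next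
    case True
    have "pser (pcoef \<theta>) = fps_X * fps_X"
      by (simp add: True pser_pcoef_0)
    then have "P = H * H"
      unfolding P_def using H0 by (simp add: fps_compose_mult_distrib)
    then have "3 * (P * Hx) = fmlt dd (H * (H * H))"
      by (simp add: fmlt_dd_mult Hx_def algebra_simps)
    then have "coef ((3 * (P * Hx)) $ Suc n) 0 = coef (fmlt dd (H * (H * H)) $ Suc n) 0"
      by simp
    then show ?thesis unfolding coef_num_mult_nth by simp
  qed
  finally show ?thesis .
qed

lemma fps_deriv_fmlt: "fps_deriv (fmlt m F) = fmlt m (fps_deriv F)"
  by (rule fps_ext) (simp only: fps_deriv_nth fmlt_nth of_nat_cst mlt_simps)

text \<open>
  Here \<open>y\<close> is the derivative of \<open>h\<close> in \<open>\<theta>\<close> at \<open>\<theta> = 0\<close>, which has the closed form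
  \<open>y\<^sub>n = 2/3 h\<^sub>n' - (n + 2)/3 h\<^sub>n\<^sub>+\<^sub>1\<close>; this turns the leading term of the half-integer functionals
  into a KdV functional.
\<close>

lemma half_identity_trig:
  fixes V :: trig
  defines "h \<equiv> hs (pcoef 0) (qcoef 0) dd (coef V)"
  defines "y \<equiv> ks (pcoef 0) (qcoef 0) dd (\<lambda>j. if j = 2 then 2 / 3 else 0) (\<lambda>j. if j = 1 then 1 else 0)
    (\<lambda>n. (of_int n)\<^sup>2 / 3) h (\<lambda>_. 0)"
  shows "dpsum (pcoef 0) h y h m 0 + psum (\<lambda>j. if j = 2 then 2 / 3 else 0) h m 0 =
    - (of_nat m / 3) * psum (pcoef 0) h (Suc m) 0"
proof -
  \<comment> \<open>The \<theta>-derivatives at 0 of \<open>pcoef\<close> and \<open>qcoef\<close>: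
    only the term linear in \<theta> contributes, with 4/3! = 2/3 at j = 2 and 2/2! = 1 at j =
    1.\<close>
  let ?p' = "\<lambda>j::nat. if j = 2 then 2 / 3 else (0::complex)" and ?q' = "\<lambda>j::nat. if j = 1 then 1 else (0::complex)"
  let ?a = "\<lambda>n::int. (of_int n)\<^sup>2 / (3::complex)"
  define e :: "trig fps" where "e = fps_X"
  have fh: "finite {n. h i n \<noteq> 0}" for i
    unfolding h_def by (rule finite_hs) simp
  have fy: "finite {n. y i n \<noteq> 0}" for i
    unfolding y_def by (rule finite_ks[OF _ fh]) simp
  define H where "H = fps_X * gen h"
  define Y where "Y = fps_X * gen y"
  define Hx where "Hx = fmlt dd H"
  define c where "c = fps_const (cst (2 / 3))"
  have c3: "3 * (c * F) = 2 * F" for F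
    using cst_mult[of 3 "2 / 3"] by (simp add: c_def numeral_fps_const mult.assoc[symmetric] cst_numeral)
  have H0: "H $ 0 = 0" by (simp add: H_def)
  note p0 = pser_pcoef_0
  have q0: "pser (qcoef 0) = 0"
    using pser_single[of 1 "qcoef 0" 0] by (simp add: qcoef_def)
  have p': "pser ?p' = fps_const (cst (2 / 3)) * (fps_X * (fps_X * fps_X))" and q': "pser ?q' = fps_X * fps_X"
    using pser_single[of 2 ?p' "2 / 3"] pser_single[of 1 ?q' 1] by (simp_all add: power2_eq_square power3_eq_cube)
  have comp: "pser (pcoef 0) oo H = H * H" "pser (qcoef 0) oo H = 0" "fps_deriv (pser (pcoef 0)) oo H = 2 * H"
    "fps_deriv (pser (qcoef 0)) oo H = 0" "pser ?p' oo H = c * (H * (H * H))" "pser ?q' oo H = H * H"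
    unfolding p0 q0 p' q' c_def using H0
    by (simp_all add: fps_compose_mult_distrib fps_const_mult_apply_left[symmetric] fps_compose_add_distrib)
  have eqH: "H = e * (fps_const (- V) + H * H + Hx)"
    using hs_gen[of "pcoef 0" "qcoef 0" dd V, folded h_def, folded H_def] unfolding comp
    by (simp add: e_def Hx_def)
  define S where "S = fps_const (- V) + H * H + Hx"
  have HS: "e * S = H" using eqH by (simp add: S_def)
  have Sx: "e * fmlt dd S = Hx" unfolding Hx_def HS[symmetric] by (simp add: e_def)
  define T where "T = fps_deriv S"
  have H': "fps_deriv H = S + e * T"
    unfolding HS[symmetric] T_def by (simp add: e_def)
  have T: "T = 2 * H * fps_deriv H + fmlt dd (fps_deriv H)"
    unfolding T_def S_def by (simp add: Hx_def fps_deriv_fmlt algebra_simps)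
  have eqY: "Y = e * (2 * H * Y + c * (H * (H * H)) + fmlt dd Y + fmlt ?a H) - H * H"
    using ks_gen[of h "pcoef 0" "qcoef 0" dd ?p' ?q' ?a 0, OF fh, folded H_def]
    unfolding lookup_zero[abs_def] y_def[symmetric] Y_def[symmetric] comp
    by (simp add: e_def zero_poly_mapping.rep_eq y_def[symmetric] Y_def[symmetric])
  have A3: "3 * fmlt ?a H = - fmlt dd Hx"
  proof (rule fps_ext, rule trig_eqI)
    fix n m
    have "coef ((- fmlt dd Hx) $ n) m = - coef (fmlt dd Hx $ n) m" by simp
    then show "coef ((3 * fmlt ?a H) $ n) m = coef ((- fmlt dd Hx) $ n) m"
      unfolding coef_num_mult_nth by (simp add: Hx_def power2_eq_square) (simp add: algebra_simps)
  qed
  \<comment> \<open>Since the \<epsilon>-derivative of H is \<open>S + e * T\<close>, this equals 2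
    H_x - dH/d\<epsilon> - V, the generating function of 3 times the announced closed form. Writing
    it with \<open>T\<close> lets the recursion be applied twice.\<close>
  define Y3 where "Y3 = - H * H + Hx - e * T"
  have Y3x: "fmlt dd Y3 = - 2 * H * Hx + fmlt dd Hx - e * fmlt dd T"
    unfolding Y3_def using fmlt_simps(2)[of dd 0 "H * H"] by (simp add: fmlt_dd_mult fmlt_dd_constants Hx_def e_def algebra_simps)
  have eT: "e * T = 2 * H * H + Hx + e * (e * (2 * H * T + fmlt dd T))"
  proof -
    have "e * T = 2 * H * (e * S) + e * fmlt dd S + e * (e * (2 * H * T + fmlt dd T))"
      by (subst T) (simp add: H' e_def algebra_simps)
    then show ?thesis unfolding HS Sx .
  qed
  have eqY3: "Y3 = e * (2 * H * Y3 + 2 * (H * (H * H)) + fmlt dd Y3 - fmlt dd Hx) - 3 * (H * H)"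
  proof -
    have "Y3 = - (e * (e * (2 * H * T + fmlt dd T))) - 3 * (H * H)"
      unfolding Y3_def by (subst eT) (simp add: algebra_simps)
    also have "\<dots> = e * (2 * H * Y3 + 2 * (H * (H * H)) + fmlt dd Y3 - fmlt dd Hx) - 3 * (H * H)"
      unfolding Y3x unfolding Y3_def by (simp add: algebra_simps)
    finally show ?thesis .
  qed
  have "3 * Y = e * (2 * H * (3 * Y) + 3 * (c * (H * (H * H))) + fmlt dd (3 * Y) + 3 * fmlt ?a H) - 3 * (H * H)"
    unfolding fmlt_numeral by (subst eqY) (simp add: algebra_simps)
  then have eqY': "3 * Y = e * (2 * H * (3 * Y) + 2 * (H * (H * H)) + fmlt dd (3 * Y) - fmlt dd Hx) - 3 * (H * H)"
    by (simp only: c3 A3 diff_conv_add_uminus)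
  have "3 * Y - Y3 = e * (2 * H * (3 * Y - Y3)) + e * fmlt dd (3 * Y - Y3)"
    by (rule trans[OF arg_cong2[OF eqY' eqY3, of "(-)"]]) (simp add: algebra_simps)
  then have "(1 - 2 * e * H) * (3 * Y - Y3) = fps_X * fmlt dd (3 * Y - Y3)"
    unfolding e_def[symmetric] by (simp add: algebra_simps)
  then have "3 * Y - Y3 = 0"
    by (rule fps_linear_unique[rotated]) (simp add: e_def mult.assoc)
  then have Y3: "3 * Y = Y3" by simp
  have "3 * (2 * H * Y + c * (H * (H * H))) = 2 * H * (3 * Y) + 3 * (c * (H * (H * H)))"
    by (simp add: algebra_simps)
  also have "\<dots> = fmlt dd (H * H) - fps_deriv (H * H) + 2 * (H * S)"
    unfolding c3 Y3 Y3_def by (simp add: H' fmlt_dd_mult Hx_def algebra_simps)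
  \<comment> \<open>An Euler identity in \<epsilon>: at index m + 1 the derivative of H^2 carries
    the factor m + 2 and \<open>H * S\<close>, which is H^2 divided by \<epsilon>, enters twice, so
    -(m + 2) + 2 = -m remains; the x-derivative has mean zero.\<close>
  finally have J: "3 * (2 * H * Y + c * (H * (H * H))) = fmlt dd (H * H) - fps_deriv (H * H) + 2 * (H * S)" .
  have HS2: "(H * S) $ Suc m = (H * H) $ Suc (Suc m)"
  proof -
    have "fps_X * (H * S) = H * (e * S)"
      by (simp only: e_def mult_ac)
    then have "(fps_X * (H * S)) $ Suc (Suc m) = (H * H) $ Suc (Suc m)"
      unfolding HS by (rule arg_cong)
    then show ?thesis by simp
  qed
  have "dpsum (pcoef 0) h y h m 0 + psum ?p' h m 0 = coef ((2 * H * Y + c * (H * (H * H))) $ Suc m) 0"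
    using dpsum_gen[of m h y "pcoef 0" 0] psum_gen[of m h ?p' 0] fh fy
    unfolding H_def[symmetric] Y_def[symmetric] comp by simp
  moreover have "psum (pcoef 0) h (Suc m) 0 = coef ((H * H) $ Suc (Suc m)) 0"
    using psum_gen[of "Suc m" h "pcoef 0" 0] fh unfolding H_def[symmetric] comp by simp
  moreover have "3 * coef ((2 * H * Y + c * (H * (H * H))) $ Suc m) 0 = - of_nat m * coef ((H * H) $ Suc (Suc m)) 0"
  proof -
    have "3 * coef ((2 * H * Y + c * (H * (H * H))) $ Suc m) 0
        = coef ((fmlt dd (H * H) - fps_deriv (H * H) + 2 * (H * S)) $ Suc m) 0"
      unfolding coef_num_mult_nth[symmetric] J ..
    also have "\<dots> = - coef (of_nat (m + 2) * (H * H) $ Suc (Suc m)) 0 + 2 * coef ((H * S) $ Suc m) 0"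
      unfolding fps_add_nth fps_sub_nth fps_deriv_nth coef_add coef_diff coef_num_mult_nth by (simp add: add.commute)
    also have "\<dots> = - of_nat m * coef ((H * H) $ Suc (Suc m)) 0"
      unfolding HS2 of_nat_cst coef_cst_mult by (simp add: algebra_simps)
    finally show ?thesis .
  qed
  ultimately show ?thesis by (simp add: field_simps)
qed

subsection \<open>Absolutely convergent Fourier series\<close>

definition ell1 :: "(int \<Rightarrow> complex) \<Rightarrow> bool" where
  "ell1 F \<longleftrightarrow> (\<lambda>n. norm (F n)) summable_on UNIV"

definition synth :: "(int \<Rightarrow> complex) \<Rightarrow> real \<Rightarrow> complex" where
  "synth F x = (\<Sum>\<^sub>\<infinity>n. F n * cis (of_int n * x))"

text \<open>Cauchy-Schwarz against weight^(-1/2). Regularity is counted in integers, so 1 stands in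
  for any index above 1/2.\<close>

lemma sob_ell1: "sob 1 F \<Longrightarrow> ell1 F"
  unfolding ell1_def
proof -
  assume F: "sob 1 F"
  let ?f = "\<lambda>n. sqrt (weight n) * cmod (F n)" and ?g = "\<lambda>n. sqrt (1 / weight n)"
  have "(\<lambda>n. ?f n * ?g n) summable_on UNIV"
  proof (rule Cauchy_Schwarz_infsum(1))
    show "(\<lambda>n. (?f n)\<^sup>2) summable_on UNIV"
      using F by (simp add: sob_def power_mult_distrib weight_pos less_imp_le)
    show "(\<lambda>n. (?g n)\<^sup>2) summable_on UNIV"
      using summable_on_inverse_weight by (simp add: weight_pos less_imp_le)
  qed (auto simp: weight_pos less_imp_le)
  moreover have "?f n * ?g n = cmod (F n)" for n
    using weight_pos[of n] by (simp add: real_sqrt_divide)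
  ultimately show "(\<lambda>n. cmod (F n)) summable_on UNIV" by simp
qed

lemma synth_summable: "ell1 F \<Longrightarrow> (\<lambda>n. F n * cis (of_int n * x)) summable_on UNIV"
  by (rule abs_summable_summable) (simp add: ell1_def norm_mult)

lemma synth_uniform_limit:
  assumes "ell1 F"
  shows "uniform_limit S (\<lambda>X x. \<Sum>n\<in>X. F n * cis (of_int n * x)) (synth F) (finite_subsets_at_top UNIV)"
  unfolding synth_def
  by (rule Weierstrass_m_test_general[where M = "\<lambda>n. norm (F n)"])
     (use assms in \<open>auto simp: ell1_def norm_mult\<close>)

lemma continuous_synth: "ell1 F \<Longrightarrow> continuous_on S (synth F)"
  by (rule uniform_limit_theorem[OF _ synth_uniform_limit])
     (auto intro!: always_eventually continuous_intros)

lemma has_vector_derivative_cis: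
  "((\<lambda>x. cis (c * x)) has_vector_derivative \<i> * of_real c * cis (c * x)) (at x within S)"
  using exp_scaleR_has_vector_derivative_right[of "\<i> * of_real c" x S]
  by (simp add: cis_conv_exp scaleR_conv_of_real mult_ac)

lemma has_integral_cis:
  "((\<lambda>x. cis (of_int k * x)) has_integral (if k = 0 then 2 * of_real pi else 0)) {0..2 * pi}"
proof (cases "k = 0")
  case True
  then show ?thesis using has_integral_const_real[of "1::complex" 0 "2 * pi"]
    by (simp add: scaleR_conv_of_real)
next
  case False
  have "((\<lambda>x. cis (of_int k * x)) has_integral
      (cis (of_int k * (2 * pi)) / (\<i> * of_int k) - cis (of_int k * 0) / (\<i> * of_int k))) {0..2 * pi}"
  proof (rule fundamental_theorem_of_calculus)
    fix x
    have "((\<lambda>x. cis (of_int k * x) * (1 / (\<i> * of_int k))) has_vector_derivative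
        (\<i> * of_real (of_int k) * cis (of_int k * x)) * (1 / (\<i> * of_int k))) (at x within {0..2 * pi})"
      by (intro has_vector_derivative_mult_left has_vector_derivative_cis)
    then show "((\<lambda>x. cis (of_int k * x) / (\<i> * of_int k)) has_vector_derivative cis (of_int k * x)) (at x within {0..2 * pi})"
      using False by simp
  qed simp
  moreover have "cis (of_int k * (2 * pi)) = 1"
    using cis_multiple_2pi[of "of_int k"] by (simp add: mult_ac)
  ultimately show ?thesis using False by simp
qed

lemma torus_integral_continuous:
  fixes f :: "real \<Rightarrow> 'a::euclidean_space"
  assumes "continuous_on {0..2 * pi} f"
  shows "torus_integral f = integral {0..2 * pi} f" "(f has_integral torus_integral f) {0..2 * pi}"
proof -
  show 1: "torus_integral f = integral {0..2 * pi} f"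
    unfolding torus_integral_def
    by (rule set_lebesgue_integral_eq_integral(2)[OF absolutely_integrable_continuous_real[OF assms]])
  show "(f has_integral torus_integral f) {0..2 * pi}"
    unfolding 1 using assms by (intro integrable_integral integrable_continuous_real)
qed

lemma torus_integral_synth:
  assumes "ell1 F"
  shows "torus_integral (synth F) = 2 * of_real pi * F 0"
proof -
  obtain I J where I: "\<And>X. ((\<lambda>x. \<Sum>n\<in>X. F n * cis (of_int n * x)) has_integral I X) {0..2 * pi}"
    and J: "(synth F has_integral J) {0..2 * pi}" and lim: "(I \<longlongrightarrow> J) (finite_subsets_at_top UNIV)"
    by (rule uniform_limit_integral[OF synth_uniform_limit[OF assms]])
       (auto intro!: continuous_intros)
  have "I X = 2 * of_real pi * F 0" if "finite X" "0 \<in> X" for X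
  proof -
    have "((\<lambda>x. \<Sum>n\<in>X. F n * cis (of_int n * x)) has_integral
        (\<Sum>n\<in>X. F n * (if n = 0 then 2 * of_real pi else 0))) {0..2 * pi}"
      using that by (intro has_integral_sum has_integral_mult_right has_integral_cis)
    then have "I X = (\<Sum>n\<in>X. F n * (if n = 0 then 2 * of_real pi else 0))"
      using I has_integral_unique by blast
    also have "\<dots> = 2 * of_real pi * F 0"
      using that by (simp add: sum.delta if_distrib cong: if_cong)
    finally show ?thesis .
  qed
  then have "\<forall>\<^sub>F X in finite_subsets_at_top UNIV. I X = 2 * of_real pi * F 0"
    unfolding eventually_finite_subsets_at_top by (intro exI[of _ "{0}"]) auto
  then have "(I \<longlongrightarrow> 2 * of_real pi * F 0) (finite_subsets_at_top UNIV)"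
    by (rule tendsto_eventually)
  then have "J = 2 * of_real pi * F 0"
    using tendsto_unique[OF finite_subsets_at_top_neq_bot lim] by blast
  then show ?thesis
    using J torus_integral_continuous(1)[OF continuous_synth[OF assms]] by (auto simp: integral_unique)
qed

lemma synth_shift: "synth F x * cis (- (of_int m * x)) = synth (\<lambda>n. F (n + m)) x"
proof -
  have bij: "bij_betw (\<lambda>n. n + m) UNIV (UNIV :: int set)"
    by (rule bij_betwI[where g = "\<lambda>n. n - m"]) auto
  have "synth F x * cis (- (of_int m * x)) = (\<Sum>\<^sub>\<infinity>n. F n * cis (of_int n * x) * cis (- (of_int m * x)))"
    by (simp add: synth_def infsum_cmult_left')
  also have "\<dots> = (\<Sum>\<^sub>\<infinity>n. F (n + m) * cis (of_int (n + m) * x) * cis (- (of_int m * x)))"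
    by (rule infsum_reindex_bij_betw[OF bij, symmetric])
  also have "\<dots> = synth (\<lambda>n. F (n + m)) x"
    by (simp add: synth_def mult.assoc cis_mult algebra_simps)
  finally show ?thesis .
qed

lemma ell1_shift: "ell1 F \<Longrightarrow> ell1 (\<lambda>n. F (n + m))"
proof -
  have bij: "bij_betw (\<lambda>n. n + m) UNIV (UNIV :: int set)"
    by (rule bij_betwI[where g = "\<lambda>n. n - m"]) auto
  show "ell1 F \<Longrightarrow> ell1 (\<lambda>n. F (n + m))"
    unfolding ell1_def using summable_on_reindex_bij_betw[OF bij, of "\<lambda>n. norm (F n)"] by simp
qed

lemma fourier_coeff_synth: "ell1 F \<Longrightarrow> fourier_coeff (synth F) m = F m"
  unfolding fourier_coeff_def synth_shift
  using torus_integral_synth[OF ell1_shift[of F m]] by (simp add: synth_shift)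

lemma fourier_multiplier_synth: "ell1 F \<Longrightarrow> fourier_multiplier m (synth F) = synth (\<lambda>n. m n * F n)"
  by (rule ext) (simp add: fourier_multiplier_def fourier_coeff_synth synth_def)

lemma ell1_add: "ell1 F \<Longrightarrow> ell1 G \<Longrightarrow> ell1 (\<lambda>n. F n + G n)"
  unfolding ell1_def
  by (rule summable_on_comparison_test[OF summable_on_add[of "\<lambda>n. norm (F n)" _ "\<lambda>n. norm (G n)"]]) (auto intro: norm_triangle_ineq)

lemma ell1_scale: "ell1 F \<Longrightarrow> ell1 (\<lambda>n. c * F n)"
  unfolding ell1_def by (simp add: norm_mult summable_on_cmult_right)

lemma ell1_sum: "(\<And>i. i \<in> I \<Longrightarrow> ell1 (F i)) \<Longrightarrow> ell1 (\<lambda>n. \<Sum>i\<in>I. F i n)"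
proof (induction I rule: infinite_finite_induct)
  case (insert i I)
  then show ?case using ell1_add[of "F i" "\<lambda>n. \<Sum>i\<in>I. F i n"] by simp
qed (simp_all add: ell1_def)

lemma synth_add: "ell1 F \<Longrightarrow> ell1 G \<Longrightarrow> synth (\<lambda>n. F n + G n) x = synth F x + synth G x"
proof -
  assume "ell1 F" "ell1 G"
  from infsum_add[OF synth_summable[OF this(1)] synth_summable[OF this(2)], of x x]
  show "synth (\<lambda>n. F n + G n) x = synth F x + synth G x"
    by (simp add: synth_def distrib_right)
qed

lemma synth_scale: "synth (\<lambda>n. c * F n) x = c * synth F x"
  by (simp add: synth_def infsum_cmult_right' mult.assoc)

lemma synth_sum: "(\<And>i. i \<in> I \<Longrightarrow> ell1 (F i)) \<Longrightarrow> synth (\<lambda>n. \<Sum>i\<in>I. F i n) x = (\<Sum>i\<in>I. synth (F i) x)"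
  by (induction I rule: infinite_finite_induct) (auto simp: synth_add ell1_sum, auto simp: synth_def)

lemma ell1_conv: "ell1 F \<Longrightarrow> ell1 G \<Longrightarrow> ell1 (conv F G)"
  unfolding ell1_def conv_def[abs_def] by (rule has_sum_convolution(3))

lemma synth_conv:
  assumes "ell1 F" "ell1 G"
  shows "synth (conv F G) x = synth F x * synth G x"
proof -
  let ?u = "\<lambda>n. F n * cis (of_int n * x)" and ?v = "\<lambda>n. G n * cis (of_int n * x)"
  have s: "(\<lambda>n. norm (?u n)) summable_on UNIV" "(\<lambda>n. norm (?v n)) summable_on UNIV"
    using assms by (auto simp: ell1_def norm_mult)
  have "?u m * ?v (n - m) = F m * G (n - m) * cis (of_int n * x)" for m n
  proof -
    have "cis (of_int n * x) = cis (of_int m * x) * cis (of_int (n - m) * x)"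
      by (simp add: cis_mult algebra_simps)
    then show ?thesis by simp
  qed
  then have "(\<Sum>\<^sub>\<infinity>m. ?u m * ?v (n - m)) = conv F G n * cis (of_int n * x)" for n
    by (simp only: conv_def infsum_cmult_left')
  then show ?thesis
    using has_sum_convolution(4)[OF s] by (simp add: synth_def)
qed

lemma norm_cis_diff_le: "norm (cis a - cis b) \<le> \<bar>a - b\<bar>"
proof -
  have "cis a - cis b = cis b * (exp (\<i> * of_real (a - b)) - 1)"
    by (simp add: cis_conv_exp algebra_simps exp_add[symmetric])
  then have "norm (cis a - cis b) = 2 * \<bar>sin ((a - b) / 2)\<bar>"
    by (simp add: norm_mult dist_exp_i_1 del: of_real_diff)
  also have "\<dots> \<le> \<bar>a - b\<bar>"
    using abs_sin_le_one abs_sin_x_le_abs_x[of "(a - b) / 2"] by simp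
  finally show ?thesis .
qed

lemma has_vector_derivative_iff_quotient:
  fixes f :: "real \<Rightarrow> 'a::real_normed_vector"
  shows "(f has_vector_derivative D) (at x) \<longleftrightarrow> ((\<lambda>y. (f y - f x) /\<^sub>R (y - x)) \<longlongrightarrow> D) (at x)"
proof -
  have eq: "norm ((f y - f x) /\<^sub>R (y - x) - D) = norm (f y - f x - (y - x) *\<^sub>R D) / norm (y - x)" if "y \<noteq> x" for y
  proof -
    have "f y - f x - (y - x) *\<^sub>R D = (y - x) *\<^sub>R ((f y - f x) /\<^sub>R (y - x) - D)"
      using that by (simp add: scaleR_diff_right)
    then show ?thesis using that by (simp only: norm_scaleR) simp
  qed
  have "((\<lambda>y. (f y - f x) /\<^sub>R (y - x)) \<longlongrightarrow> D) (at x) \<longleftrightarrow>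
      ((\<lambda>y. norm ((f y - f x) /\<^sub>R (y - x) - D)) \<longlongrightarrow> 0) (at x)"
    by (simp add: tendsto_norm_zero_iff LIM_zero_iff)
  also have "\<dots> \<longleftrightarrow> ((\<lambda>y. norm (f y - f x - (y - x) *\<^sub>R D) / norm (y - x)) \<longlongrightarrow> 0) (at x)"
    by (rule tendsto_cong) (auto simp: eventually_at_filter eq)
  finally show ?thesis
    by (simp add: has_vector_derivative_def has_derivative_iff_norm bounded_linear_scaleR_left)
qed

text \<open>Termwise differentiation by dominated convergence: the difference quotient of mode n is
  at most |n| times the modulus of its coefficient.\<close>

lemma has_vector_derivative_synth:
  assumes F: "ell1 F" and F': "ell1 (\<lambda>n. dd n * F n)"
  shows "(synth F has_vector_derivative synth (\<lambda>n. dd n * F n) x) (at x)"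
proof -
  let ?q = "\<lambda>y n. F n * ((cis (of_int n * y) - cis (of_int n * x)) / of_real (y - x))"
  have "((\<lambda>y. \<Sum>\<^sub>\<infinity>n. ?q y n) \<longlongrightarrow> (\<Sum>\<^sub>\<infinity>n. F n * (dd n * cis (of_int n * x)))) (at x)"
  proof (rule infsum_dominated_tendsto)
    show "(\<lambda>n. norm (dd n * F n)) summable_on UNIV" using F' by (simp add: ell1_def)
    have le: "norm (?q y n) \<le> norm (dd n * F n)" if "y \<noteq> x" for y n
    proof -
      have "norm (cis (of_int n * y) - cis (of_int n * x)) \<le> \<bar>of_int n\<bar> * \<bar>y - x\<bar>"
        using norm_cis_diff_le[of "of_int n * y" "of_int n * x"]
        by (simp add: right_diff_distrib[symmetric] abs_mult)
      then have "norm (cis (of_int n * y) - cis (of_int n * x)) / \<bar>y - x\<bar> \<le> \<bar>of_int n\<bar>"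
        using that by (simp add: divide_le_eq)
      from mult_left_mono[OF this, of "norm (F n)"] show ?thesis
        by (simp add: norm_mult norm_divide mult.commute del: of_real_diff)
    qed
    show "\<forall>\<^sub>F y in at x. \<forall>n. norm (?q y n) \<le> norm (dd n * F n)"
      unfolding eventually_at by (intro exI[of _ 1]) (use le in auto)
    show "((\<lambda>y. ?q y n) \<longlongrightarrow> F n * (dd n * cis (of_int n * x))) (at x)" for n
    proof (rule tendsto_mult_left)
      have "((\<lambda>y. (cis (of_int n * y) - cis (of_int n * x)) /\<^sub>R (y - x)) \<longlongrightarrow> \<i> * of_real (of_int n) * cis (of_int n * x)) (at x)"
        using has_vector_derivative_cis[of "of_int n" x UNIV] by (simp only: has_vector_derivative_iff_quotient)
      then show "((\<lambda>y. (cis (of_int n * y) - cis (of_int n * x)) / of_real (y - x)) \<longlongrightarrow> dd n * cis (of_int n * x)) (at x)"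
        by (simp add: scaleR_conv_of_real divide_inverse mult.commute)
    qed
    show "norm (F n * (dd n * cis (of_int n * x))) \<le> norm (dd n * F n)" for n
      by (simp add: norm_mult)
  qed
  moreover have "(\<Sum>\<^sub>\<infinity>n. ?q y n) = (synth F y - synth F x) / of_real (y - x)" for y
  proof -
    have "(\<Sum>\<^sub>\<infinity>n. ?q y n) = (\<Sum>\<^sub>\<infinity>n. (F n * cis (of_int n * y) + - (F n * cis (of_int n * x))) * (1 / of_real (y - x)))"
      by (rule infsum_cong) (simp add: divide_inverse algebra_simps)
    also have "\<dots> = (\<Sum>\<^sub>\<infinity>n. F n * cis (of_int n * y) + - (F n * cis (of_int n * x))) * (1 / of_real (y - x))"
      by (rule infsum_cmult_left')
    also have "(\<Sum>\<^sub>\<infinity>n. F n * cis (of_int n * y) + - (F n * cis (of_int n * x))) = synth F y - synth F x"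
      using infsum_add[OF synth_summable[OF F] summable_on_uminus[THEN iffD2, OF synth_summable[OF F]]]
      by (simp add: synth_def infsum_uminus)
    finally show ?thesis by simp
  qed
  moreover have "(\<Sum>\<^sub>\<infinity>n. F n * (dd n * cis (of_int n * x))) = synth (\<lambda>n. dd n * F n) x"
    by (simp add: synth_def mult_ac)
  ultimately have "((\<lambda>y. (synth F y - synth F x) / of_real (y - x)) \<longlongrightarrow> synth (\<lambda>n. dd n * F n) x) (at x)"
    by simp
  then have "((\<lambda>y. (synth F y - synth F x) /\<^sub>R (y - x)) \<longlongrightarrow> synth (\<lambda>n. dd n * F n) x) (at x)"
    by (simp add: scaleR_conv_of_real divide_inverse mult.commute)
  then show ?thesis
    by (simp only: has_vector_derivative_iff_quotient)
qed

subsection \<open>Fourier inversion for periodic functions of finite regularity\<close>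

lemma has_integral_fourier_coeff:
  assumes "continuous_on UNIV f"
  shows "((\<lambda>x. f x * cis (- (of_int n * x))) has_integral 2 * of_real pi * fourier_coeff f n) {0..2 * pi}"
proof -
  have "continuous_on {0..2 * pi} (\<lambda>x. f x * cis (- (of_int n * x)))"
    by (intro continuous_intros continuous_on_subset[OF assms]) auto
  from torus_integral_continuous(2)[OF this] show ?thesis
    by (simp add: fourier_coeff_def)
qed

text \<open>Bessel's inequality, from expanding the integral of the squared distance between g and a
  partial Fourier sum. Only boundedness matters in the sequel, so the constant stays
  unspecified.\<close>

lemma bessel:
  assumes g: "continuous_on UNIV g"
  shows "\<exists>Q. \<forall>X. finite X \<longrightarrow> (\<Sum>n\<in>X. (cmod (fourier_coeff g n))\<^sup>2) \<le> Q"
proof -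
  have "continuous_on {0..2 * pi} (\<lambda>x. g x * cnj (g x))"
    by (intro continuous_intros continuous_on_subset[OF g]) auto
  then obtain Q where Q: "((\<lambda>x. g x * cnj (g x)) has_integral Q) {0..2 * pi}"
    using torus_integral_continuous(2) by blast
  have "(\<Sum>n\<in>X. (cmod (fourier_coeff g n))\<^sup>2) \<le> Re Q / (2 * pi)" if X: "finite X" for X
  proof -
    let ?c = "fourier_coeff g"
    define P where "P x = (\<Sum>n\<in>X. ?c n * cis (of_int n * x))" for x
    define S where "S = (\<Sum>n\<in>X. ?c n * cnj (?c n))"
    have cP: "cnj (P x) = (\<Sum>n\<in>X. cnj (?c n) * cis (- (of_int n * x)))" for x
      by (simp add: P_def cis_cnj)
    have "((\<lambda>x. \<Sum>n\<in>X. cnj (?c n) * (g x * cis (- (of_int n * x)))) has_integral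
        (\<Sum>n\<in>X. cnj (?c n) * (2 * of_real pi * ?c n))) {0..2 * pi}"
      by (intro has_integral_sum X has_integral_mult_right has_integral_fourier_coeff g)
    moreover have "(\<Sum>n\<in>X. cnj (?c n) * (2 * of_real pi * ?c n)) = 2 * of_real pi * S"
      by (simp add: S_def sum_distrib_left mult_ac)
    moreover have "(\<Sum>n\<in>X. cnj (?c n) * (g x * cis (- (of_int n * x)))) = g x * cnj (P x)" for x
      by (simp add: cP sum_distrib_left mult_ac)
    ultimately have 1: "((\<lambda>x. g x * cnj (P x)) has_integral 2 * of_real pi * S) {0..2 * pi}"
      by simp
    have 2: "((\<lambda>x. cnj (g x * cnj (P x))) has_integral 2 * of_real pi * S) {0..2 * pi}"
    proof -
      have "cnj (2 * of_real pi * S) = 2 * of_real pi * S"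
        by (simp add: S_def mult.commute)
      then show ?thesis
        using has_integral_linear[OF 1 bounded_linear_cnj] by (simp only: o_def)
    qed
    have "((\<lambda>x. \<Sum>n\<in>X. \<Sum>m\<in>X. ?c n * cnj (?c m) * cis (of_int (n - m) * x)) has_integral
        (\<Sum>n\<in>X. \<Sum>m\<in>X. ?c n * cnj (?c m) * (if n - m = 0 then 2 * of_real pi else 0))) {0..2 * pi}"
      by (intro has_integral_sum X has_integral_mult_right has_integral_cis)
    moreover have "(\<Sum>n\<in>X. \<Sum>m\<in>X. ?c n * cnj (?c m) * (if n - m = 0 then 2 * of_real pi else 0)) = 2 * of_real pi * S"
      using X by (simp add: S_def if_distrib sum.delta sum_distrib_left mult_ac cong: if_cong)
    moreover have "(\<Sum>n\<in>X. \<Sum>m\<in>X. ?c n * cnj (?c m) * cis (of_int (n - m) * x)) = P x * cnj (P x)" for x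
    proof -
      have "cis (of_int (n - m) * x) = cis (of_int n * x) * cis (- (of_int m * x))" for n m
        by (simp add: cis_mult algebra_simps)
      then show ?thesis
        unfolding cP unfolding P_def sum_product by (simp only: mult_ac)
    qed
    ultimately have 3: "((\<lambda>x. P x * cnj (P x)) has_integral 2 * of_real pi * S) {0..2 * pi}"
      by simp
    have "((\<lambda>x. g x * cnj (g x) - g x * cnj (P x) - cnj (g x * cnj (P x)) + P x * cnj (P x)) has_integral
        (Q - 2 * of_real pi * S - 2 * of_real pi * S + 2 * of_real pi * S)) {0..2 * pi}"
      by (intro has_integral_add has_integral_diff Q 1 2 3)
    moreover have "g x * cnj (g x) - g x * cnj (P x) - cnj (g x * cnj (P x)) + P x * cnj (P x)
        = of_real ((cmod (g x - P x))\<^sup>2)" for x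
      unfolding complex_norm_square by (simp add: algebra_simps)
    moreover have "Q - T - T + T = Q - T" for T :: complex
      by simp
    ultimately have "((\<lambda>x. complex_of_real ((cmod (g x - P x))\<^sup>2)) has_integral (Q - 2 * of_real pi * S)) {0..2 * pi}"
      by (simp only:)
    from has_integral_linear[OF this bounded_linear_Re]
    have "((\<lambda>x. (cmod (g x - P x))\<^sup>2) has_integral Re (Q - 2 * of_real pi * S)) {0..2 * pi}"
      by (simp add: o_def)
    then have "0 \<le> Re (Q - 2 * of_real pi * S)"
      by (rule has_integral_nonneg) auto
    moreover have "S = of_real (\<Sum>n\<in>X. (cmod (?c n))\<^sup>2)"
      unfolding S_def of_real_sum complex_norm_square ..
    ultimately show ?thesis
      by (simp add: pos_le_divide_eq mult.commute)
  qed
  then show ?thesis by blast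
qed

text \<open>Divide u - u(x0) by exp(i(x - x0)) - 1; differentiability makes the quotient g
  continuous. Vanishing coefficients of u force consecutive coefficients of g to have equal modulus,
  except across the step from -1 to 0. By Bessel both half-lines of coefficients vanish, and the
  exceptional step then gives u(x0) = 0.\<close>

lemma fourier_uniqueness:
  assumes per: "\<And>x. u (x + 2 * pi) = u x" and der: "\<And>x. (u has_vector_derivative u' x) (at x)"
    and zero: "\<And>n. fourier_coeff u n = 0"
  shows "u x0 = (0::complex)"
proof -
  interpret periodic_fun_simple u "2 * pi" by unfold_locales (rule per)
  have cu: "continuous_on UNIV u"
    using der by (auto intro!: continuous_at_imp_continuous_on has_vector_derivative_continuous)
  define d where "d x = cis (x - x0) - 1" for x
  \<comment> \<open>At a zero of \<open>d\<close> the derivative of \<open>d\<close> is \<i>, so the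
    first branch is the limit of the quotient there.\<close>
  define g where "g x = (if d x = 0 then u' x / \<i> else (u x - u x0) / d x)" for x
  have dd: "(d has_vector_derivative \<i> * cis (x - x0)) (at x)" for x
  proof -
    have "((\<lambda>x. cis (1 * x) * cis (- x0) - 1) has_vector_derivative (\<i> * of_real 1 * cis (1 * x)) * cis (- x0) - 0) (at x)"
      by (intro has_vector_derivative_diff has_vector_derivative_mult_left has_vector_derivative_cis has_vector_derivative_const)
    then show ?thesis by (simp add: d_def[abs_def] cis_mult mult.assoc)
  qed
  have d0: "u x = u x0" "cis (x - x0) = 1" if "d x = 0" for x
  proof -
    show c: "cis (x - x0) = 1" using that by (simp add: d_def)
    then have "cos (x - x0) = 1" by (metis cis.simps(1) one_complex.simps(1))
    then obtain k where "x - x0 = of_int k * 2 * pi" using cos_one_2pi_int by blast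
    then have "x = x0 + of_int k * (2 * pi)" by (simp add: algebra_simps)
    then show "u x = u x0" by (simp add: plus_of_int)
  qed
  have gd: "d x * g x = u x - u x0" for x
    using d0(1)[of x] by (simp add: g_def)
  have "isCont g x" for x
  proof (cases "d x = 0")
    case False
    have "isCont d x" "isCont u x"
      using dd[of x] der[of x] has_vector_derivative_continuous by blast+
    then have "isCont (\<lambda>y. (u y - u x0) / d y) x"
      using False by (intro continuous_intros) auto
    moreover have "isCont (\<lambda>y. (u y - u x0) / d y) x \<longleftrightarrow> isCont g x"
    proof (rule isCont_cong)
      have "\<forall>\<^sub>F y in nhds x. d y \<noteq> 0"
        using \<open>isCont d x\<close> False unfolding isCont_def tendsto_at_iff_tendsto_nhds
        by (rule tendsto_imp_eventually_ne)
      then show "\<forall>\<^sub>F y in nhds x. (u y - u x0) / d y = g y"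
        by eventually_elim (simp add: g_def)
    qed
    ultimately show ?thesis by simp
  next
    case True
    have 1: "((\<lambda>y. (u y - u x) /\<^sub>R (y - x)) \<longlongrightarrow> u' x) (at x)"
      and 2: "((\<lambda>y. (d y - d x) /\<^sub>R (y - x)) \<longlongrightarrow> \<i>) (at x)"
      using der[of x] dd[of x] d0(2)[OF True] by (simp_all add: has_vector_derivative_iff_quotient)
    have "((\<lambda>y. ((u y - u x) /\<^sub>R (y - x)) / ((d y - d x) /\<^sub>R (y - x))) \<longlongrightarrow> u' x / \<i>) (at x)"
      by (intro tendsto_divide 1 2) simp
    moreover have "\<forall>\<^sub>F y in at x. ((u y - u x) /\<^sub>R (y - x)) / ((d y - d x) /\<^sub>R (y - x)) = g y"
    proof -
      have "\<forall>\<^sub>F y in at x. (d y - d x) /\<^sub>R (y - x) \<noteq> 0"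
        using 2 by (rule tendsto_imp_eventually_ne) simp
      then show ?thesis
      proof eventually_elim
        case (elim y)
        then have "y \<noteq> x" "d y \<noteq> 0" using True by auto
        moreover have "(a /\<^sub>R (y - x)) / (b /\<^sub>R (y - x)) = a / b" for a b :: complex
          using \<open>y \<noteq> x\<close> by (simp add: scaleR_conv_of_real del: of_real_diff)
        ultimately show ?case
          using True d0(1)[OF True] by (simp add: g_def)
      qed
    qed
    ultimately have "(g \<longlongrightarrow> u' x / \<i>) (at x)"
      by (rule Lim_transform_eventually)
    then show ?thesis using True by (simp add: isCont_def g_def)
  qed
  then have cg: "continuous_on UNIV g"
    by (simp add: continuous_at_imp_continuous_on)
  let ?G = "fourier_coeff g"
  have rec: "cis (- x0) * ?G (n - 1) - ?G n = (if n = 0 then - u x0 else 0)" for n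
  proof -
    have "((\<lambda>x. cis (- x0) * (g x * cis (- (of_int (n - 1) * x))) - g x * cis (- (of_int n * x))) has_integral
       (cis (- x0) * (2 * of_real pi * ?G (n - 1)) - 2 * of_real pi * ?G n)) {0..2 * pi}"
      by (intro has_integral_diff has_integral_mult_right has_integral_fourier_coeff cg)
    moreover have "cis (- x0) * (g x * cis (- (of_int (n - 1) * x))) - g x * cis (- (of_int n * x)) =
        u x * cis (- (of_int n * x)) - u x0 * cis (of_int (- n) * x)" for x
    proof -
      have "cis (- x0) * cis (- (of_int (n - 1) * x)) = cis (x - x0) * cis (- (of_int n * x))"
        by (simp add: cis_mult algebra_simps)
      then have "cis (- x0) * (g x * cis (- (of_int (n - 1) * x))) - g x * cis (- (of_int n * x)) =
          (d x * g x) * cis (- (of_int n * x))"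
        by (simp add: d_def algebra_simps)
      then show ?thesis by (simp add: gd algebra_simps)
    qed
    moreover have "((\<lambda>x. u x * cis (- (of_int n * x)) - u x0 * cis (of_int (- n) * x)) has_integral
        (2 * of_real pi * fourier_coeff u n - u x0 * (if - n = 0 then 2 * of_real pi else 0))) {0..2 * pi}"
      by (intro has_integral_diff has_integral_mult_right has_integral_fourier_coeff has_integral_cis cu)
    ultimately have "cis (- x0) * (2 * of_real pi * ?G (n - 1)) - 2 * of_real pi * ?G n =
        2 * of_real pi * fourier_coeff u n - u x0 * (if - n = 0 then 2 * of_real pi else 0)"
      by (simp add: has_integral_unique)
    then have "2 * of_real pi * (cis (- x0) * ?G (n - 1) - ?G n) = 2 * of_real pi * (if n = 0 then - u x0 else 0)"
      using zero by (cases "n = 0") (simp_all add: algebra_simps)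
    then show ?thesis by simp
  qed
  have step: "cmod (?G (n - 1)) = cmod (?G n)" if "n \<noteq> 0" for n
  proof -
    have "?G n = cis (- x0) * ?G (n - 1)" using rec[of n] that by simp
    then show ?thesis by (simp add: norm_mult)
  qed
  obtain Q where Q: "\<And>X. finite X \<Longrightarrow> (\<Sum>n\<in>X. (cmod (?G n))\<^sup>2) \<le> Q"
    using bessel[OF cg] by blast
  have vanish: "c = 0" if "inj f" "\<And>k. cmod (?G (f k)) = c" for f :: "nat \<Rightarrow> int" and c
  proof (rule ccontr)
    assume "c \<noteq> 0"
    then obtain N :: nat where "Q < of_nat N * c\<^sup>2"
      using ex_less_of_nat_mult[of "c\<^sup>2" Q] by auto
    moreover have "(\<Sum>n\<in>f ` {..<N}. (cmod (?G n))\<^sup>2) = of_nat N * c\<^sup>2"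
      using that by (subst sum.reindex) (auto intro: inj_on_subset)
    ultimately show False using Q[of "f ` {..<N}"] by simp
  qed
  have "cmod (?G (int k)) = cmod (?G 0)" for k
  proof (induction k)
    case (Suc k)
    then show ?case using step[of "int (Suc k)"] by simp
  qed simp
  then have "?G 0 = 0" using vanish[of int] by simp
  moreover have "cmod (?G (- 1 - int k)) = cmod (?G (- 1))" for k
  proof (induction k)
    case (Suc k)
    then show ?case using step[of "- 1 - int k"] by (simp add: algebra_simps)
  qed simp
  then have "?G (- 1) = 0" using vanish[of "\<lambda>k. - 1 - int k"] by (simp add: inj_on_def)
  ultimately show ?thesis using rec[of 0] by simp
qed

lemma fourier_coeff_deriv:
  assumes f: "\<And>x. (f has_vector_derivative f' x) (at x)" and f': "continuous_on UNIV f'"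
    and per: "f (2 * pi) = f 0"
  shows "fourier_coeff f' n = dd n * fourier_coeff f n"
proof -
  have cf: "continuous_on UNIV f"
    using f by (auto intro!: continuous_at_imp_continuous_on has_vector_derivative_continuous)
  have "((\<lambda>x. f x * (\<i> * of_real (- of_int n) * cis (- of_int n * x)) + f' x * cis (- of_int n * x)) has_integral
      (f (2 * pi) * cis (- of_int n * (2 * pi)) - f 0 * cis (- of_int n * 0))) {0..2 * pi}"
    by (intro fundamental_theorem_of_calculus has_vector_derivative_mult has_vector_derivative_at_within[OF f]
        has_vector_derivative_cis) simp
  moreover have "cis (- of_int n * (2 * pi)) = 1"
    using cis_multiple_2pi[of "- of_int n"] by (simp add: mult_ac)
  ultimately have "((\<lambda>x. - dd n * (f x * cis (- (of_int n * x))) + f' x * cis (- (of_int n * x))) has_integral 0) {0..2 * pi}"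
    using per by (simp add: mult_ac)
  moreover have "((\<lambda>x. - dd n * (f x * cis (- (of_int n * x))) + f' x * cis (- (of_int n * x))) has_integral
      (- dd n * (2 * of_real pi * fourier_coeff f n) + 2 * of_real pi * fourier_coeff f' n)) {0..2 * pi}"
    by (intro has_integral_add has_integral_mult_right has_integral_fourier_coeff cf f')
  ultimately have "0 = - dd n * (2 * of_real pi * fourier_coeff f n) + 2 * of_real pi * fourier_coeff f' n"
    using has_integral_unique by blast
  then have "2 * of_real pi * (fourier_coeff f' n - dd n * fourier_coeff f n) = 0"
    by (simp add: algebra_simps)
  then show ?thesis by simp
qed

lemma fourier_coeff_bound:
  assumes "continuous_on UNIV f" "\<And>x. x \<in> {0..2 * pi} \<Longrightarrow> cmod (f x) \<le> B"
  shows "cmod (fourier_coeff f n) \<le> B"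
proof -
  have "0 \<le> B" using order_trans[OF norm_ge_zero assms(2)[of 0]] by simp
  then have "cmod (2 * of_real pi * fourier_coeff f n) \<le> B * (2 * pi)"
    using has_integral_bound_real[OF _ finite.emptyI has_integral_fourier_coeff[OF assms(1), of n], of B] assms(2)
    by (simp add: norm_mult)
  then show ?thesis by (simp add: norm_mult)
qed

definition per_C :: "nat \<Rightarrow> (real \<Rightarrow> real) \<Rightarrow> bool" where
  "per_C K v \<longleftrightarrow> (\<forall>x. v (x + 2 * pi) = v x) \<and> (\<forall>k<K. \<forall>x. (deriv ^^ k) v differentiable (at x)) \<and>
     continuous_on UNIV ((deriv ^^ K) v)"

abbreviation fc :: "(real \<Rightarrow> real) \<Rightarrow> int \<Rightarrow> complex" where
  "fc v \<equiv> fourier_coeff (\<lambda>x. complex_of_real (v x))"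

lemma deriv_periodic:
  assumes "\<And>x. f (x + a) = f x"
  shows "deriv f (x + a) = deriv f (x :: real)"
  unfolding deriv_def DERIV_shift using assms by simp

lemma per_C_periodic: "per_C K v \<Longrightarrow> (deriv ^^ k) v (x + 2 * pi) = (deriv ^^ k) v x"
  by (induction k arbitrary: x) (auto simp: per_C_def intro: deriv_periodic)

lemma per_C_deriv:
  assumes "per_C K v" "k < K"
  shows "((deriv ^^ k) v has_vector_derivative (deriv ^^ Suc k) v x) (at x)"
  using assms by (simp add: per_C_def DERIV_deriv_iff_real_differentiable[symmetric]
      has_real_derivative_iff_has_vector_derivative)

lemma per_C_continuous: "per_C K v \<Longrightarrow> k \<le> K \<Longrightarrow> continuous_on UNIV ((deriv ^^ k) v)"
  by (cases "k = K")
     (auto simp: per_C_def intro!: continuous_at_imp_continuous_on differentiable_imp_continuous_within)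

lemma has_vector_derivative_complex_of_real:
  "(f has_vector_derivative D) F \<Longrightarrow> ((\<lambda>x. complex_of_real (f x)) has_vector_derivative of_real D) F"
  by (rule bounded_linear.has_vector_derivative[OF bounded_linear_of_real])

lemma fc_deriv:
  assumes "per_C K v" "k \<le> K"
  shows "fc ((deriv ^^ k) v) n = dd n ^ k * fc v n"
  using assms(2)
proof (induction k)
  case (Suc k)
  have "fc ((deriv ^^ Suc k) v) n = dd n * fc ((deriv ^^ k) v) n"
  proof (rule fourier_coeff_deriv)
    show "((\<lambda>x. complex_of_real ((deriv ^^ k) v x)) has_vector_derivative complex_of_real ((deriv ^^ Suc k) v x)) (at x)" for x
      using per_C_deriv[OF assms(1)] Suc.prems by (intro has_vector_derivative_complex_of_real) simp
    show "continuous_on UNIV (\<lambda>x. complex_of_real ((deriv ^^ Suc k) v x))"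
      using per_C_continuous[OF assms(1) Suc.prems] by (intro continuous_intros)
    show "complex_of_real ((deriv ^^ k) v (2 * pi)) = complex_of_real ((deriv ^^ k) v 0)"
      using per_C_periodic[OF assms(1), of k 0] by simp
  qed
  then show ?case using Suc by simp
qed simp

text \<open>The bound on the K-th derivative says nothing at n = 0, so it is combined with the bound
  on F itself.\<close>

lemma weight_decay:
  assumes "cmod F \<le> B" "cmod (dd n ^ K * F) \<le> B"
  shows "(cmod F)\<^sup>2 \<le> 2 ^ Suc K * B\<^sup>2 * weight n powi (- int K)"
proof -
  have B: "0 \<le> B" using assms(1) norm_ge_zero order_trans by blast
  have le: "weight n ^ K \<le> 2 ^ K * (1 + (of_int n)\<^sup>2 ^ K)"
  proof (cases "n = 0")
    case False
    then have "1 \<le> \<bar>n\<bar>" by simp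
    then have "1 \<le> (real_of_int n)\<^sup>2" using one_le_power[of "real_of_int \<bar>n\<bar>" 2] by simp
    then have "weight n ^ K \<le> (2 * (of_int n)\<^sup>2) ^ K"
      by (intro power_mono) (auto simp: weight_def)
    then have "weight n ^ K \<le> 2 ^ K * (of_int n)\<^sup>2 ^ K" by (simp add: power_mult_distrib)
    also have "\<dots> \<le> 2 ^ K * (1 + (of_int n)\<^sup>2 ^ K)" by (intro mult_left_mono) auto
    finally show ?thesis .
  next
    case True
    then show ?thesis using mult_mono[of 1 "2 ^ K" 1 "1 + 0 ^ K :: real"] by (simp add: weight_def)
  qed
  have "weight n ^ K * (cmod F)\<^sup>2 \<le> 2 ^ K * (1 + (of_int n)\<^sup>2 ^ K) * (cmod F)\<^sup>2"
    by (intro mult_right_mono le) auto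
  also have "\<dots> = 2 ^ K * ((cmod F)\<^sup>2 + (cmod (dd n ^ K * F))\<^sup>2)"
  proof -
    have "(\<bar>real_of_int n\<bar> ^ K)\<^sup>2 = (of_int n)\<^sup>2 ^ K"
      by (metis power2_abs power_mult mult.commute)
    then show ?thesis by (simp add: norm_mult norm_power power_mult_distrib distrib_left distrib_right)
  qed
  also have "\<dots> \<le> 2 ^ K * (B\<^sup>2 + B\<^sup>2)"
    using assms by (intro mult_left_mono add_mono power_mono) auto
  finally have "weight n ^ K * (cmod F)\<^sup>2 \<le> 2 ^ Suc K * B\<^sup>2" by simp
  then show ?thesis
    using weight_pos[of n] by (simp add: power_int_minus field_simps)
qed

text \<open>One order of decay is kept back: 1 / \<open>weight\<close> is the summable majorant,
  which explains s + 1 \<le> K.\<close>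

lemma sob_decay:
  assumes "\<And>n. (cmod (F n))\<^sup>2 \<le> C * weight n powi (- K)" "s + 1 \<le> K" "0 \<le> C"
  shows "sob s F" "sobsq s F \<le> C * (\<Sum>\<^sub>\<infinity>n. 1 / weight n)"
proof -
  have le: "weight n powi s * (cmod (F n))\<^sup>2 \<le> C * (1 / weight n)" for n
  proof -
    have "weight n powi s * (cmod (F n))\<^sup>2 \<le> weight n powi s * (C * weight n powi (- K))"
      using assms(1) weight_powi_pos[of n s] by (intro mult_left_mono) auto
    also have "\<dots> = C * weight n powi (s - K)"
      using weight_pos[of n] by (simp add: power_int_diff power_int_minus field_simps)
    also have "\<dots> \<le> C * weight n powi (- 1)"
      using assms weight_ge_1[of n] by (intro mult_left_mono power_int_increasing) auto
    finally show ?thesis by (simp add: power_int_minus inverse_eq_divide)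
  qed
  have s: "(\<lambda>n. C * (1 / weight n)) summable_on UNIV"
    by (intro summable_on_cmult_right summable_on_inverse_weight)
  show "sob s F" "sobsq s F \<le> C * (\<Sum>\<^sub>\<infinity>n. 1 / weight n)"
    using sob_comparison[OF le s] by (simp_all add: infsum_cmult_right' del: times_divide_eq_right)
qed

lemma per_C_decay:
  assumes v: "per_C K v" and B: "\<And>x. x \<in> {0..2 * pi} \<Longrightarrow> \<bar>v x\<bar> \<le> B"
    "\<And>x. x \<in> {0..2 * pi} \<Longrightarrow> \<bar>(deriv ^^ K) v x\<bar> \<le> B"
  shows "(cmod (fc v n))\<^sup>2 \<le> 2 ^ Suc K * B\<^sup>2 * weight n powi (- int K)"
proof (rule weight_decay)
  show "cmod (fc v n) \<le> B"
    using per_C_continuous[OF v, of 0] B by (intro fourier_coeff_bound continuous_intros) auto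
  show "cmod (dd n ^ K * fc v n) \<le> B"
    unfolding fc_deriv[OF v order_refl, symmetric]
    using per_C_continuous[OF v, of K] B by (intro fourier_coeff_bound continuous_intros) auto
qed

lemma per_C_sob:
  assumes v: "per_C K v" and "s + 1 \<le> int K"
  shows "sob s (fc v)"
proof -
  have "\<exists>B. \<forall>x\<in>{0..2 * pi}. \<bar>(deriv ^^ k) v x\<bar> \<le> B" if "k \<le> K" for k
  proof -
    have "compact ((deriv ^^ k) v ` {0..2 * pi})"
      by (intro compact_continuous_image continuous_on_subset[OF per_C_continuous[OF v that]]) auto
    then show ?thesis using compact_imp_bounded by (fastforce simp: bounded_iff)
  qed
  from this[of 0] this[of K] obtain B B' where
    B: "\<And>x. x \<in> {0..2 * pi} \<Longrightarrow> \<bar>v x\<bar> \<le> B" and B': "\<And>x. x \<in> {0..2 * pi} \<Longrightarrow> \<bar>(deriv ^^ K) v x\<bar> \<le> B'"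
    by (metis funpow_0 le0 order_refl)
  have "(cmod (fc v n))\<^sup>2 \<le> 2 ^ Suc K * (max B B')\<^sup>2 * weight n powi (- int K)" for n
    by (rule per_C_decay[OF v]) (use B B' in fastforce)+
  then show ?thesis by (rule sob_decay) (use assms(2) in auto)
qed

lemma dd_weight: "(cmod (dd n))\<^sup>2 \<le> 1 * weight n powi 1"
  by (simp add: norm_mult weight_def power2_abs)

lemma sob_dd: "sob s F \<Longrightarrow> sob (s - 1) (\<lambda>n. dd n * F n)"
  using dd_weight by (rule sob_multiplier)

text \<open>The difference between v and its Fourier series is periodic and differentiable with
  vanishing coefficients. Three derivatives put the coefficients in H^2, so that the differentiated
  series still converges absolutely.\<close>

lemma per_C_synth:
  assumes v: "per_C K v" and "3 \<le> K"
  shows "complex_of_real (v x) = synth (fc v) x"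
proof -
  have s2: "sob 2 (fc v)" using per_C_sob[OF v] assms(2) by simp
  have l: "ell1 (fc v)" and l': "ell1 (\<lambda>n. dd n * fc v n)"
    using sob_ell1[OF sob_mono(1)[OF _ s2]] sob_ell1[of "\<lambda>n. dd n * fc v n"] sob_dd[OF s2] by simp_all
  let ?u = "\<lambda>x. complex_of_real (v x) - synth (fc v) x"
  have c: "continuous_on UNIV (\<lambda>x. complex_of_real (v x))"
    using per_C_continuous[OF v, of 0] by (auto intro: continuous_intros)
  have "?u x = 0"
  proof (rule fourier_uniqueness)
    fix x
    show "?u (x + 2 * pi) = ?u x"
    proof -
      have "cis (of_int n * (x + 2 * pi)) = cis (of_int n * x)" for n
      proof -
        have "cis (of_int n * (x + 2 * pi)) = cis (of_int n * x) * cis (2 * pi * of_int n)"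
          unfolding cis_mult by (simp add: algebra_simps)
        then show ?thesis by (simp add: cis_multiple_2pi)
      qed
      then show ?thesis using v by (simp add: synth_def per_C_def)
    qed
    show "(?u has_vector_derivative (complex_of_real (deriv v x) - synth (\<lambda>n. dd n * fc v n) x)) (at x)"
      using per_C_deriv[OF v, of 0 x] assms(2)
      by (intro has_vector_derivative_diff has_vector_derivative_complex_of_real has_vector_derivative_synth l l') simp
  next
    fix n
    have cu: "continuous_on UNIV ?u" by (intro continuous_intros c continuous_synth l)
    have "((\<lambda>x. complex_of_real (v x) * cis (- (of_int n * x)) - synth (fc v) x * cis (- (of_int n * x))) has_integral
        2 * of_real pi * fc v n - 2 * of_real pi * fourier_coeff (synth (fc v)) n) {0..2 * pi}"
      by (intro has_integral_diff has_integral_fourier_coeff c continuous_synth l)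
    then have "((\<lambda>x. ?u x * cis (- (of_int n * x))) has_integral 0) {0..2 * pi}"
      by (simp add: fourier_coeff_synth[OF l] left_diff_distrib)
    then have "2 * of_real pi * fourier_coeff ?u n = 0"
      by (rule has_integral_unique[OF has_integral_fourier_coeff[OF cu]])
    then show "fourier_coeff ?u n = 0" by simp
  qed
  then show ?thesis by simp
qed

subsection \<open>The symbols of the scaled ILW operators\<close>

definition langevin :: "real \<Rightarrow> real" where
  "langevin y = coth y - 1 / y"

lemma langevin_minus: "langevin (- y) = - langevin y"
  by (simp add: langevin_def coth_def)

lemma sinh_ge: "0 \<le> y \<Longrightarrow> y \<le> sinh (y::real)"
proof -
  assume y: "0 \<le> y"
  have "sinh 0 - 0 \<le> sinh y - y"
  proof (rule DERIV_nonneg_imp_nondecreasing[OF y])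
    fix x :: real
    show "\<exists>z. ((\<lambda>y. sinh y - y) has_real_derivative z) (at x) \<and> 0 \<le> z"
      by (intro exI[of _ "cosh x - 1"] conjI) (auto intro!: derivative_eq_intros simp: cosh_real_ge_1)
  qed
  then show ?thesis by simp
qed

lemma cosh_sinh_ge: "0 \<le> y \<Longrightarrow> 0 \<le> y * cosh y - sinh (y::real)"
proof -
  assume y: "0 \<le> y"
  have "0 * cosh 0 - sinh 0 \<le> y * cosh y - sinh y"
  proof (rule DERIV_nonneg_imp_nondecreasing[OF y])
    fix x :: real assume "0 \<le> x" "x \<le> y"
    then show "\<exists>z. ((\<lambda>y. y * cosh y - sinh y) has_real_derivative z) (at x) \<and> 0 \<le> z"
      by (intro exI[of _ "x * sinh x"] conjI) (auto intro!: derivative_eq_intros)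
  qed
  then show ?thesis by simp
qed

text \<open>The bound by 1 gives \<delta> A order one, the bound by y/3 gives A order two, both
  uniformly in \<delta>. The first controls the densities as \<delta> tends to 0, the second their
  \<theta>-derivative. Each bound is monotonicity of an auxiliary function vanishing at 0 or follows
  from such.\<close>

lemma langevin_bounds:
  assumes "0 < y"
  shows "0 \<le> langevin y" "langevin y \<le> 1" "langevin y \<le> y / 3"
proof -
  have s: "0 < sinh y" using assms by simp
  have eq: "langevin y = (y * cosh y - sinh y) / (y * sinh y)"
    using assms s by (simp add: langevin_def coth_def field_simps)
  show "0 \<le> langevin y"
    unfolding eq using assms s cosh_sinh_ge[of y] by simp
  have "y * exp (- y) \<le> y * 1" using assms by (intro mult_left_mono) auto
  also have "\<dots> \<le> sinh y" using sinh_ge[of y] assms by simp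
  finally have "y * (cosh y - sinh y) \<le> sinh y" by (simp add: cosh_minus_sinh)
  then show "langevin y \<le> 1"
    unfolding eq using assms s by (simp add: divide_le_eq algebra_simps)
  have "(1 + 0\<^sup>2 / 3) * sinh 0 - 0 * cosh 0 \<le> (1 + y\<^sup>2 / 3) * sinh y - y * cosh y"
  proof (rule DERIV_nonneg_imp_nondecreasing[OF less_imp_le[OF assms]])
    fix x :: real assume x: "0 \<le> x" "x \<le> y"
    have "((\<lambda>y. (1 + y\<^sup>2 / 3) * sinh y - y * cosh y) has_real_derivative (x / 3 * (x * cosh x - sinh x))) (at x)"
      by (auto intro!: derivative_eq_intros simp: power2_eq_square field_simps)
    moreover have "0 \<le> x / 3 * (x * cosh x - sinh x)"
      using x cosh_sinh_ge[of x] by simp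
    ultimately show "\<exists>z. ((\<lambda>y. (1 + y\<^sup>2 / 3) * sinh y - y * cosh y) has_real_derivative z) (at x) \<and> 0 \<le> z"
      by blast
  qed
  then have "y * cosh y - sinh y \<le> (y\<^sup>2 / 3) * sinh y"
    by (simp add: algebra_simps)
  then show "langevin y \<le> y / 3"
    unfolding eq using assms s by (simp add: divide_le_eq power2_eq_square field_simps)
qed

lemma langevin_limit: "((\<lambda>y. langevin y / y) \<longlongrightarrow> 1 / 3) (at_right 0)"
  unfolding langevin_def coth_def by real_asymp

text \<open>The symbol of the scaled operator composed with \<partial>: the factors -\<i> and \<i> n
  multiply to n, so A is real and even.\<close>

definition A_symbol :: "real \<Rightarrow> int \<Rightarrow> complex" where
  "A_symbol \<delta> n = of_real (of_int n * langevin (\<delta> * of_int n) / \<delta>)"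

definition L_symbol :: "real \<Rightarrow> int \<Rightarrow> complex" where
  "L_symbol \<delta> n = dd n + \<i> * of_real \<delta> * A_symbol \<delta> n"

lemma langevin_abs: "of_int n * langevin (\<delta> * of_int n) = \<bar>of_int n\<bar> * langevin (\<delta> * \<bar>of_int n\<bar>)"
proof (cases "0 \<le> n")
  case False
  then show ?thesis using langevin_minus[of "\<delta> * of_int n"] by simp
qed simp

text \<open>Division by zero yields 0, which happens to agree with the value prescribed for the
  symbol at frequency 0, so no case distinction is needed.\<close>

lemma langevin_0 [simp]: "langevin 0 = 0"
  by (simp add: langevin_def coth_def)

lemma A_symbol_even [simp]: "A_symbol \<delta> (- n) = A_symbol \<delta> n"
  by (simp add: A_symbol_def langevin_minus)

lemma A_symbol_0 [simp]: "A_symbol \<delta> 0 = 0" and L_symbol_0 [simp]: "L_symbol \<delta> 0 = 0"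
  by (simp_all add: A_symbol_def L_symbol_def)

lemma norm_A_symbol:
  assumes "0 < \<delta>"
  shows "cmod (of_real \<delta> * A_symbol \<delta> n) \<le> \<bar>of_int n\<bar>" "cmod (A_symbol \<delta> n) \<le> (of_int n)\<^sup>2 / 3"
proof -
  have "0 \<le> langevin (\<delta> * \<bar>of_int n\<bar>) \<and> langevin (\<delta> * \<bar>of_int n\<bar>) \<le> 1 \<and>
      langevin (\<delta> * \<bar>of_int n\<bar>) \<le> \<delta> * \<bar>of_int n\<bar> / 3"
    using langevin_bounds[of "\<delta> * \<bar>of_int n\<bar>"] assms by (cases "n = 0") auto
  note b = this[THEN conjunct1] this[THEN conjunct2, THEN conjunct1] this[THEN conjunct2, THEN conjunct2]
  have A: "A_symbol \<delta> n = of_real (\<bar>of_int n\<bar> * langevin (\<delta> * \<bar>of_int n\<bar>) / \<delta>)"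
    unfolding A_symbol_def langevin_abs ..
  have "of_real \<delta> * A_symbol \<delta> n = of_real (\<bar>of_int n\<bar> * langevin (\<delta> * \<bar>of_int n\<bar>))"
    using assms by (simp add: A)
  then have "cmod (of_real \<delta> * A_symbol \<delta> n) = \<bar>of_int n\<bar> * langevin (\<delta> * \<bar>of_int n\<bar>)"
    using b(1) by (simp only: norm_of_real abs_mult abs_idempotent abs_of_nonneg)
  then show "cmod (of_real \<delta> * A_symbol \<delta> n) \<le> \<bar>of_int n\<bar>"
    using mult_left_mono[OF b(2), of "\<bar>of_int n\<bar>"] by simp
  have "cmod (A_symbol \<delta> n) = \<bar>of_int n\<bar> * langevin (\<delta> * \<bar>of_int n\<bar>) / \<delta>"
    unfolding A norm_of_real using b(1) assms by simp
  also have "\<dots> \<le> \<bar>of_int n\<bar> * (\<delta> * \<bar>of_int n\<bar> / 3) / \<delta>"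
    using b(3) assms by (intro divide_right_mono mult_left_mono) auto
  also have "\<dots> = (of_int n)\<^sup>2 / 3"
    using assms by (simp add: power2_eq_square abs_mult_self_eq)
  finally show "cmod (A_symbol \<delta> n) \<le> (of_int n)\<^sup>2 / 3" .
qed

lemma L_symbol_bound:
  assumes "0 < \<delta>"
  shows "(cmod (L_symbol \<delta> n))\<^sup>2 \<le> 4 * weight n powi 1"
proof -
  have "cmod (L_symbol \<delta> n) \<le> cmod (dd n) + cmod (\<i> * (of_real \<delta> * A_symbol \<delta> n))"
    unfolding L_symbol_def mult.assoc by (rule norm_triangle_ineq)
  also have "\<dots> \<le> 2 * \<bar>of_int n\<bar>"
    using norm_A_symbol(1)[OF assms, of n] by (simp add: norm_mult)
  finally have "(cmod (L_symbol \<delta> n))\<^sup>2 \<le> (2 * \<bar>of_int n\<bar>)\<^sup>2" by (intro power_mono) auto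
  then show ?thesis by (simp add: weight_def power_mult_distrib)
qed

lemma A_symbol_limit: "((\<lambda>\<delta>. A_symbol \<delta> n) \<longlongrightarrow> (of_int n)\<^sup>2 / 3) (at_right 0)"
proof (cases "n = 0")
  case False
  have fl: "filterlim (\<lambda>\<delta>. \<delta> * \<bar>real_of_int n\<bar>) (at_right 0) (at_right 0)"
    unfolding filterlim_at
  proof
    have "((\<lambda>\<delta>. \<delta> * \<bar>real_of_int n\<bar>) \<longlongrightarrow> 0 * \<bar>real_of_int n\<bar>) (at_right 0)"
      by (intro tendsto_intros)
    then show "((\<lambda>\<delta>. \<delta> * \<bar>real_of_int n\<bar>) \<longlongrightarrow> 0) (at_right 0)" by simp
    show "\<forall>\<^sub>F \<delta> in at_right 0. \<delta> * \<bar>real_of_int n\<bar> \<in> {0<..} \<and> \<delta> * \<bar>real_of_int n\<bar> \<noteq> 0"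
      using eventually_at_right_less[of "0::real"] by eventually_elim (use False in auto)
  qed
  have "((\<lambda>\<delta>. complex_of_real ((of_int n)\<^sup>2 * (langevin (\<delta> * \<bar>of_int n\<bar>) / (\<delta> * \<bar>of_int n\<bar>)))) \<longlongrightarrow>
      of_real ((of_int n)\<^sup>2 * (1 / 3))) (at_right 0)"
    by (intro tendsto_of_real tendsto_mult tendsto_const filterlim_compose[OF langevin_limit fl])
  moreover have "complex_of_real ((of_int n)\<^sup>2 * (langevin (\<delta> * \<bar>of_int n\<bar>) / (\<delta> * \<bar>of_int n\<bar>))) = A_symbol \<delta> n" for \<delta>
  proof -
    define m where "m = \<bar>real_of_int n\<bar>"
    have m: "(real_of_int n)\<^sup>2 = m\<^sup>2" "m \<noteq> 0" using False by (simp_all add: m_def)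
    have "m\<^sup>2 * (langevin (\<delta> * m) / (\<delta> * m)) = m * langevin (\<delta> * m) / \<delta>"
      using m(2) by (simp add: power2_eq_square)
    then show ?thesis
      unfolding A_symbol_def langevin_abs m(1) m_def[symmetric] by (rule arg_cong)
  qed
  ultimately show ?thesis by simp
qed simp

lemma coth_add:
  assumes "p \<noteq> 0" "q \<noteq> 0" "p + q \<noteq> (0::real)"
  shows "coth (p + q) * (coth p + coth q) = coth p * coth q + 1"
proof -
  have "sinh p \<noteq> 0" "sinh q \<noteq> 0" "sinh (p + q) \<noteq> 0" using assms by auto
  then show ?thesis
    unfolding coth_def by (simp add: divide_simps) (simp add: sinh_add cosh_add algebra_simps)
qed

lemma ILW_symbol_A:
  assumes "0 < \<delta>"
  shows "ILW_symbol (\<i> * of_real \<delta>) (A_symbol \<delta>)"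
proof -
  define a where "a n = of_int n * langevin (\<delta> * of_int n) / \<delta>" for n :: int
  have a0: "a 0 = 0" and am: "a (- n) = a n" for n by (simp_all add: a_def langevin_minus)
  have an: "a n = of_int n * coth (\<delta> * of_int n) / \<delta> - 1 / \<delta>\<^sup>2" if "n \<noteq> 0" for n
    using that assms by (simp add: a_def langevin_def power2_eq_square field_simps)
  have key: "\<delta>\<^sup>2 * a (m + n) * (of_int m * a n + of_int n * a m) + a (m + n) * of_int (m + n) =
      \<delta>\<^sup>2 * of_int (m + n) * a m * a n + of_int n * a n + of_int m * a m + of_int (m + n) * of_int m * of_int n" for m n
  proof -
    consider "m = 0" | "n = 0" | "n = - m" | "m \<noteq> 0" "n \<noteq> 0" "m + n \<noteq> 0" by linarith
    then show ?thesis
    proof cases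
      case 4
      define x y where "x = real_of_int m" and "y = real_of_int n"
      define c d s where "c = coth (\<delta> * x)" and "d = coth (\<delta> * y)" and "s = coth (\<delta> * (x + y))"
      have "coth (\<delta> * x + \<delta> * y) * (coth (\<delta> * x) + coth (\<delta> * y)) = coth (\<delta> * x) * coth (\<delta> * y) + 1"
        by (rule coth_add) (use 4 assms in \<open>auto simp: x_def y_def distrib_left[symmetric] of_int_add[symmetric] simp del: of_int_add\<close>)
      then have s: "s * (c + d) = c * d + 1" by (simp add: c_def d_def s_def distrib_left)
      have A: "a m = x * c / \<delta> - 1 / \<delta>\<^sup>2" "a n = y * d / \<delta> - 1 / \<delta>\<^sup>2" "a (m + n) = (x + y) * s / \<delta> - 1 / \<delta>\<^sup>2"
        using 4 by (simp_all add: an c_def d_def s_def x_def y_def)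
      define t where "t = 1 / \<delta>"
      have t: "\<delta> * t = 1" using assms by (simp add: t_def)
      have B: "a m = t * (x * c - t)" "a n = t * (y * d - t)" "a (m + n) = t * ((x + y) * s - t)"
        unfolding A t_def by (simp_all add: power2_eq_square divide_inverse algebra_simps)
      have dt: "\<delta>\<^sup>2 * (t * u) * (t * w) = u * w" for u w
      proof -
        have "\<delta>\<^sup>2 * (t * u) * (t * w) = (\<delta> * t) * (\<delta> * t) * (u * w)" by (simp add: power2_eq_square mult_ac)
        then show ?thesis by (simp add: t)
      qed
      have "\<delta>\<^sup>2 * a (m + n) * (x * a n + y * a m) = ((x + y) * s - t) * (x * (y * d - t) + y * (x * c - t))"
        unfolding B by (subst dt[symmetric]) (simp add: algebra_simps)
      note M1 = this
      have M2: "\<delta>\<^sup>2 * (x + y) * a m * a n = (x + y) * ((x * c - t) * (y * d - t))"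
        unfolding B by (subst dt[symmetric]) (simp add: algebra_simps)
      have M3: "((x + y) * s - t) * (x * (y * d - t) + y * (x * c - t)) + t * ((x + y) * s - t) * (x + y)
          = (x + y) * ((x * c - t) * (y * d - t)) + y * (t * (y * d - t)) + x * (t * (x * c - t)) + (x + y) * x * y"
      proof -
        have "(x + y) * (x * y) * (s * (c + d)) = (x + y) * (x * y) * (c * d + 1)" unfolding s ..
        then show ?thesis by (simp add: algebra_simps)
      qed
      show ?thesis
        unfolding x_def[symmetric] y_def[symmetric] of_int_add M1 M2 unfolding B by (rule M3)
    qed (auto simp: a0 am)
  qed
  have th: "(\<i> * of_real \<delta>)\<^sup>2 = - of_real (\<delta>\<^sup>2)"
    by (simp add: power_mult_distrib)
  have A: "A_symbol \<delta> n = of_real (a n)" for n by (simp add: A_symbol_def a_def)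
  have "- ((\<i> * of_real \<delta>)\<^sup>2 * A_symbol \<delta> (m + n) * (dd m * A_symbol \<delta> n + dd n * A_symbol \<delta> m)) + A_symbol \<delta> (m + n) * dd (m + n) =
       - ((\<i> * of_real \<delta>)\<^sup>2 * dd (m + n) * A_symbol \<delta> m * A_symbol \<delta> n) + dd n * A_symbol \<delta> n + dd m * A_symbol \<delta> m
       - dd (m + n) * dd m * dd n" for m n
  proof -
    have "\<i> * of_real (\<delta>\<^sup>2 * a (m + n) * (of_int m * a n + of_int n * a m) + a (m + n) * of_int (m + n)) =
      \<i> * of_real (\<delta>\<^sup>2 * of_int (m + n) * a m * a n + of_int n * a n + of_int m * a m + of_int (m + n) * of_int m * of_int n)"
      unfolding key ..
    then show ?thesis unfolding A th by (simp add: algebra_simps)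
  qed
  then show ?thesis unfolding ILW_symbol_def by simp
qed

text \<open>At \<theta> = 0 the condition is the binomial formula (m + n)^3 = m^3 + n^3 + 3 m n (m +
  n).\<close>

lemma ILW_symbol_KdV: "ILW_symbol 0 (\<lambda>n. (of_int n)\<^sup>2 / 3)"
  unfolding ILW_symbol_def by (simp add: power2_eq_square field_simps) 

subsection \<open>The functionals in terms of Fourier coefficients\<close>

lemma compositions_Suc:
  "bij_betw (\<lambda>(i, ns). i # ns) (SIGMA i:{..s}. compositions j (s - i)) (compositions (Suc j) s)"
proof (rule bij_betwI[where g = "\<lambda>ns. (hd ns, tl ns)"])
  show "(\<lambda>ns. (hd ns, tl ns)) \<in> compositions (Suc j) s \<rightarrow> (SIGMA i:{..s}. compositions j (s - i))"
    by (auto simp: compositions_def length_Suc_conv)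
  show "(\<lambda>(i, ns). i # ns) \<in> (SIGMA i:{..s}. compositions j (s - i)) \<rightarrow> compositions (Suc j) s"
    by (auto simp: compositions_def)
qed (auto simp: compositions_def length_Suc_conv)

lemma finite_compositions: "finite (compositions j s)"
proof (induction j arbitrary: s)
  case 0
  have "compositions 0 s \<subseteq> {[]}" by (auto simp: compositions_def)
  then show ?case using finite_subset by blast
next
  case (Suc j)
  then show ?case using bij_betw_finite[OF compositions_Suc, of s j] by auto
qed

lemma sum_compositions:
  fixes f :: "nat \<Rightarrow> 'a::comm_ring_1"
  shows "(\<Sum>ns\<in>compositions j s. prod_list (map f ns)) = (Abs_fps f ^ j) $ s"
proof (induction j arbitrary: s)
  case 0
  have "compositions 0 s = (if s = 0 then {[]} else {})" by (auto simp: compositions_def)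
  then show ?case by simp
next
  case (Suc j)
  have "(\<Sum>ns\<in>compositions (Suc j) s. prod_list (map f ns)) =
      (\<Sum>(i, ns)\<in>(SIGMA i:{..s}. compositions j (s - i)). prod_list (map f (i # ns)))"
    by (subst sum.reindex_bij_betw[OF compositions_Suc, symmetric]) (simp add: case_prod_unfold)
  also have "\<dots> = (\<Sum>i\<le>s. \<Sum>ns\<in>compositions j (s - i). f i * prod_list (map f ns))"
    by (subst sum.Sigma) (auto simp: finite_compositions)
  also have "\<dots> = (Abs_fps f ^ Suc j) $ s"
    by (simp add: Suc[symmetric] sum_distrib_left fps_mult_nth atLeast0AtMost)
  finally show ?case .
qed

lemma synth_cpow:
  assumes "\<And>i. i \<le> s \<Longrightarrow> ell1 (h i)"
  shows "ell1 (cpow h j s)" and "synth (cpow h j s) x = (Abs_fps (\<lambda>i. synth (h i) x) ^ Suc j) $ s"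
proof -
  have "ell1 (cpow h j s) \<and> synth (cpow h j s) x = (Abs_fps (\<lambda>i. synth (h i) x) ^ Suc j) $ s"
    using assms
  proof (induction j arbitrary: s)
    case (Suc j)
    let ?A = "Abs_fps (\<lambda>i. synth (h i) x)"
    have IH: "ell1 (cpow h j (s - i))" "synth (cpow h j (s - i)) x = (?A ^ Suc j) $ (s - i)" if "i \<le> s" for i
      using Suc that by auto
    have "synth (cpow h (Suc j) s) x = (\<Sum>i\<le>s. synth (h i) x * (?A ^ Suc j) $ (s - i))"
    proof -
      have "synth (cpow h (Suc j) s) x = (\<Sum>i\<le>s. synth (conv (h i) (cpow h j (s - i))) x)"
        unfolding cpow.simps by (rule synth_sum) (use Suc.prems IH in \<open>auto intro: ell1_conv\<close>)
      also have "\<dots> = (\<Sum>i\<le>s. synth (h i) x * (?A ^ Suc j) $ (s - i))"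
        by (rule sum.cong) (use Suc.prems IH in \<open>auto simp: synth_conv simp del: power_Suc\<close>)
      finally show ?thesis .
    qed
    also have "\<dots> = (?A ^ Suc (Suc j)) $ s"
      unfolding power_Suc[of _ "Suc j"] by (simp add: fps_mult_nth[of ?A] atLeast0AtMost del: power_Suc)
    finally have "synth (cpow h (Suc j) s) x = (?A ^ Suc (Suc j)) $ s" .
    moreover have "ell1 (cpow h (Suc j) s)"
      unfolding cpow.simps by (rule ell1_sum) (use Suc.prems IH in \<open>auto intro: ell1_conv\<close>)
    ultimately show ?case by blast
  qed simp
  then show "ell1 (cpow h j s)" and "synth (cpow h j s) x = (Abs_fps (\<lambda>i. synth (h i) x) ^ Suc j) $ s"
    by auto
qed

lemma synth_psum:
  assumes "\<And>i. i < m \<Longrightarrow> ell1 (h i)"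
  shows "ell1 (psum p h m)"
    and "synth (psum p h m) x = (\<Sum>j=1..m. p j * (Abs_fps (\<lambda>i. synth (h i) x) ^ Suc j) $ (m - j))"
proof -
  have c: "ell1 (cpow h j (m - j))" "synth (cpow h j (m - j)) x = (Abs_fps (\<lambda>i. synth (h i) x) ^ Suc j) $ (m - j)"
    if "j \<in> {1..m}" for j
    using synth_cpow[of "m - j" h j] assms that by auto
  show "ell1 (psum p h m)"
    unfolding psum_def using c by (intro ell1_sum ell1_scale)
  show "synth (psum p h m) x = (\<Sum>j=1..m. p j * (Abs_fps (\<lambda>i. synth (h i) x) ^ Suc j) $ (m - j))"
  proof -
    have "synth (psum p h m) x = (\<Sum>j=1..m. synth (\<lambda>n. p j * cpow h j (m - j) n) x)"
      unfolding psum_def using c by (intro synth_sum ell1_scale)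
    also have "\<dots> = (\<Sum>j=1..m. p j * (Abs_fps (\<lambda>i. synth (h i) x) ^ Suc j) $ (m - j))"
      by (rule sum.cong) (use c in \<open>auto simp: synth_scale simp del: power_Suc\<close>)
    finally show ?thesis .
  qed
qed

lemma G_symbol_langevin: "G_symbol \<delta> n = - \<i> * of_real (langevin (\<delta> * of_int n))"
  by (auto simp: G_symbol_def langevin_def coth_def)

lemma ell1_A:
  assumes "0 < \<delta>" "sob 2 F"
  shows "ell1 (\<lambda>n. of_real \<delta> * A_symbol \<delta> n * F n)"
proof (rule sob_ell1)
  have "(cmod (of_real \<delta> * A_symbol \<delta> n))\<^sup>2 \<le> 1 * weight n powi 1" for n
    using power_mono[OF norm_A_symbol(1)[OF assms(1), of n], of 2] by (simp add: weight_def)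
  from sob_multiplier(1)[OF this assms(2)] show "sob 1 (\<lambda>n. of_real \<delta> * A_symbol \<delta> n * F n)" by simp
qed

lemma Gt_op_synth:
  assumes "0 < \<delta>" and F: "ell1 F"
  shows "Gt_op \<delta> (synth F) x = synth (\<lambda>n. G_symbol \<delta> n * F n) x / of_real \<delta>"
  by (simp add: Gt_op_def G_op_def fourier_multiplier_synth[OF F])

lemma vector_derivative_synth:
  assumes "sob 2 F"
  shows "(synth F has_vector_derivative synth (\<lambda>n. dd n * F n) x) (at x)"
  using sob_dd[OF assms] by (intro has_vector_derivative_synth sob_ell1 sob_mono(1)[OF _ assms]) auto

lemma L0_op_synth:
  assumes d: "0 < \<delta>" and F: "sob 2 F"
  shows "L0_op \<delta> (synth F) = synth (\<lambda>n. L_symbol \<delta> n * F n)"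
proof
  fix x
  have F': "ell1 (\<lambda>n. dd n * F n)" using sob_dd[OF F] by (intro sob_ell1) simp
  have GF: "G_symbol \<delta> n * (dd n * F n) = of_real \<delta> * A_symbol \<delta> n * F n" for n
    using d by (simp add: G_symbol_langevin A_symbol_def algebra_simps)
  have "L0_op \<delta> (synth F) x = synth (\<lambda>n. dd n * F n) x + \<i> * synth (\<lambda>n. of_real \<delta> * A_symbol \<delta> n * F n) x"
    unfolding L0_op_def Let_def vector_derivative_at[OF vector_derivative_synth[OF F]] Gt_op_synth[OF d F'] GF
    using d by simp
  also have "\<dots> = synth (\<lambda>n. dd n * F n + \<i> * (of_real \<delta> * A_symbol \<delta> n * F n)) x"
    using F' ell1_A[OF d F] by (simp only: synth_add ell1_scale synth_scale)
  finally show "L0_op \<delta> (synth F) x = synth (\<lambda>n. L_symbol \<delta> n * F n) x"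
    by (simp add: L_symbol_def algebra_simps)
qed

abbreviation h_seq :: "real \<Rightarrow> (int \<Rightarrow> complex) \<Rightarrow> nat \<Rightarrow> int \<Rightarrow> complex" where
  "h_seq \<delta> V \<equiv> hs (pcoef (\<i> * of_real \<delta>)) (qcoef (\<i> * of_real \<delta>)) (L_symbol \<delta>) V"

abbreviation h_seq0 :: "(int \<Rightarrow> complex) \<Rightarrow> nat \<Rightarrow> int \<Rightarrow> complex" where
  "h_seq0 V \<equiv> hs (pcoef 0) (qcoef 0) dd V"

lemma dd_weight4: "(cmod (dd n))\<^sup>2 \<le> 4 * weight n powi 1"
  using dd_weight[of n] weight_pos[of n] by simp

lemma sob_h_seq: "0 < \<delta> \<Longrightarrow> sob \<kappa> V \<Longrightarrow> int n \<le> 2 * \<kappa> + 1 \<Longrightarrow> sob (\<kappa> - int n) (h_seq \<delta> V n)"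
  by (rule sob_hs[OF _ L_symbol_bound])

lemma sob_h_seq0: "sob \<kappa> V \<Longrightarrow> int n \<le> 2 * \<kappa> + 1 \<Longrightarrow> sob (\<kappa> - int n) (h_seq0 V n)"
  by (rule sob_hs[OF _ dd_weight])

lemma ell1_h_seq: "0 < \<delta> \<Longrightarrow> sob \<kappa> V \<Longrightarrow> int n + 1 \<le> \<kappa> \<Longrightarrow> ell1 (h_seq \<delta> V n)"
  by (intro sob_ell1 sob_mono(1)[OF _ sob_h_seq]) auto

lemma ell1_h_seq0: "sob \<kappa> V \<Longrightarrow> int n + 1 \<le> \<kappa> \<Longrightarrow> ell1 (h_seq0 V n)"
  by (intro sob_ell1 sob_mono(1)[OF _ sob_h_seq0]) auto

lemma synth_minus: "synth (\<lambda>n. - F n) x = - synth F x"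
  using synth_scale[of "-1" F x] by simp

lemma synth_diff: "ell1 F \<Longrightarrow> ell1 G \<Longrightarrow> synth (\<lambda>n. F n - G n) x = synth F x - synth G x"
  using synth_add[of F "\<lambda>n. -1 * G n" x] ell1_scale[of G "-1"] by (simp add: synth_minus)

lemma synth_hs_Suc:
  assumes "\<And>i. i \<le> n \<Longrightarrow> ell1 (hs p q l V i)" "ell1 (\<lambda>m. l m * hs p q l V n m)"
  shows "synth (hs p q l V (Suc n)) x =
    (\<Sum>j=1..n. p j * (Abs_fps (\<lambda>i. synth (hs p q l V i) x) ^ Suc j) $ (n - j))
    - (\<Sum>j=1..Suc n. q j * (Abs_fps (\<lambda>i. synth (hs p q l V i) x) ^ Suc j) $ (Suc n - j))
    + synth (\<lambda>m. l m * hs p q l V n m) x"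
proof -
  have "ell1 (psum p (hs p q l V) n)" "ell1 (psum q (hs p q l V) (Suc n))"
    using assms(1) by (auto intro!: synth_psum(1))
  moreover have "ell1 (\<lambda>m. psum p (hs p q l V) n m - psum q (hs p q l V) (Suc n) m)"
    using ell1_add[OF calculation(1) ell1_scale[OF calculation(2), of "-1"]] by simp
  ultimately show ?thesis
    using assms(2) synth_psum(2)[of n "hs p q l V" p x] synth_psum(2)[of "Suc n" "hs p q l V" q x] assms(1)
    by (simp add: synth_add synth_diff del: power_Suc sum.atLeast_Suc_atMost sum.cl_ivl_Suc)
qed

lemma fps_power_cong:
  assumes "\<And>i. i \<le> s \<Longrightarrow> f i = g i"
  shows "(Abs_fps f ^ j) $ s = (Abs_fps g ^ j) $ (s :: nat)"
  using assms
proof (induction j arbitrary: s)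
  case (Suc j)
  have "(Abs_fps f ^ j) $ (s - i) = (Abs_fps g ^ j) $ (s - i)" for i
    using Suc.prems by (intro Suc.IH) auto
  then show ?case using Suc.prems by (simp add: fps_mult_nth)
qed simp

text \<open>The margin n + 1 \<le> \<kappa> keeps all densities up to n absolutely convergent
  Fourier series, so that the pointwise definition can be evaluated classically. Rougher functions
  are reached only through the extension.\<close>

lemma h_ILW_synth:
  assumes d: "0 < \<delta>" and V: "sob \<kappa> V" and v: "\<And>x. complex_of_real (v x) = synth V x"
    and "int n + 1 \<le> \<kappa>"
  shows "h_ILW \<delta> v n = synth (h_seq \<delta> V n)"
  using assms(4)
proof (induction n rule: less_induct)
  case (less n)
  let ?\<theta> = "\<i> * complex_of_real \<delta>"
  have th: "?\<theta> \<noteq> 0" using d by simp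
  have th2: "?\<theta>\<^sup>2 = - of_real (\<delta>\<^sup>2)" by (simp add: power_mult_distrib)
  have IH: "h_ILW \<delta> v i = synth (h_seq \<delta> V i)" if "i < n" for i
    using less that by auto
  have e: "ell1 (h_seq \<delta> V i)" if "i \<le> n" for i
    using less that by (intro ell1_h_seq[OF d V]) auto
  have s2: "sob 2 (h_seq \<delta> V i)" if "i < n" for i
    using less that by (intro sob_mono(1)[OF _ sob_h_seq[OF d V]]) auto
  have eL: "ell1 (\<lambda>m. L_symbol \<delta> m * h_seq \<delta> V i m)" if "i < n" for i
    using sob_multiplier(1)[OF L_symbol_bound[OF d] s2[OF that]] by (intro sob_ell1) simp
  have L0: "L0_op \<delta> (h_ILW \<delta> v i) = synth (\<lambda>m. L_symbol \<delta> m * h_seq \<delta> V i m)" if "i < n" for i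
    unfolding IH[OF that] by (rule L0_op_synth[OF d s2[OF that]])
  consider "n = 0" | "n = 1" | m where "n = Suc m" "1 \<le> m"
    by (metis One_nat_def Suc_le_eq not0_implies_Suc neq0_conv)
  then show ?case
  proof cases
    case 1
    then show ?thesis using v by (auto simp: synth_minus)
  next
    case 2
    show ?thesis
    proof
      fix x
      have "synth (h_seq \<delta> V (Suc 0)) x = - (qcoef ?\<theta> 1 * (synth (h_seq \<delta> V 0) x)\<^sup>2)
          + synth (\<lambda>m. L_symbol \<delta> m * h_seq \<delta> V 0 m) x"
        by (subst synth_hs_Suc) (use e eL 2 in \<open>auto simp: power2_eq_square simp del: hs.simps\<close>)
      then show "h_ILW \<delta> v n x = synth (h_seq \<delta> V n) x"
        using 2 L0[of 0] IH[of 0] by (simp add: qcoef_def del: hs.simps h_ILW.simps(1))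
    qed
  next
    case 3
    show ?thesis
    proof
      fix x
      define B where "B = Abs_fps (\<lambda>i. synth (h_seq \<delta> V i) x)"
      have comp: "(\<Sum>ns\<in>compositions j s. prod_list (map (\<lambda>m. h_ILW \<delta> v m x) ns)) = (B ^ j) $ s" if "s < n" for j s
        unfolding sum_compositions B_def by (rule fps_power_cong) (use IH that in auto)
      have "h_ILW \<delta> v n x =
         - (1 / (2 * (of_real \<delta>)\<^sup>2)) * (\<Sum>j=2..n. (2 * \<i> * of_real \<delta>) ^ j / fact j * (B ^ j) $ (n - j))
         + \<i> / (2 * of_real \<delta>) * (\<Sum>j=2..n+1. (2 * \<i> * of_real \<delta>) ^ j / fact j * (B ^ j) $ (n + 1 - j))
         + synth (\<lambda>k. L_symbol \<delta> k * h_seq \<delta> V m k) x"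
      proof -
        have c: "(\<Sum>j=2..k. (2 * \<i> * of_real \<delta>) ^ j / fact j * (\<Sum>ns\<in>compositions j (k - j). prod_list (map (\<lambda>m. h_ILW \<delta> v m x) ns))) =
            (\<Sum>j=2..k. (2 * \<i> * of_real \<delta>) ^ j / fact j * (B ^ j) $ (k - j))" if "k \<le> n + 1" for k
          by (rule sum.cong) (use 3 that in \<open>auto simp: comp\<close>)
        have "h_ILW \<delta> v n x =
         - (1 / (2 * (of_real \<delta>)\<^sup>2)) * (\<Sum>j=2..n. (2 * \<i> * of_real \<delta>) ^ j / fact j *
            (\<Sum>ns\<in>compositions j (n - j). prod_list (map (\<lambda>m. h_ILW \<delta> v m x) ns)))
         + \<i> / (2 * of_real \<delta>) * (\<Sum>j=2..n+1. (2 * \<i> * of_real \<delta>) ^ j / fact j *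
            (\<Sum>ns\<in>compositions j (n + 1 - j). prod_list (map (\<lambda>m. h_ILW \<delta> v m x) ns)))
         + L0_op \<delta> (h_ILW \<delta> v (n - 1)) x"
          using 3 by (subst h_ILW.simps(3)) auto
        then show ?thesis
          unfolding c[OF le_add1] c[OF order_refl] using L0[of m] 3 by simp
      qed
      also have "- (1 / (2 * (of_real \<delta>)\<^sup>2)) * (\<Sum>j=2..n. (2 * \<i> * of_real \<delta>) ^ j / fact j * (B ^ j) $ (n - j))
        = (\<Sum>j=1..m. pcoef ?\<theta> j * (B ^ Suc j) $ (m - j))"
      proof -
        have "(\<Sum>j=1..m. pcoef ?\<theta> j * (B ^ Suc j) $ (m - j)) =
            (\<Sum>j=2..n. pcoef ?\<theta> (j - 1) * (B ^ j) $ (n - j))"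
          by (rule sum.reindex_bij_witness[of _ "\<lambda>j. j - 1" Suc]) (use 3 in auto)
        also have "\<dots> = (\<Sum>j=2..n. - (1 / (2 * (of_real \<delta>)\<^sup>2)) * ((2 * \<i> * of_real \<delta>) ^ j / fact j * (B ^ j) $ (n - j)))"
        proof (rule sum.cong[OF refl])
          fix j assume "j \<in> {2..n}"
          then obtain i where j: "j = Suc (Suc i)" by (metis Suc_le_D atLeastAtMost_iff numeral_2_eq_2 Suc_le_mono)
          \<comment> \<open>With \<theta>^2 = -\<delta>^2 the prefactor removes two powers of
            \<theta> and one of 2, which is the origin of the coefficients 2^(j-1) \<theta>^(j-2) /
            j! of \<Psi>.\<close>
          have "- (1 / (2 * (complex_of_real \<delta>)\<^sup>2)) * (2 * ?\<theta>) ^ j = 2 ^ Suc i * ?\<theta> ^ i"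
          proof -
            have "(2 * ?\<theta>) ^ j = 2 ^ Suc i * 2 * (?\<theta>\<^sup>2 * ?\<theta> ^ i)"
              unfolding j by (simp add: power_mult_distrib power2_eq_square mult_ac)
            then show ?thesis unfolding th2 using d by simp
          qed
          moreover have "pcoef ?\<theta> (j - 1) = 2 ^ Suc i * ?\<theta> ^ i / fact j"
            by (simp add: pcoef_def j)
          ultimately have "pcoef ?\<theta> (j - 1) = - (1 / (2 * (complex_of_real \<delta>)\<^sup>2)) * (2 * ?\<theta>) ^ j / fact j"
            by simp
          then show "pcoef ?\<theta> (j - 1) * (B ^ j) $ (n - j) =
              - (1 / (2 * (of_real \<delta>)\<^sup>2)) * ((2 * \<i> * of_real \<delta>) ^ j / fact j * (B ^ j) $ (n - j))"
            by (simp add: mult.assoc)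
        qed
        finally show ?thesis by (simp only: sum_distrib_left)
      qed
      also have "\<i> / (2 * of_real \<delta>) * (\<Sum>j=2..n+1. (2 * \<i> * of_real \<delta>) ^ j / fact j * (B ^ j) $ (n + 1 - j))
        = - (\<Sum>j=1..Suc m. qcoef ?\<theta> j * (B ^ Suc j) $ (Suc m - j))"
      proof -
        have "(\<Sum>j=1..Suc m. qcoef ?\<theta> j * (B ^ Suc j) $ (Suc m - j)) =
            (\<Sum>j=2..n+1. qcoef ?\<theta> (j - 1) * (B ^ j) $ (n + 1 - j))"
          by (rule sum.reindex_bij_witness[of _ "\<lambda>j. j - 1" Suc]) (use 3 in auto)
        also have "\<dots> = (\<Sum>j=2..n+1. - (\<i> / (2 * of_real \<delta>)) * ((2 * \<i> * of_real \<delta>) ^ j / fact j * (B ^ j) $ (n + 1 - j)))"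
        proof (rule sum.cong[OF refl])
          fix j assume "j \<in> {2..n+1}"
          then obtain i where j: "j = Suc i" by (metis Suc_le_D atLeastAtMost_iff numeral_2_eq_2)
          have "- (\<i> / (2 * of_real \<delta>)) * (2 * ?\<theta>) ^ j = (2 * ?\<theta>) ^ i"
            unfolding j using d by (simp add: field_simps)
          then have "qcoef ?\<theta> (j - 1) = - (\<i> / (2 * of_real \<delta>)) * (2 * ?\<theta>) ^ j / fact j"
            by (simp add: qcoef_def j power_mult_distrib)
          then show "qcoef ?\<theta> (j - 1) * (B ^ j) $ (n + 1 - j) =
              - (\<i> / (2 * of_real \<delta>)) * ((2 * \<i> * of_real \<delta>) ^ j / fact j * (B ^ j) $ (n + 1 - j))"
            by (simp add: mult.assoc)
        qed
        finally show ?thesis by (simp only: sum_distrib_left minus_mult_left[symmetric] sum_negf minus_minus)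
      qed
      finally show "h_ILW \<delta> v n x = synth (h_seq \<delta> V n) x"
        unfolding 3 by (subst synth_hs_Suc) (use e eL 3 in \<open>auto simp: B_def[symmetric] simp del: power_Suc\<close>)
    qed
  qed
qed

lemma psum_pcoef_0: "psum (pcoef 0) h (Suc m) = cpow h 1 m"
proof
  fix n
  have "psum (pcoef 0) h (Suc m) n = (\<Sum>j\<in>{1}. pcoef 0 j * cpow h j (Suc m - j) n)"
    unfolding psum_def by (rule sum.mono_neutral_right) (auto simp: pcoef_def)
  then show "psum (pcoef 0) h (Suc m) n = cpow h 1 m n"
    by (simp add: pcoef_def)
qed

lemma psum_qcoef_0: "psum (qcoef 0) h m = (\<lambda>_. 0)"
  by (rule ext) (auto simp: psum_def qcoef_def intro!: sum.neutral)

lemma of_real_deriv_synth: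
  assumes F: "sob 2 F" and f: "\<And>x. complex_of_real (f x) = synth F x"
  shows "(f has_real_derivative deriv f x) (at x)"
    and "complex_of_real (deriv f x) = synth (\<lambda>m. dd m * F m) x"
proof -
  have 1: "((\<lambda>x. complex_of_real (f x)) has_vector_derivative synth (\<lambda>n. dd n * F n) x) (at x)"
    unfolding f by (rule vector_derivative_synth[OF F])
  from bounded_linear.has_vector_derivative[OF bounded_linear_Re 1]
  have d: "(f has_real_derivative Re (synth (\<lambda>n. dd n * F n) x)) (at x)"
    by (simp add: has_real_derivative_iff_has_vector_derivative)
  then have 2: "deriv f x = Re (synth (\<lambda>n. dd n * F n) x)"
    by (rule DERIV_imp_deriv)
  show "(f has_real_derivative deriv f x) (at x)" using d 2 by simp
  have "((\<lambda>x. complex_of_real (f x)) has_vector_derivative of_real (Re (synth (\<lambda>n. dd n * F n) x))) (at x)"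
    using d by (intro has_vector_derivative_complex_of_real) (simp add: has_real_derivative_iff_has_vector_derivative)
  then have "synth (\<lambda>n. dd n * F n) x = of_real (Re (synth (\<lambda>n. dd n * F n) x))"
    by (rule vector_derivative_unique_at[OF 1])
  then show "complex_of_real (deriv f x) = synth (\<lambda>m. dd m * F m) x"
    by (simp only: 2)
qed

lemma h_KdV_synth:
  assumes V: "sob \<kappa> V" and v: "\<And>x. complex_of_real (v x) = synth V x" and "int n + 1 \<le> \<kappa>"
  shows "complex_of_real (h_KdV v n x) = synth (h_seq0 V n) x"
  using assms(3)
proof (induction n arbitrary: x rule: less_induct)
  case (less n)
  have IH: "complex_of_real (h_KdV v i x) = synth (h_seq0 V i) x" if "i < n" for i x
    using less that by auto
  have e: "ell1 (h_seq0 V i)" if "i \<le> n" for i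
    using less that by (intro ell1_h_seq0[OF V]) auto
  have s2: "sob 2 (h_seq0 V i)" if "i < n" for i
    using less that by (intro sob_mono(1)[OF _ sob_h_seq0[OF V]]) auto
  have ed: "ell1 (\<lambda>m. dd m * h_seq0 V i m)" if "i < n" for i
    using sob_dd[OF s2[OF that]] by (intro sob_ell1) simp
  consider "n = 0" | "n = 1" | m where "n = Suc (Suc m)"
    by (metis One_nat_def not0_implies_Suc)
  then show ?case
  proof cases
    case 1
    then show ?thesis using v by (simp add: synth_minus)
  next
    case 2
    have V2: "sob 2 V" using less.prems 2 by (intro sob_mono(1)[OF _ V]) auto
    have "h_seq0 V (Suc 0) = (\<lambda>m. - (dd m * V m))"
      by (rule ext) (simp add: psum_def qcoef_def)
    then show ?thesis using 2 of_real_deriv_synth(2)[OF V2 v] by (simp add: synth_minus del: hs.simps)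
  next
    case 3
    have n: "n - 1 < n" "n \<ge> 2" using 3 by auto
    have r: "h_seq0 V n = (\<lambda>k. cpow (h_seq0 V) 1 m k + dd k * h_seq0 V (Suc m) k)"
      by (rule ext) (simp only: 3 hs.simps(2)[of _ _ _ _ "Suc m"] psum_qcoef_0 psum_pcoef_0 diff_zero)
    have c: "ell1 (cpow (h_seq0 V) 1 m)"
      "synth (cpow (h_seq0 V) 1 m) x = (Abs_fps (\<lambda>i. synth (h_seq0 V i) x) ^ Suc 1) $ m"
      using synth_cpow(1)[of m "h_seq0 V" 1] synth_cpow(2)[of m "h_seq0 V" 1 x] e 3 by auto
    have "complex_of_real (\<Sum>ns\<in>compositions 2 (n - 2). prod_list (map (\<lambda>m. h_KdV v m x) ns))
        = (\<Sum>ns\<in>compositions 2 (n - 2). prod_list (map (\<lambda>m. complex_of_real (h_KdV v m x)) ns))"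
    proof -
      have "complex_of_real (prod_list (map f ns)) = prod_list (map (\<lambda>m. complex_of_real (f m)) ns)" for f and ns :: "nat list"
        by (induction ns) auto
      then show ?thesis by simp
    qed
    also have "\<dots> = (Abs_fps (\<lambda>i. synth (h_seq0 V i) x) ^ 2) $ m"
      unfolding sum_compositions 3 diff_Suc_Suc numeral_2_eq_2 diff_zero
      by (rule fps_power_cong) (use IH 3 in auto)
    finally have sq: "complex_of_real (\<Sum>ns\<in>compositions 2 (n - 2). prod_list (map (\<lambda>m. h_KdV v m x) ns))
        = synth (cpow (h_seq0 V) 1 m) x"
      unfolding c(2) by (simp add: numeral_2_eq_2)
    have dv: "complex_of_real (deriv (h_KdV v (n - 1)) x) = synth (\<lambda>k. dd k * h_seq0 V (n - 1) k) x"
      by (rule of_real_deriv_synth(2)[OF s2[OF n(1)] IH[OF n(1)]])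
    have "h_KdV v n x = (\<Sum>ns\<in>compositions 2 (n - 2). prod_list (map (\<lambda>m. h_KdV v m x) ns)) + deriv (h_KdV v (n - 1)) x"
      using n(2) by (subst h_KdV.simps(3)) auto
    then have "complex_of_real (h_KdV v n x) = synth (cpow (h_seq0 V) 1 m) x + synth (\<lambda>k. dd k * h_seq0 V (n - 1) k) x"
      by (simp only: of_real_add sq dv)
    also have "\<dots> = synth (h_seq0 V n) x"
      unfolding r using c(1) ed[OF n(1)] 3 by (simp add: synth_add)
    finally show ?thesis .
  qed
qed

text \<open>
  \<open>psi \<theta> l V m\<close> is the mean of the coefficient of \<open>\<epsilon> ^ (m + 1)\<close> in \<open>\<Psi>(H)\<close>. The means of the densities
  telescope to it because \<open>L\<close> annihilates means.
\<close>

definition psi :: "complex \<Rightarrow> (int \<Rightarrow> complex) \<Rightarrow> (int \<Rightarrow> complex) \<Rightarrow> nat \<Rightarrow> complex" where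
  "psi \<theta> l V m = psum (pcoef \<theta>) (hs (pcoef \<theta>) (qcoef \<theta>) l V) m 0"

lemma psum_qcoef: "psum (qcoef \<theta>) h m n = \<theta> * psum (pcoef \<theta>) h m n"
  by (simp add: psum_def sum_distrib_left qcoef_eq mult.assoc)

text \<open>At frequency 0 the recursion expresses density n + 1 as \<open>psi\<close> at n minus
  \<theta> times \<open>psi\<close> at n + 1; the weights \<theta>^(j-n) make neighbouring terms
  cancel, and \<open>psi\<close> at 0 is an empty sum.\<close>

lemma sum_hs_telescope:
  assumes "\<theta> \<noteq> 0" "l 0 = 0"
  shows "(\<Sum>j=1..n. 1 / \<theta> ^ (n - j) * hs (pcoef \<theta>) (qcoef \<theta>) l V j 0) = - \<theta> * psi \<theta> l V n"
proof (induction n)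
  case 0
  then show ?case by (simp add: psi_def psum_def)
next
  case (Suc n)
  let ?h = "hs (pcoef \<theta>) (qcoef \<theta>) l V"
  have "(\<Sum>j=1..Suc n. 1 / \<theta> ^ (Suc n - j) * ?h j 0) = (\<Sum>j=1..n. 1 / \<theta> * (1 / \<theta> ^ (n - j) * ?h j 0)) + ?h (Suc n) 0"
    by (simp add: Suc_diff_le del: hs.simps)
  also have "\<dots> = 1 / \<theta> * (- \<theta> * psi \<theta> l V n) + ?h (Suc n) 0"
    by (simp only: sum_distrib_left[symmetric] Suc.IH)
  also have "\<dots> = - \<theta> * psi \<theta> l V (Suc n)"
    using assms by (simp add: psi_def psum_qcoef)
  finally show ?case .
qed

lemma torus_integral_ht_ILW:
  assumes d: "0 < \<delta>" and V: "sob \<kappa> V" and v: "\<And>x. complex_of_real (v x) = synth V x"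
    and "int n + 1 \<le> \<kappa>"
  shows "torus_integral (ht_ILW \<delta> v n) = 2 * of_real pi * ((- (\<i> * of_real \<delta>)) ^ (if even n then 0 else 1) / (of_real \<delta>)\<^sup>2 *
      (- (\<i> * of_real \<delta>) * psi (\<i> * of_real \<delta>) (L_symbol \<delta>) V n))"
proof -
  let ?\<theta> = "\<i> * complex_of_real \<delta>"
  let ?c = "(- ?\<theta>) ^ (if even n then 0 else 1) / (of_real \<delta>)\<^sup>2"
  let ?F = "\<lambda>m. ?c * (\<Sum>j=1..n. 1 / ?\<theta> ^ (n - j) * h_seq \<delta> V j m)"
  have e: "ell1 (\<lambda>m. 1 / ?\<theta> ^ (n - j) * h_seq \<delta> V j m)" if "j \<in> {1..n}" for j
    using that assms(4) by (intro ell1_scale ell1_h_seq[OF d V]) auto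
  have "ht_ILW \<delta> v n x = synth ?F x" for x
  proof -
    have "h_ILW \<delta> v j x = synth (h_seq \<delta> V j) x" if "j \<in> {1..n}" for j
      using h_ILW_synth[OF d V v, of j] that assms(4) by auto
    then have "ht_ILW \<delta> v n x = ?c * (\<Sum>j=1..n. 1 / ?\<theta> ^ (n - j) * synth (h_seq \<delta> V j) x)"
      by (simp add: ht_ILW_def)
    also have "\<dots> = synth ?F x"
    proof -
      have "synth (\<lambda>m. \<Sum>j=1..n. 1 / ?\<theta> ^ (n - j) * h_seq \<delta> V j m) x
          = (\<Sum>j=1..n. synth (\<lambda>m. 1 / ?\<theta> ^ (n - j) * h_seq \<delta> V j m) x)"
        by (rule synth_sum) (rule e)
      then show ?thesis by (simp only: synth_scale)
    qed
    finally show ?thesis .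
  qed
  then have "torus_integral (ht_ILW \<delta> v n) = torus_integral (synth ?F)" by presburger
  also have "\<dots> = 2 * of_real pi * ?F 0"
    by (intro torus_integral_synth ell1_scale ell1_sum e)
  also have "?F 0 = ?c * (- ?\<theta> * psi ?\<theta> (L_symbol \<delta>) V n)"
    using sum_hs_telescope[where \<theta> = ?\<theta> and l = "L_symbol \<delta>" and V = V and n = n] d by simp
  finally show ?thesis .
qed

lemma Re_of_real_mult: "Re (of_real c * z) = c * Re z"
  by simp

lemma E_ILW_zero_eq:
  assumes "0 < \<delta>" "sob \<kappa> V" "\<And>x. complex_of_real (v x) = synth V x" "2 \<le> \<kappa>"
  shows "E_ILW_zero \<delta> v = of_real pi * psi (\<i> * of_real \<delta>) (L_symbol \<delta>) V 1"
  using torus_integral_ht_ILW[OF assms(1-3), of 1] assms(1,4)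
  by (simp add: E_ILW_zero_def power2_eq_square)

text \<open>For odd index the two factors -\<theta> multiply to -\<delta>^2, so no power of \<delta>
  survives the normalisation.\<close>

lemma E_ILW_eq:
  assumes "0 < \<delta>" "sob s V" "\<And>x. complex_of_real (v x) = synth V x" "2 * int \<kappa> + 2 \<le> s"
  shows "E_ILW \<kappa> \<delta> v = (-1) ^ \<kappa> * pi * Re (psi (\<i> * of_real \<delta>) (L_symbol \<delta>) V (2 * \<kappa> + 1))"
proof -
  let ?\<psi> = "psi (\<i> * of_real \<delta>) (L_symbol \<delta>) V (2 * \<kappa> + 1)"
  have "torus_integral (ht_ILW \<delta> v (2 * \<kappa> + 1)) = of_real (- 2 * pi) * ?\<psi>"
    using torus_integral_ht_ILW[OF assms(1-3), of "2 * \<kappa> + 1"] assms(1,4)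
    by (simp add: power2_eq_square)
  then show ?thesis unfolding E_ILW_def by (simp only: Re_of_real_mult) (simp add: mult_ac)
qed

text \<open>For even index the prefactor -\<theta> / \<delta>^2 is 1 / \<theta>. Taking the real
  part is what will turn this singular expression into a symmetric difference quotient.\<close>

lemma E_ILW_half_eq:
  assumes "0 < \<delta>" "sob s V" "\<And>x. complex_of_real (v x) = synth V x" "2 * int \<kappa> + 1 \<le> s"
  shows "E_ILW_half \<kappa> \<delta> v = (-1) ^ (\<kappa> + 1) * (3 / (4 * real \<kappa>)) *
    (2 * pi * Re (psi (\<i> * of_real \<delta>) (L_symbol \<delta>) V (2 * \<kappa>) / (\<i> * of_real \<delta>)))"
proof -
  let ?\<psi> = "psi (\<i> * of_real \<delta>) (L_symbol \<delta>) V (2 * \<kappa>)"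
  have "torus_integral (ht_ILW \<delta> v (2 * \<kappa>)) = 2 * of_real pi * (1 / (of_real \<delta>)\<^sup>2 * (- (\<i> * of_real \<delta>) * ?\<psi>))"
    using torus_integral_ht_ILW[OF assms(1-3), of "2 * \<kappa>"] assms(4) by simp
  also have "\<dots> = of_real (2 * pi) * (?\<psi> / (\<i> * of_real \<delta>))"
    using assms(1) by (simp add: power2_eq_square field_simps)
  finally have "Re (torus_integral (ht_ILW \<delta> v (2 * \<kappa>))) = 2 * pi * Re (?\<psi> / (\<i> * of_real \<delta>))"
    by (simp only: Re_of_real_mult)
  then show ?thesis unfolding E_ILW_half_def by simp
qed

lemma E_KdV_eq:
  assumes "sob s V" "\<And>x. complex_of_real (v x) = synth V x" "2 * int \<kappa> + 3 \<le> s"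
  shows "E_KdV \<kappa> v = (-1) ^ \<kappa> * pi * Re (psi 0 dd V (2 * \<kappa> + 1))"
proof -
  let ?h = "h_seq0 V (2 * \<kappa> + 2)"
  have e: "ell1 ?h" using assms(3) by (intro ell1_h_seq0[OF assms(1)]) auto
  have eq: "complex_of_real (h_KdV v (2 * \<kappa> + 2) x) = synth ?h x" for x
    by (rule h_KdV_synth[OF assms(1,2)]) (use assms(3) in auto)
  have hr: "h_KdV v (2 * \<kappa> + 2) x = Re (synth ?h x)" for x
    using arg_cong[OF eq, of Re] by simp
  have "(synth ?h has_integral torus_integral (synth ?h)) {0..2 * pi}"
    by (intro torus_integral_continuous(2) continuous_synth e)
  from has_integral_linear[OF this bounded_linear_Re]
  have "(h_KdV v (2 * \<kappa> + 2) has_integral Re (torus_integral (synth ?h))) {0..2 * pi}"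
    unfolding o_def hr[symmetric] .
  moreover have "continuous_on {0..2 * pi} (h_KdV v (2 * \<kappa> + 2))"
    unfolding hr[abs_def] by (intro continuous_intros continuous_synth e)
  ultimately have "torus_integral (h_KdV v (2 * \<kappa> + 2)) = Re (torus_integral (synth ?h))"
    using torus_integral_continuous(1) integral_unique by metis
  also have "\<dots> = Re (of_real (2 * pi) * ?h 0)"
    unfolding torus_integral_synth[OF e] by simp
  also have "?h 0 = psi 0 dd V (2 * \<kappa> + 1)"
    by (simp add: psi_def psum_qcoef_0)
  finally show ?thesis unfolding E_KdV_def Re_of_real_mult by simp
qed

subsection \<open>Extension of the identities by density\<close>

text \<open>Continuity of the variation in the base point and in the direction, which carries
  identities from trigonometric polynomials to Sobolev data.\<close>

lemma ks_slim:
  fixes \<kappa> :: int and b :: nat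
  assumes h: "\<And>i. i \<le> n \<Longrightarrow> slim (\<kappa> - int i) \<F> (\<lambda>r. h r i) (h' i)"
    and W: "slim (\<kappa> - int b) \<F> W W'"
    and l: "\<And>n. (cmod (l n))\<^sup>2 \<le> C * weight n powi 1"
    and l': "\<And>n. (cmod (l' n))\<^sup>2 \<le> D * weight n powi (1 + int b)"
    and "int n + int b \<le> 2 * \<kappa> + 1"
  shows "slim (\<kappa> - int n - int b) \<F> (\<lambda>r. ks p q l p' q' l' (h r) (W r) n) (ks p q l p' q' l' h' W' n)"
  using h assms(5)
proof (induction n rule: less_induct)
  case (less n)
  let ?k = "\<lambda>r. ks p q l p' q' l' (h r) (W r)" and ?k' = "ks p q l p' q' l' h' W'"
  show ?case
  proof (cases n)
    case 0
    then show ?thesis using slim_scale[OF tendsto_const[of "-1"] W] by simp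
  next
    case (Suc m)
    have IH: "slim (\<kappa> - int i - int b) \<F> (\<lambda>r. ?k r i) (?k' i)" if "i < n" for i
      using that less by auto
    have b: "int m + int b \<le> 2 * \<kappa> + 1" "int (Suc m) + int b \<le> 2 * \<kappa> + 1"
      using less.prems Suc by auto
    have "slim (\<kappa> - int n - int b) \<F> (\<lambda>r x. (dpsum p (h r) (?k r) (h r) m x + psum p' (h r) m x)
        - (dpsum q (h r) (?k r) (h r) (Suc m) x + psum q' (h r) (Suc m) x)
        + (l x * ?k r m x + l' x * h r m x)) (?k' (Suc m))"
      unfolding ks.simps
    proof (intro slim_add slim_diff)
      show "slim (\<kappa> - int n - int b) \<F> (\<lambda>r. dpsum p (h r) (?k r) (h r) m) (dpsum p h' ?k' h' m)"
        by (rule slim_mono[OF _ dpsum_slim[where \<kappa> = \<kappa> and b = b]]) (use less.prems IH b Suc in auto)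
      show "slim (\<kappa> - int n - int b) \<F> (\<lambda>r. dpsum q (h r) (?k r) (h r) (Suc m)) (dpsum q h' ?k' h' (Suc m))"
        by (rule slim_mono[OF _ dpsum_slim[where \<kappa> = \<kappa> and b = b]]) (use less.prems IH b Suc in auto)
      show "slim (\<kappa> - int n - int b) \<F> (\<lambda>r. psum p' (h r) m) (psum p' h' m)"
        by (rule slim_mono[OF _ psum_slim[where \<kappa> = \<kappa>]]) (use less.prems b Suc in auto)
      show "slim (\<kappa> - int n - int b) \<F> (\<lambda>r. psum q' (h r) (Suc m)) (psum q' h' (Suc m))"
        by (rule slim_mono[OF _ psum_slim[where \<kappa> = \<kappa>]]) (use less.prems b Suc in auto)
      have "slim (\<kappa> - int m - int b - 1) \<F> (\<lambda>r x. l x * ?k r m x) (\<lambda>x. l x * ?k' m x)"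
        using IH[of m] Suc l by (intro slim_multiplier[where C = C]) auto
      then show "slim (\<kappa> - int n - int b) \<F> (\<lambda>r x. l x * ?k r m x) (\<lambda>x. l x * ?k' m x)"
        using Suc by (simp add: algebra_simps)
      have "slim (\<kappa> - int m - (1 + int b)) \<F> (\<lambda>r x. l' x * h r m x) (\<lambda>x. l' x * h' m x)"
        using less.prems(1)[of m] Suc l' by (intro slim_multiplier[where C = D]) auto
      then show "slim (\<kappa> - int n - int b) \<F> (\<lambda>r x. l' x * h r m x) (\<lambda>x. l' x * h' m x)"
        using Suc by (simp add: algebra_simps)
    qed
    then show ?thesis using Suc by simp
  qed
qed

definition trunc :: "nat \<Rightarrow> (int \<Rightarrow> complex) \<Rightarrow> int \<Rightarrow> complex" where
  "trunc N F = (\<lambda>n. (if \<bar>n\<bar> \<le> int N then 1 else 0) * F n)"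

lemma trunc_slim:
  assumes "sob s F"
  shows "slim s sequentially (\<lambda>N. trunc N F) F"
proof -
  have "slim (s - 0) sequentially (\<lambda>N n. (if \<bar>n\<bar> \<le> int N then 1 else 0) * F n) (\<lambda>n. 1 * F n)"
  proof (rule slim_multiplier[where C = 1])
    show "(\<lambda>N. if \<bar>n\<bar> \<le> int N then 1 else (0::complex)) \<longlonglongrightarrow> 1" for n
    proof (rule tendsto_eventually)
      show "\<forall>\<^sub>F N in sequentially. (if \<bar>n\<bar> \<le> int N then 1 else (0::complex)) = 1"
        using eventually_ge_at_top[of "nat \<bar>n\<bar>"] by eventually_elim auto
    qed
  qed (use assms in auto)
  then show ?thesis by (simp add: trunc_def)
qed

lemma finite_trunc: "finite {n. trunc N F n \<noteq> 0}"
  by (rule finite_subset[of _ "{- int N..int N}"]) (auto simp: trunc_def split: if_splits)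

text \<open>Fourier truncations are trigonometric polynomials, for which the variation has mean
  zero. The dispersive term of the velocity loses three orders, so four orders above \<kappa> leave
  the velocity in H^\<kappa>.\<close>

lemma conservation_seq:
  fixes \<kappa> :: int
  assumes a: "ILW_symbol \<theta> a" "\<And>n. cmod (a n) \<le> (of_int n)\<^sup>2 / 3"
    and l: "\<And>n. l n = dd n + \<theta> * a n" "\<And>n. (cmod (l n))\<^sup>2 \<le> C * weight n powi 1"
    and V: "sob (\<kappa> + 4) V" and n: "int n \<le> 2 * \<kappa> + 1" and "0 \<le> \<kappa>"
  shows "ks (pcoef \<theta>) (qcoef \<theta>) l (\<lambda>_. 0) (\<lambda>_. 0) (\<lambda>_. 0) (hs (pcoef \<theta>) (qcoef \<theta>) l V)
    (\<lambda>n. a n * (dd n * V n) + dd n * conv V V n) n 0 = 0"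
proof -
  let ?h = "\<lambda>V. hs (pcoef \<theta>) (qcoef \<theta>) l V" and ?W = "\<lambda>V n. a n * (dd n * V n) + dd n * conv V V n"
  let ?k = "\<lambda>V. ks (pcoef \<theta>) (qcoef \<theta>) l (\<lambda>_. 0) (\<lambda>_. 0) (\<lambda>_. 0) (?h V) (?W V) n 0"
  have Vs: "slim (\<kappa> + 4) sequentially (\<lambda>N. trunc N V) V" by (rule trunc_slim[OF V])
  have h: "slim (\<kappa> - int i) sequentially (\<lambda>N. ?h (trunc N V) i) (?h V i)" if "i \<le> n" for i
    using that n l(2) by (intro hs_slim[where C = C] slim_mono[OF _ Vs]) auto
  have W: "slim (\<kappa> - int 0) sequentially (\<lambda>N. ?W (trunc N V)) (?W V)"
  proof (intro slim_add)
    have "(cmod (a n * dd n))\<^sup>2 \<le> 1 * weight n powi 3" for n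
    proof -
      have "(cmod (a n))\<^sup>2 \<le> ((of_int n)\<^sup>2 / 3)\<^sup>2" using a(2) by (intro power_mono) auto
      also have "\<dots> \<le> (weight n)\<^sup>2" by (intro power_mono) (auto simp: weight_def)
      finally have "(cmod (a n))\<^sup>2 * (cmod (dd n))\<^sup>2 \<le> (weight n)\<^sup>2 * (1 * weight n powi 1)"
        by (intro mult_mono dd_weight) auto
      moreover have "(weight n)\<^sup>2 * (1 * weight n powi 1) = 1 * weight n powi 3"
        by (simp add: power2_eq_square power3_eq_cube)
      ultimately show ?thesis by (simp only: norm_mult power_mult_distrib)
    qed
    from slim_multiplier[OF _ this _ Vs, of "\<lambda>_ n. a n * dd n"] this
    have "slim (\<kappa> + 4 - 3) sequentially (\<lambda>N n. a n * dd n * trunc N V n) (\<lambda>n. a n * dd n * V n)"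
      by auto
    then show "slim (\<kappa> - int 0) sequentially (\<lambda>N n. a n * (dd n * trunc N V n)) (\<lambda>n. a n * (dd n * V n))"
      using slim_mono[of "\<kappa> - int 0" "\<kappa> + 4 - 3"] by (simp add: mult.assoc)
    have "slim ((\<kappa> + 4) + (\<kappa> + 4) - (\<kappa> + 4) - 1) sequentially (\<lambda>N. conv (trunc N V) (trunc N V)) (conv V V)"
      using assms(7) by (intro slim_conv Vs) auto
    from slim_multiplier[OF _ dd_weight _ this, of "\<lambda>_ n. dd n"] dd_weight
    have "slim (\<kappa> + 2) sequentially (\<lambda>N n. dd n * conv (trunc N V) (trunc N V) n) (\<lambda>n. dd n * conv V V n)"
      by (simp add: algebra_simps)
    then show "slim (\<kappa> - int 0) sequentially (\<lambda>N n. dd n * conv (trunc N V) (trunc N V) n) (\<lambda>n. dd n * conv V V n)"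
      by (rule slim_mono[rotated]) simp
  qed
  have "slim (\<kappa> - int n - int 0) sequentially
      (\<lambda>N. ks (pcoef \<theta>) (qcoef \<theta>) l (\<lambda>_. 0) (\<lambda>_. 0) (\<lambda>_. 0) (?h (trunc N V)) (?W (trunc N V)) n)
      (ks (pcoef \<theta>) (qcoef \<theta>) l (\<lambda>_. 0) (\<lambda>_. 0) (\<lambda>_. 0) (?h V) (?W V) n)"
    by (rule ks_slim[OF h W l(2), where D = 0]) (use n in auto)
  then have "(\<lambda>N. ?k (trunc N V)) \<longlonglongrightarrow> ?k V"
    by (rule slim_eval)
  moreover have "?k (trunc N V) = 0" for N
  proof -
    define U where "U = trig_of (trunc N V)"
    have U: "trunc N V = coef U" unfolding U_def by (rule coef_trig_of[OF finite_trunc, symmetric])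
    have "?W (coef U) = coef (mlt a (mlt dd U) + mlt dd (U * U))"
      by (rule ext) (simp add: conv_coef)
    then show ?thesis
      unfolding U using conservation_trig[OF a(1) l(1), of U n] by (simp only:)
  qed
  ultimately have "(\<lambda>N. 0) \<longlonglongrightarrow> ?k V" by simp
  then show ?thesis by (rule LIMSEQ_unique[OF _ tendsto_const])
qed

text \<open>With one order lost to the \<theta>-derivative, index 2 \<kappa> exhausts the admissible
  range; the density argument therefore works for V merely in H^\<kappa>.\<close>

lemma half_identity:
  fixes \<kappa> :: nat
  assumes V: "sob (int \<kappa>) V"
  defines "h \<equiv> h_seq0 V"
  defines "y \<equiv> ks (pcoef 0) (qcoef 0) dd (\<lambda>j. if j = 2 then 2 / 3 else 0) (\<lambda>j. if j = 1 then 1 else 0)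
    (\<lambda>n. (of_int n)\<^sup>2 / 3) h (\<lambda>_. 0)"
  shows "dpsum (pcoef 0) h y h (2 * \<kappa>) 0 + psum (\<lambda>j. if j = 2 then 2 / 3 else 0) h (2 * \<kappa>) 0 =
    - (2 * of_nat \<kappa> / 3) * psi 0 dd V (2 * \<kappa> + 1)"
proof -
  let ?y = "\<lambda>h. ks (pcoef 0) (qcoef 0) dd (\<lambda>j. if j = 2 then 2 / 3 else 0) (\<lambda>j. if j = 1 then 1 else 0)
    (\<lambda>n. (of_int n)\<^sup>2 / 3) h (\<lambda>_. 0)"
  let ?p = "\<lambda>j. if j = 2 then 2 / 3 else (0::complex)"
  let ?h = "\<lambda>N. h_seq0 (trunc N V)"
  have h: "slim (int \<kappa> - int i) sequentially (\<lambda>N. ?h N i) (h i)" if "i \<le> 2 * \<kappa> + 1" for i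
    unfolding h_def using that dd_weight by (intro hs_slim[where C = 1] trunc_slim V) auto
  have y: "slim (int \<kappa> - int i - int 1) sequentially (\<lambda>N. ?y (?h N) i) (y i)" if "i \<le> 2 * \<kappa>" for i
    unfolding y_def
  proof (rule ks_slim[OF _ _ dd_weight, where D = 1])
    show "(cmod ((of_int n)\<^sup>2 / 3))\<^sup>2 \<le> 1 * weight n powi (1 + int 1)" for n
    proof -
      have "((real_of_int n)\<^sup>2 / 3)\<^sup>2 \<le> (weight n)\<^sup>2" by (intro power_mono) (auto simp: weight_def)
      then show ?thesis by (simp add: norm_divide norm_power)
    qed
  qed (use h that in \<open>auto intro: slim_const\<close>)
  have 1: "(\<lambda>N. dpsum (pcoef 0) (?h N) (?y (?h N)) (?h N) (2 * \<kappa>) 0) \<longlonglongrightarrow> dpsum (pcoef 0) h y h (2 * \<kappa>) 0"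
    by (rule slim_eval[OF dpsum_slim[where \<kappa> = "int \<kappa>" and b = 1]]) (use h y in auto)
  have 2: "(\<lambda>N. psum ?p (?h N) (2 * \<kappa>) 0) \<longlonglongrightarrow> psum ?p h (2 * \<kappa>) 0"
    by (rule slim_eval[OF psum_slim[where \<kappa> = "int \<kappa>"]]) (use h in auto)
  have 3: "(\<lambda>N. psum (pcoef 0) (?h N) (2 * \<kappa> + 1) 0) \<longlonglongrightarrow> psum (pcoef 0) h (2 * \<kappa> + 1) 0"
    by (rule slim_eval[OF psum_slim[where \<kappa> = "int \<kappa>"]]) (use h in auto)
  have eq: "dpsum (pcoef 0) (?h N) (?y (?h N)) (?h N) (2 * \<kappa>) 0 + psum ?p (?h N) (2 * \<kappa>) 0
      = - (2 * of_nat \<kappa> / 3) * psum (pcoef 0) (?h N) (2 * \<kappa> + 1) 0" for N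
    using half_identity_trig[of "trig_of (trunc N V)" "2 * \<kappa>"]
    unfolding coef_trig_of[OF finite_trunc] by simp
  from tendsto_add[OF 1 2]
  have "(\<lambda>N. - (2 * of_nat \<kappa> / 3) * psum (pcoef 0) (?h N) (2 * \<kappa> + 1) 0) \<longlonglongrightarrow>
      dpsum (pcoef 0) h y h (2 * \<kappa>) 0 + psum ?p h (2 * \<kappa>) 0"
    unfolding eq .
  moreover have "(\<lambda>N. - (2 * of_nat \<kappa> / 3) * psum (pcoef 0) (?h N) (2 * \<kappa> + 1) 0) \<longlonglongrightarrow>
      - (2 * of_nat \<kappa> / 3) * psum (pcoef 0) h (2 * \<kappa> + 1) 0"
    by (rule tendsto_mult_left[OF 3])
  ultimately show ?thesis
    unfolding psi_def h_def[symmetric] by (rule LIMSEQ_unique)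
qed

text \<open>The difference quotient in time converges to the variation in the direction of the
  velocity, with only V varying and no order lost. Its mean is zero, so the mean of the density has
  zero derivative on the whole line.\<close>

lemma conservation_flow:
  fixes \<kappa> :: int and V :: "real \<Rightarrow> int \<Rightarrow> complex"
  assumes a: "ILW_symbol \<theta> a" "\<And>n. cmod (a n) \<le> (of_int n)\<^sup>2 / 3"
    and l: "\<And>n. l n = dd n + \<theta> * a n" "\<And>n. (cmod (l n))\<^sup>2 \<le> C * weight n powi 1"
    and V: "\<And>t. sob (\<kappa> + 4) (V t)" and n: "int n \<le> 2 * \<kappa> + 1" "0 \<le> \<kappa>"
    and der: "\<And>t. slim \<kappa> (at 0) (\<lambda>r n. (V (t + r) n - V t n) / of_real r)
      (\<lambda>n. a n * (dd n * V t n) + dd n * conv (V t) (V t) n)"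
  shows "hs (pcoef \<theta>) (qcoef \<theta>) l (V t) n 0 = hs (pcoef \<theta>) (qcoef \<theta>) l (V s) n 0"
proof -
  let ?\<phi> = "\<lambda>t. hs (pcoef \<theta>) (qcoef \<theta>) l (V t) n 0"
  have "(?\<phi> has_vector_derivative 0) (at t)" for t
  proof -
    let ?W = "\<lambda>n. a n * (dd n * V t n) + dd n * conv (V t) (V t) n"
    let ?Q = "\<lambda>r n. (V (t + r) n - V t n) / of_real r"
    have Vt: "sob \<kappa> (V t)" by (rule sob_mono(1)[OF _ V]) simp
    have Vr: "slim \<kappa> (at 0) (\<lambda>r. V (t + r)) (V t)"
    proof -
      have "((\<lambda>r. complex_of_real r) \<longlongrightarrow> of_real 0) (at 0)" by (intro tendsto_intros)
      from slim_add[OF slim_const[OF Vt] slim_scale[OF this der[of t]]]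
      have "slim \<kappa> (at 0) (\<lambda>r n. V t n + of_real r * ?Q r n) (V t)" by simp
      then show ?thesis
        by (rule slim_cong[rotated]) (auto simp: eventually_at_filter)
    qed
    have "slim (\<kappa> - int n - int 0) (at 0)
      (\<lambda>r m. (hs (pcoef \<theta>) (qcoef \<theta>) l (V (t + r)) n m - hs (pcoef \<theta>) (qcoef \<theta>) l (V t) n m) / of_real r)
      (ks (pcoef \<theta>) (qcoef \<theta>) l (\<lambda>_. 0) (\<lambda>_. 0) (\<lambda>_. 0) (hs (pcoef \<theta>) (qcoef \<theta>) l (V t)) ?W n)"
      by (rule quotient_slim[OF refl refl refl Vr slim_const[OF Vt], where C = C and D = 0])
         (use l(2) n der in auto)
    from slim_eval[OF this, of 0]
    have "((\<lambda>r. (?\<phi> (t + r) - ?\<phi> t) / of_real r) \<longlongrightarrow> 0) (at 0)"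
      using conservation_seq[OF a l V n, of t] by simp
    then have "((\<lambda>r. (?\<phi> (t + r) - ?\<phi> t) /\<^sub>R (t + r - t)) \<longlongrightarrow> 0) (at 0)"
      by (simp add: scaleR_conv_of_real divide_inverse mult.commute)
    then show ?thesis
      unfolding has_vector_derivative_iff_quotient
      by (subst LIM_offset_zero_iff) auto
  qed
  then obtain c where "\<And>t. ?\<phi> t = c"
    using has_vector_derivative_zero_constant[of UNIV ?\<phi>] by auto
  then show ?thesis by simp
qed

subsection \<open>Time derivatives of Fourier coefficients\<close>

lemma slim_dominated:
  assumes ev: "\<forall>\<^sub>F r in \<F>. \<forall>n. (cmod (F r n))\<^sup>2 \<le> C * weight n powi (- K)"
    and G: "\<And>n. (cmod (G n))\<^sup>2 \<le> C * weight n powi (- K)"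
    and lim: "\<And>n. ((\<lambda>r. F r n) \<longlongrightarrow> G n) \<F>" and K: "s + 1 \<le> K" and C: "0 \<le> C"
  shows "slim s \<F> F G"
  unfolding slim_def
proof (intro conjI)
  show "\<forall>\<^sub>F r in \<F>. sob s (F r)"
    using ev by eventually_elim (rule sob_decay(1)[OF _ K C], blast)
  show "sob s G" by (rule sob_decay(1)[OF G K C])
  have "((\<lambda>r. \<Sum>\<^sub>\<infinity>n. weight n powi s * (cmod (F r n - G n))\<^sup>2) \<longlongrightarrow> (\<Sum>\<^sub>\<infinity>n::int. 0)) \<F>"
  proof (rule infsum_dominated_tendsto)
    show "(\<lambda>n. 4 * C * (1 / weight n)) summable_on UNIV"
      by (intro summable_on_cmult_right summable_on_inverse_weight)
    show "\<forall>\<^sub>F r in \<F>. \<forall>n. norm (weight n powi s * (cmod (F r n - G n))\<^sup>2) \<le> 4 * C * (1 / weight n)"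
      using ev
    proof eventually_elim
      case (elim r)
      show ?case
      proof
        fix n
        have "(cmod (F r n - G n))\<^sup>2 \<le> 2 * (cmod (F r n))\<^sup>2 + 2 * (cmod (G n))\<^sup>2"
          using cmod_add_square_le[of "F r n" "- G n"] by simp
        also have "\<dots> \<le> 4 * C * weight n powi (- K)"
          using elim[rule_format, of n] G[of n] by simp
        finally have "weight n powi s * (cmod (F r n - G n))\<^sup>2 \<le> weight n powi s * (4 * C * weight n powi (- K))"
          using weight_powi_pos[of n s] by (intro mult_left_mono) auto
        also have "\<dots> = 4 * C * weight n powi (s - K)"
          using weight_pos[of n] by (simp add: power_int_diff power_int_minus field_simps)
        also have "\<dots> \<le> 4 * C * weight n powi (- 1)"
          using K C weight_ge_1[of n] by (intro mult_left_mono power_int_increasing) auto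
        finally show "norm (weight n powi s * (cmod (F r n - G n))\<^sup>2) \<le> 4 * C * (1 / weight n)"
          using weight_powi_pos[of n s] by (simp add: power_int_minus inverse_eq_divide)
      qed
    qed
    have "((\<lambda>r. weight n powi s * (cmod (F r n - G n))\<^sup>2) \<longlongrightarrow> weight n powi s * (cmod (G n - G n))\<^sup>2) \<F>" for n
      by (intro tendsto_intros lim)
    then show "((\<lambda>r. weight n powi s * (cmod (F r n - G n))\<^sup>2) \<longlongrightarrow> 0) \<F>" for n
      by simp
    show "norm (0::real) \<le> 4 * C * (1 / weight n)" for n
      using C weight_pos[of n] by simp
  qed
  then show "((\<lambda>r. sobsq s (\<lambda>n. F r n - G n)) \<longlongrightarrow> 0) \<F>"
    by (simp add: sobsq_def)
qed

lemma has_vector_derivative_bound: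
  fixes \<phi> :: "real \<Rightarrow> 'a::real_normed_vector"
  assumes "\<And>s. s \<in> {a..b} \<Longrightarrow> (\<phi> has_vector_derivative \<phi>' s) (at s)"
    and B: "\<And>s. s \<in> {a..b} \<Longrightarrow> norm (\<phi>' s) \<le> B" and "x \<in> {a..b}" "y \<in> {a..b}"
  shows "norm (\<phi> x - \<phi> y) \<le> B * \<bar>x - y\<bar>"
proof -
  have "norm (\<phi> x - \<phi> y) \<le> B * norm (x - y)"
  proof (rule differentiable_bound[where S = "{a..b}" and f' = "\<lambda>s h. h *\<^sub>R \<phi>' s"])
    fix s assume s: "s \<in> {a..b}"
    show "(\<phi> has_derivative (\<lambda>h. h *\<^sub>R \<phi>' s)) (at s within {a..b})"
      using assms(1)[OF s] by (auto simp: has_vector_derivative_def intro: has_derivative_at_withinI)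
    show "onorm (\<lambda>h. h *\<^sub>R \<phi>' s) \<le> B"
    proof (rule onorm_le)
      show "norm (h *\<^sub>R \<phi>' s) \<le> B * norm h" for h
        using mult_right_mono[OF B[OF s], of "\<bar>h\<bar>"] by (simp add: mult.commute)
    qed
  qed (use assms(3,4) in auto)
  then show ?thesis by simp
qed

lemma spacetime_per_C: "spacetime_class N v \<Longrightarrow> per_C N (v t)"
proof -
  assume v: "spacetime_class N v"
  have c: "continuous_on UNIV (\<lambda>(t, x). (deriv ^^ N) (v t) x)"
    using v unfolding spacetime_class_def by blast
  have "continuous_on UNIV (\<lambda>x. (\<lambda>(t, x). (deriv ^^ N) (v t) x) (t, x))"
    by (rule continuous_on_compose2[OF c]) (auto intro!: continuous_intros)
  then have "continuous_on UNIV ((deriv ^^ N) (v t))"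
    by (simp only: prod.case)
  then show "per_C N (v t)"
    using v unfolding spacetime_class_def per_C_def periodic_mean_zero_def by blast
qed

lemma spacetime_bound:
  assumes "spacetime_class N v" "k \<le> N"
  shows "\<exists>B. \<forall>t\<in>{-T..T}. \<forall>x\<in>{0..2 * pi}. \<bar>(deriv ^^ k) (v t) x\<bar> \<le> B"
proof -
  let ?f = "\<lambda>(t, x). (deriv ^^ k) (v t) x"
  have c: "continuous_on UNIV ?f"
    using assms unfolding spacetime_class_def by blast
  have "compact (?f ` ({-T..T} \<times> {0..2 * pi}))"
    by (rule compact_continuous_image[OF continuous_on_subset[OF c subset_UNIV] compact_Times[OF compact_Icc compact_Icc]])
  then have "\<exists>B. \<forall>z\<in>?f ` ({-T..T} \<times> {0..2 * pi}). norm z \<le> B"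
    unfolding bounded_iff[symmetric] by (rule compact_imp_bounded)
  then obtain B where B: "\<forall>z\<in>?f ` ({-T..T} \<times> {0..2 * pi}). norm z \<le> B"
    by (rule exE)
  have "norm (?f (t, x)) \<le> B" if "t \<in> {-T..T}" "x \<in> {0..2 * pi}" for t x
    by (rule bspec[OF B imageI]) (use that in simp)
  then have "\<bar>(deriv ^^ k) (v t) x\<bar> \<le> B" if "t \<in> {-T..T}" "x \<in> {0..2 * pi}" for t x
    using that by (simp only: prod.case real_norm_def)
  then show ?thesis by blast
qed

definition flow_field :: "(int \<Rightarrow> complex) \<Rightarrow> (int \<Rightarrow> complex) \<Rightarrow> int \<Rightarrow> complex" where
  "flow_field a V = (\<lambda>n. a n * (dd n * V n) + dd n * conv V V n)"

text \<open>From \<kappa> + 5 derivatives the coefficients gain decay of that order, uniformly on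
  compact time intervals. The dispersion costs three orders; the square is estimated in
  H^(\<kappa>+4), which leaves it no worse.\<close>

lemma flow_field_decay:
  fixes \<kappa> :: nat
  assumes a: "\<And>n. cmod (a n) \<le> (of_int n)\<^sup>2 / 3" and v: "spacetime_class (\<kappa> + 5) v"
  shows "\<exists>C\<ge>0. \<forall>t\<in>{-T..T}. \<forall>n. (cmod (flow_field a (fc (v t)) n))\<^sup>2 \<le> C * weight n powi (- (int \<kappa> + 2))"
proof -
  obtain B0 B1 where B: "\<And>t x. t \<in> {-T..T} \<Longrightarrow> x \<in> {0..2 * pi} \<Longrightarrow> \<bar>v t x\<bar> \<le> B0"
    "\<And>t x. t \<in> {-T..T} \<Longrightarrow> x \<in> {0..2 * pi} \<Longrightarrow> \<bar>(deriv ^^ (\<kappa> + 5)) (v t) x\<bar> \<le> B1"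
    using spacetime_bound[OF v, of 0 T] spacetime_bound[OF v, of "\<kappa> + 5" T] by (metis funpow_0 le0 order_refl)
  define C1 where "C1 = 2 ^ Suc (\<kappa> + 5) * (max B0 B1)\<^sup>2"
  have C1: "0 \<le> C1" by (simp add: C1_def)
  have V: "(cmod (fc (v t) n))\<^sup>2 \<le> C1 * weight n powi (- int (\<kappa> + 5))" if "t \<in> {-T..T}" for t n
    unfolding C1_def
    by (rule per_C_decay[OF spacetime_per_C[OF v]]) (use B[OF that] in \<open>auto simp: le_max_iff_disj\<close>)
  let ?S = "\<Sum>\<^sub>\<infinity>n. 1 / weight n"
  let ?k = "int \<kappa> + 4"
  define C2 where "C2 = 9 * 4 powi ?k * ?S * ((C1 * ?S) * (C1 * ?S))"
  have S: "0 \<le> ?S" by (intro infsum_nonneg) (auto simp: weight_pos less_imp_le)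
  have conv: "(cmod (conv (fc (v t)) (fc (v t)) n))\<^sup>2 \<le> C2 * weight n powi (- (int \<kappa> + 3))" if t: "t \<in> {-T..T}" for t n
  proof -
    note d = sob_decay[OF V[OF t], of ?k] 
    have s: "sob ?k (fc (v t))" and s': "sobsq ?k (fc (v t)) \<le> C1 * ?S"
      using d C1 by auto
    note c = sob_conv[OF _ _ _ s s, of ?k]
    have "weight n powi (?k + ?k - ?k - 1) * (cmod (conv (fc (v t)) (fc (v t)) n))\<^sup>2
        \<le> sobsq (?k + ?k - ?k - 1) (conv (fc (v t)) (fc (v t)))"
      by (rule sob_eval_le[OF c(2)]) auto
    also have "\<dots> \<le> 9 * 4 powi ?k * ?S * (sobsq ?k (fc (v t)) * sobsq ?k (fc (v t)))"
      by (rule c(3)) auto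
    also have "\<dots> \<le> C2"
      unfolding C2_def using S C1 s' by (intro mult_left_mono mult_mono sobsq_nonneg) auto
    finally have "weight n powi (int \<kappa> + 3) * (cmod (conv (fc (v t)) (fc (v t)) n))\<^sup>2 \<le> C2"
      by (simp add: add.commute)
    then show ?thesis
      using weight_powi_pos[of n "int \<kappa> + 3"] unfolding power_int_minus by (simp add: field_simps)
  qed
  have C2: "0 \<le> C2" unfolding C2_def using S C1 by simp
  have "(cmod (flow_field a (fc (v t)) n))\<^sup>2 \<le> (2 * C1 + 2 * C2) * weight n powi (- (int \<kappa> + 2))"
    if t: "t \<in> {-T..T}" for t n
  proof -
    have "(cmod (a n))\<^sup>2 \<le> ((of_int n)\<^sup>2 / 3)\<^sup>2" using a by (intro power_mono) auto
    also have "\<dots> \<le> (weight n)\<^sup>2" by (intro power_mono) (auto simp: weight_def)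
    finally have "(cmod (a n * (dd n * fc (v t) n)))\<^sup>2 \<le> (weight n)\<^sup>2 * ((1 * weight n powi 1) * (C1 * weight n powi (- int (\<kappa> + 5))))"
      unfolding norm_mult[of "a n"] norm_mult[of _ "fc (v t) n"] power_mult_distrib
      by (intro mult_mono dd_weight V t) (auto simp: weight_pos less_imp_le)
    also have "\<dots> = C1 * (weight n powi 2 * weight n powi 1 * weight n powi (- int (\<kappa> + 5)))"
      by simp
    also have "weight n powi 2 * weight n powi 1 * weight n powi (- int (\<kappa> + 5)) = weight n powi (- (int \<kappa> + 2))"
    proof -
      have w: "weight n \<noteq> 0" using weight_pos[of n] by simp
      have e: "2 + 1 + - int (\<kappa> + 5) = - (int \<kappa> + 2)" by simp
      show ?thesis unfolding power_int_add[OF disjI1[OF w], symmetric] e ..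
    qed
    finally have 1: "(cmod (a n * (dd n * fc (v t) n)))\<^sup>2 \<le> C1 * weight n powi (- (int \<kappa> + 2))" .
    have "(cmod (dd n * conv (fc (v t)) (fc (v t)) n))\<^sup>2 \<le> (1 * weight n powi 1) * (C2 * weight n powi (- (int \<kappa> + 3)))"
      unfolding norm_mult[of _ "conv (fc (v t)) (fc (v t)) n"] power_mult_distrib
      by (intro mult_mono dd_weight conv t) (auto simp: weight_pos less_imp_le)
    also have "\<dots> = C2 * (weight n powi 1 * weight n powi (- (int \<kappa> + 3)))" by simp
    also have "weight n powi 1 * weight n powi (- (int \<kappa> + 3)) = weight n powi (- (int \<kappa> + 2))"
    proof -
      have w: "weight n \<noteq> 0" using weight_pos[of n] by simp
      have e: "1 + - (int \<kappa> + 3) = - (int \<kappa> + 2)" by simp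
      show ?thesis unfolding power_int_add[OF disjI1[OF w], symmetric] e ..
    qed
    finally have 2: "(cmod (dd n * conv (fc (v t)) (fc (v t)) n))\<^sup>2 \<le> C2 * weight n powi (- (int \<kappa> + 2))" .
    have "(cmod (flow_field a (fc (v t)) n))\<^sup>2 \<le> 2 * (cmod (a n * (dd n * fc (v t) n)))\<^sup>2 + 2 * (cmod (dd n * conv (fc (v t)) (fc (v t)) n))\<^sup>2"
      unfolding flow_field_def by (rule cmod_add_square_le)
    then show ?thesis using 1 2 by (simp add: algebra_simps)
  qed
  then show ?thesis using C1 C2 by (intro exI[of _ "2 * C1 + 2 * C2"]) auto
qed

lemma decay_ell1:
  assumes "\<And>n. (cmod (F n))\<^sup>2 \<le> C * weight n powi (- K)" "2 \<le> K" "0 \<le> C"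
  shows "ell1 F" "cmod (synth F x) \<le> sqrt C * (\<Sum>\<^sub>\<infinity>n. 1 / weight n)"
proof -
  have le: "cmod (F n) \<le> sqrt C * (1 / weight n)" for n
  proof -
    have "(cmod (F n))\<^sup>2 \<le> C * weight n powi (- K)" by (rule assms(1))
    also have "\<dots> \<le> C * weight n powi (- 2)"
      using assms(2,3) weight_ge_1[of n] by (intro mult_left_mono power_int_increasing) auto
    also have "\<dots> = (sqrt C * (1 / weight n))\<^sup>2"
      using assms(3) by (simp add: power_int_minus power_mult_distrib power_divide inverse_eq_divide)
    finally show ?thesis
      by (rule power2_le_imp_le) (use assms(3) weight_pos[of n] in simp)
  qed
  have s: "(\<lambda>n. sqrt C * (1 / weight n)) summable_on UNIV"
    by (intro summable_on_cmult_right summable_on_inverse_weight)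
  show e: "ell1 F"
    unfolding ell1_def by (rule summable_on_comparison_test[OF s le]) auto
  have "cmod (synth F x) \<le> (\<Sum>\<^sub>\<infinity>n. norm (F n * cis (of_int n * x)))"
    unfolding synth_def using e by (intro norm_infsum_bound) (simp add: ell1_def norm_mult)
  also have "\<dots> \<le> (\<Sum>\<^sub>\<infinity>n. sqrt C * (1 / weight n))"
    using e s le by (intro infsum_mono) (simp_all add: ell1_def norm_mult)
  finally show "cmod (synth F x) \<le> sqrt C * (\<Sum>\<^sub>\<infinity>n. 1 / weight n)"
    unfolding infsum_cmult_right' .
qed

text \<open>Differentiation under the integral. A solution is only pointwise differentiable in time,
  so the majorant comes from the equation: the decay of the velocity coefficients bounds the time
  derivative uniformly, and the mean value inequality bounds the quotients.\<close>

lemma flow_coefficient_derivative: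
  fixes \<kappa> :: nat
  assumes a: "\<And>n. cmod (a n) \<le> (of_int n)\<^sup>2 / 3" and v: "spacetime_class (\<kappa> + 5) v"
    and eq: "\<And>t x. (\<lambda>s. v s x) differentiable (at t)"
      "\<And>t x. complex_of_real (deriv (\<lambda>s. v s x) t) = synth (flow_field a (fc (v t))) x"
  shows "((\<lambda>r. (fc (v (s + r)) n - fc (v s) n) / of_real r) \<longlongrightarrow> flow_field a (fc (v s)) n) (at 0)"
proof -
  obtain C where C: "0 \<le> C" "\<And>t n. t \<in> {-(\<bar>s\<bar> + 1)..\<bar>s\<bar> + 1} \<Longrightarrow>
      (cmod (flow_field a (fc (v t)) n))\<^sup>2 \<le> C * weight n powi (- (int \<kappa> + 2))"
    using flow_field_decay[OF a v, of "\<bar>s\<bar> + 1"] by blast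
  define M where "M = sqrt C * (\<Sum>\<^sub>\<infinity>n. 1 / weight n)"
  have vt: "((\<lambda>s. v s x) has_real_derivative deriv (\<lambda>s. v s x) t) (at t)" for t x
    using eq(1) DERIV_deriv_iff_real_differentiable by blast
  have M: "\<bar>deriv (\<lambda>s. v s x) t\<bar> \<le> M" if "t \<in> {s - 1..s + 1}" for t x
  proof -
    have "t \<in> {-(\<bar>s\<bar> + 1)..\<bar>s\<bar> + 1}" using that by auto
    from decay_ell1(2)[OF C(2)[OF this], of x] C(1) show ?thesis
      unfolding eq(2)[symmetric] M_def by simp
  qed
  have lip: "\<bar>v (s + r) x - v s x\<bar> \<le> M * \<bar>r\<bar>" if r: "-1 \<le> r" "r \<le> 1" for r x
    using has_vector_derivative_bound[of "s - 1" "s + 1" "\<lambda>s. v s x" "deriv (\<lambda>s. v s x)" M "s + r" s] vt M that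
    by (auto simp: has_real_derivative_iff_has_vector_derivative)
  have cv: "continuous_on UNIV (\<lambda>x. complex_of_real (v t x))" for t
    using per_C_continuous[OF spacetime_per_C[OF v], of 0] by (auto intro: continuous_intros)
  have es: "ell1 (flow_field a (fc (v s)))"
    by (rule decay_ell1(1)[OF C(2) _ C(1)]) auto
  \<comment> \<open>Restricting the increments to modulus below 1 makes the Lipschitz bound hold
    along the entire test sequence, as dominated convergence requires.\<close>
  have "((\<lambda>r. (fc (v (s + r)) n - fc (v s) n) / of_real r) \<longlongrightarrow> flow_field a (fc (v s)) n) (at 0 within {-1<..<1})"
    unfolding tendsto_at_iff_sequentially
  proof (intro allI impI)
    fix X :: "nat \<Rightarrow> real" assume X: "\<forall>i. X i \<in> {-1<..<1} - {0}" "X \<longlonglongrightarrow> 0"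
    define f where "f k x = complex_of_real ((v (s + X k) x - v s x) / X k) * cis (- (of_int n * x))" for k x
    define g where "g x = synth (flow_field a (fc (v s))) x * cis (- (of_int n * x))" for x
    have f: "(f k has_integral (2 * of_real pi * ((fc (v (s + X k)) n - fc (v s) n) / of_real (X k)))) {0..2 * pi}" for k
    proof -
      have "((\<lambda>x. (1 / of_real (X k)) * (complex_of_real (v (s + X k) x) * cis (- (of_int n * x))
            - complex_of_real (v s x) * cis (- (of_int n * x)))) has_integral
          (1 / of_real (X k)) * (2 * of_real pi * fc (v (s + X k)) n - 2 * of_real pi * fc (v s) n)) {0..2 * pi}"
        by (intro has_integral_mult_right has_integral_diff has_integral_fourier_coeff cv)
      then show ?thesis
        unfolding f_def[abs_def] by (simp add: divide_inverse algebra_simps)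
    qed
    have g: "(g has_integral (2 * of_real pi * flow_field a (fc (v s)) n)) {0..2 * pi}"
      using has_integral_fourier_coeff[OF continuous_synth[OF es], of n]
      unfolding g_def fourier_coeff_synth[OF es] .
    have "(\<lambda>k. integral {0..2 * pi} (f k)) \<longlonglongrightarrow> integral {0..2 * pi} g"
    proof (rule dominated_convergence(2))
      show "f k integrable_on {0..2 * pi}" for k using f by blast
      show "(\<lambda>_::real. M) integrable_on {0..2 * pi}" by (rule integrable_const_ivl)
      show "norm (f k x) \<le> M" for k x
        using lip[of "X k" x] X(1)[rule_format, of k]  
        by (simp add: f_def norm_mult norm_divide divide_le_eq abs_less_iff del: of_real_diff of_real_divide)
      show "(\<lambda>k. f k x) \<longlonglongrightarrow> g x" for x
      proof -
        have "((\<lambda>h. (v (s + h) x - v s x) / h) \<longlongrightarrow> deriv (\<lambda>s. v s x) s) (at 0)"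
          using vt[of x s] by (simp add: DERIV_def)
        then have "(\<lambda>k. (v (s + X k) x - v s x) / X k) \<longlonglongrightarrow> deriv (\<lambda>s. v s x) s"
          using X unfolding tendsto_at_iff_sequentially by (auto simp: o_def)
        then have "(\<lambda>k. f k x) \<longlonglongrightarrow> complex_of_real (deriv (\<lambda>s. v s x) s) * cis (- (of_int n * x))"
          unfolding f_def by (intro tendsto_intros)
        then show ?thesis unfolding g_def eq(2) .
      qed
    qed
    then have "(\<lambda>k. 2 * of_real pi * ((fc (v (s + X k)) n - fc (v s) n) / of_real (X k))) \<longlonglongrightarrow> 2 * of_real pi * flow_field a (fc (v s)) n"
      unfolding integral_unique[OF f] integral_unique[OF g] .
    from tendsto_mult_left[OF this, of "1 / (2 * of_real pi)"]
    show "((\<lambda>r. (fc (v (s + r)) n - fc (v s) n) / of_real r) \<circ> X) \<longlonglongrightarrow> flow_field a (fc (v s)) n"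
      by (simp add: o_def)
  qed
  moreover have "at (0::real) within {-1<..<1} = at 0"
    by (rule at_within_open) auto
  ultimately show ?thesis by (simp only:)
qed

text \<open>Upgrades convergence of the single coefficients to convergence in H^\<kappa>: by the
  mean value inequality the quotients inherit the decay of the velocity, so they are dominated
  uniformly in the increment.\<close>

lemma flow_slim:
  fixes \<kappa> :: nat
  assumes a: "\<And>n. cmod (a n) \<le> (of_int n)\<^sup>2 / 3" and v: "spacetime_class (\<kappa> + 5) v"
    and eq: "\<And>t x. (\<lambda>s. v s x) differentiable (at t)"
      "\<And>t x. complex_of_real (deriv (\<lambda>s. v s x) t) = synth (flow_field a (fc (v t))) x"
  shows "slim (int \<kappa>) (at 0) (\<lambda>r n. (fc (v (t + r)) n - fc (v t) n) / of_real r) (flow_field a (fc (v t)))"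
proof -
  note D = flow_coefficient_derivative[OF a v eq]
  obtain C where C: "0 \<le> C" "\<And>s n. s \<in> {-(\<bar>t\<bar> + 1)..\<bar>t\<bar> + 1} \<Longrightarrow>
      (cmod (flow_field a (fc (v s)) n))\<^sup>2 \<le> C * weight n powi (- (int \<kappa> + 2))"
    using flow_field_decay[OF a v, of "\<bar>t\<bar> + 1"] by blast
  have der: "((\<lambda>s. fc (v s) n) has_vector_derivative flow_field a (fc (v s)) n) (at s)" for s n
    unfolding has_vector_derivative_iff_quotient
    by (subst LIM_offset_zero_iff) (use D[of s n] in \<open>auto simp: scaleR_conv_of_real divide_inverse mult.commute\<close>)
  have le: "(cmod ((fc (v (t + r)) n - fc (v t) n) / of_real r))\<^sup>2 \<le> C * weight n powi (- (int \<kappa> + 2))"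
    if r: "r \<noteq> 0" "\<bar>r\<bar> < 1" for r n
  proof -
    let ?b = "sqrt (C * weight n powi (- (int \<kappa> + 2)))"
    have nn: "0 \<le> C * weight n powi (- (int \<kappa> + 2))"
      using C(1) weight_powi_pos[of n "- (int \<kappa> + 2)"] by simp
    have "norm (fc (v (t + r)) n - fc (v t) n) \<le> ?b * \<bar>t + r - t\<bar>"
    proof (rule has_vector_derivative_bound[where a = "t - 1" and b = "t + 1"])
      show "((\<lambda>s. fc (v s) n) has_vector_derivative flow_field a (fc (v s)) n) (at s)" for s by (rule der)
      show "cmod (flow_field a (fc (v s)) n) \<le> ?b" if "s \<in> {t - 1..t + 1}" for s
      proof -
        have "s \<in> {-(\<bar>t\<bar> + 1)..\<bar>t\<bar> + 1}" using that by auto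
        from C(2)[OF this, of n] show ?thesis by (rule real_le_rsqrt)
      qed
    qed (use r in auto)
    then have "cmod ((fc (v (t + r)) n - fc (v t) n) / of_real r) \<le> ?b"
      using r by (simp add: norm_divide divide_le_eq)
    then have "(cmod ((fc (v (t + r)) n - fc (v t) n) / of_real r))\<^sup>2 \<le> ?b\<^sup>2"
      by (intro power_mono) auto
    then show ?thesis using nn by simp
  qed
  show ?thesis
  proof (rule slim_dominated[where K = "int \<kappa> + 2" and C = C])
    show "\<forall>\<^sub>F r in at 0. \<forall>n. (cmod ((fc (v (t + r)) n - fc (v t) n) / of_real r))\<^sup>2 \<le> C * weight n powi (- (int \<kappa> + 2))"
      unfolding eventually_at by (intro exI[of _ 1]) (use le in \<open>auto simp: dist_norm\<close>)
    have "t \<in> {-(\<bar>t\<bar> + 1)..\<bar>t\<bar> + 1}" by auto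
    then show "(cmod (flow_field a (fc (v t)) n))\<^sup>2 \<le> C * weight n powi (- (int \<kappa> + 2))" for n
      by (rule C(2))
  qed (use C D in auto)
qed

subsection \<open>The shallow-water limit\<close>

lemma pcoef_tendsto: "(\<theta> \<longlongrightarrow> \<theta>') \<F> \<Longrightarrow> ((\<lambda>r. pcoef (\<theta> r) j) \<longlongrightarrow> pcoef \<theta>' j) \<F>"
  unfolding pcoef_def by (intro tendsto_intros) (simp_all del: fact_Suc)

lemma qcoef_tendsto: "(\<theta> \<longlongrightarrow> \<theta>') \<F> \<Longrightarrow> ((\<lambda>r. qcoef (\<theta> r) j) \<longlongrightarrow> qcoef \<theta>' j) \<F>"
  unfolding qcoef_def by (intro tendsto_intros) (simp_all del: fact_Suc)

lemma psi_tendsto: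
  assumes V: "slim \<kappa> \<F> V V'" and \<theta>: "(\<theta> \<longlongrightarrow> \<theta>') \<F>"
    and l: "\<forall>\<^sub>F r in \<F>. \<forall>n. (cmod (l r n))\<^sup>2 \<le> C * weight n powi 1"
      "\<And>n. (cmod (l' n))\<^sup>2 \<le> C * weight n powi 1" "\<And>n. ((\<lambda>r. l r n) \<longlongrightarrow> l' n) \<F>"
    and m: "int m \<le> 2 * \<kappa> + 1"
  shows "((\<lambda>r. psi (\<theta> r) (l r) (V r) m) \<longlongrightarrow> psi \<theta>' l' V' m) \<F>"
  unfolding psi_def
  by (rule slim_eval[OF psum_slim[OF hs_slim[OF V pcoef_tendsto[OF \<theta>] qcoef_tendsto[OF \<theta>] l] m pcoef_tendsto[OF \<theta>]]])
     (use m in auto)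

lemma psi_tendsto_symbol:
  assumes V: "slim \<kappa> \<F> V V'" and l: "\<And>n. (cmod (l n))\<^sup>2 \<le> C * weight n powi 1" and m: "int m \<le> 2 * \<kappa> + 1"
  shows "((\<lambda>r. psi \<theta> l (V r) m) \<longlongrightarrow> psi \<theta> l V' m) \<F>"
  by (rule psi_tendsto[OF V tendsto_const always_eventually[OF allI[OF allI[OF l]]] l tendsto_const m])

text \<open>Complex conjugation of functions, seen on their Fourier coefficients; its fixed points
  are the coefficient sequences of real functions.\<close>

definition refl :: "(int \<Rightarrow> complex) \<Rightarrow> int \<Rightarrow> complex" where
  "refl F = (\<lambda>n. cnj (F (- n)))"

lemma refl_conv: "refl (conv F G) = conv (refl F) (refl G)"
proof
  fix n
  have bij: "bij_betw uminus UNIV (UNIV :: int set)"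
    by (rule bij_betwI[where g = uminus]) auto
  have "refl (conv F G) n = (\<Sum>\<^sub>\<infinity>m. cnj (F m) * cnj (G (- n - m)))"
    by (simp add: refl_def conv_def flip: infsum_cnj)
  also have "\<dots> = (\<Sum>\<^sub>\<infinity>m. cnj (F (- m)) * cnj (G (- n - (- m))))"
    by (rule infsum_reindex_bij_betw[OF bij, symmetric])
  also have "\<dots> = conv (refl F) (refl G) n"
    by (simp add: conv_def refl_def)
  finally show "refl (conv F G) n = conv (refl F) (refl G) n" .
qed

lemma refl_cpow: "refl (cpow h j s) = cpow (\<lambda>i. refl (h i)) j s"
proof (induction j arbitrary: s)
  case (Suc j)
  have "refl (cpow h (Suc j) s) = (\<lambda>n. \<Sum>i\<le>s. refl (conv (h i) (cpow h j (s - i))) n)"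
    by (rule ext) (simp add: refl_def)
  then show ?case by (simp add: refl_conv Suc)
qed simp

lemma refl_psum: "refl (psum p h m) = psum (\<lambda>j. cnj (p j)) (\<lambda>i. refl (h i)) m"
proof -
  have "refl (psum p h m) = (\<lambda>n. \<Sum>j=1..m. cnj (p j) * refl (cpow h j (m - j)) n)"
    by (rule ext) (simp add: refl_def psum_def)
  then show ?thesis by (simp add: refl_cpow psum_def)
qed

lemma refl_hs: "refl (hs p q l V n) = hs (\<lambda>j. cnj (p j)) (\<lambda>j. cnj (q j)) (refl l) (refl V) n"
proof (induction n rule: less_induct)
  case (less n)
  show ?case
  proof (cases n)
    case 0
    then show ?thesis by (auto simp: refl_def)
  next
    case (Suc m)
    let ?h = "hs p q l V" and ?h' = "hs (\<lambda>j. cnj (p j)) (\<lambda>j. cnj (q j)) (refl l) (refl V)"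
    have "refl (?h (Suc m)) = (\<lambda>k. refl (psum p ?h m) k - refl (psum q ?h (Suc m)) k + refl l k * refl (?h m) k)"
      by (rule ext) (simp add: refl_def)
    also have "refl (psum p ?h m) = psum (\<lambda>j. cnj (p j)) ?h' m"
      unfolding refl_psum by (rule psum_cong) (use less Suc in auto)
    also have "refl (psum q ?h (Suc m)) = psum (\<lambda>j. cnj (q j)) ?h' (Suc m)"
      unfolding refl_psum by (rule psum_cong) (use less Suc in auto)
    also have "refl (?h m) = ?h' m" using less Suc by auto
    finally show ?thesis using Suc by simp
  qed
qed

text \<open>\<open>pcoef\<close> and \<open>qcoef\<close> are polynomials in \<theta> with real
  coefficients, so conjugation acts only on \<theta>, the symbol and V. For \<theta> = \<i> \<delta>
  and real v it amounts to replacing \<theta> by -\<theta>.\<close>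

lemma cnj_psi: "cnj (psi \<theta> l V m) = psi (cnj \<theta>) (refl l) (refl V) m"
proof -
  have c: "cnj (pcoef \<theta> j) = pcoef (cnj \<theta>) j" "cnj (qcoef \<theta> j) = qcoef (cnj \<theta>) j" for j
    by (simp_all add: pcoef_def qcoef_def)
  have "cnj (psi \<theta> l V m) = refl (psum (pcoef \<theta>) (hs (pcoef \<theta>) (qcoef \<theta>) l V) m) 0"
    by (simp add: psi_def refl_def)
  then show ?thesis unfolding refl_psum refl_hs c psi_def by (simp add: c[abs_def])
qed

definition L_symbol_cnj :: "real \<Rightarrow> int \<Rightarrow> complex" where
  "L_symbol_cnj \<delta> n = dd n - \<i> * of_real \<delta> * A_symbol \<delta> n"

lemma refl_L_symbol: "refl (L_symbol \<delta>) = L_symbol_cnj \<delta>"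
proof
  fix n
  have "cnj (A_symbol \<delta> n) = A_symbol \<delta> n" by (simp add: A_symbol_def)
  then show "refl (L_symbol \<delta>) n = L_symbol_cnj \<delta> n"
    by (simp add: refl_def L_symbol_def L_symbol_cnj_def)
qed

lemma L_symbol_cnj_bound: "0 < \<delta> \<Longrightarrow> (cmod (L_symbol_cnj \<delta> n))\<^sup>2 \<le> 4 * weight n powi 1"
  using L_symbol_bound[of \<delta> "- n"] by (simp add: refl_L_symbol[symmetric] refl_def)

section \<open>Limits of the coefficients and of their symmetric quotients in \<theta>\<close>

lemma L_symbol_tendsto:
  "((\<lambda>\<delta>. L_symbol \<delta> n) \<longlongrightarrow> dd n) (at_right 0)" "((\<lambda>\<delta>. L_symbol_cnj \<delta> n) \<longlongrightarrow> dd n) (at_right 0)"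
proof -
  have d: "((\<lambda>\<delta>. \<i> * of_real \<delta> * A_symbol \<delta> n) \<longlongrightarrow> \<i> * of_real 0 * ((of_int n)\<^sup>2 / 3)) (at_right 0)"
    by (intro tendsto_intros A_symbol_limit)
  show "((\<lambda>\<delta>. L_symbol \<delta> n) \<longlongrightarrow> dd n) (at_right 0)"
    using tendsto_add[OF tendsto_const[of "dd n"] d] by (simp add: L_symbol_def)
  show "((\<lambda>\<delta>. L_symbol_cnj \<delta> n) \<longlongrightarrow> dd n) (at_right 0)"
    using tendsto_diff[OF tendsto_const[of "dd n"] d] by (simp add: L_symbol_cnj_def)
qed

lemma theta_tendsto: "((\<lambda>\<delta>. \<i> * of_real \<delta>) \<longlongrightarrow> 0) (at_right 0)"
  "((\<lambda>\<delta>. - (\<i> * of_real \<delta>)) \<longlongrightarrow> 0) (at_right 0)"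
proof -
  have "((\<lambda>\<delta>. \<i> * of_real \<delta>) \<longlongrightarrow> \<i> * of_real 0) (at_right 0)" by (intro tendsto_intros)
  then show "((\<lambda>\<delta>. \<i> * of_real \<delta>) \<longlongrightarrow> 0) (at_right 0)" by simp
  then show "((\<lambda>\<delta>. - (\<i> * of_real \<delta>)) \<longlongrightarrow> 0) (at_right 0)" using tendsto_minus by fastforce
qed

text \<open>Even powers cancel in the symmetric quotient; an odd power i leaves the power i - 1,
  which tends to 0 unless i = 1.\<close>

lemma odd_quotient_tendsto:
  "((\<lambda>\<delta>. ((\<i> * of_real \<delta>) ^ i - (- (\<i> * of_real \<delta>)) ^ i) / (2 * (\<i> * of_real \<delta>))) \<longlongrightarrow> (if i = 1 then 1 else 0)) (at_right 0)"
proof -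
  have 1: "((\<lambda>\<delta>. if odd i then (\<i> * complex_of_real \<delta>) ^ (i - 1) else 0) \<longlongrightarrow> (if odd i then 0 ^ (i - 1) else 0)) (at_right 0)"
    by (cases "odd i") (auto intro!: tendsto_power theta_tendsto)
  have 2: "(if odd i then 0 ^ (i - 1) else (0::complex)) = (if i = 1 then 1 else 0)"
    by (cases i) auto
  have 3: "\<forall>\<^sub>F \<delta> in at_right 0. (if odd i then (\<i> * complex_of_real \<delta>) ^ (i - 1) else 0) =
      ((\<i> * of_real \<delta>) ^ i - (- (\<i> * of_real \<delta>)) ^ i) / (2 * (\<i> * of_real \<delta>))"
    using eventually_at_right_less[of "0::real"]
  proof eventually_elim
    case (elim \<delta>)
    define z where "z = \<i> * complex_of_real \<delta>"
    have "z \<noteq> 0" using elim by (simp add: z_def)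
    then have "(if odd i then z ^ (i - 1) else 0) = (z ^ i - (- z) ^ i) / (2 * z)"
      by (cases i) auto
    then show ?case unfolding z_def .
  qed
  from Lim_transform_eventually[OF 1 3] show ?thesis unfolding 2 .
qed

lemma pcoef_quotient_tendsto:
  "((\<lambda>\<delta>. (pcoef (\<i> * of_real \<delta>) j - pcoef (- (\<i> * of_real \<delta>)) j) / (2 * (\<i> * of_real \<delta>)))
    \<longlongrightarrow> (if j = 2 then 2 / 3 else 0)) (at_right 0)"
proof -
  have eq: "(pcoef a j - pcoef b j) / c = 2 ^ j / fact (j + 1) * ((a ^ (j - 1) - b ^ (j - 1)) / c)" for a b c
    by (simp add: pcoef_def divide_inverse ring_distribs mult_ac del: fact_Suc)
  have "((\<lambda>\<delta>. 2 ^ j / fact (j + 1) * (((\<i> * of_real \<delta>) ^ (j - 1) - (- (\<i> * of_real \<delta>)) ^ (j - 1)) / (2 * (\<i> * of_real \<delta>))))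
      \<longlongrightarrow> 2 ^ j / fact (j + 1) * (if j - 1 = 1 then 1 else (0::complex))) (at_right 0)"
    by (intro tendsto_mult_left odd_quotient_tendsto)
  moreover have "2 ^ j / fact (j + 1) * (if j - 1 = 1 then 1 else (0::complex)) = (if j = 2 then 2 / 3 else 0)"
    by (auto simp: fact_numeral eval_nat_numeral)
  ultimately show ?thesis
    by (simp only: eq)
qed

lemma qcoef_quotient_tendsto:
  "((\<lambda>\<delta>. (qcoef (\<i> * of_real \<delta>) j - qcoef (- (\<i> * of_real \<delta>)) j) / (2 * (\<i> * of_real \<delta>)))
    \<longlongrightarrow> (if j = 1 then 1 else 0)) (at_right 0)"
proof -
  have eq: "(qcoef a j - qcoef b j) / c = 2 ^ j / fact (j + 1) * ((a ^ j - b ^ j) / c)" for a b c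
    by (simp add: qcoef_def divide_inverse ring_distribs mult_ac del: fact_Suc)
  have "((\<lambda>\<delta>. 2 ^ j / fact (j + 1) * (((\<i> * of_real \<delta>) ^ j - (- (\<i> * of_real \<delta>)) ^ j) / (2 * (\<i> * of_real \<delta>))))
      \<longlongrightarrow> 2 ^ j / fact (j + 1) * (if j = 1 then 1 else (0::complex))) (at_right 0)"
    by (intro tendsto_mult_left odd_quotient_tendsto)
  moreover have "2 ^ j / fact (j + 1) * (if j = 1 then 1 else (0::complex)) = (if j = 1 then 1 else 0)"
    by (auto simp: fact_numeral eval_nat_numeral)
  ultimately show ?thesis
    by (simp only: eq)
qed

text \<open>Both families share V, so the direction of variation in V is 0. Although A itself
  depends on \<delta>, it is the same at \<theta> and -\<theta>, so the symmetric quotient of the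
  symbols is exactly A, of order two uniformly in \<delta>; hence the loss of one order, which
  H^\<kappa> just affords.\<close>

lemma psi_difference_quotient_tendsto:
  fixes \<kappa> :: nat
  assumes V: "sob (int \<kappa>) V"
  shows "((\<lambda>\<delta>. (psi (\<i> * of_real \<delta>) (L_symbol \<delta>) V (2 * \<kappa>) - psi (- (\<i> * of_real \<delta>)) (L_symbol_cnj \<delta>) V (2 * \<kappa>)) /
      (2 * (\<i> * of_real \<delta>))) \<longlongrightarrow> - (2 * of_nat \<kappa> / 3) * psi 0 dd V (2 * \<kappa> + 1)) (at_right 0)"
proof -
  let ?\<theta> = "\<lambda>\<delta>. \<i> * complex_of_real \<delta>" and ?k = "int \<kappa>"
  let ?h1 = "\<lambda>\<delta>. hs (pcoef (?\<theta> \<delta>)) (qcoef (?\<theta> \<delta>)) (L_symbol \<delta>) V"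
  let ?h2 = "\<lambda>\<delta>. hs (pcoef (- ?\<theta> \<delta>)) (qcoef (- ?\<theta> \<delta>)) (L_symbol_cnj \<delta>) V"
  let ?h = "h_seq0 V"
  let ?p' = "\<lambda>j. if j = 2 then 2 / 3 else (0::complex)" and ?q' = "\<lambda>j. if j = 1 then 1 else (0::complex)"
  let ?y = "ks (pcoef 0) (qcoef 0) dd ?p' ?q' (\<lambda>n. (of_int n)\<^sup>2 / 3) ?h (\<lambda>_. 0)"
  let ?Q = "\<lambda>\<delta> i m. (?h1 \<delta> i m - ?h2 \<delta> i m) / (2 * ?\<theta> \<delta>)"
  have pos: "\<forall>\<^sub>F \<delta> in at_right (0::real). 0 < \<delta>" by (rule eventually_at_right_less)
  have b1: "\<forall>\<^sub>F \<delta> in at_right 0. \<forall>n. (cmod (L_symbol \<delta> n))\<^sup>2 \<le> 4 * weight n powi 1"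
    and b2: "\<forall>\<^sub>F \<delta> in at_right 0. \<forall>n. (cmod (L_symbol_cnj \<delta> n))\<^sup>2 \<le> 4 * weight n powi 1"
    using pos by (eventually_elim, simp add: L_symbol_bound L_symbol_cnj_bound del: power_int_1_right)+
  note P1 = pcoef_tendsto[OF theta_tendsto(1)] and P2 = pcoef_tendsto[OF theta_tendsto(2)]
    and Q1 = qcoef_tendsto[OF theta_tendsto(1)] and Q2 = qcoef_tendsto[OF theta_tendsto(2)]
  have h1: "slim (?k - int i) (at_right 0) (\<lambda>\<delta>. ?h1 \<delta> i) (?h i)" if "int i \<le> 2 * ?k + 1" for i
    by (rule hs_slim[OF slim_const[OF V] P1 Q1 b1 dd_weight4 L_symbol_tendsto(1) that])
  have h2: "slim (?k - int i) (at_right 0) (\<lambda>\<delta>. ?h2 \<delta> i) (?h i)" if "int i \<le> 2 * ?k + 1" for i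
    by (rule hs_slim[OF slim_const[OF V] P2 Q2 b2 dd_weight4 L_symbol_tendsto(2) that])
  have lq: "(L_symbol \<delta> n - L_symbol_cnj \<delta> n) / (2 * ?\<theta> \<delta>) = A_symbol \<delta> n" if "0 < \<delta>" for \<delta> n
    using that by (simp add: L_symbol_def L_symbol_cnj_def)
  have w2: "((real_of_int n)\<^sup>2 / 3)\<^sup>2 \<le> 1 * weight n powi (1 + int 1)" for n
  proof -
    have "((real_of_int n)\<^sup>2 / 3)\<^sup>2 \<le> (weight n)\<^sup>2" by (intro power_mono) (auto simp: weight_def)
    then show ?thesis by simp
  qed
  have Q: "slim (?k - int i - int 1) (at_right 0) (\<lambda>\<delta>. ?Q \<delta> i) (?y i)" if i: "int i + int 1 \<le> 2 * ?k + 1" for i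
  proof (rule quotient_slim[OF refl refl refl slim_const[OF V] slim_const[OF V] P1 P2 Q1 Q2 b1 L_symbol_tendsto(1)
      b2 L_symbol_tendsto(2) dd_weight4 _ pcoef_quotient_tendsto qcoef_quotient_tendsto, where D = 1])
    show "slim (?k - int 1) (at_right 0) (\<lambda>\<delta> n. (V n - V n) / (2 * ?\<theta> \<delta>)) (\<lambda>_. 0)"
      using slim_const[of "?k - int 1" "\<lambda>_. 0"] by simp
    show "\<forall>\<^sub>F \<delta> in at_right 0. \<forall>n. (cmod ((L_symbol \<delta> n - L_symbol_cnj \<delta> n) / (2 * ?\<theta> \<delta>)))\<^sup>2 \<le> 1 * weight n powi (1 + int 1)"
      using pos
    proof eventually_elim
      case (elim \<delta>)
      show ?case
      proof
        fix n
        have "(cmod (A_symbol \<delta> n))\<^sup>2 \<le> ((real_of_int n)\<^sup>2 / 3)\<^sup>2"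
          by (intro power_mono norm_A_symbol(2)[OF elim]) auto
        also note w2[of n]
        finally show "(cmod ((L_symbol \<delta> n - L_symbol_cnj \<delta> n) / (2 * ?\<theta> \<delta>)))\<^sup>2 \<le> 1 * weight n powi (1 + int 1)"
          unfolding lq[OF elim] .
      qed
    qed
    show "((\<lambda>\<delta>. (L_symbol \<delta> n - L_symbol_cnj \<delta> n) / (2 * ?\<theta> \<delta>)) \<longlongrightarrow> (of_int n)\<^sup>2 / 3) (at_right 0)" for n
    proof (rule Lim_transform_eventually[OF A_symbol_limit])
      show "\<forall>\<^sub>F \<delta> in at_right 0. A_symbol \<delta> n = (L_symbol \<delta> n - L_symbol_cnj \<delta> n) / (2 * ?\<theta> \<delta>)"
        using pos by eventually_elim (simp only: lq)
    qed
    show "(cmod ((of_int n)\<^sup>2 / 3))\<^sup>2 \<le> 1 * weight n powi (1 + int 1)" for n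
      using w2[of n] by (simp add: norm_divide norm_power)
    show "int i + int 1 \<le> 2 * ?k + 1" by (rule i)
  qed
  have T1: "((\<lambda>\<delta>. dpsum (pcoef (?\<theta> \<delta>)) (?h2 \<delta>) (?Q \<delta>) (?h1 \<delta>) (2 * \<kappa>) 0) \<longlongrightarrow> dpsum (pcoef 0) ?h ?y ?h (2 * \<kappa>) 0) (at_right 0)"
    by (rule slim_eval[OF dpsum_slim[where \<kappa> = ?k and b = 1, OF h1 h2 Q _ P1]]) auto
  have T2: "((\<lambda>\<delta>. psum (\<lambda>j. (pcoef (?\<theta> \<delta>) j - pcoef (- ?\<theta> \<delta>) j) / (2 * ?\<theta> \<delta>)) (?h2 \<delta>) (2 * \<kappa>) 0) \<longlongrightarrow> psum ?p' ?h (2 * \<kappa>) 0) (at_right 0)"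
    by (rule slim_eval[OF psum_slim[where \<kappa> = ?k, OF h2 _ pcoef_quotient_tendsto]]) auto
  have "\<forall>\<^sub>F \<delta> in at_right 0. \<forall>i\<in>{..2 * \<kappa>}. sob (?k - int i) (?h1 \<delta> i) \<and> sob (?k - int i) (?h2 \<delta> i)"
    using h1 h2 by (intro eventually_ball_finite) (auto simp: slim_def intro: eventually_conj)
  then have "\<forall>\<^sub>F \<delta> in at_right 0.
      dpsum (pcoef (?\<theta> \<delta>)) (?h2 \<delta>) (?Q \<delta>) (?h1 \<delta>) (2 * \<kappa>) 0
      + psum (\<lambda>j. (pcoef (?\<theta> \<delta>) j - pcoef (- ?\<theta> \<delta>) j) / (2 * ?\<theta> \<delta>)) (?h2 \<delta>) (2 * \<kappa>) 0
      = (psi (?\<theta> \<delta>) (L_symbol \<delta>) V (2 * \<kappa>) - psi (- ?\<theta> \<delta>) (L_symbol_cnj \<delta>) V (2 * \<kappa>)) / (2 * ?\<theta> \<delta>)"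
  proof eventually_elim
    case (elim \<delta>)
    show ?case
      unfolding psi_def by (rule psum_diff[where \<kappa> = ?k, symmetric]) (use elim in auto)
  qed
  with tendsto_add[OF T1 T2] show ?thesis
    unfolding half_identity[OF V] by (rule Lim_transform_eventually)
qed

subsection \<open>Conservation along solutions\<close>

lemma per_C_funpow:
  assumes "per_C K v" "j \<le> K"
  shows "per_C (K - j) ((deriv ^^ j) v)"
  unfolding per_C_def
proof (intro conjI allI impI)
  fix x
  show "(deriv ^^ j) v (x + 2 * pi) = (deriv ^^ j) v x" by (rule per_C_periodic[OF assms(1)])
  have e: "(deriv ^^ k) ((deriv ^^ j) v) = (deriv ^^ (k + j)) v" for k by (simp add: funpow_add)
  show "(deriv ^^ k) ((deriv ^^ j) v) differentiable at x" if "k < K - j" for k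
    unfolding e using assms(1) that by (simp add: per_C_def)
  show "continuous_on UNIV ((deriv ^^ (K - j)) ((deriv ^^ j) v))"
    unfolding e using per_C_continuous[OF assms(1), of "K - j + j"] assms(2) by simp
qed

lemma of_real_deriv_square:
  assumes v: "per_C K v" and K: "4 \<le> K"
  shows "complex_of_real (deriv (\<lambda>y. (v y)\<^sup>2) x) = synth (\<lambda>n. dd n * conv (fc v) (fc v) n) x"
proof (rule of_real_deriv_synth(2))
  have V: "sob 3 (fc v)" using K by (intro per_C_sob[OF v]) simp
  have l: "ell1 (fc v)" by (rule sob_ell1[OF sob_mono(1)[OF _ V]]) simp
  show "sob 2 (conv (fc v) (fc v))" using sob_conv(2)[OF _ _ _ V V, of 3] by simp
  show "complex_of_real ((v y)\<^sup>2) = synth (conv (fc v) (fc v)) y" for y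
    using per_C_synth[OF v, of y] K by (simp add: synth_conv[OF l l] power2_eq_square)
qed

lemma of_real_deriv_funpow:
  assumes v: "per_C K v" and "j + 3 \<le> K"
  shows "complex_of_real ((deriv ^^ j) v x) = synth (\<lambda>n. dd n ^ j * fc v n) x"
proof -
  have "complex_of_real ((deriv ^^ j) v x) = synth (fc ((deriv ^^ j) v)) x"
    by (rule per_C_synth[OF per_C_funpow[OF v]]) (use assms(2) in auto)
  moreover have "fc ((deriv ^^ j) v) = (\<lambda>n. dd n ^ j * fc v n)"
    by (rule ext, rule fc_deriv[OF v]) (use assms(2) in simp)
  ultimately show ?thesis by simp
qed

lemma ell1_square_term:
  assumes v: "per_C K v" and K: "4 \<le> K"
  shows "ell1 (\<lambda>n. dd n * conv (fc v) (fc v) n)"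
proof -
  have V: "sob 3 (fc v)" using K by (intro per_C_sob[OF v]) simp
  have "sob 2 (conv (fc v) (fc v))" using sob_conv(2)[OF _ _ _ V V, of 3] by simp
  from sob_dd[OF this] show ?thesis by (intro sob_ell1) simp
qed

lemma ell1_dd_power:
  assumes v: "per_C K v" and "j + 2 \<le> K"
  shows "ell1 (\<lambda>n. dd n ^ j * fc v n)"
proof -
  have "sob (s - int j) (\<lambda>n. dd n ^ j * F n)" if "sob s F" for s F
  proof (induction j)
    case (Suc j)
    from sob_dd[OF this] show ?case by (simp add: algebra_simps)
  qed (use that in simp)
  from this[OF per_C_sob[OF v, of "int j + 1"]] assms(2) show ?thesis
    by (intro sob_ell1) simp
qed

lemma ILW_flow_field:
  assumes d: "0 < \<delta>" and v: "ILW_solution N \<delta> v" and N: "5 \<le> N"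
  shows "complex_of_real (deriv (\<lambda>s. v s x) t) = synth (flow_field (A_symbol \<delta>) (fc (v t))) x"
proof -
  have p: "per_C N (v t)" using v by (intro spacetime_per_C) (simp add: ILW_solution_def)
  let ?V = "fc (v t)"
  have l: "ell1 (\<lambda>n. dd n ^ 2 * ?V n)" by (rule ell1_dd_power[OF p]) (use N in simp)
  have eq: "complex_of_real (deriv (\<lambda>s. v s x) t)
      = Gt_op \<delta> (\<lambda>y. of_real ((deriv ^^ 2) (v t) y)) x + complex_of_real (deriv (\<lambda>y. (v t y)\<^sup>2) x)"
    using v unfolding ILW_solution_def by (metis diff_add_cancel add.commute)
  have "(\<lambda>y. complex_of_real ((deriv ^^ 2) (v t) y)) = synth (\<lambda>n. dd n ^ 2 * ?V n)"
    by (rule ext, rule of_real_deriv_funpow[OF p]) (use N in simp)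
  then have "Gt_op \<delta> (\<lambda>y. of_real ((deriv ^^ 2) (v t) y)) x = synth (\<lambda>n. G_symbol \<delta> n * (dd n ^ 2 * ?V n)) x / of_real \<delta>"
    using Gt_op_synth[OF d l] by simp
  also have "\<dots> = synth (\<lambda>n. (1 / of_real \<delta>) * (G_symbol \<delta> n * (dd n ^ 2 * ?V n))) x"
    unfolding synth_scale by simp
  also have "(\<lambda>n. (1 / of_real \<delta>) * (G_symbol \<delta> n * (dd n ^ 2 * ?V n))) = (\<lambda>n. A_symbol \<delta> n * (dd n * ?V n))"
    using d by (intro ext) (simp add: G_symbol_langevin A_symbol_def power2_eq_square field_simps)
  finally have 1: "Gt_op \<delta> (\<lambda>y. of_real ((deriv ^^ 2) (v t) y)) x = synth (\<lambda>n. A_symbol \<delta> n * (dd n * ?V n)) x" .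
  have "ell1 (\<lambda>n. A_symbol \<delta> n * (dd n * ?V n))"
  proof -
    have "sob 3 ?V" using N by (intro per_C_sob[OF p]) simp
    from ell1_scale[OF ell1_A[OF d sob_dd[OF this, simplified]], of "1 / of_real \<delta>"] show ?thesis
      using d by (simp add: mult.assoc)
  qed
  then show ?thesis
    unfolding eq 1 of_real_deriv_square[OF p order_trans[OF _ N, of 4, simplified]] flow_field_def
    by (intro synth_add[symmetric] ell1_square_term[OF p]) (use N in auto)
qed

lemma KdV_flow_field:
  assumes v: "KdV_solution N v" and N: "6 \<le> N"
  shows "complex_of_real (deriv (\<lambda>s. v s x) t) = synth (flow_field (\<lambda>n. (of_int n)\<^sup>2 / 3) (fc (v t))) x"
proof -
  have p: "per_C N (v t)" using v by (intro spacetime_per_C) (simp add: KdV_solution_def)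
  let ?V = "fc (v t)"
  have l: "ell1 (\<lambda>n. dd n ^ 3 * ?V n)" by (rule ell1_dd_power[OF p]) (use N in simp)
  have "deriv (\<lambda>s. v s x) t + (1 / 3) * (deriv ^^ 3) (v t) x = deriv (\<lambda>y. (v t y)\<^sup>2) x"
    using v unfolding KdV_solution_def by blast
  then have "deriv (\<lambda>s. v s x) t = - (1 / 3) * (deriv ^^ 3) (v t) x + deriv (\<lambda>y. (v t y)\<^sup>2) x"
    by linarith
  then have "complex_of_real (deriv (\<lambda>s. v s x) t)
      = - (1 / 3) * complex_of_real ((deriv ^^ 3) (v t) x) + complex_of_real (deriv (\<lambda>y. (v t y)\<^sup>2) x)"
    by simp
  also have "- (1 / 3) * complex_of_real ((deriv ^^ 3) (v t) x) = synth (\<lambda>n. - (1 / 3) * (dd n ^ 3 * ?V n)) x"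
    unfolding synth_scale using N by (simp only: of_real_deriv_funpow[OF p])
  also have "(\<lambda>n. - (1 / 3) * (dd n ^ 3 * ?V n)) = (\<lambda>n. (of_int n)\<^sup>2 / 3 * (dd n * ?V n))"
    by (rule ext) (simp add: power3_eq_cube power2_eq_square algebra_simps)
  finally have eq: "complex_of_real (deriv (\<lambda>s. v s x) t)
      = synth (\<lambda>n. (of_int n)\<^sup>2 / 3 * (dd n * ?V n)) x + complex_of_real (deriv (\<lambda>y. (v t y)\<^sup>2) x)" .
  have "ell1 (\<lambda>n. (of_int n)\<^sup>2 / 3 * (dd n * ?V n))"
    using ell1_scale[OF l, of "- (1 / 3)"]
    by (simp add: power3_eq_cube power2_eq_square algebra_simps)
  then show ?thesis
    unfolding eq of_real_deriv_square[OF p order_trans[OF _ N, of 4, simplified]] flow_field_def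
    by (intro synth_add[symmetric] ell1_square_term[OF p]) (use N in auto)
qed

text \<open>Of the nine derivatives, four keep the velocity in H^\<kappa> and five make the Fourier
  coefficients differentiable in time in the Sobolev norm.\<close>

lemma ILW_h_seq_conserved:
  fixes \<kappa> :: nat
  assumes d: "0 < \<delta>" and v: "ILW_solution (\<kappa> + 9) \<delta> v" and n: "int n \<le> 2 * int \<kappa> + 1"
  shows "h_seq \<delta> (fc (v t)) n 0 = h_seq \<delta> (fc (v s)) n 0"
proof (rule conservation_flow[OF ILW_symbol_A[OF d] norm_A_symbol(2)[OF d] L_symbol_def L_symbol_bound[OF d], where \<kappa> = "int \<kappa>"])
  have sp: "spacetime_class (\<kappa> + 4 + 5) v"
    using v unfolding ILW_solution_def add.assoc by simp
  show "sob (int \<kappa> + 4) (fc (v t))" for t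
    by (rule per_C_sob[OF spacetime_per_C[OF sp]]) simp
  have "slim (int (\<kappa> + 4)) (at 0) (\<lambda>r n. (fc (v (t + r)) n - fc (v t) n) / of_real r) (flow_field (A_symbol \<delta>) (fc (v t)))" for t
    by (rule flow_slim[OF norm_A_symbol(2)[OF d] sp _ ILW_flow_field[OF d v]])
       (use v in \<open>auto simp: ILW_solution_def\<close>)
  then show "slim (int \<kappa>) (at 0) (\<lambda>r n. (fc (v (t + r)) n - fc (v t) n) / of_real r)
      (\<lambda>n. A_symbol \<delta> n * (dd n * fc (v t) n) + dd n * conv (fc (v t)) (fc (v t)) n)" for t
    unfolding flow_field_def by (rule slim_mono[rotated]) simp
qed (use n in auto)

lemma KdV_h_seq_conserved:
  fixes \<kappa> :: nat
  assumes v: "KdV_solution (\<kappa> + 9) v" and n: "int n \<le> 2 * int \<kappa> + 1"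
  shows "h_seq0 (fc (v t)) n 0 = h_seq0 (fc (v s)) n 0"
proof -
  have a: "cmod ((of_int n)\<^sup>2 / 3) \<le> (of_int n)\<^sup>2 / 3" for n
    by (simp add: norm_divide norm_power)
  have sp: "spacetime_class (\<kappa> + 4 + 5) v"
    using v unfolding KdV_solution_def add.assoc by simp
  show ?thesis
  proof (rule conservation_flow[where \<theta> = 0 and a = "\<lambda>n. (of_int n)\<^sup>2 / 3" and l = dd and \<kappa> = "int \<kappa>",
        OF ILW_symbol_KdV a _ dd_weight])
    show "sob (int \<kappa> + 4) (fc (v t))" for t
      by (rule per_C_sob[OF spacetime_per_C[OF sp]]) simp
    have "slim (int (\<kappa> + 4)) (at 0) (\<lambda>r n. (fc (v (t + r)) n - fc (v t) n) / of_real r)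
        (flow_field (\<lambda>n. (of_int n)\<^sup>2 / 3) (fc (v t)))" for t
      by (rule flow_slim[OF a sp _ KdV_flow_field[OF v]])
         (use v in \<open>auto simp: KdV_solution_def\<close>)
    then show "slim (int \<kappa>) (at 0) (\<lambda>r n. (fc (v (t + r)) n - fc (v t) n) / of_real r)
        (\<lambda>n. (of_int n)\<^sup>2 / 3 * (dd n * fc (v t) n) + dd n * conv (fc (v t)) (fc (v t)) n)" for t
      unfolding flow_field_def by (rule slim_mono[rotated]) simp
  qed (use n in auto)
qed

lemma ILW_psi_conserved:
  fixes \<kappa> :: nat
  assumes d: "0 < \<delta>" and v: "ILW_solution (\<kappa> + 9) \<delta> v" and n: "int n \<le> 2 * int \<kappa> + 1"
  shows "psi (\<i> * of_real \<delta>) (L_symbol \<delta>) (fc (v t)) n = psi (\<i> * of_real \<delta>) (L_symbol \<delta>) (fc (v s)) n"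
proof -
  let ?\<theta> = "\<i> * complex_of_real \<delta>"
  have th: "?\<theta> \<noteq> 0" using d by simp
  have "(\<Sum>j=1..n. 1 / ?\<theta> ^ (n - j) * h_seq \<delta> (fc (v t)) j 0) = (\<Sum>j=1..n. 1 / ?\<theta> ^ (n - j) * h_seq \<delta> (fc (v s)) j 0)"
    using n by (intro sum.cong refl arg_cong2[of _ _ _ _ "(*)"] ILW_h_seq_conserved[OF d v]) auto
  then have "- ?\<theta> * psi ?\<theta> (L_symbol \<delta>) (fc (v t)) n = - ?\<theta> * psi ?\<theta> (L_symbol \<delta>) (fc (v s)) n"
    unfolding sum_hs_telescope[where \<theta> = ?\<theta> and l = "L_symbol \<delta>", OF th L_symbol_0] .
  then show ?thesis using th by simp
qed

text \<open>Here the functionals are evaluated by their pointwise definition, so density 2 \<kappa>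
  + 1 must be an absolutely convergent series; this is why the number of derivatives grows like 2
  \<kappa> and not like \<kappa>.\<close>

lemma ILW_conserved:
  fixes \<kappa> :: nat
  assumes d: "0 < \<delta>" and v: "ILW_solution (2 * \<kappa> + 9) \<delta> v" and \<kappa>: "1 \<le> \<kappa>"
  shows "conserved (E_ILW_zero \<delta>) v \<and> conserved (E_ILW_half \<kappa> \<delta>) v \<and> conserved (E_ILW \<kappa> \<delta>) v"
proof -
  have p: "per_C (2 * \<kappa> + 9) (v t)" for t using v by (intro spacetime_per_C) (simp add: ILW_solution_def)
  have s: "sob (2 * int \<kappa> + 8) (fc (v t))" for t by (rule per_C_sob[OF p]) simp
  have e: "complex_of_real (v t x) = synth (fc (v t)) x" for t x by (rule per_C_synth[OF p]) simp
  note c = ILW_psi_conserved[OF d v]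
  have "E_ILW_zero \<delta> (v s) = E_ILW_zero \<delta> (v t)" for s t
    using c[of 1 s t] by (simp only: E_ILW_zero_eq[OF d s e], simp?)
  moreover have "E_ILW_half \<kappa> \<delta> (v s) = E_ILW_half \<kappa> \<delta> (v t)" for s t
    using c[of "2 * \<kappa>" s t] by (simp only: E_ILW_half_eq[OF d s e], simp?)
  moreover have "E_ILW \<kappa> \<delta> (v s) = E_ILW \<kappa> \<delta> (v t)" if "1 \<le> \<kappa>" for s t
    using c[of "2 * \<kappa> + 1" s t] that by (simp only: E_ILW_eq[OF d s e], simp?)
  ultimately show ?thesis using \<kappa> unfolding conserved_def by blast
qed

lemma KdV_conserved:
  fixes \<kappa> :: nat
  assumes v: "KdV_solution (2 * \<kappa> + 1 + 9) v"
  shows "conserved (E_KdV 0) v \<and> conserved (E_KdV \<kappa>) v"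
proof -
  have p: "per_C (2 * \<kappa> + 1 + 9) (v t)" for t using v by (intro spacetime_per_C) (simp add: KdV_solution_def)
  have s: "sob (2 * int \<kappa> + 9) (fc (v t))" for t by (rule per_C_sob[OF p]) simp
  have e: "complex_of_real (v t x) = synth (fc (v t)) x" for t x by (rule per_C_synth[OF p]) simp
  have c: "psi 0 dd (fc (v t)) (2 * k + 1) = psi 0 dd (fc (v s)) (2 * k + 1)" if "k \<le> \<kappa>" for k t s
  proof -
    \<comment> \<open>Telescoping would divide by \<theta> = 0. It is not called for:
      \<open>qcoef\<close> vanishes at \<theta> = 0 and \<partial> kills means, so the mean of one
      density is already \<open>psi\<close>.\<close>
    have "h_seq0 V (Suc (2 * k + 1)) 0 = psi 0 dd V (2 * k + 1)" for V
      by (simp only: hs.simps psum_qcoef_0 psi_def) simp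
    then show ?thesis
      using KdV_h_seq_conserved[OF v, of "Suc (2 * k + 1)" t s] that by (simp only:) simp
  qed
  have "E_KdV k (v s) = E_KdV k (v t)" if "k \<le> \<kappa>" for k s t
    using c[OF that, of s t] that by (subst (1 2) E_KdV_eq[OF s e]) auto
  then show ?thesis unfolding conserved_def by blast
qed

subsection \<open>Continuous extension to Sobolev functions\<close>

lemma sobolev_norm_eq: "sobolev_norm \<kappa> w = sqrt (sobsq (int \<kappa>) (fc w))"
  by (simp add: sobolev_norm_def sobsq_def weight_def)

lemma sobolev_mean_zero_sob: "sobolev_mean_zero \<kappa> v \<Longrightarrow> sob (int \<kappa>) (fc v)"
  by (simp add: sobolev_mean_zero_def sob_def weight_def)

lemma smooth_per_C: "smooth_mean_zero u \<Longrightarrow> per_C K u"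
  by (auto simp: smooth_mean_zero_def periodic_mean_zero_def per_C_def
      intro!: continuous_at_imp_continuous_on differentiable_imp_continuous_within)

lemma smooth_sob: "smooth_mean_zero u \<Longrightarrow> sob s (fc u)"
  by (rule per_C_sob[OF smooth_per_C[where K = "nat (s + 1)"]]) auto

lemma smooth_synth: "smooth_mean_zero u \<Longrightarrow> complex_of_real (u x) = synth (fc u) x"
  by (rule per_C_synth[OF smooth_per_C order_refl])

text \<open>On a bounded interval |y| \<le> 1 + y^2 makes a square-integrable v integrable.
  Integrals of non-integrable functions are 0 by convention, so additivity of \<open>fc\<close>
  depends on this.\<close>

lemma set_integrable_fourier:
  assumes "v \<in> borel_measurable lebesgue" "set_integrable lebesgue {0..2 * pi} (\<lambda>x. (v x)\<^sup>2)"
  shows "set_integrable lebesgue {0..2 * pi} (\<lambda>x. complex_of_real (v x) * cis (- (of_int n * x)))"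
proof (rule set_integrable_bound)
  have "set_integrable lebesgue {0..2 * pi} (\<lambda>x::real. 1::real)"
    by (rule absolutely_integrable_continuous_real) simp
  from set_integral_add(1)[OF this assms(2)]
  show "set_integrable lebesgue {0..2 * pi} (\<lambda>x. 1 + (v x)\<^sup>2)" .
  have "(\<lambda>x. cis (- (of_int n * x))) \<in> borel_measurable borel"
    by (intro borel_measurable_continuous_onI continuous_intros)
  then have "(\<lambda>x. cis (- (of_int n * x))) \<in> borel_measurable lebesgue"
    by (intro measurable_completion) simp
  then have "(\<lambda>x. complex_of_real (v x) * cis (- (of_int n * x))) \<in> borel_measurable lebesgue"
    using assms(1) by measurable
  then show "set_borel_measurable lebesgue {0..2 * pi} (\<lambda>x. complex_of_real (v x) * cis (- (of_int n * x)))"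
    unfolding set_borel_measurable_def by (intro borel_measurable_scaleR borel_measurable_indicator) auto
  have "\<bar>y\<bar> \<le> 1 + y\<^sup>2" for y :: real
    using zero_le_power2[of "\<bar>y\<bar> - 1"] by (simp add: power2_diff)
  then show "AE x in lebesgue. x \<in> {0..2 * pi} \<longrightarrow>
      norm (complex_of_real (v x) * cis (- (of_int n * x))) \<le> norm (1 + (v x)\<^sup>2)"
    by (intro AE_I2) (simp add: norm_mult)
qed

lemma fc_diff:
  assumes u: "continuous_on UNIV u" and v: "sobolev_mean_zero \<kappa> v"
  shows "fc (\<lambda>x. u x - v x) n = fc u n - fc v n"
proof -
  have 1: "set_integrable lebesgue {0..2 * pi} (\<lambda>x. complex_of_real (u x) * cis (- (of_int n * x)))"
    by (intro absolutely_integrable_continuous_real continuous_intros continuous_on_subset[OF u]) auto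
  have 2: "set_integrable lebesgue {0..2 * pi} (\<lambda>x. complex_of_real (v x) * cis (- (of_int n * x)))"
    using v by (intro set_integrable_fourier) (auto simp: sobolev_mean_zero_def)
  show ?thesis
    using set_integral_diff(2)[OF 1 2]
    by (simp add: fourier_coeff_def torus_integral_def left_diff_distrib diff_divide_distrib)
qed

section \<open>Real functions and their truncations\<close>

lemma refl_fc: "refl (fc v) = fc v"
proof
  fix n
  have "cnj (LINT x:{0..2 * pi}|lebesgue. complex_of_real (v x) * cis (of_int n * x))
      = (LINT x:{0..2 * pi}|lebesgue. complex_of_real (v x) * cis (- (of_int n * x)))"
    unfolding set_lebesgue_integral_def
    by (subst Bochner_Integration.integral_cnj[symmetric], rule Bochner_Integration.integral_cong) (auto simp: cis_cnj)
  then show "refl (fc v) n = fc v n"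
    by (simp add: refl_def fourier_coeff_def torus_integral_def)
qed

lemma fc_0: "periodic_mean_zero v \<Longrightarrow> fc v 0 = 0"
  by (simp add: fourier_coeff_def torus_integral_def periodic_mean_zero_def set_integral_complex_of_real)

lemma synth_periodic: "synth F (x + 2 * pi) = synth F x"
proof -
  have "cis (of_int n * (x + 2 * pi)) = cis (of_int n * x)" for n :: int
  proof -
    have "cis (of_int n * (x + 2 * pi)) = cis (of_int n * x) * cis (2 * pi * of_int n)"
      unfolding cis_mult by (simp add: algebra_simps)
    then show ?thesis by simp
  qed
  then show ?thesis by (simp add: synth_def)
qed

lemma cnj_synth: "cnj (synth F x) = synth (refl F) x"
proof -
  have bij: "bij_betw uminus UNIV (UNIV :: int set)"
    by (rule bij_betwI[where g = uminus]) auto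
  have "cnj (synth F x) = (\<Sum>\<^sub>\<infinity>n. cnj (F n) * cis (- (of_int n * x)))"
    by (simp add: synth_def cis_cnj flip: infsum_cnj)
  also have "\<dots> = (\<Sum>\<^sub>\<infinity>n. cnj (F (- n)) * cis (- (of_int (- n) * x)))"
    by (rule infsum_reindex_bij_betw[OF bij, symmetric])
  finally show ?thesis by (simp add: synth_def refl_def)
qed

lemma finite_support_ell1: "finite {n. F n \<noteq> 0} \<Longrightarrow> ell1 F"
  unfolding ell1_def
  by (rule finite_nonzero_values_imp_summable_on) simp

lemma smooth_Re_synth:
  assumes F: "finite {n. F n \<noteq> 0}" and r: "refl F = F" and "F 0 = 0"
  shows "smooth_mean_zero (\<lambda>x. Re (synth F x))" and "fc (\<lambda>x. Re (synth F x)) = F"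
proof -
  let ?u = "\<lambda>x. Re (synth F x)"
  have ell: "ell1 (\<lambda>n. dd n ^ k * F n)" for k
    by (rule finite_support_ell1, rule finite_subset[OF _ F]) auto
  have der: "((\<lambda>x. Re (synth (\<lambda>n. dd n ^ k * F n) x)) has_real_derivative Re (synth (\<lambda>n. dd n ^ Suc k * F n) x)) (at x)" for k x
    unfolding has_real_derivative_iff_has_vector_derivative
    using bounded_linear.has_vector_derivative[OF bounded_linear_Re has_vector_derivative_synth[OF ell[of k], of x]]
      ell[of "Suc k"] by (simp add: mult.assoc)
  have eq: "(deriv ^^ k) ?u = (\<lambda>x. Re (synth (\<lambda>n. dd n ^ k * F n) x))" for k
  proof (induction k)
    case (Suc k)
    show ?case using DERIV_imp_deriv[OF der[of k]] by (simp add: Suc fun_eq_iff)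
  qed simp
  have "(deriv ^^ k) ?u differentiable (at x)" for k x
    unfolding eq real_differentiable_def using der by blast
  moreover have re: "complex_of_real (?u x) = synth F x" for x
    using cnj_synth[of F x] unfolding r by (simp add: complex_eq_iff)
  moreover have "complex_of_real (torus_integral ?u) = torus_integral (synth F)"
    using set_integral_complex_of_real[where A = "{0..2 * pi}" and M = lebesgue and f = ?u]
    unfolding re torus_integral_def by simp
  then have "torus_integral ?u = 0"
    using torus_integral_synth[OF ell[of 0, simplified]] \<open>F 0 = 0\<close> by simp
  ultimately show "smooth_mean_zero ?u"
    by (simp add: smooth_mean_zero_def periodic_mean_zero_def synth_periodic)
  show "fc ?u = F"
    unfolding re using fourier_coeff_synth[OF ell[of 0, simplified]] by (simp add: fun_eq_iff)
qed

lemma smooth_approx_diff: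
  assumes u: "smooth_mean_zero u" and v: "sobolev_mean_zero \<kappa> v"
  shows "sobolev_norm \<kappa> (\<lambda>x. u x - v x) = sqrt (sobsq (int \<kappa>) (\<lambda>n. fc u n - fc v n))"
proof -
  have "continuous_on UNIV u" using per_C_continuous[OF smooth_per_C[OF u], of 0] by simp
  from fc_diff[OF this v] have "fc (\<lambda>x. u x - v x) = (\<lambda>n. fc u n - fc v n)" ..
  then show ?thesis by (simp only: sobolev_norm_eq)
qed

lemma eventually_smooth: "\<forall>\<^sub>F u in smooth_approx \<kappa> v. smooth_mean_zero u"
  by (auto simp: smooth_approx_def eventually_inf_principal)

lemma smooth_approx_slim:
  assumes v: "sobolev_mean_zero \<kappa> v"
  shows "slim (int \<kappa>) (smooth_approx \<kappa> v) fc (fc v)"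
  unfolding slim_def
proof (intro conjI sobolev_mean_zero_sob[OF v])
  show "\<forall>\<^sub>F u in smooth_approx \<kappa> v. sob (int \<kappa>) (fc u)"
    using eventually_smooth by (rule eventually_mono) (rule smooth_sob)
  have "((\<lambda>u. sobolev_norm \<kappa> (\<lambda>x. u x - v x)) \<longlongrightarrow> 0) (smooth_approx \<kappa> v)"
    unfolding smooth_approx_def by (rule filterlim_mono[OF filterlim_filtercomap order_refl inf_le1])
  from tendsto_power[OF this, of 2]
  have "((\<lambda>u. (sobolev_norm \<kappa> (\<lambda>x. u x - v x))\<^sup>2) \<longlongrightarrow> 0) (smooth_approx \<kappa> v)" by simp
  moreover have "\<forall>\<^sub>F u in smooth_approx \<kappa> v. (sobolev_norm \<kappa> (\<lambda>x. u x - v x))\<^sup>2 = sobsq (int \<kappa>) (\<lambda>n. fc u n - fc v n)"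
    using eventually_smooth by (rule eventually_mono) (simp add: smooth_approx_diff[OF _ v] sobsq_nonneg)
  ultimately show "((\<lambda>u. sobsq (int \<kappa>) (\<lambda>n. fc u n - fc v n)) \<longlongrightarrow> 0) (smooth_approx \<kappa> v)"
    by (rule Lim_transform_eventually)
qed

text \<open>Truncated Fourier series are smooth, real and mean-zero, so that every element of the
  Sobolev space is approximated.\<close>

lemma smooth_approx_nontrivial:
  assumes v: "sobolev_mean_zero \<kappa> v"
  shows "smooth_approx \<kappa> v \<noteq> bot"
proof
  let ?u = "\<lambda>N x. Re (synth (trunc N (fc v)) x)"
  have "refl (trunc N (fc v)) = trunc N (refl (fc v))" for N
    by (rule ext) (simp add: refl_def trunc_def)
  then have r: "refl (trunc N (fc v)) = trunc N (fc v)" for N by (simp add: refl_fc)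
  have z: "trunc N (fc v) 0 = 0" for N
    using v by (simp add: trunc_def fc_0 sobolev_mean_zero_def)
  note u = smooth_Re_synth[OF finite_trunc r z]
  have "(\<lambda>N. sobsq (int \<kappa>) (\<lambda>n. trunc N (fc v) n - fc v n)) \<longlonglongrightarrow> 0"
    using trunc_slim[OF sobolev_mean_zero_sob[OF v]] by (simp add: slim_def)
  from tendsto_real_sqrt[OF this]
  have "(\<lambda>N. sobolev_norm \<kappa> (\<lambda>x. ?u N x - v x)) \<longlonglongrightarrow> 0"
    by (simp add: smooth_approx_diff[OF u(1) v] u(2))
  then have "filterlim ?u (smooth_approx \<kappa> v) sequentially"
    using u(1) by (simp add: smooth_approx_def filterlim_inf filterlim_principal filterlim_filtercomap_iff o_def)
  moreover assume "smooth_approx \<kappa> v = bot"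
  ultimately show False by (simp add: filterlim_def bot_unique filtermap_bot_iff)
qed

section \<open>The functionals and their limits on Sobolev functions\<close>

lemma smooth_approx_limit:
  assumes v: "sobolev_mean_zero \<kappa> v" and E: "\<And>u. smooth_mean_zero u \<Longrightarrow> E u = \<Phi> (fc u)"
    and \<Phi>: "((\<lambda>u. \<Phi> (fc u)) \<longlongrightarrow> \<Phi> (fc v)) (smooth_approx \<kappa> v)"
  shows "(E \<longlongrightarrow> \<Phi> (fc v)) (smooth_approx \<kappa> v)"
  using \<Phi> by (rule Lim_transform_eventually) (simp add: eventually_mono[OF eventually_smooth] E)

text \<open>\<open>Lim\<close> names a definite value only if limits are unique, for which the
  filter must not be trivial.\<close>

lemma extension_eqI:
  "sobolev_mean_zero \<kappa> v \<Longrightarrow> (E \<longlongrightarrow> l) (smooth_approx \<kappa> v) \<Longrightarrow> extension \<kappa> E v = l"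
  unfolding extension_def by (rule tendsto_Lim[OF smooth_approx_nontrivial])

text \<open>On smooth functions the functional is a function of the Fourier coefficients. The index
  2 \<kappa> + 1 is the largest one covered by the continuity of \<open>psi\<close> on
  H^\<kappa>.\<close>

lemma E_ILW_limit:
  assumes "0 < \<delta>" "sobolev_mean_zero \<kappa> v"
  shows "(E_ILW \<kappa> \<delta> \<longlongrightarrow> (-1) ^ \<kappa> * pi * Re (psi (\<i> * of_real \<delta>) (L_symbol \<delta>) (fc v) (2 * \<kappa> + 1))) (smooth_approx \<kappa> v)"
proof (rule smooth_approx_limit[OF assms(2)])
  show "E_ILW \<kappa> \<delta> u = (-1) ^ \<kappa> * pi * Re (psi (\<i> * of_real \<delta>) (L_symbol \<delta>) (fc u) (2 * \<kappa> + 1))"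
    if u: "smooth_mean_zero u" for u
    by (rule E_ILW_eq[OF assms(1) smooth_sob[OF u] smooth_synth[OF u] order_refl])
qed (intro tendsto_intros psi_tendsto_symbol[OF smooth_approx_slim[OF assms(2)] L_symbol_bound[OF assms(1)]], simp)

lemma E_ILW_half_limit:
  assumes "0 < \<delta>" "sobolev_mean_zero \<kappa> v"
  shows "(E_ILW_half \<kappa> \<delta> \<longlongrightarrow> (-1) ^ (\<kappa> + 1) * (3 / (4 * real \<kappa>)) *
    (2 * pi * Re (psi (\<i> * of_real \<delta>) (L_symbol \<delta>) (fc v) (2 * \<kappa>) / (\<i> * of_real \<delta>)))) (smooth_approx \<kappa> v)"
proof (rule smooth_approx_limit[OF assms(2)])
  show "E_ILW_half \<kappa> \<delta> u = (-1) ^ (\<kappa> + 1) * (3 / (4 * real \<kappa>)) *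
    (2 * pi * Re (psi (\<i> * of_real \<delta>) (L_symbol \<delta>) (fc u) (2 * \<kappa>) / (\<i> * of_real \<delta>)))"
    if u: "smooth_mean_zero u" for u
    by (rule E_ILW_half_eq[OF assms(1) smooth_sob[OF u] smooth_synth[OF u] order_refl])
qed (use assms(1) in \<open>intro tendsto_intros psi_tendsto_symbol[OF smooth_approx_slim[OF assms(2)] L_symbol_bound[OF assms(1)]], auto\<close>)

lemma E_KdV_limit:
  assumes "sobolev_mean_zero \<kappa> v"
  shows "(E_KdV \<kappa> \<longlongrightarrow> (-1) ^ \<kappa> * pi * Re (psi 0 dd (fc v) (2 * \<kappa> + 1))) (smooth_approx \<kappa> v)"
proof (rule smooth_approx_limit[OF assms])
  show "E_KdV \<kappa> u = (-1) ^ \<kappa> * pi * Re (psi 0 dd (fc u) (2 * \<kappa> + 1))"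
    if u: "smooth_mean_zero u" for u
    by (rule E_KdV_eq[OF smooth_sob[OF u] smooth_synth[OF u] order_refl])
qed (intro tendsto_intros psi_tendsto_symbol[OF smooth_approx_slim[OF assms] dd_weight], simp)

lemma extension_E_ILW_tendsto:
  assumes v: "sobolev_mean_zero \<kappa> v"
  shows "((\<lambda>\<delta>. extension \<kappa> (E_ILW \<kappa> \<delta>) v) \<longlongrightarrow> extension \<kappa> (E_KdV \<kappa>) v) (at_right 0)"
proof -
  have "((\<lambda>\<delta>. psi (\<i> * of_real \<delta>) (L_symbol \<delta>) (fc v) (2 * \<kappa> + 1)) \<longlongrightarrow> psi 0 dd (fc v) (2 * \<kappa> + 1)) (at_right 0)"
    by (rule psi_tendsto[OF slim_const[OF sobolev_mean_zero_sob[OF v]] theta_tendsto(1) _ dd_weight4 L_symbol_tendsto(1)])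
       (auto intro!: eventually_mono[OF eventually_at_right_less] L_symbol_bound simp del: power_int_1_right)
  then have "((\<lambda>\<delta>. (-1) ^ \<kappa> * pi * Re (psi (\<i> * of_real \<delta>) (L_symbol \<delta>) (fc v) (2 * \<kappa> + 1))) \<longlongrightarrow> extension \<kappa> (E_KdV \<kappa>) v) (at_right 0)"
    unfolding extension_eqI[OF v E_KdV_limit[OF v]] by (intro tendsto_intros)
  then show ?thesis
    by (rule Lim_transform_eventually)
       (auto simp: extension_eqI[OF v E_ILW_limit[OF _ v]] intro!: eventually_mono[OF eventually_at_right_less])
qed

lemma Re_divide_imaginary:
  assumes "0 < \<delta>"
  shows "complex_of_real (Re (z / (\<i> * of_real \<delta>))) = (z - cnj z) / (2 * (\<i> * of_real \<delta>))"
  using assms by (simp add: complex_eq_iff Re_divide Im_divide power2_eq_square)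

lemma extension_E_ILW_half_tendsto:
  assumes v: "sobolev_mean_zero \<kappa> v" and "1 \<le> \<kappa>"
  shows "((\<lambda>\<delta>. extension \<kappa> (E_ILW_half \<kappa> \<delta>) v) \<longlongrightarrow> extension \<kappa> (E_KdV \<kappa>) v) (at_right 0)"
proof -
  let ?p = "\<lambda>\<delta>. psi (\<i> * of_real \<delta>) (L_symbol \<delta>) (fc v) (2 * \<kappa>)"
  \<comment> \<open>As v is real, \<open>psi\<close> at -\<theta> is the conjugate of
    \<open>psi\<close> at \<theta>; the real part of the quotient by the imaginary number \<theta>
    is thus the symmetric quotient.\<close>
  have "(?p \<delta> - psi (- (\<i> * of_real \<delta>)) (L_symbol_cnj \<delta>) (fc v) (2 * \<kappa>)) / (2 * (\<i> * of_real \<delta>)) =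
      complex_of_real (Re (?p \<delta> / (\<i> * of_real \<delta>)))" if "0 < \<delta>" for \<delta>
    using cnj_psi[of "\<i> * of_real \<delta>" "L_symbol \<delta>" "fc v" "2 * \<kappa>"]
    by (simp add: Re_divide_imaginary[OF that] refl_L_symbol refl_fc)
  then have "((\<lambda>\<delta>. complex_of_real (Re (?p \<delta> / (\<i> * of_real \<delta>)))) \<longlongrightarrow> - (2 * of_nat \<kappa> / 3) * psi 0 dd (fc v) (2 * \<kappa> + 1)) (at_right 0)"
    by (intro Lim_transform_eventually[OF psi_difference_quotient_tendsto[OF sobolev_mean_zero_sob[OF v]]]
        eventually_mono[OF eventually_at_right_less]) auto
  from tendsto_Re[OF this]
  have "((\<lambda>\<delta>. Re (?p \<delta> / (\<i> * of_real \<delta>))) \<longlongrightarrow> - (2 * real \<kappa> / 3) * Re (psi 0 dd (fc v) (2 * \<kappa> + 1))) (at_right 0)"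
    by simp
  \<comment> \<open>The constants combine as 3/(4 \<kappa>) times 2 pi times -2 \<kappa>/3, which is
    -pi. This explains the normalisation 3/(4 \<kappa>), and the minus sign turns (-1)^(\<kappa>+1)
    into the sign (-1)^\<kappa> of the KdV functional.\<close>
  from tendsto_mult[OF tendsto_const[of "(-1) ^ (\<kappa> + 1) * (3 / (4 * real \<kappa>)) * (2 * pi)"] this]
  have "((\<lambda>\<delta>. (-1) ^ (\<kappa> + 1) * (3 / (4 * real \<kappa>)) * (2 * pi * Re (?p \<delta> / (\<i> * of_real \<delta>)))) \<longlongrightarrow>
      extension \<kappa> (E_KdV \<kappa>) v) (at_right 0)"
    unfolding extension_eqI[OF v E_KdV_limit[OF v]] using assms(2) by (simp add: mult_ac)
  then show ?thesis
    by (rule Lim_transform_eventually)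
       (auto simp: extension_eqI[OF v E_ILW_half_limit[OF _ v]] intro!: eventually_mono[OF eventually_at_right_less])
qed

theorem theorem1p4:
  fixes \<kappa> :: nat
  assumes "\<kappa> \<ge> 1"
  shows "(\<exists>N. \<forall>\<delta>>0. \<forall>v. ILW_solution N \<delta> v \<longrightarrow>
            conserved (E_ILW_zero \<delta>) v \<and> conserved (E_ILW_half \<kappa> \<delta>) v \<and> conserved (E_ILW \<kappa> \<delta>) v)
       \<and> (\<exists>N. \<forall>v. KdV_solution N v \<longrightarrow> conserved (E_KdV 0) v \<and> conserved (E_KdV \<kappa>) v)
       \<and> (\<forall>\<delta>>0. extendable \<kappa> (E_ILW_half \<kappa> \<delta>) \<and> extendable \<kappa> (E_ILW \<kappa> \<delta>))
       \<and> extendable \<kappa> (E_KdV \<kappa>)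
       \<and> (\<forall>v. sobolev_mean_zero \<kappa> v \<longrightarrow>
            ((\<lambda>\<delta>. extension \<kappa> (E_ILW_half \<kappa> \<delta>) v) \<longlongrightarrow> extension \<kappa> (E_KdV \<kappa>) v) (at_right 0) \<and>
            ((\<lambda>\<delta>. extension \<kappa> (E_ILW \<kappa> \<delta>) v) \<longlongrightarrow> extension \<kappa> (E_KdV \<kappa>) v) (at_right 0))"
proof (intro conjI)
  show "\<exists>N. \<forall>\<delta>>0. \<forall>v. ILW_solution N \<delta> v \<longrightarrow>
      conserved (E_ILW_zero \<delta>) v \<and> conserved (E_ILW_half \<kappa> \<delta>) v \<and> conserved (E_ILW \<kappa> \<delta>) v"
    using ILW_conserved assms by blast
  show "\<exists>N. \<forall>v. KdV_solution N v \<longrightarrow> conserved (E_KdV 0) v \<and> conserved (E_KdV \<kappa>) v"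
    using KdV_conserved by blast
  show "\<forall>\<delta>>0. extendable \<kappa> (E_ILW_half \<kappa> \<delta>) \<and> extendable \<kappa> (E_ILW \<kappa> \<delta>)"
    unfolding extendable_def using E_ILW_half_limit E_ILW_limit by blast
  show "extendable \<kappa> (E_KdV \<kappa>)"
    unfolding extendable_def using E_KdV_limit by blast
  show "\<forall>v. sobolev_mean_zero \<kappa> v \<longrightarrow>
      ((\<lambda>\<delta>. extension \<kappa> (E_ILW_half \<kappa> \<delta>) v) \<longlongrightarrow> extension \<kappa> (E_KdV \<kappa>) v) (at_right 0) \<and>
      ((\<lambda>\<delta>. extension \<kappa> (E_ILW \<kappa> \<delta>) v) \<longlongrightarrow> extension \<kappa> (E_KdV \<kappa>) v) (at_right 0)"
    using extension_E_ILW_half_tendsto extension_E_ILW_tendsto assms by blast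
qed

end
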